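(* (1) The theory $\mathrm{RCA}_0^{\Omega}$ proves $\mathrm{FAN}^{\mathrm{st}}\leftrightarrow\mathrm{HB}^{\mathrm{st}}\leftrightarrow\mathrm{UHB}^{\mathrm{st}}\leftrightarrow\mathrm{HB}^{*}$. (2) The theory $\mathrm{RCA}_0^{\Omega}+\mathrm{QF\text{-}AC}^{2,0}$ proves $\mathrm{FAN}^{\mathrm{st}}\leftrightarrow\mathrm{HB}\leftrightarrow\mathrm{UHB}$.
   Context: BASE THEORY. Finite types: $0$ (natural numbers), $\sigma\to\tau$, and $\sigma^{*}$ (finite sequences of objects of type $\sigma$); $1=0\to 0$, $2=1\to 0$, $3=2\to 0$. Superscripts indicate types; tuples are coded as single objects where convenient. Equality $=_0$ is primitive; for $\tau=\tau_1\to\dots\to\tau_k\to 0$, $x=_\tau y$ means $(\forall z_1\dots z_k)(xz_1\dots z_k=_0 yz_1\dots z_k)$. $\mathrm{RCA}_0^{\omega}$ is Kohlenbach's higher-order base theory: classical arithmetic in all finite types with combinators, zero, successor, the recursor $R_0$ (primitive recursion with type $0$ values), quantifier-free induction, extensionality $x=_\rho y\to\varphi(x)=_\tau\varphi(y)$ for all $\varphi^{\rho\to\tau}$, and $\mathrm{QF\text{-}AC}^{1,0}$, where $\mathrm{QF\text{-}AC}^{\sigma,\tau}$ is $(\forall x^\sigma)(\exists y^\tau)A_0(x,y)\to(\exists F^{\sigma\to\tau})(\forall x)A_0(x,F(x))$ for quantifier-free $A_0$. $\mathrm{RCA}_0^{\Omega}$ extends $\mathrm{RCA}_0^{\omega}$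 (with the types $\sigma^*$) by a predicate $\mathrm{st}$ ("is standard") for each type. A formula is internal if it does not contain $\mathrm{st}$; $(\forall^{\mathrm{st}}x)A$ is $(\forall x)(\mathrm{st}(x)\to A)$, $(\exists^{\mathrm{st}}x)A$ is $(\exists x)(\mathrm{st}(x)\wedge A)$; $N\in\Omega$ means $\neg\mathrm{st}(N^0)$; $A^{\mathrm{st}}$ is $A$ with all quantifiers (except bounded number quantifiers) relativised to $\mathrm{st}$. Axioms: (i) standardness respects equality, closed terms are standard, a standard functional applied to a standard object is standard, and numbers below a standard number are standard; (ii) Idealization: $(\forall^{\mathrm{st}}x^{\sigma^*})(\exists y^\tau)(\forall z\in x)\varphi(z,y)\to(\exists y)(\forall^{\mathrm{st}}z^{\sigma})\varphi(z,y)$ for internal $\varphi$; (iii) $\mathrm{HAC}_{\mathrm{int}}$: $(\forall^{\mathrm{st}}x^{\rho})(\exists^{\mathrm{st}}y^{\tau})\varphi(x,y)\to(\exists^{\mathrm{st}}\Phi^{\rho\to\tau^*})(\forall^{\mathrm{st}}x)(\exists y\in\Phi(x))\varphi(x,y)$ for internal $\varphi$; (iv) $\mathrm{PF\text{-}TP}_\forall$: $(\forall^{\mathrm{st}}x^\tau)\varphi(x)\to(\forall x^\tau)\varphi(x)$ for internal $\varphi(x)$ with no parameters other than $x$; (v) for certain functionals uniquely specified by a parameter-free internal formula $D$, a constant $\Xi_0$ with the axiom $\mathrm{st}(\Xi_0)\wedge(\forall^{\mathrm{st}}\Xi)[D^{\mathrm{st}}(\Xi)\to \Xi_0$ and $\Xi$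 agree on all standard inputs$]$; these constants do not count as parameters in (iv). NOTATION. $\alpha\leq_11$ means $\alpha^1$ is a $0$-$1$ sequence; $\overline{\alpha}n$ is the (code of the) initial segment of $\alpha$ of length $n$. Reals are fast-converging Cauchy sequences of rationals $q_{(\cdot)}^1$, i.e. $(\forall n,i)(|q_n-q_{n+i}|<2^{-n})$, with equality and order defined as usual. PRINCIPLES. $\mathrm{FAN}$: for all binary trees $T$, $(\forall\alpha^1\leq_11)(\exists n^0)(\overline{\alpha}n\notin T)\to(\exists k_0^0)(\forall\alpha^1\leq_11)(\exists n^0\leq k_0)(\overline{\alpha}n\notin T)$. $\mathrm{HB}$ (Heine-Borel lemma): for every sequence of open intervals $I_n=(c_n,d_n)$ (an object $I^{0\to1}$) with $(\forall x\in[0,1])(\exists n)(x\in(c_n,d_n))$, there is $k$ such that $(\forall x\in[0,1])(\exists n\leq k)(x\in(c_n,d_n))$. $\mathrm{UHB}$: there is $\Phi^{((0\to1)\times2)\to0}$ such that for all sequences of open intervals $I_n^{0\to1}=(c_n,d_n)$ and all $g^2$, $$(\forall x\in[0,1])(x\in(c_{g(x)},d_{g(x)}))\to(\forall x\in[0,1])(\exists n\leq\Phi(I_n,g))(x\in(c_n,d_n)).$$ $\mathrm{HB}^*$: $\mathrm{HB}^{\mathrm{st}}$ but with the conclusion that the finite (standard) subcover covers all of $[0,1]$, including the nonstandard reals. *)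

theory Defs
  imports Main
begin

section \<open>Language\<close>

datatype ty = Nat | Fn ty ty (infixr "\<rightarrow>\<^sub>t" 65) | Seq ty

abbreviation T1 :: ty where "T1 \<equiv> Nat \<rightarrow>\<^sub>t Nat"
abbreviation T2 :: ty where "T2 \<equiv> T1 \<rightarrow>\<^sub>t Nat"

text \<open>
  \<open>Comb_K\<close> and \<open>Comb_S\<close> are the combinators usually written \<open>\<Pi>\<close> and \<open>\<Sigma>\<close>; \<open>Rec\<close> is \<open>R\<^sub>0\<close>.
  Finite sequences are added as a definitional extension: an object of type \<open>Seq \<sigma>\<close> is given by
  its length and its entries, and \<open>Mk f n\<close> is the sequence \<open>\<langle>f 0, \<dots>, f (n - 1)\<rangle>\<close>.
  \<open>Xi n \<tau>\<close> is the constant \<open>\<Xi>\<^sub>0\<close> of type \<open>\<tau>\<close> for the \<open>n\<close>-th specification.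
\<close>
datatype const =
    Zero | Succ
  | Comb_K ty ty | Comb_S ty ty ty
  | Rec
  | Len ty | Nth ty | Mk ty
  | Xi nat ty

text \<open>De Bruijn indices; every variable occurrence carries the type given to it by its binder
  (or by the context).\<close>
datatype tm = Var ty nat | Cst const | App tm tm

datatype fm = Fls | Eq tm tm | St tm | Imp fm fm | All ty fm

text \<open>A specification assigns to the index of a constant its type and its defining formula, in
  which the variable 0 stands for the functional.\<close>
type_synonym spec = "nat \<Rightarrow> (ty \<times> fm) option"

fun cty :: "const \<Rightarrow> ty" where
  "cty Zero = Nat"
| "cty Succ = T1"
| "cty (Comb_K \<rho> \<tau>) = \<rho> \<rightarrow>\<^sub>t \<tau> \<rightarrow>\<^sub>t \<rho>"
| "cty (Comb_S \<delta> \<rho> \<tau>) = (\<delta> \<rightarrow>\<^sub>t \<rho> \<rightarrow>\<^sub>t \<tau>) \<rightarrow>\<^sub>t (\<delta> \<rightarrow>\<^sub>t \<rho>) \<rightarrow>\<^sub>t \<delta> \<rightarrow>\<^sub>t \<tau>"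
| "cty Rec = Nat \<rightarrow>\<^sub>t Nat \<rightarrow>\<^sub>t (Nat \<rightarrow>\<^sub>t Nat \<rightarrow>\<^sub>t Nat) \<rightarrow>\<^sub>t Nat"
| "cty (Len \<sigma>) = Seq \<sigma> \<rightarrow>\<^sub>t Nat"
| "cty (Nth \<sigma>) = Seq \<sigma> \<rightarrow>\<^sub>t Nat \<rightarrow>\<^sub>t \<sigma>"
| "cty (Mk \<sigma>) = (Nat \<rightarrow>\<^sub>t \<sigma>) \<rightarrow>\<^sub>t Nat \<rightarrow>\<^sub>t Seq \<sigma>"
| "cty (Xi n \<tau>) = \<tau>"

fun res_ty :: "ty \<Rightarrow> ty" where
  "res_ty (\<sigma> \<rightarrow>\<^sub>t \<tau>) = \<tau>"
| "res_ty \<tau> = \<tau>"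

text \<open>The type of a term, meaningful only for terms that satisfy \<open>tm_ok\<close>.\<close>
fun tyof :: "tm \<Rightarrow> ty" where
  "tyof (Var \<tau> n) = \<tau>"
| "tyof (Cst c) = cty c"
| "tyof (App s t) = res_ty (tyof s)"

fun const_ok :: "spec \<Rightarrow> const \<Rightarrow> bool" where
  "const_ok sp (Xi n \<tau>) = (map_option fst (sp n) = Some \<tau>)"
| "const_ok sp _ = True"

fun tm_ok :: "spec \<Rightarrow> ty list \<Rightarrow> tm \<Rightarrow> bool" where
  "tm_ok sp \<Gamma> (Var \<tau> n) = (n < length \<Gamma> \<and> \<Gamma> ! n = \<tau>)"
| "tm_ok sp \<Gamma> (Cst c) = const_ok sp c"
| "tm_ok sp \<Gamma> (App s t) =
     (tm_ok sp \<Gamma> s \<and> tm_ok sp \<Gamma> t \<and> tyof s = tyof t \<rightarrow>\<^sub>t tyof (App s t))"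

fun fm_ok :: "spec \<Rightarrow> ty list \<Rightarrow> fm \<Rightarrow> bool" where
  "fm_ok sp \<Gamma> Fls = True"
| "fm_ok sp \<Gamma> (Eq s t) = (tm_ok sp \<Gamma> s \<and> tm_ok sp \<Gamma> t \<and> tyof s = Nat \<and> tyof t = Nat)"
| "fm_ok sp \<Gamma> (St t) = tm_ok sp \<Gamma> t"
| "fm_ok sp \<Gamma> (Imp \<phi> \<psi>) = (fm_ok sp \<Gamma> \<phi> \<and> fm_ok sp \<Gamma> \<psi>)"
| "fm_ok sp \<Gamma> (All \<tau> \<phi>) = fm_ok sp (\<tau> # \<Gamma>) \<phi>"

fun internal :: "fm \<Rightarrow> bool" where
  "internal Fls = True"
| "internal (Eq s t) = True"
| "internal (St t) = False"
| "internal (Imp \<phi> \<psi>) = (internal \<phi> \<and> internal \<psi>)"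
| "internal (All \<tau> \<phi>) = internal \<phi>"

text \<open>Internal formulas without quantifiers; recall that equality at higher types is not prime.\<close>
fun qfree :: "fm \<Rightarrow> bool" where
  "qfree Fls = True"
| "qfree (Eq s t) = True"
| "qfree (St t) = False"
| "qfree (Imp \<phi> \<psi>) = (qfree \<phi> \<and> qfree \<psi>)"
| "qfree (All \<tau> \<phi>) = False"

fun lift_tm :: "nat \<Rightarrow> tm \<Rightarrow> tm" where
  "lift_tm k (Var \<tau> n) = Var \<tau> (if n < k then n else Suc n)"
| "lift_tm k (Cst c) = Cst c"
| "lift_tm k (App s t) = App (lift_tm k s) (lift_tm k t)"

fun lift_fm :: "nat \<Rightarrow> fm \<Rightarrow> fm" where
  "lift_fm k Fls = Fls"
| "lift_fm k (Eq s t) = Eq (lift_tm k s) (lift_tm k t)"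
| "lift_fm k (St t) = St (lift_tm k t)"
| "lift_fm k (Imp \<phi> \<psi>) = Imp (lift_fm k \<phi>) (lift_fm k \<psi>)"
| "lift_fm k (All \<tau> \<phi>) = All \<tau> (lift_fm (Suc k) \<phi>)"

text \<open>Substitution for the variable \<open>k\<close>, which is thereby removed from the context.\<close>
fun subst_tm :: "nat \<Rightarrow> tm \<Rightarrow> tm \<Rightarrow> tm" where
  "subst_tm k u (Var \<tau> n) = (if n < k then Var \<tau> n else if n = k then u else Var \<tau> (n - 1))"
| "subst_tm k u (Cst c) = Cst c"
| "subst_tm k u (App s t) = App (subst_tm k u s) (subst_tm k u t)"

fun subst_fm :: "nat \<Rightarrow> tm \<Rightarrow> fm \<Rightarrow> fm" where
  "subst_fm k u Fls = Fls"
| "subst_fm k u (Eq s t) = Eq (subst_tm k u s) (subst_tm k u t)"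
| "subst_fm k u (St t) = St (subst_tm k u t)"
| "subst_fm k u (Imp \<phi> \<psi>) = Imp (subst_fm k u \<phi>) (subst_fm k u \<psi>)"
| "subst_fm k u (All \<tau> \<phi>) = All \<tau> (subst_fm (Suc k) (lift_tm 0 u) \<phi>)"


section \<open>Derivability\<close>

abbreviation Neg :: "fm \<Rightarrow> fm" where "Neg \<phi> \<equiv> Imp \<phi> Fls"

text \<open>
  Classical many-sorted natural deduction. Axioms may contain free variables; they can then be used
  in every context in which they are well-formed, that is, they stand for their universal closures.
\<close>
inductive derives :: "spec \<Rightarrow> fm set \<Rightarrow> ty list \<Rightarrow> fm list \<Rightarrow> fm \<Rightarrow> bool"
  for sp :: spec and T :: "fm set" where
  Ax: "\<phi> \<in> T \<Longrightarrow> fm_ok sp \<Gamma> \<phi> \<Longrightarrow> derives sp T \<Gamma> \<Delta> \<phi>"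
| Asm: "\<phi> \<in> set \<Delta> \<Longrightarrow> fm_ok sp \<Gamma> \<phi> \<Longrightarrow> derives sp T \<Gamma> \<Delta> \<phi>"
| ImpI: "fm_ok sp \<Gamma> \<phi> \<Longrightarrow> derives sp T \<Gamma> (\<phi> # \<Delta>) \<psi> \<Longrightarrow> derives sp T \<Gamma> \<Delta> (Imp \<phi> \<psi>)"
| ImpE: "derives sp T \<Gamma> \<Delta> (Imp \<phi> \<psi>) \<Longrightarrow> derives sp T \<Gamma> \<Delta> \<phi> \<Longrightarrow> derives sp T \<Gamma> \<Delta> \<psi>"
| Raa: "fm_ok sp \<Gamma> \<phi> \<Longrightarrow> derives sp T \<Gamma> (Neg \<phi> # \<Delta>) Fls \<Longrightarrow> derives sp T \<Gamma> \<Delta> \<phi>"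
| AllI: "derives sp T (\<tau> # \<Gamma>) (map (lift_fm 0) \<Delta>) \<phi> \<Longrightarrow> derives sp T \<Gamma> \<Delta> (All \<tau> \<phi>)"
| AllE: "derives sp T \<Gamma> \<Delta> (All \<tau> \<phi>) \<Longrightarrow> tm_ok sp \<Gamma> t \<Longrightarrow> tyof t = \<tau> \<Longrightarrow>
         derives sp T \<Gamma> \<Delta> (subst_fm 0 t \<phi>)"

definition proves :: "spec \<Rightarrow> fm set \<Rightarrow> fm \<Rightarrow> bool" where
  "proves sp T \<phi> \<longleftrightarrow> derives sp T [] [] \<phi>"


section \<open>Notation for terms and formulas in scope\<close>

text \<open>
  To write formulas with bound variables named at the meta-level, terms and formulas are presented
  as functions of the number of binders they are under. A binder at depth \<open>d\<close> passes on its
  variable as the function that at depth \<open>d' > d\<close> is the index \<open>d' - Suc d\<close>.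
  Applying the result to 0 gives the actual formula.
\<close>
type_synonym stm = "nat \<Rightarrow> tm"
type_synonym sfm = "nat \<Rightarrow> fm"

definition bvar :: "ty \<Rightarrow> nat \<Rightarrow> stm" where "bvar \<tau> d = (\<lambda>d'. Var \<tau> (d' - Suc d))"

definition con :: "const \<Rightarrow> stm" where "con c = (\<lambda>d. Cst c)"
definition app :: "stm \<Rightarrow> stm \<Rightarrow> stm" (infixl "\<cdot>" 200) where "s \<cdot> t = (\<lambda>d. App (s d) (t d))"

text \<open>A term or formula that is already at the depth where it is placed.\<close>
definition raw :: "'a \<Rightarrow> nat \<Rightarrow> 'a" where "raw a = (\<lambda>d. a)"

text \<open>Bracket abstraction of the variable 0 of type \<open>\<tau>\<close>.\<close>
fun abst :: "ty \<Rightarrow> tm \<Rightarrow> tm" where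
  "abst \<tau> (Var \<sigma> n) =
     (if n = 0 then App (App (Cst (Comb_S \<tau> (\<tau> \<rightarrow>\<^sub>t \<tau>) \<tau>)) (Cst (Comb_K \<tau> (\<tau> \<rightarrow>\<^sub>t \<tau>)))) (Cst (Comb_K \<tau> \<tau>))
      else App (Cst (Comb_K \<sigma> \<tau>)) (Var \<sigma> (n - 1)))"
| "abst \<tau> (Cst c) = App (Cst (Comb_K (cty c) \<tau>)) (Cst c)"
| "abst \<tau> (App s t) =
     App (App (Cst (Comb_S \<tau> (tyof t) (tyof (App s t)))) (abst \<tau> s)) (abst \<tau> t)"

definition lam :: "ty \<Rightarrow> (stm \<Rightarrow> stm) \<Rightarrow> stm" where
  "lam \<tau> F = (\<lambda>d. abst \<tau> (F (bvar \<tau> d) (Suc d)))"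

definition fls :: sfm where "fls = (\<lambda>d. Fls)"
definition eq0 :: "stm \<Rightarrow> stm \<Rightarrow> sfm" where "eq0 s t = (\<lambda>d. Eq (s d) (t d))"
definition st :: "stm \<Rightarrow> sfm" where "st t = (\<lambda>d. St (t d))"
definition imp :: "sfm \<Rightarrow> sfm \<Rightarrow> sfm" (infixr "\<^bold>\<longrightarrow>" 45) where "imp A B = (\<lambda>d. Imp (A d) (B d))"
definition all :: "ty \<Rightarrow> (stm \<Rightarrow> sfm) \<Rightarrow> sfm" where
  "all \<tau> F = (\<lambda>d. All \<tau> (F (bvar \<tau> d) (Suc d)))"

definition neg :: "sfm \<Rightarrow> sfm" ("\<^bold>\<not> _" [60] 60) where "neg A = (A \<^bold>\<longrightarrow> fls)"
definition conj :: "sfm \<Rightarrow> sfm \<Rightarrow> sfm" (infixr "\<^bold>\<and>" 55) where "conj A B = \<^bold>\<not> (A \<^bold>\<longrightarrow> \<^bold>\<not> B)"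
definition ex :: "ty \<Rightarrow> (stm \<Rightarrow> sfm) \<Rightarrow> sfm" where "ex \<tau> F = \<^bold>\<not> all \<tau> (\<lambda>x. \<^bold>\<not> F x)"
definition allst :: "ty \<Rightarrow> (stm \<Rightarrow> sfm) \<Rightarrow> sfm" where "allst \<tau> F = all \<tau> (\<lambda>x. st x \<^bold>\<longrightarrow> F x)"
definition exst :: "ty \<Rightarrow> (stm \<Rightarrow> sfm) \<Rightarrow> sfm" where "exst \<tau> F = ex \<tau> (\<lambda>x. st x \<^bold>\<and> F x)"

definition Iff :: "fm \<Rightarrow> fm \<Rightarrow> fm" where
  "Iff \<phi> \<psi> = ((raw \<phi> \<^bold>\<longrightarrow> raw \<psi>) \<^bold>\<and> (raw \<psi> \<^bold>\<longrightarrow> raw \<phi>)) 0"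


section \<open>Arithmetic terms\<close>

definition zero :: stm where "zero = con Zero"
definition suc :: "stm \<Rightarrow> stm" where "suc t = con Succ \<cdot> t"

text \<open>\<open>rec n a F\<close> is the value at \<open>n\<close> of the function with \<open>0 \<mapsto> a\<close> and \<open>Suc i \<mapsto> F r i\<close>, where
  \<open>r\<close> is the value at \<open>i\<close>.\<close>
definition rec :: "stm \<Rightarrow> stm \<Rightarrow> (stm \<Rightarrow> stm \<Rightarrow> stm) \<Rightarrow> stm" where
  "rec n a F = con Rec \<cdot> n \<cdot> a \<cdot> lam Nat (\<lambda>r. lam Nat (\<lambda>i. F r i))"

definition addT :: tm where "addT = lam Nat (\<lambda>x. lam Nat (\<lambda>y. rec y x (\<lambda>r i. suc r))) 0"
definition add :: "stm \<Rightarrow> stm \<Rightarrow> stm" where "add s t = raw addT \<cdot> s \<cdot> t"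

definition mulT :: tm where "mulT = lam Nat (\<lambda>x. lam Nat (\<lambda>y. rec y zero (\<lambda>r i. add r x))) 0"
definition mul :: "stm \<Rightarrow> stm \<Rightarrow> stm" where "mul s t = raw mulT \<cdot> s \<cdot> t"

definition predT :: tm where "predT = lam Nat (\<lambda>x. rec x zero (\<lambda>r i. i)) 0"

text \<open>Cut-off subtraction.\<close>
definition monusT :: tm where
  "monusT = lam Nat (\<lambda>x. lam Nat (\<lambda>y. rec y x (\<lambda>r i. raw predT \<cdot> r))) 0"
definition monus :: "stm \<Rightarrow> stm \<Rightarrow> stm" where "monus s t = raw monusT \<cdot> s \<cdot> t"

definition pow2T :: tm where "pow2T = lam Nat (\<lambda>x. rec x (suc zero) (\<lambda>r i. add r r)) 0"
definition pow2 :: "stm \<Rightarrow> stm" where "pow2 t = raw pow2T \<cdot> t"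

text \<open>Triangular numbers, and the largest \<open>w\<close> whose triangular number is at most \<open>z\<close>.\<close>
definition triT :: tm where "triT = lam Nat (\<lambda>x. rec x zero (\<lambda>r i. add r (suc i))) 0"
definition tri :: "stm \<Rightarrow> stm" where "tri t = raw triT \<cdot> t"
definition trirootT :: tm where
  "trirootT = lam Nat (\<lambda>z. rec z zero
     (\<lambda>r i. rec (monus (tri (suc r)) (suc i)) (suc r) (\<lambda>_ _. r))) 0"
definition triroot :: "stm \<Rightarrow> stm" where "triroot t = raw trirootT \<cdot> t"

text \<open>Cantor's bijective pairing \<open>(x + y) (x + y + 1) / 2 + y\<close> and its projections.\<close>
definition pairing :: "stm \<Rightarrow> stm \<Rightarrow> stm" where "pairing s t = add (tri (add s t)) t"
definition proj2 :: "stm \<Rightarrow> stm" where "proj2 t = monus t (tri (triroot t))"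
definition proj1 :: "stm \<Rightarrow> stm" where "proj1 t = monus (triroot t) (proj2 t)"

definition LeqT :: "tm \<Rightarrow> tm \<Rightarrow> fm" where "LeqT s t = Eq (App (App monusT s) t) (Cst Zero)"
definition leq :: "stm \<Rightarrow> stm \<Rightarrow> sfm" where "leq s t = (\<lambda>d. LeqT (s d) (t d))"
definition less :: "stm \<Rightarrow> stm \<Rightarrow> sfm" where "less s t = leq (suc s) t"

definition all_le :: "stm \<Rightarrow> (stm \<Rightarrow> sfm) \<Rightarrow> sfm" where
  "all_le t F = all Nat (\<lambda>n. leq n t \<^bold>\<longrightarrow> F n)"
definition ex_le :: "stm \<Rightarrow> (stm \<Rightarrow> sfm) \<Rightarrow> sfm" where
  "ex_le t F = \<^bold>\<not> all_le t (\<lambda>n. \<^bold>\<not> F n)"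
definition all_less :: "stm \<Rightarrow> (stm \<Rightarrow> sfm) \<Rightarrow> sfm" where
  "all_less t F = all Nat (\<lambda>n. less n t \<^bold>\<longrightarrow> F n)"
definition ex_less :: "stm \<Rightarrow> (stm \<Rightarrow> sfm) \<Rightarrow> sfm" where
  "ex_less t F = \<^bold>\<not> all_less t (\<lambda>n. \<^bold>\<not> F n)"


section \<open>Higher-type equality and relativisation to the standard objects\<close>

fun eq :: "ty \<Rightarrow> stm \<Rightarrow> stm \<Rightarrow> sfm" where
  "eq Nat s t = eq0 s t"
| "eq (\<sigma> \<rightarrow>\<^sub>t \<tau>) s t = all \<sigma> (\<lambda>x. eq \<tau> (s \<cdot> x) (t \<cdot> x))"
| "eq (Seq \<sigma>) s t =
     (eq0 (con (Len \<sigma>) \<cdot> s) (con (Len \<sigma>) \<cdot> t) \<^bold>\<and>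
      all_less (con (Len \<sigma>) \<cdot> s) (\<lambda>i. eq \<sigma> (con (Nth \<sigma>) \<cdot> s \<cdot> i) (con (Nth \<sigma>) \<cdot> t \<cdot> i)))"

definition mem :: "ty \<Rightarrow> stm \<Rightarrow> stm \<Rightarrow> sfm" where
  "mem \<sigma> x w = ex_less (con (Len \<sigma>) \<cdot> w) (\<lambda>i. eq \<sigma> (con (Nth \<sigma>) \<cdot> w \<cdot> i) x)"

text \<open>Holds if \<open>All \<tau> \<phi>\<close> is a bounded number quantifier: the bound \<open>t\<close> may not depend on the
  quantified variable.\<close>
definition bounded_quant :: "ty \<Rightarrow> fm \<Rightarrow> bool" where
  "bounded_quant \<tau> \<phi> \<longleftrightarrow> \<tau> = Nat \<and>
     (\<exists>t \<psi>. \<phi> = Imp (LeqT (Var Nat 0) (lift_tm 0 t)) \<psi> \<or>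
            \<phi> = Imp (LeqT (App (Cst Succ) (Var Nat 0)) (lift_tm 0 t)) \<psi>)"

fun rel :: "fm \<Rightarrow> fm" where
  "rel Fls = Fls"
| "rel (Eq s t) = Eq s t"
| "rel (St t) = St t"
| "rel (Imp \<phi> \<psi>) = Imp (rel \<phi>) (rel \<psi>)"
| "rel (All \<tau> \<phi>) =
     (if bounded_quant \<tau> \<phi> then All \<tau> (rel \<phi>) else All \<tau> (Imp (St (Var \<tau> 0)) (rel \<phi>)))"

definition srel :: "sfm \<Rightarrow> sfm" where "srel A = (\<lambda>d. rel (A d))"


section \<open>The theories\<close>

definition ax_eq :: "fm set" where
  "ax_eq = {all Nat (\<lambda>x. eq0 x x) 0,
            all Nat (\<lambda>x. all Nat (\<lambda>y. all Nat (\<lambda>z. eq0 x y \<^bold>\<longrightarrow> eq0 x z \<^bold>\<longrightarrow> eq0 y z))) 0}"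

definition ax_succ :: "fm set" where
  "ax_succ = {all Nat (\<lambda>x. \<^bold>\<not> eq0 (suc x) zero) 0,
              all Nat (\<lambda>x. all Nat (\<lambda>y. eq0 (suc x) (suc y) \<^bold>\<longrightarrow> eq0 x y)) 0}"

definition ax_comb :: "fm set" where
  "ax_comb =
     {all \<rho> (\<lambda>x. all \<tau> (\<lambda>y. eq \<rho> (con (Comb_K \<rho> \<tau>) \<cdot> x \<cdot> y) x)) 0 | \<rho> \<tau>. True} \<union>
     {all (\<delta> \<rightarrow>\<^sub>t \<rho> \<rightarrow>\<^sub>t \<tau>) (\<lambda>x. all (\<delta> \<rightarrow>\<^sub>t \<rho>) (\<lambda>y. all \<delta> (\<lambda>z.
        eq \<tau> (con (Comb_S \<delta> \<rho> \<tau>) \<cdot> x \<cdot> y \<cdot> z) (x \<cdot> z \<cdot> (y \<cdot> z))))) 0 | \<delta> \<rho> \<tau>. True}"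

definition ax_rec :: "fm set" where
  "ax_rec =
     {all Nat (\<lambda>y. all (Nat \<rightarrow>\<^sub>t Nat \<rightarrow>\<^sub>t Nat) (\<lambda>z. eq0 (con Rec \<cdot> zero \<cdot> y \<cdot> z) y)) 0,
      all Nat (\<lambda>x. all Nat (\<lambda>y. all (Nat \<rightarrow>\<^sub>t Nat \<rightarrow>\<^sub>t Nat) (\<lambda>z.
        eq0 (con Rec \<cdot> suc x \<cdot> y \<cdot> z) (z \<cdot> (con Rec \<cdot> x \<cdot> y \<cdot> z) \<cdot> x)))) 0}"

definition ax_seq :: "fm set" where
  "ax_seq =
     {all (Nat \<rightarrow>\<^sub>t \<sigma>) (\<lambda>f. all Nat (\<lambda>n. eq0 (con (Len \<sigma>) \<cdot> (con (Mk \<sigma>) \<cdot> f \<cdot> n)) n)) 0 | \<sigma>. True} \<union>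
     {all (Nat \<rightarrow>\<^sub>t \<sigma>) (\<lambda>f. all Nat (\<lambda>n. all_less n (\<lambda>i.
        eq \<sigma> (con (Nth \<sigma>) \<cdot> (con (Mk \<sigma>) \<cdot> f \<cdot> n) \<cdot> i) (f \<cdot> i)))) 0 | \<sigma>. True}"

definition ax_ext :: "fm set" where
  "ax_ext =
     {all (\<rho> \<rightarrow>\<^sub>t \<tau>) (\<lambda>f. all \<rho> (\<lambda>x. all \<rho> (\<lambda>y. eq \<rho> x y \<^bold>\<longrightarrow> eq \<tau> (f \<cdot> x) (f \<cdot> y)))) 0 | \<rho> \<tau>. True}"

text \<open>In the schemata below, \<open>\<phi>\<close> may contain further free variables (parameters) unless this is
  excluded. They are not affected by the binders of the schema: where a binder is inserted around
  \<open>\<phi>\<close>, the variables beyond it are lifted.\<close>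

text \<open>\<open>\<phi>\<close> has \<open>n\<close> as variable 0.\<close>
definition ax_qf_ind :: "fm set" where
  "ax_qf_ind =
     {((raw (subst_fm 0 (Cst Zero) \<phi>) \<^bold>\<and>
        all Nat (\<lambda>n. raw \<phi> \<^bold>\<longrightarrow> raw (subst_fm 0 (App (Cst Succ) (Var Nat 0)) (lift_fm 1 \<phi>))))
       \<^bold>\<longrightarrow> all Nat (\<lambda>n. raw \<phi>)) 0 | \<phi>. qfree \<phi>}"

text \<open>\<open>\<phi>\<close> has \<open>y\<close> as variable 0 and \<open>x\<close> as variable 1. In the conclusion \<open>F\<close> has index 1 and \<open>x\<close>
  has index 0 in the term substituted for \<open>y\<close>.\<close>
definition ax_QF_AC :: "ty \<Rightarrow> ty \<Rightarrow> fm set" where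
  "ax_QF_AC \<sigma> \<tau> =
     {(all \<sigma> (\<lambda>x. ex \<tau> (\<lambda>y. raw \<phi>)) \<^bold>\<longrightarrow>
       ex (\<sigma> \<rightarrow>\<^sub>t \<tau>) (\<lambda>F. all \<sigma> (\<lambda>x.
         raw (subst_fm 0 (App (Var (\<sigma> \<rightarrow>\<^sub>t \<tau>) 1) (Var \<sigma> 0)) (lift_fm 2 \<phi>))))) 0 | \<phi>. qfree \<phi>}"

definition RCA0_omega :: "fm set" where
  "RCA0_omega =
     ax_eq \<union> ax_succ \<union> ax_comb \<union> ax_rec \<union> ax_seq \<union> ax_ext \<union> ax_qf_ind \<union> ax_QF_AC T1 Nat"

definition ax_standard :: "spec \<Rightarrow> fm set" where
  "ax_standard sp =
     {all \<tau> (\<lambda>x. all \<tau> (\<lambda>y. eq \<tau> x y \<^bold>\<longrightarrow> st x \<^bold>\<longrightarrow> st y)) 0 | \<tau>. True} \<union>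
     {St t | t. tm_ok sp [] t} \<union>
     {all (\<sigma> \<rightarrow>\<^sub>t \<tau>) (\<lambda>f. all \<sigma> (\<lambda>x. st f \<^bold>\<longrightarrow> st x \<^bold>\<longrightarrow> st (f \<cdot> x))) 0 | \<sigma> \<tau>. True} \<union>
     {all Nat (\<lambda>n. all Nat (\<lambda>m. st n \<^bold>\<longrightarrow> leq m n \<^bold>\<longrightarrow> st m)) 0}"

text \<open>\<open>\<phi>\<close> has \<open>z\<close> as variable 0 and \<open>y\<close> as variable 1.\<close>
definition ax_idealization :: "fm set" where
  "ax_idealization =
     {(allst (Seq \<sigma>) (\<lambda>x. ex \<tau> (\<lambda>y. all \<sigma> (\<lambda>z. mem \<sigma> z x \<^bold>\<longrightarrow> raw (lift_fm 2 \<phi>)))) \<^bold>\<longrightarrow>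
       ex \<tau> (\<lambda>y. allst \<sigma> (\<lambda>z. raw \<phi>))) 0 | \<sigma> \<tau> \<phi>. internal \<phi>}"

text \<open>\<open>\<phi>\<close> has \<open>y\<close> as variable 0 and \<open>x\<close> as variable 1.\<close>
definition ax_HAC_int :: "fm set" where
  "ax_HAC_int =
     {(allst \<rho> (\<lambda>x. exst \<tau> (\<lambda>y. raw \<phi>)) \<^bold>\<longrightarrow>
       exst (\<rho> \<rightarrow>\<^sub>t Seq \<tau>) (\<lambda>F. allst \<rho> (\<lambda>x. ex \<tau> (\<lambda>y. mem \<tau> y (F \<cdot> x) \<^bold>\<and> raw (lift_fm 2 \<phi>))))) 0
      | \<rho> \<tau> \<phi>. internal \<phi>}"

text \<open>Here \<open>x\<close>, the variable 0, is the only free variable of \<open>\<phi>\<close>.\<close>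
definition ax_PF_TP :: "spec \<Rightarrow> fm set" where
  "ax_PF_TP sp =
     {(allst \<tau> (\<lambda>x. raw \<phi>) \<^bold>\<longrightarrow> all \<tau> (\<lambda>x. raw \<phi>)) 0 | \<tau> \<phi>. internal \<phi> \<and> fm_ok sp [\<tau>] \<phi>}"

text \<open>Agreement on all standard inputs is the relativisation of equality.\<close>
definition ax_spec :: "spec \<Rightarrow> fm set" where
  "ax_spec sp =
     {(st (con (Xi n \<tau>)) \<^bold>\<and>
       allst \<tau> (\<lambda>X. raw (rel D) \<^bold>\<longrightarrow> srel (eq \<tau> (con (Xi n \<tau>)) X))) 0 | n \<tau> D. sp n = Some (\<tau>, D)}"

definition RCA0_Omega :: "spec \<Rightarrow> fm set" where
  "RCA0_Omega sp =
     RCA0_omega \<union> ax_standard sp \<union> ax_idealization \<union> ax_HAC_int \<union> ax_PF_TP sp \<union> ax_spec sp"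

text \<open>
  Every defining formula is a parameter-free internal formula of the base language that specifies
  at most one functional, provably in the base theory. Which functionals are named in this way is
  left open.
\<close>
definition admissible :: "spec \<Rightarrow> bool" where
  "admissible sp \<longleftrightarrow> (\<forall>n \<tau> D. sp n = Some (\<tau>, D) \<longrightarrow>
     fm_ok Map.empty [\<tau>] D \<and> internal D \<and>
     proves Map.empty RCA0_omega
       (all \<tau> (\<lambda>X. all \<tau> (\<lambda>Y. raw (lift_fm 0 D) \<^bold>\<longrightarrow> raw D \<^bold>\<longrightarrow> eq \<tau> X Y)) 0))"


section \<open>Binary sequences and the fan theorem\<close>

definition binary :: "stm \<Rightarrow> sfm" where
  "binary \<alpha> = all Nat (\<lambda>n. leq (\<alpha> \<cdot> n) (suc zero))"

text \<open>Finite number sequences are coded by \<open>\<langle>\<rangle> \<mapsto> 0\<close> and \<open>s \<^emph>\<open>followed by\<close> a \<mapsto> Suc (pairing s a)\<close>;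
  as the pairing is a bijection, every number codes exactly one sequence.\<close>
definition snoc :: "stm \<Rightarrow> stm \<Rightarrow> stm" where "snoc s a = suc (pairing s a)"
definition initial :: "stm \<Rightarrow> stm \<Rightarrow> stm" where
  "initial \<alpha> n = rec n zero (\<lambda>s i. snoc s (\<alpha> \<cdot> i))"

definition in_tree :: "stm \<Rightarrow> stm \<Rightarrow> sfm" where "in_tree s T = eq0 (T \<cdot> s) (suc zero)"

text \<open>\<open>T\<close> is the characteristic function of a set of 0-1 sequences that is closed under initial
  segments.\<close>
definition binary_tree :: "stm \<Rightarrow> sfm" where
  "binary_tree T =
     (binary T \<^bold>\<and>
      all Nat (\<lambda>s. all Nat (\<lambda>a. in_tree (snoc s a) T \<^bold>\<longrightarrow> in_tree s T \<^bold>\<and> leq a (suc zero))))"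

definition FAN :: fm where
  "FAN = all T1 (\<lambda>T. binary_tree T \<^bold>\<longrightarrow>
     all T1 (\<lambda>\<alpha>. binary \<alpha> \<^bold>\<longrightarrow> ex Nat (\<lambda>n. \<^bold>\<not> in_tree (initial \<alpha> n) T)) \<^bold>\<longrightarrow>
     ex Nat (\<lambda>k. all T1 (\<lambda>\<alpha>. binary \<alpha> \<^bold>\<longrightarrow> ex_le k (\<lambda>n. \<^bold>\<not> in_tree (initial \<alpha> n) T)))) 0"


section \<open>Real numbers and the Heine-Borel lemma\<close>

text \<open>The number \<open>pairing (pairing a b) c\<close> codes the rational \<open>(a - b) / (c + 1)\<close>. Comparisons of
  rationals are multiplied out to comparisons of natural numbers.\<close>
definition rpos :: "stm \<Rightarrow> stm" where "rpos u = proj1 (proj1 u)"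
definition rneg :: "stm \<Rightarrow> stm" where "rneg u = proj2 (proj1 u)"
definition rden :: "stm \<Rightarrow> stm" where "rden u = suc (proj2 u)"

text \<open>The numerator of \<open>max (u - v) 0\<close> over the denominator \<open>rden u * rden v\<close>.\<close>
definition rdiff :: "stm \<Rightarrow> stm \<Rightarrow> stm" where
  "rdiff u v = monus (add (mul (rpos u) (rden v)) (mul (rneg v) (rden u)))
                     (add (mul (rpos v) (rden u)) (mul (rneg u) (rden v)))"

text \<open>\<open>\<bar>u - v\<bar> < 2\<^sup>-\<^sup>n\<close>\<close>
definition rclose :: "stm \<Rightarrow> stm \<Rightarrow> stm \<Rightarrow> sfm" where
  "rclose n u v = less (mul (pow2 n) (add (rdiff u v) (rdiff v u))) (mul (rden u) (rden v))"

text \<open>\<open>v - u > 2\<^sup>-\<^sup>n\<^sup>+\<^sup>1\<close>\<close>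
definition rgap :: "stm \<Rightarrow> stm \<Rightarrow> stm \<Rightarrow> sfm" where
  "rgap n u v = less (mul (suc (suc zero)) (mul (rden u) (rden v))) (mul (pow2 n) (rdiff v u))"

text \<open>Sequences of rationals are given here by their values, as functions on terms.\<close>
type_synonym rseq = "stm \<Rightarrow> stm"

definition is_real :: "rseq \<Rightarrow> sfm" where
  "is_real q = all Nat (\<lambda>n. all Nat (\<lambda>i. rclose n (q n) (q (add n i))))"

definition real_less :: "rseq \<Rightarrow> rseq \<Rightarrow> sfm" where
  "real_less q r = ex Nat (\<lambda>n. rgap n (q n) (r n))"

definition real0 :: rseq where "real0 = (\<lambda>n. zero)"
definition real1 :: rseq where "real1 = (\<lambda>n. pairing (pairing (suc zero) zero) zero)"

definition of1 :: "stm \<Rightarrow> rseq" where "of1 x = (\<lambda>n. x \<cdot> n)"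

definition in_unit :: "stm \<Rightarrow> sfm" where
  "in_unit x = (is_real (of1 x) \<^bold>\<and> \<^bold>\<not> real_less (of1 x) real0 \<^bold>\<and> \<^bold>\<not> real_less real1 (of1 x))"

definition all_unit :: "(stm \<Rightarrow> sfm) \<Rightarrow> sfm" where
  "all_unit F = all T1 (\<lambda>x. in_unit x \<^bold>\<longrightarrow> F x)"

text \<open>A sequence of intervals \<open>I\<close> has the pair of the \<open>m\<close>-th approximations to \<open>c\<^sub>n\<close> and \<open>d\<^sub>n\<close> as
  value \<open>I n m\<close>.\<close>
definition left_end :: "stm \<Rightarrow> stm \<Rightarrow> rseq" where "left_end I n = (\<lambda>m. proj1 (I \<cdot> n \<cdot> m))"
definition right_end :: "stm \<Rightarrow> stm \<Rightarrow> rseq" where "right_end I n = (\<lambda>m. proj2 (I \<cdot> n \<cdot> m))"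

definition intervals :: "stm \<Rightarrow> sfm" where
  "intervals I = all Nat (\<lambda>n. is_real (left_end I n) \<^bold>\<and> is_real (right_end I n))"

definition in_interval :: "stm \<Rightarrow> stm \<Rightarrow> stm \<Rightarrow> sfm" where
  "in_interval x I n = (real_less (left_end I n) (of1 x) \<^bold>\<and> real_less (of1 x) (right_end I n))"

definition HB :: fm where
  "HB = all (Nat \<rightarrow>\<^sub>t T1) (\<lambda>I. intervals I \<^bold>\<longrightarrow>
     all_unit (\<lambda>x. ex Nat (\<lambda>n. in_interval x I n)) \<^bold>\<longrightarrow>
     ex Nat (\<lambda>k. all_unit (\<lambda>x. ex_le k (\<lambda>n. in_interval x I n)))) 0"

text \<open>The pair of arguments of the functional is curried.\<close>
definition UHB :: fm where
  "UHB = ex ((Nat \<rightarrow>\<^sub>t T1) \<rightarrow>\<^sub>t T2 \<rightarrow>\<^sub>t Nat) (\<lambda>H. all (Nat \<rightarrow>\<^sub>t T1) (\<lambda>I. all T2 (\<lambda>g. intervals I \<^bold>\<longrightarrow>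
     all_unit (\<lambda>x. in_interval x I (g \<cdot> x)) \<^bold>\<longrightarrow>
     all_unit (\<lambda>x. ex_le (H \<cdot> I \<cdot> g) (\<lambda>n. in_interval x I n))))) 0"

text \<open>\<open>rel HB\<close> with the innermost part of the conclusion left internal, so that it concerns all
  reals in the unit interval, standard or not.\<close>
definition HB_star :: fm where
  "HB_star = allst (Nat \<rightarrow>\<^sub>t T1) (\<lambda>I. srel (intervals I) \<^bold>\<longrightarrow>
     srel (all_unit (\<lambda>x. ex Nat (\<lambda>n. in_interval x I n))) \<^bold>\<longrightarrow>
     exst Nat (\<lambda>k. all_unit (\<lambda>x. ex_le k (\<lambda>n. in_interval x I n)))) 0"

end

theory Submission
  imports Defs "HOL-Library.Countable" "HOL-Computational_Algebra.Fraction_Field"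
begin

text \<open>
  Derivability is reduced to truth by a completeness theorem: if one of the equivalences were not
  derivable, it would fail in some model \<open>M0\<close> of the theory in which equality is the identity. The
  argument takes place in \<open>M0\<close>, simultaneously for its two ``worlds'', all objects and the standard
  objects; each satisfies enough comprehension and quantifier-free choice.

  From the fan theorem to the Heine-Borel lemma: let \<open>g\<close> select an interval of the cover for each
  point. A binary sequence is alive at level \<open>n\<close> if none of the first \<open>n\<close> intervals visibly contains the
  dyadic interval that it determines, and \<open>g\<close> is at least \<open>n\<close> at one of finitely many candidate points
  there: the right ends of the first \<open>n\<close> intervals, moved into the dyadic interval, and its left end.
  Every sequence dies since an interval around its limit becomes visible; and if all are dead by level
  \<open>k\<close>, then the intervals up to \<open>k\<close> cover, as the supremum of the part of a dyadic interval that they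
  cover would be a candidate. The time of death is bounded by \<open>g\<close> at a point that is defined outright
  from the sequence, which yields the uniform version. Conversely, the complement of a tree is a
  cover of the Cantor set, which together with the gaps covers the unit interval.

  The uniform fan theorem for standard objects follows from the plain one by \<open>HAC\<close>. To compare the fan
  theorem for all objects with the one for standard objects, consider trees \<open>T\<close> with a bound \<open>h\<close> on the
  time at which a path leaves \<open>T\<close>. If choice for type 2 gives a functional that computes the height of
  \<open>T\<close> from \<open>T\<close> and \<open>h\<close>, then it can be taken to be standard by transfer without parameters. Otherwise
  there is a tree with a path on which \<open>h\<close> fails to be continuous, and Grilliot's trick gives the search
  operator \<open>mu\<close>, and with it the leftmost path of every tree of unbounded height.
\<close>

section \<open>Substitution\<close>

text \<open>A formal derivation of this much analysis from the axioms is hardly feasible, while in a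
  model HOL can quantify over the objects and choose among them. The price is that the numbers of
  the model may be nonstandard and satisfy induction for quantifier-free formulas only. This shapes
  the tree of a cover: an extreme point must be found in a bounded list of named points, by
  induction along the list. The same definability proofs yield standardness: whatever is built by
  application from standard objects is standard. Most arguments are therefore carried out once, for
  a class \<open>W\<close> of objects closed under application, and are then read in both worlds.
  The selector \<open>g\<close> need not be continuous, hence its values are used only at points
  that are explicitly defined.\<close>

primrec psub_tm :: "(ty \<Rightarrow> nat \<Rightarrow> tm) \<Rightarrow> tm \<Rightarrow> tm" where
  "psub_tm \<theta> (Var \<tau> n) = \<theta> \<tau> n"
| "psub_tm \<theta> (Cst c) = Cst c"
| "psub_tm \<theta> (App s t) = App (psub_tm \<theta> s) (psub_tm \<theta> t)"

definition up :: "(ty \<Rightarrow> nat \<Rightarrow> tm) \<Rightarrow> ty \<Rightarrow> nat \<Rightarrow> tm" where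
  "up \<theta> \<tau> n = (case n of 0 \<Rightarrow> Var \<tau> 0 | Suc m \<Rightarrow> lift_tm 0 (\<theta> \<tau> m))"

primrec psub_fm :: "(ty \<Rightarrow> nat \<Rightarrow> tm) \<Rightarrow> fm \<Rightarrow> fm" where
  "psub_fm \<theta> Fls = Fls"
| "psub_fm \<theta> (Eq s t) = Eq (psub_tm \<theta> s) (psub_tm \<theta> t)"
| "psub_fm \<theta> (St t) = St (psub_tm \<theta> t)"
| "psub_fm \<theta> (Imp \<phi> \<psi>) = Imp (psub_fm \<theta> \<phi>) (psub_fm \<theta> \<psi>)"
| "psub_fm \<theta> (All \<tau> \<phi>) = All \<tau> (psub_fm (up \<theta>) \<phi>)"

definition lsub :: "nat \<Rightarrow> ty \<Rightarrow> nat \<Rightarrow> tm" where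
  "lsub k \<tau> n = Var \<tau> (if n < k then n else Suc n)"

definition ssub :: "nat \<Rightarrow> tm \<Rightarrow> ty \<Rightarrow> nat \<Rightarrow> tm" where
  "ssub k u \<tau> n = (if n < k then Var \<tau> n else if n = k then u else Var \<tau> (n - 1))"

lemma up_simps [simp]: "up \<theta> \<tau> 0 = Var \<tau> 0" "up \<theta> \<tau> (Suc m) = lift_tm 0 (\<theta> \<tau> m)"
  by (simp_all add: up_def)

text \<open>Lifting and single substitution become instances of parallel substitution, so that all
  commutation laws follow from the one composition law \<open>psub_psub_fm\<close> instead of index
  arithmetic for each pair.\<close>

lemma lift_tm_psub: "lift_tm k t = psub_tm (lsub k) t"
  by (induction t) (auto simp: lsub_def)

lemma subst_tm_psub: "subst_tm k u t = psub_tm (ssub k u) t"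
  by (induction t) (auto simp: ssub_def)

lemma up_lsub: "up (lsub k) = lsub (Suc k)"
  by (intro ext) (auto simp: up_def lsub_def split: nat.split)

lemma up_ssub: "up (ssub k u) = ssub (Suc k) (lift_tm 0 u)"
  by (intro ext) (auto simp: up_def ssub_def split: nat.split)

lemma lift_fm_psub: "lift_fm k \<phi> = psub_fm (lsub k) \<phi>"
  by (induction \<phi> arbitrary: k) (auto simp: lift_tm_psub up_lsub)

lemma subst_fm_psub: "subst_fm k u \<phi> = psub_fm (ssub k u) \<phi>"
  by (induction \<phi> arbitrary: k u) (auto simp: subst_tm_psub up_ssub)

lemma psub_psub_tm: "psub_tm \<theta> (psub_tm \<eta> t) = psub_tm (\<lambda>\<tau> n. psub_tm \<theta> (\<eta> \<tau> n)) t"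
  by (induction t) auto

lemma up_comp: "(\<lambda>\<tau> n. psub_tm (up \<theta>) (up \<eta> \<tau> n)) = up (\<lambda>\<tau> n. psub_tm \<theta> (\<eta> \<tau> n))"
proof (intro ext)
  fix \<tau> n
  have *: "psub_tm (up \<theta>) (lift_tm 0 s) = lift_tm 0 (psub_tm \<theta> s)" for s
    unfolding lift_tm_psub psub_psub_tm by (simp add: lsub_def lift_tm_psub)
  show "psub_tm (up \<theta>) (up \<eta> \<tau> n) = up (\<lambda>\<tau> n. psub_tm \<theta> (\<eta> \<tau> n)) \<tau> n"
    by (cases n) (simp_all add: *)
qed

lemma psub_psub_fm: "psub_fm \<theta> (psub_fm \<eta> \<phi>) = psub_fm (\<lambda>\<tau> n. psub_tm \<theta> (\<eta> \<tau> n)) \<phi>"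
  by (induction \<phi> arbitrary: \<theta> \<eta>) (auto simp: psub_psub_tm up_comp)

lemma psub_up_lift: "psub_fm (up \<theta>) (lift_fm 0 \<phi>) = lift_fm 0 (psub_fm \<theta> \<phi>)"
  unfolding lift_fm_psub psub_psub_fm by (simp add: lsub_def lift_tm_psub)

lemma psub_lift_ssub: "psub_tm (ssub 0 u) (lift_tm 0 t) = t"
proof -
  have "psub_tm (ssub 0 u) (lift_tm 0 t) = psub_tm Var t"
    unfolding lift_tm_psub psub_psub_tm by (simp add: lsub_def ssub_def)
  also have "\<dots> = t" by (induction t) auto
  finally show ?thesis .
qed

definition scons :: "tm \<Rightarrow> (ty \<Rightarrow> nat \<Rightarrow> tm) \<Rightarrow> ty \<Rightarrow> nat \<Rightarrow> tm" where
  "scons u \<theta> \<tau> n = (case n of 0 \<Rightarrow> u | Suc m \<Rightarrow> \<theta> \<tau> m)"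

text \<open>This is the form in which quantifiers meet environments: going under a binder and then
  instantiating it amounts to putting \<open>u\<close> in front of the substitution. In the term
  model an environment is such a substitution.\<close>

lemma subst_psub_up: "subst_fm 0 u (psub_fm (up \<theta>) \<phi>) = psub_fm (scons u \<theta>) \<phi>"
proof -
  have "(\<lambda>\<tau> n. psub_tm (ssub 0 u) (up \<theta> \<tau> n)) = scons u \<theta>"
    by (intro ext) (simp add: scons_def up_def psub_lift_ssub ssub_def split: nat.split)
  then show ?thesis unfolding subst_fm_psub psub_psub_fm by simp
qed

lemma psub_subst: "psub_fm \<theta> (subst_fm 0 u \<phi>) = subst_fm 0 (psub_tm \<theta> u) (psub_fm (up \<theta>) \<phi>)"
proof -
  have "(\<lambda>\<tau> n. psub_tm \<theta> (ssub 0 u \<tau> n)) = scons (psub_tm \<theta> u) \<theta>"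
    by (intro ext) (simp add: scons_def ssub_def split: nat.split)
  then show ?thesis unfolding subst_psub_up by (simp add: subst_fm_psub psub_psub_fm)
qed

lemma psub_tm_cong:
  "tm_ok sp \<Gamma> t \<Longrightarrow> (\<And>n. n < length \<Gamma> \<Longrightarrow> \<theta> (\<Gamma> ! n) n = \<eta> (\<Gamma> ! n) n) \<Longrightarrow>
   psub_tm \<theta> t = psub_tm \<eta> t"
  by (induction t) auto

lemma psub_fm_cong:
  "fm_ok sp \<Gamma> \<phi> \<Longrightarrow> (\<And>n. n < length \<Gamma> \<Longrightarrow> \<theta> (\<Gamma> ! n) n = \<eta> (\<Gamma> ! n) n) \<Longrightarrow>
   psub_fm \<theta> \<phi> = psub_fm \<eta> \<phi>"
proof (induction \<phi> arbitrary: \<Gamma> \<theta> \<eta>)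
  case (All \<tau> \<phi>)
  have "up \<theta> ((\<tau> # \<Gamma>) ! n) n = up \<eta> ((\<tau> # \<Gamma>) ! n) n" if "n < length (\<tau> # \<Gamma>)" for n
    using that All.prems(2) by (cases n) auto
  then have "psub_fm (up \<theta>) \<phi> = psub_fm (up \<eta>) \<phi>"
    using All.prems(1) by (intro All.IH[of "\<tau> # \<Gamma>"]) simp_all
  then show ?case by simp
next
  case (Imp \<phi> \<psi>)
  then have "psub_fm \<theta> \<phi> = psub_fm \<eta> \<phi>" "psub_fm \<theta> \<psi> = psub_fm \<eta> \<psi>"
    by (auto intro!: Imp.IH[of \<Gamma>])
  then show ?case by simp
next
  case (Eq s t)
  then show ?case using psub_tm_cong[of sp \<Gamma> s \<theta> \<eta>] psub_tm_cong[of sp \<Gamma> t \<theta> \<eta>] by simp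
next
  case (St t)
  then show ?case using psub_tm_cong[of sp \<Gamma> t \<theta> \<eta>] by simp
qed simp

lemma psub_tm_Var [simp]: "psub_tm Var t = t"
  by (induction t) auto

lemma up_Var [simp]: "up Var = Var"
  by (intro ext) (simp add: up_def split: nat.split)

lemma psub_fm_Var [simp]: "psub_fm Var \<phi> = \<phi>"
  by (induction \<phi>) auto

lemma psub_fm_id:
  assumes "fm_ok sp \<Gamma> \<phi>" "\<And>n. n < length \<Gamma> \<Longrightarrow> \<theta> (\<Gamma> ! n) n = Var (\<Gamma> ! n) n"
  shows "psub_fm \<theta> \<phi> = \<phi>"
  using psub_fm_cong[OF assms(1), of \<theta> Var] assms(2) by simp

definition wtsub :: "spec \<Rightarrow> ty list \<Rightarrow> ty list \<Rightarrow> (ty \<Rightarrow> nat \<Rightarrow> tm) \<Rightarrow> bool" where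
  "wtsub sp \<Gamma> \<Gamma>' \<theta> \<longleftrightarrow>
     (\<forall>n<length \<Gamma>. tm_ok sp \<Gamma>' (\<theta> (\<Gamma> ! n) n) \<and> tyof (\<theta> (\<Gamma> ! n) n) = \<Gamma> ! n)"

lemma tm_ok_psub:
  "tm_ok sp \<Gamma> t \<Longrightarrow> wtsub sp \<Gamma> \<Gamma>' \<theta> \<Longrightarrow> tm_ok sp \<Gamma>' (psub_tm \<theta> t) \<and> tyof (psub_tm \<theta> t) = tyof t"
  by (induction t) (auto simp: wtsub_def)

lemma wtsub_lsub: "wtsub sp \<Gamma> (\<tau> # \<Gamma>) (lsub 0)"
  by (simp add: wtsub_def lsub_def)

lemma wtsub_up:
  assumes "wtsub sp \<Gamma> \<Gamma>' \<theta>"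
  shows "wtsub sp (\<tau> # \<Gamma>) (\<tau> # \<Gamma>') (up \<theta>)"
  unfolding wtsub_def
proof (intro allI impI)
  fix n assume "n < length (\<tau> # \<Gamma>)"
  then show "tm_ok sp (\<tau> # \<Gamma>') (up \<theta> ((\<tau> # \<Gamma>) ! n) n) \<and>
      tyof (up \<theta> ((\<tau> # \<Gamma>) ! n) n) = (\<tau> # \<Gamma>) ! n"
    using assms tm_ok_psub[OF _ wtsub_lsub]
    by (cases n) (auto simp: wtsub_def lift_tm_psub)
qed

lemma wtsub_Var: "wtsub sp \<Gamma> (\<Gamma> @ \<Gamma>') Var"
  by (auto simp: wtsub_def nth_append)

lemma fm_ok_psub: "fm_ok sp \<Gamma> \<phi> \<Longrightarrow> wtsub sp \<Gamma> \<Gamma>' \<theta> \<Longrightarrow> fm_ok sp \<Gamma>' (psub_fm \<theta> \<phi>)"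
  by (induction \<phi> arbitrary: \<Gamma> \<Gamma>' \<theta>) (auto simp: tm_ok_psub wtsub_up)

lemma tm_ok_append: "tm_ok sp \<Gamma> t \<Longrightarrow> tm_ok sp (\<Gamma> @ \<Gamma>') t"
  using tm_ok_psub[OF _ wtsub_Var] by simp

lemma fm_ok_append: "fm_ok sp \<Gamma> \<phi> \<Longrightarrow> fm_ok sp (\<Gamma> @ \<Gamma>') \<phi>"
  using fm_ok_psub[OF _ wtsub_Var] by simp

lemma fm_ok_subst: "fm_ok sp (\<tau> # \<Gamma>) \<phi> \<Longrightarrow> tm_ok sp \<Gamma> t \<Longrightarrow> tyof t = \<tau> \<Longrightarrow> fm_ok sp \<Gamma> (subst_fm 0 t \<phi>)"
  unfolding subst_fm_psub
  by (erule fm_ok_psub) (auto simp: wtsub_def ssub_def less_Suc_eq_0_disj)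

section \<open>Derived rules\<close>

lemma derives_ok: "derives sp T \<Gamma> \<Delta> \<phi> \<Longrightarrow> fm_ok sp \<Gamma> \<phi>"
  by (induction rule: derives.induct) (auto intro: fm_ok_subst)

lemma derives_mono: "derives sp T \<Gamma> \<Delta> \<phi> \<Longrightarrow> set \<Delta> \<subseteq> set \<Delta>' \<Longrightarrow> derives sp T \<Gamma> \<Delta>' \<phi>"
proof (induction arbitrary: \<Delta>' rule: derives.induct)
  case (ImpI \<Gamma> \<phi> \<Delta> \<psi>)
  then show ?case by (intro derives.ImpI ImpI.IH) auto
next
  case (Raa \<Gamma> \<phi> \<Delta>)
  then show ?case by (intro derives.Raa[OF Raa.hyps(1) Raa.IH]) auto
next
  case (AllI \<tau> \<Gamma> \<Delta> \<phi>)
  then show ?case by (intro derives.AllI AllI.IH) auto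
next
  case (ImpE \<Gamma> \<Delta> \<phi> \<psi>)
  then show ?case by (blast intro: derives.ImpE)
qed (auto intro: derives.intros)

text \<open>Contexts grow at the far end, where no index shifts. A Henkin set can thus be extended
  by new variables while its formulas stay literally the same.\<close>

lemma derives_append: "derives sp T \<Gamma> \<Delta> \<phi> \<Longrightarrow> derives sp T (\<Gamma> @ \<Gamma>') \<Delta> \<phi>"
proof (induction rule: derives.induct)
  case (AllI \<tau> \<Gamma> \<Delta> \<phi>)
  then show ?case by (intro derives.AllI) auto
next
  case (ImpE \<Gamma> \<Delta> \<phi> \<psi>)
  then show ?case by (blast intro: derives.ImpE)
qed (auto intro: derives.intros fm_ok_append tm_ok_append)

primrec closure :: "ty list \<Rightarrow> fm \<Rightarrow> fm" where
  "closure [] \<phi> = \<phi>"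
| "closure (\<tau> # \<Gamma>) \<phi> = closure \<Gamma> (All \<tau> \<phi>)"

lemma derives_closure: "derives sp T \<Gamma> [] \<phi> \<Longrightarrow> derives sp T [] [] (closure \<Gamma> \<phi>)"
  by (induction \<Gamma> arbitrary: \<phi>) (auto intro: derives.AllI[where \<Delta> = "[]", simplified])

lemma derives_closureE:
  "derives sp T \<Gamma>' \<Delta> (closure \<Gamma> \<phi>) \<Longrightarrow> fm_ok sp \<Gamma> \<phi> \<Longrightarrow> wtsub sp \<Gamma> \<Gamma>' \<theta> \<Longrightarrow>
   derives sp T \<Gamma>' \<Delta> (psub_fm \<theta> \<phi>)"
proof (induction \<Gamma> arbitrary: \<phi> \<theta>)
  case Nil
  then show ?case using psub_fm_id[of sp "[]" \<phi> \<theta>] by simp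
next
  case (Cons \<tau> \<Gamma>)
  have wt: "wtsub sp \<Gamma> \<Gamma>' (\<lambda>\<sigma> n. \<theta> \<sigma> (Suc n))"
    using Cons.prems(3) by (force simp: wtsub_def)
  have "derives sp T \<Gamma>' \<Delta> (psub_fm (\<lambda>\<sigma> n. \<theta> \<sigma> (Suc n)) (All \<tau> \<phi>))"
    using Cons.prems wt by (intro Cons.IH) auto
  moreover have "tm_ok sp \<Gamma>' (\<theta> \<tau> 0)" "tyof (\<theta> \<tau> 0) = \<tau>"
    using Cons.prems(3) by (force simp: wtsub_def)+
  ultimately have
    "derives sp T \<Gamma>' \<Delta> (subst_fm 0 (\<theta> \<tau> 0) (psub_fm (up (\<lambda>\<sigma> n. \<theta> \<sigma> (Suc n))) \<phi>))"
    by (intro derives.AllE[where \<tau> = \<tau>]) simp_all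
  moreover have "psub_fm (scons (\<theta> \<tau> 0) (\<lambda>\<sigma> n. \<theta> \<sigma> (Suc n))) \<phi> = psub_fm \<theta> \<phi>"
    using Cons.prems(2) by (intro psub_fm_cong[of sp "\<tau> # \<Gamma>"]) (auto simp: scons_def less_Suc_eq_0_disj)
  ultimately show ?case by (simp add: subst_psub_up)
qed

lemma derives_psub:
  "derives sp T \<Gamma> \<Delta> \<phi> \<Longrightarrow> wtsub sp \<Gamma> \<Gamma>' \<theta> \<Longrightarrow> derives sp T \<Gamma>' (map (psub_fm \<theta>) \<Delta>) (psub_fm \<theta> \<phi>)"
proof (induction arbitrary: \<Gamma>' \<theta> rule: derives.induct)
  case (Ax \<phi> \<Gamma> \<Delta>)
  \<comment> \<open>\<open>T\<close> need not be closed under substitution. An axiom with parameters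
    is first generalised to its closure and then instantiated by the terms of
    \<open>\<theta>\<close>.\<close>
  have "derives sp T [] [] (closure \<Gamma> \<phi>)"
    using Ax by (intro derives_closure derives.Ax)
  then have "derives sp T ([] @ \<Gamma>') (map (psub_fm \<theta>) \<Delta>) (closure \<Gamma> \<phi>)"
    by (intro derives_append) (rule derives_mono, auto)
  with Ax show ?case using derives_closureE by auto
next
  case (Asm \<phi> \<Delta> \<Gamma>)
  then show ?case by (auto intro: derives.Asm fm_ok_psub)
next
  case (ImpI \<Gamma> \<phi> \<Delta> \<psi>)
  then have "derives sp T \<Gamma>' (psub_fm \<theta> \<phi> # map (psub_fm \<theta>) \<Delta>) (psub_fm \<theta> \<psi>)" by force
  then show ?case using ImpI by (auto intro: derives.ImpI fm_ok_psub)
next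
  case (ImpE \<Gamma> \<Delta> \<phi> \<psi>)
  then have "derives sp T \<Gamma>' (map (psub_fm \<theta>) \<Delta>) (Imp (psub_fm \<theta> \<phi>) (psub_fm \<theta> \<psi>))"
    "derives sp T \<Gamma>' (map (psub_fm \<theta>) \<Delta>) (psub_fm \<theta> \<phi>)" by auto
  then show ?case by (rule derives.ImpE)
next
  case (Raa \<Gamma> \<phi> \<Delta>)
  then have "derives sp T \<Gamma>' (Neg (psub_fm \<theta> \<phi>) # map (psub_fm \<theta>) \<Delta>) Fls" by force
  moreover have "fm_ok sp \<Gamma>' (psub_fm \<theta> \<phi>)" using Raa by (blast intro: fm_ok_psub)
  ultimately show ?case by (rule derives.Raa[rotated])
next
  case (AllI \<tau> \<Gamma> \<Delta> \<phi>)
  have "derives sp T (\<tau> # \<Gamma>') (map (psub_fm (up \<theta>)) (map (lift_fm 0) \<Delta>)) (psub_fm (up \<theta>) \<phi>)"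
    using AllI by (intro AllI.IH wtsub_up)
  then show ?case by (auto intro!: derives.AllI simp: psub_up_lift comp_def)
next
  case (AllE \<Gamma> \<Delta> \<tau> \<phi> t)
  then have "derives sp T \<Gamma>' (map (psub_fm \<theta>) \<Delta>) (All \<tau> (psub_fm (up \<theta>) \<phi>))" by simp
  moreover have "tm_ok sp \<Gamma>' (psub_tm \<theta> t)" "tyof (psub_tm \<theta> t) = \<tau>"
    using AllE tm_ok_psub by blast+
  ultimately show ?case unfolding psub_subst by (rule derives.AllE)
qed

lemma derives_Fls: "derives sp T \<Gamma> \<Delta> Fls \<Longrightarrow> fm_ok sp \<Gamma> \<phi> \<Longrightarrow> derives sp T \<Gamma> \<Delta> \<phi>"
  by (rule derives.Raa) (assumption, erule derives_mono, auto)

lemma derives_cut: "derives sp T \<Gamma> \<Delta> \<phi> \<Longrightarrow> derives sp T \<Gamma> (\<phi> # \<Delta>) \<psi> \<Longrightarrow> derives sp T \<Gamma> \<Delta> \<psi>"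
  by (rule derives.ImpE[OF derives.ImpI]) (auto intro: derives_ok)

text \<open>The new variable is appended at the end of the context, so that the other indices stay fixed.\<close>
lemma derives_eigenvariable:
  assumes d: "derives sp T (\<Gamma> @ [\<tau>]) \<Delta> (subst_fm 0 (Var \<tau> (length \<Gamma>)) \<phi>)"
    and \<Delta>: "\<forall>\<psi>\<in>set \<Delta>. fm_ok sp \<Gamma> \<psi>" and \<phi>: "fm_ok sp (\<tau> # \<Gamma>) \<phi>"
  shows "derives sp T \<Gamma> \<Delta> (All \<tau> \<phi>)"
proof -
  \<comment> \<open>The appended variable becomes number 0 and all others move up by one, which is
    the shape that \<open>AllI\<close> asks for.\<close>
  let ?r = "\<lambda>\<sigma> n. Var \<sigma> (if n = length \<Gamma> then 0 else Suc n)"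
  have "wtsub sp (\<Gamma> @ [\<tau>]) (\<tau> # \<Gamma>) ?r"
    by (auto simp: wtsub_def nth_append)
  from derives_psub[OF d this]
  have "derives sp T (\<tau> # \<Gamma>) (map (psub_fm ?r) \<Delta>) (psub_fm ?r (subst_fm 0 (Var \<tau> (length \<Gamma>)) \<phi>))" .
  moreover have "map (psub_fm ?r) \<Delta> = map (lift_fm 0) \<Delta>"
    unfolding lift_fm_psub using \<Delta> by (auto intro!: psub_fm_cong[of sp \<Gamma>] simp: lsub_def)
  moreover have "psub_fm ?r (subst_fm 0 (Var \<tau> (length \<Gamma>)) \<phi>) = \<phi>"
    unfolding psub_subst subst_psub_up
    by (rule psub_fm_id[OF \<phi>]) (auto simp: scons_def less_Suc_eq_0_disj)
  ultimately show ?thesis by (auto intro: derives.AllI)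
qed

text \<open>Countability of the syntax lets a sequence of stages reach every formula.\<close>

instance ty :: countable by countable_datatype
instance const :: countable by countable_datatype
instance tm :: countable by countable_datatype
instance fm :: countable by countable_datatype

section \<open>Henkin sets\<close>

definition henkin_good :: "spec \<Rightarrow> fm set \<Rightarrow> ty list \<times> fm list \<Rightarrow> bool" where
  "henkin_good sp T = (\<lambda>(\<Gamma>, \<Delta>). (\<forall>\<phi>\<in>set \<Delta>. fm_ok sp \<Gamma> \<phi>) \<and> \<not> derives sp T \<Gamma> \<Delta> Fls)"

text \<open>Witnesses are variables appended to the context instead of new constants, so the
  language stays fixed. A formula is decided only once all its variables are in the context; a
  negated universal formula receives its counterexample at the same stage.\<close>

definition henkin_step :: "spec \<Rightarrow> fm \<Rightarrow> ty list \<times> fm list \<Rightarrow> ty list \<times> fm list \<Rightarrow> bool" where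
  "henkin_step sp \<phi> = (\<lambda>(\<Gamma>, \<Delta>) (\<Gamma>2, \<Delta>2). (\<exists>\<Gamma>'. \<Gamma>2 = \<Gamma> @ \<Gamma>') \<and> set \<Delta> \<subseteq> set \<Delta>2 \<and>
     (fm_ok sp \<Gamma> \<phi> \<longrightarrow> (\<phi> \<in> set \<Delta>2 \<or> Neg \<phi> \<in> set \<Delta>2) \<and>
       (\<forall>\<tau> \<psi>. \<phi> = All \<tau> \<psi> \<longrightarrow> Neg \<phi> \<in> set \<Delta>2 \<longrightarrow>
          (\<exists>i<length \<Gamma>2. \<Gamma>2 ! i = \<tau> \<and> Neg (subst_fm 0 (Var \<tau> i) \<psi>) \<in> set \<Delta>2))))"

lemma henkin_step_ex:
  assumes good: "henkin_good sp T (\<Gamma>, \<Delta>)"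
  shows "\<exists>X. henkin_good sp T X \<and> henkin_step sp \<phi> (\<Gamma>, \<Delta>) X"
proof (cases "fm_ok sp \<Gamma> \<phi>")
  case False
  then show ?thesis using good by (intro exI[of _ "(\<Gamma>, \<Delta>)"]) (auto simp: henkin_step_def)
next
  case ok: True
  show ?thesis
  proof (cases "derives sp T \<Gamma> (\<phi> # \<Delta>) Fls")
    case False
    have "Neg \<phi> \<notin> set (\<phi> # \<Delta>)"
    proof
      assume "Neg \<phi> \<in> set (\<phi> # \<Delta>)"
      then have "derives sp T \<Gamma> (\<phi> # \<Delta>) (Neg \<phi>)" "derives sp T \<Gamma> (\<phi> # \<Delta>) \<phi>"
        using ok by (auto intro!: derives.Asm)
      then have "derives sp T \<Gamma> (\<phi> # \<Delta>) Fls" by (rule derives.ImpE)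
      then show False using False by simp
    qed
    then show ?thesis using good ok False
      by (intro exI[of _ "(\<Gamma>, \<phi> # \<Delta>)"]) (auto simp: henkin_step_def henkin_good_def)
  next
    case True
    have n: "\<not> derives sp T \<Gamma> (Neg \<phi> # \<Delta>) Fls"
    proof
      assume "derives sp T \<Gamma> (Neg \<phi> # \<Delta>) Fls"
      with ok have "derives sp T \<Gamma> \<Delta> \<phi>" by (rule derives.Raa)
      with True have "derives sp T \<Gamma> \<Delta> Fls" by (blast intro: derives_cut)
      then show False using good by (simp add: henkin_good_def)
    qed
    show ?thesis
    proof (cases "\<exists>\<tau> \<psi>. \<phi> = All \<tau> \<psi>")
      case False
      then show ?thesis using good ok n
        by (intro exI[of _ "(\<Gamma>, Neg \<phi> # \<Delta>)"]) (auto simp: henkin_step_def henkin_good_def)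
    next
      case True
      then obtain \<tau> \<psi> where \<phi>: "\<phi> = All \<tau> \<psi>" by blast
      let ?\<chi> = "subst_fm 0 (Var \<tau> (length \<Gamma>)) \<psi>"
      have ok\<psi>: "fm_ok sp (\<tau> # \<Gamma>) \<psi>" using ok \<phi> by simp
      have ok\<chi>: "fm_ok sp (\<Gamma> @ [\<tau>]) ?\<chi>"
        using ok\<psi> fm_ok_append[of sp "\<tau> # \<Gamma>" \<psi> "[\<tau>]"] by (intro fm_ok_subst[where \<tau> = \<tau>]) auto
      \<comment> \<open>If the new witness were inconsistent, \<open>?\<chi>\<close> would be
        derivable for a fresh variable, hence \<open>\<phi>\<close> by the eigenvariable rule,
        against the consistency of \<open>Neg \<phi>\<close>.\<close>
      have "\<not> derives sp T (\<Gamma> @ [\<tau>]) (Neg ?\<chi> # Neg \<phi> # \<Delta>) Fls"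
      proof
        assume "derives sp T (\<Gamma> @ [\<tau>]) (Neg ?\<chi> # Neg \<phi> # \<Delta>) Fls"
        with ok\<chi> have "derives sp T (\<Gamma> @ [\<tau>]) (Neg \<phi> # \<Delta>) ?\<chi>" by (rule derives.Raa)
        moreover have "\<forall>\<psi>\<in>set (Neg \<phi> # \<Delta>). fm_ok sp \<Gamma> \<psi>"
          using good ok by (auto simp: henkin_good_def)
        ultimately have "derives sp T \<Gamma> (Neg \<phi> # \<Delta>) \<phi>"
          unfolding \<phi> using ok\<psi> by (intro derives_eigenvariable)
        moreover have "derives sp T \<Gamma> (Neg \<phi> # \<Delta>) (Neg \<phi>)"
          using ok by (intro derives.Asm) auto
        ultimately have "derives sp T \<Gamma> (Neg \<phi> # \<Delta>) Fls" by (rule derives.ImpE[rotated])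
        then show False using n by simp
      qed
      then have "henkin_good sp T (\<Gamma> @ [\<tau>], Neg ?\<chi> # Neg \<phi> # \<Delta>)"
        using good ok ok\<chi> fm_ok_append[of sp \<Gamma> _ "[\<tau>]"] fm_ok_append[OF ok, of "[\<tau>]"]
        by (auto simp: henkin_good_def)
      moreover have "henkin_step sp \<phi> (\<Gamma>, \<Delta>) (\<Gamma> @ [\<tau>], Neg ?\<chi> # Neg \<phi> # \<Delta>)"
        by (auto simp: henkin_step_def \<phi> intro!: exI[of _ "length \<Gamma>"])
      ultimately show ?thesis by blast
    qed
  qed
qed

locale henkin =
  fixes sp :: spec and T :: "fm set" and \<Gamma>s :: "nat \<Rightarrow> ty list" and H :: "fm set"
  assumes chain: "\<And>k. \<exists>\<Gamma>'. \<Gamma>s (Suc k) = \<Gamma>s k @ \<Gamma>'"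
    and H_ok: "\<And>\<phi>. \<phi> \<in> H \<Longrightarrow> \<exists>k. fm_ok sp (\<Gamma>s k) \<phi>"
    and H_cons: "\<And>k \<Delta>. set \<Delta> \<subseteq> H \<Longrightarrow> \<not> derives sp T (\<Gamma>s k) \<Delta> Fls"
    and H_dec: "\<And>k \<phi>. fm_ok sp (\<Gamma>s k) \<phi> \<Longrightarrow> \<phi> \<in> H \<or> Neg \<phi> \<in> H"
    and H_wit: "\<And>\<tau> \<psi>. Neg (All \<tau> \<psi>) \<in> H \<Longrightarrow>
      \<exists>k i. i < length (\<Gamma>s k) \<and> \<Gamma>s k ! i = \<tau> \<and> Neg (subst_fm 0 (Var \<tau> i) \<psi>) \<in> H"

lemma henkin_exists:
  assumes np: "\<not> derives sp T [] [] \<phi>" and ok: "fm_ok sp [] \<phi>"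
  obtains \<Gamma>s H where "henkin sp T \<Gamma>s H" "Neg \<phi> \<in> H"
proof -
  have "\<not> derives sp T [] [Neg \<phi>] Fls" using np ok derives.Raa by blast
  then have "henkin_good sp T ([], [Neg \<phi>])" using ok by (simp add: henkin_good_def)
  \<comment> \<open>Stage \<open>n\<close> decides the formula numbered by the first component of
    \<open>n\<close>. The second component makes each formula return at arbitrarily late stages,
    when its variables have entered the context.\<close>
  then obtain f where f: "\<And>n. henkin_good sp T (f n)" "\<And>n. n = 0 \<Longrightarrow> f n = ([], [Neg \<phi>])"
    "\<And>n. henkin_step sp (from_nat (fst (prod_decode n))) (f n) (f (Suc n))"
    using dependent_nat_choice[of "\<lambda>n X. henkin_good sp T X \<and> (n = 0 \<longrightarrow> X = ([], [Neg \<phi>]))"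
        "\<lambda>n X Y. henkin_step sp (from_nat (fst (prod_decode n))) X Y"]
      henkin_step_ex[of sp T]
    by (metis (no_types, lifting) old.nat.distinct(2) surj_pair)
  define \<Gamma>s where "\<Gamma>s n = fst (f n)" for n
  define \<Delta>s where "\<Delta>s n = snd (f n)" for n
  define H where "H = (\<Union>n. set (\<Delta>s n))"
  have ff: "f n = (\<Gamma>s n, \<Delta>s n)" for n by (simp add: \<Gamma>s_def \<Delta>s_def)
  have st1: "\<exists>\<Gamma>'. \<Gamma>s (Suc n) = \<Gamma>s n @ \<Gamma>'" and st2: "set (\<Delta>s n) \<subseteq> set (\<Delta>s (Suc n))" for n
    using f(3)[of n] by (simp_all add: henkin_step_def ff)
  have mono1: "\<exists>\<Gamma>'. \<Gamma>s (n + j) = \<Gamma>s n @ \<Gamma>'" for n j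
    by (induction j) (use st1 in \<open>auto, metis append.assoc\<close>)
  have mono2: "n \<le> m \<Longrightarrow> set (\<Delta>s n) \<subseteq> set (\<Delta>s m)" for n m
    by (rule lift_Suc_mono_le[of "\<lambda>n. set (\<Delta>s n)"]) (use st2 in auto)
  have good: "henkin_good sp T (\<Gamma>s n, \<Delta>s n)" for n using f(1)[of n] by (simp add: ff)
  have fin: "\<exists>n. set \<Delta> \<subseteq> set (\<Delta>s n)" if "set \<Delta> \<subseteq> H" for \<Delta>
    using that
  proof (induction \<Delta>)
    case (Cons \<psi> \<Delta>)
    then obtain n m where "set \<Delta> \<subseteq> set (\<Delta>s n)" "\<psi> \<in> set (\<Delta>s m)" by (auto simp: H_def)
    then have "set (\<psi> # \<Delta>) \<subseteq> set (\<Delta>s (max n m))"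
      using mono2[of n "max n m"] mono2[of m "max n m"] by auto
    then show ?case by blast
  qed simp
  have cons: "\<not> derives sp T (\<Gamma>s k) \<Delta> Fls" if sub: "set \<Delta> \<subseteq> H" for k \<Delta>
  proof
    assume d: "derives sp T (\<Gamma>s k) \<Delta> Fls"
    obtain n where n: "set \<Delta> \<subseteq> set (\<Delta>s n)" using fin[OF sub] by blast
    obtain \<Gamma>' where g: "\<Gamma>s (k + n) = \<Gamma>s k @ \<Gamma>'" using mono1 by blast
    have "derives sp T (\<Gamma>s (k + n)) \<Delta> Fls" unfolding g by (rule derives_append[OF d])
    then have "derives sp T (\<Gamma>s (k + n)) (\<Delta>s (k + n)) Fls"
      by (rule derives_mono) (use n mono2[of n "k + n"] in auto)
    then show False using good[of "k + n"] by (simp add: henkin_good_def)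
  qed
  have stage: "\<exists>n\<ge>k. from_nat (fst (prod_decode n)) = \<psi>" for k and \<psi> :: fm
    by (intro exI[of _ "prod_encode (to_nat \<psi>, k)"]) (simp add: le_prod_encode_2)
  have ok_mono: "fm_ok sp (\<Gamma>s n) \<psi>" if "fm_ok sp (\<Gamma>s k) \<psi>" "n \<ge> k" for n k \<psi>
    using mono1[of k "n - k"] that fm_ok_append by auto
  have dec: "(\<psi> \<in> H \<or> Neg \<psi> \<in> H) \<and>
      (\<forall>\<tau> \<chi>. \<psi> = All \<tau> \<chi> \<longrightarrow> Neg \<psi> \<in> H \<longrightarrow>
         (\<exists>k i. i < length (\<Gamma>s k) \<and> \<Gamma>s k ! i = \<tau> \<and> Neg (subst_fm 0 (Var \<tau> i) \<chi>) \<in> H))"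
    if "fm_ok sp (\<Gamma>s k) \<psi>" for k \<psi>
  proof -
    obtain n where n: "n \<ge> k" "from_nat (fst (prod_decode n)) = \<psi>" using stage by blast
    have okn: "fm_ok sp (\<Gamma>s n) \<psi>" using ok_mono that n(1) by blast
    have step: "\<psi> \<in> set (\<Delta>s (Suc n)) \<or> Neg \<psi> \<in> set (\<Delta>s (Suc n))"
      "\<And>\<tau> \<chi>. \<psi> = All \<tau> \<chi> \<Longrightarrow> Neg \<psi> \<in> set (\<Delta>s (Suc n)) \<Longrightarrow>
        \<exists>i<length (\<Gamma>s (Suc n)). \<Gamma>s (Suc n) ! i = \<tau> \<and> Neg (subst_fm 0 (Var \<tau> i) \<chi>) \<in> set (\<Delta>s (Suc n))"
      using f(3)[of n] okn n(2) by (simp_all add: henkin_step_def ff)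
    \<comment> \<open>A negation that enters \<open>H\<close> elsewhere was also chosen at the stage
      for \<open>\<psi>\<close>, since \<open>H\<close> contains no contradictory pair; so the
      witness of that stage is available.\<close>
    have "Neg \<psi> \<in> set (\<Delta>s (Suc n))" if "Neg \<psi> \<in> H"
    proof (rule ccontr)
      assume "Neg \<psi> \<notin> set (\<Delta>s (Suc n))"
      then have "\<psi> \<in> H" using step(1) by (auto simp: H_def)
      moreover have "derives sp T (\<Gamma>s n) [Neg \<psi>, \<psi>] Fls"
        by (rule derives.ImpE[of _ _ _ _ \<psi>]) (use okn in \<open>auto intro: derives.Asm\<close>)
      ultimately show False using cons[of "[Neg \<psi>, \<psi>]" n] that by simp
    qed
    then show ?thesis using step unfolding H_def by blast
  qed
  have "henkin sp T \<Gamma>s H"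
  proof
    show "\<exists>\<Gamma>'. \<Gamma>s (Suc k) = \<Gamma>s k @ \<Gamma>'" for k by (rule st1)
    show "\<exists>k. fm_ok sp (\<Gamma>s k) \<psi>" if "\<psi> \<in> H" for \<psi>
      using that good by (auto simp: H_def henkin_good_def)
    show "\<exists>k i. i < length (\<Gamma>s k) \<and> \<Gamma>s k ! i = \<tau> \<and> Neg (subst_fm 0 (Var \<tau> i) \<psi>) \<in> H"
      if "Neg (All \<tau> \<psi>) \<in> H" for \<tau> \<psi>
    proof -
      have "\<exists>k. fm_ok sp (\<Gamma>s k) (Neg (All \<tau> \<psi>))"
        using that good by (force simp: H_def henkin_good_def)
      then obtain k where "fm_ok sp (\<Gamma>s k) (Neg (All \<tau> \<psi>))" by blast
      then show ?thesis using dec[of k "All \<tau> \<psi>"] that by simp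
    qed
  qed (use cons dec in auto)
  moreover have "Neg \<phi> \<in> set (\<Delta>s 0)" by (simp add: f(2) \<Delta>s_def)
  then have "Neg \<phi> \<in> H" by (auto simp: H_def)
  ultimately show ?thesis by (rule that)
qed

context henkin
begin

definition okt :: "tm \<Rightarrow> bool" where "okt t \<longleftrightarrow> (\<exists>k. tm_ok sp (\<Gamma>s k) t)"
definition okf :: "fm \<Rightarrow> bool" where "okf \<phi> \<longleftrightarrow> (\<exists>k. fm_ok sp (\<Gamma>s k) \<phi>)"
definition Dt :: "ty \<Rightarrow> tm set" where "Dt \<tau> = {t. okt t \<and> tyof t = \<tau>}"

lemma chain_le: "n \<le> m \<Longrightarrow> \<exists>\<Gamma>'. \<Gamma>s m = \<Gamma>s n @ \<Gamma>'"
proof (induction m)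
  case (Suc m)
  then show ?case using chain[of m] by (cases "n = Suc m") (simp, force)
qed simp

lemma tm_ok_le: "tm_ok sp (\<Gamma>s n) t \<Longrightarrow> n \<le> m \<Longrightarrow> tm_ok sp (\<Gamma>s m) t"
  using chain_le tm_ok_append by metis

lemma fm_ok_le: "fm_ok sp (\<Gamma>s n) \<phi> \<Longrightarrow> n \<le> m \<Longrightarrow> fm_ok sp (\<Gamma>s m) \<phi>"
  using chain_le fm_ok_append by metis

lemma okt_App: "okt s \<Longrightarrow> okt t \<Longrightarrow> tyof s = tyof t \<rightarrow>\<^sub>t \<tau> \<Longrightarrow> okt (App s t)"
  unfolding okt_def
proof (elim exE)
  fix k l assume "tm_ok sp (\<Gamma>s k) s" "tm_ok sp (\<Gamma>s l) t" "tyof s = tyof t \<rightarrow>\<^sub>t \<tau>"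
  then show "\<exists>k. tm_ok sp (\<Gamma>s k) (App s t)"
    using tm_ok_le[of k s "max k l"] tm_ok_le[of l t "max k l"] by (intro exI[of _ "max k l"]) simp
qed

lemma ded: "set \<Delta> \<subseteq> H \<Longrightarrow> derives sp T (\<Gamma>s k) \<Delta> \<phi> \<Longrightarrow> \<phi> \<in> H"
proof (rule ccontr)
  assume *: "set \<Delta> \<subseteq> H" "derives sp T (\<Gamma>s k) \<Delta> \<phi>" "\<phi> \<notin> H"
  have ok: "fm_ok sp (\<Gamma>s k) \<phi>" using *(2) by (rule derives_ok)
  then have n: "Neg \<phi> \<in> H" using H_dec *(3) by blast
  have "derives sp T (\<Gamma>s k) (Neg \<phi> # \<Delta>) Fls"
  proof (rule derives.ImpE)
    show "derives sp T (\<Gamma>s k) (Neg \<phi> # \<Delta>) (Neg \<phi>)" using ok by (auto intro: derives.Asm)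
    show "derives sp T (\<Gamma>s k) (Neg \<phi> # \<Delta>) \<phi>" using *(2) by (rule derives_mono) auto
  qed
  then show False using H_cons[of "Neg \<phi> # \<Delta>" k] n *(1) by simp
qed

lemma Fls_H: "Fls \<notin> H"
proof
  assume "Fls \<in> H"
  then show False using H_cons[of "[Fls]" 0] derives.Asm[of Fls "[Fls]" sp "\<Gamma>s 0" T] by simp
qed

lemma Imp_H: assumes "okf (Imp \<phi> \<psi>)" shows "Imp \<phi> \<psi> \<in> H \<longleftrightarrow> (\<phi> \<in> H \<longrightarrow> \<psi> \<in> H)"
proof -
  obtain k where k: "fm_ok sp (\<Gamma>s k) (Imp \<phi> \<psi>)" using assms okf_def by blast
  show ?thesis
  proof (intro iffI impI)
    assume "Imp \<phi> \<psi> \<in> H" "\<phi> \<in> H"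
    moreover have "derives sp T (\<Gamma>s k) [Imp \<phi> \<psi>, \<phi>] \<psi>"
      by (rule derives.ImpE[of _ _ _ _ \<phi>]) (use k in \<open>auto intro: derives.Asm\<close>)
    ultimately show "\<psi> \<in> H" by (intro ded[of "[Imp \<phi> \<psi>, \<phi>]"]) auto
  next
    assume *: "\<phi> \<in> H \<longrightarrow> \<psi> \<in> H"
    show "Imp \<phi> \<psi> \<in> H"
    proof (cases "\<psi> \<in> H")
      case True
      moreover have "derives sp T (\<Gamma>s k) [\<psi>] (Imp \<phi> \<psi>)"
        by (rule derives.ImpI) (use k in \<open>auto intro: derives.Asm\<close>)
      ultimately show ?thesis by (intro ded[of "[\<psi>]"]) auto
    next
      case False
      then have "Neg \<phi> \<in> H" using * H_dec[of k \<phi>] k by auto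
      moreover have "derives sp T (\<Gamma>s k) [Neg \<phi>] (Imp \<phi> \<psi>)"
      proof (rule derives.ImpI[OF _ derives_Fls])
        show "derives sp T (\<Gamma>s k) [\<phi>, Neg \<phi>] Fls"
          by (rule derives.ImpE[of _ _ _ _ \<phi>]) (use k in \<open>auto intro: derives.Asm\<close>)
      qed (use k in auto)
      ultimately show ?thesis by (intro ded[of "[Neg \<phi>]"]) auto
    qed
  qed
qed

text \<open>The right-to-left direction is where the witnesses are used: a universal formula outside
  \<open>H\<close> has its negation in \<open>H\<close>, and then some variable refutes an
  instance.\<close>

lemma All_H:
  assumes "okf (All \<tau> \<phi>)"
  shows "All \<tau> \<phi> \<in> H \<longleftrightarrow> (\<forall>t\<in>Dt \<tau>. subst_fm 0 t \<phi> \<in> H)"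
proof -
  obtain k where k: "fm_ok sp (\<Gamma>s k) (All \<tau> \<phi>)" using assms okf_def by blast
  show ?thesis
  proof (intro iffI ballI)
    fix t assume *: "All \<tau> \<phi> \<in> H" "t \<in> Dt \<tau>"
    then obtain l where l: "tm_ok sp (\<Gamma>s l) t" "tyof t = \<tau>" by (auto simp: Dt_def okt_def)
    let ?m = "max k l"
    have "derives sp T (\<Gamma>s ?m) [All \<tau> \<phi>] (subst_fm 0 t \<phi>)"
      by (rule derives.AllE[OF derives.Asm]) (use l fm_ok_le[OF k, of ?m] tm_ok_le[of l _ ?m] in auto)
    then show "subst_fm 0 t \<phi> \<in> H" using * by (intro ded[of "[All \<tau> \<phi>]"]) auto
  next
    assume *: "\<forall>t\<in>Dt \<tau>. subst_fm 0 t \<phi> \<in> H"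
    show "All \<tau> \<phi> \<in> H"
    proof (rule ccontr)
      assume "All \<tau> \<phi> \<notin> H"
      then have "Neg (All \<tau> \<phi>) \<in> H" using H_dec k by blast
      then obtain l i where l: "i < length (\<Gamma>s l)" "\<Gamma>s l ! i = \<tau>"
        "Neg (subst_fm 0 (Var \<tau> i) \<phi>) \<in> H" using H_wit by blast
      have "Var \<tau> i \<in> Dt \<tau>" using l by (auto simp: Dt_def okt_def)
      then have "subst_fm 0 (Var \<tau> i) \<phi> \<in> H" using * by blast
      moreover have "okf (Neg (subst_fm 0 (Var \<tau> i) \<phi>))" using H_ok[OF l(3)] by (auto simp: okf_def)
      ultimately show False using Imp_H l(3) Fls_H by blast
    qed
  qed
qed

lemma axiom_H: "\<phi> \<in> T \<Longrightarrow> fm_ok sp (\<Gamma>s k) \<phi> \<Longrightarrow> \<phi> \<in> H"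
  by (rule ded[of "[]"]) (auto intro: derives.Ax)

end

section \<open>Structures\<close>

definition scn :: "'u \<Rightarrow> (nat \<Rightarrow> 'u) \<Rightarrow> nat \<Rightarrow> 'u" (infixr "##" 65) where
  "(a ## e) n = (case n of 0 \<Rightarrow> a | Suc m \<Rightarrow> e m)"

lemma scn_simps [simp]: "(a ## e) 0 = a" "(a ## e) (Suc n) = e n" "(a ## e) 1 = e 0"
  "(a ## e) (numeral m) = e (pred_numeral m)"
  by (simp_all add: scn_def numeral_eq_Suc)

text \<open>Equality of numbers is a relation \<open>Er\<close>, so that the term model is a structure before the passage
  to the quotient.\<close>
record 'u struct =
  Dom :: "ty \<Rightarrow> 'u set"
  Ap :: "'u \<Rightarrow> 'u \<Rightarrow> 'u"
  Cv :: "const \<Rightarrow> 'u"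
  Er :: "'u \<Rightarrow> 'u \<Rightarrow> bool"
  Sd :: "ty \<Rightarrow> 'u \<Rightarrow> bool"

primrec evl :: "('u, 'b) struct_scheme \<Rightarrow> (nat \<Rightarrow> 'u) \<Rightarrow> tm \<Rightarrow> 'u" where
  "evl M e (Var \<tau> n) = e n"
| "evl M e (Cst c) = Cv M c"
| "evl M e (App s t) = Ap M (evl M e s) (evl M e t)"

primrec sat :: "('u, 'b) struct_scheme \<Rightarrow> (nat \<Rightarrow> 'u) \<Rightarrow> fm \<Rightarrow> bool" where
  "sat M e Fls = False"
| "sat M e (Eq s t) = Er M (evl M e s) (evl M e t)"
| "sat M e (St t) = Sd M (tyof t) (evl M e t)"
| "sat M e (Imp \<phi> \<psi>) = (sat M e \<phi> \<longrightarrow> sat M e \<psi>)"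
| "sat M e (All \<tau> \<phi>) = (\<forall>a\<in>Dom M \<tau>. sat M (a ## e) \<phi>)"

definition envok :: "('u, 'b) struct_scheme \<Rightarrow> ty list \<Rightarrow> (nat \<Rightarrow> 'u) \<Rightarrow> bool" where
  "envok M \<Gamma> e \<longleftrightarrow> (\<forall>n<length \<Gamma>. e n \<in> Dom M (\<Gamma> ! n))"

lemma envok_Nil [simp]: "envok M [] e"
  by (simp add: envok_def)

lemma envok_scn [simp]: "envok M (\<tau> # \<Gamma>) (a ## e) \<longleftrightarrow> a \<in> Dom M \<tau> \<and> envok M \<Gamma> e"
  by (auto simp: envok_def less_Suc_eq_0_disj)

lemma evl_lift: "evl M (a ## e) (lift_tm 0 t) = evl M e t"
  by (induction t) auto

lemma evl_cong: "tm_ok sp \<Gamma> t \<Longrightarrow> (\<And>n. n < length \<Gamma> \<Longrightarrow> e n = e' n) \<Longrightarrow> evl M e t = evl M e' t"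
  by (induction t) auto

lemma evl_closed: "tm_ok sp [] t \<Longrightarrow> evl M e t = evl M e' t"
  by (rule evl_cong) auto

text \<open>Terms in scope whose value does not depend on the depth at which they are placed.\<close>
definition stable :: "nat \<Rightarrow> stm \<Rightarrow> bool" where
  "stable d s \<longleftrightarrow> (\<forall>d'\<ge>d. s (Suc d') = lift_tm 0 (s d'))"

lemma stable_bvar [simp]: "d < d' \<Longrightarrow> stable d' (bvar \<tau> d)"
  by (auto simp: stable_def bvar_def)

lemma stable_con [simp]: "stable d (con c)"
  by (simp add: stable_def con_def)

lemma stable_app [simp]: "stable d s \<Longrightarrow> stable d t \<Longrightarrow> stable d (s \<cdot> t)"
  by (simp add: stable_def app_def)

lemma stable_mono: "stable d s \<Longrightarrow> d \<le> d' \<Longrightarrow> stable d' s"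
  by (simp add: stable_def)

lemma evl_stable: "stable d s \<Longrightarrow> evl M (a ## e) (s (Suc d)) = evl M e (s d)"
  by (simp add: stable_def evl_lift)

lemma evl_bvar [simp]: "evl M e (bvar \<tau> d d') = e (d' - Suc d)"
  by (simp add: bvar_def)

lemma evl_app [simp]: "evl M e ((s \<cdot> t) d) = Ap M (evl M e (s d)) (evl M e (t d))"
  by (simp add: app_def)

lemma evl_con [simp]: "evl M e (con c d) = Cv M c"
  by (simp add: con_def)

lemma evl_raw [simp]: "evl M e (raw t d) = evl M e t"
  by (simp add: raw_def)

lemma sat_sfm [simp]:
  "sat M e (fls d) = False"
  "sat M e (eq0 s t d) = Er M (evl M e (s d)) (evl M e (t d))"
  "sat M e (st s d) = Sd M (tyof (s d)) (evl M e (s d))"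
  "sat M e ((A \<^bold>\<longrightarrow> B) d) = (sat M e (A d) \<longrightarrow> sat M e (B d))"
  "sat M e ((\<^bold>\<not> A) d) = (\<not> sat M e (A d))"
  "sat M e ((A \<^bold>\<and> B) d) = (sat M e (A d) \<and> sat M e (B d))"
  "sat M e (all \<tau> F d) = (\<forall>a\<in>Dom M \<tau>. sat M (a ## e) (F (bvar \<tau> d) (Suc d)))"
  "sat M e (ex \<tau> F d) = (\<exists>a\<in>Dom M \<tau>. sat M (a ## e) (F (bvar \<tau> d) (Suc d)))"
  "sat M e (allst \<tau> F d) = (\<forall>a\<in>Dom M \<tau>. Sd M \<tau> a \<longrightarrow> sat M (a ## e) (F (bvar \<tau> d) (Suc d)))"
  "sat M e (exst \<tau> F d) = (\<exists>a\<in>Dom M \<tau>. Sd M \<tau> a \<and> sat M (a ## e) (F (bvar \<tau> d) (Suc d)))"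
  "sat M e (raw \<phi> d) = sat M e \<phi>"
  by (auto simp: fls_def eq0_def st_def imp_def neg_def conj_def all_def ex_def allst_def exst_def
      raw_def bvar_def)

lemma sat_Iff: "sat M e (Iff \<phi> \<psi>) = (sat M e \<phi> \<longleftrightarrow> sat M e \<psi>)"
  by (auto simp: Iff_def)

text \<open>The order is not primitive in the language, so it is read off from cut-off subtraction
  in the structure. The environment is arbitrary because \<open>monusT\<close> is closed.\<close>

definition lessv :: "('u, 'b) struct_scheme \<Rightarrow> 'u \<Rightarrow> 'u \<Rightarrow> bool" where
  "lessv M a b \<longleftrightarrow> Er M (Ap M (Ap M (evl M (\<lambda>_. undefined) monusT) (Ap M (Cv M Succ) a)) b) (Cv M Zero)"

section \<open>Typing of bracket abstraction and of the arithmetic terms\<close>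

lemma abst_ok: "tm_ok sp (\<tau> # \<Gamma>) t \<Longrightarrow> tm_ok sp \<Gamma> (abst \<tau> t) \<and> tyof (abst \<tau> t) = \<tau> \<rightarrow>\<^sub>t tyof t"
  by (induction t) (auto simp: nth_Cons')

definition ht :: "spec \<Rightarrow> ty list \<Rightarrow> tm \<Rightarrow> ty \<Rightarrow> bool" where
  "ht sp \<Gamma> t \<sigma> \<longleftrightarrow> tm_ok sp \<Gamma> t \<and> tyof t = \<sigma>"

lemma ht_Var: "n < length \<Gamma> \<Longrightarrow> \<Gamma> ! n = \<tau> \<Longrightarrow> ht sp \<Gamma> (Var \<tau> n) \<tau>"
  by (simp add: ht_def)

lemma ht_Cst: "const_ok sp c \<Longrightarrow> cty c = \<sigma> \<Longrightarrow> ht sp \<Gamma> (Cst c) \<sigma>"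
  by (simp add: ht_def)

lemma ht_App: "ht sp \<Gamma> s (\<sigma> \<rightarrow>\<^sub>t \<tau>) \<Longrightarrow> ht sp \<Gamma> t \<sigma> \<Longrightarrow> ht sp \<Gamma> (App s t) \<tau>"
  by (simp add: ht_def)

lemma ht_lam: "ht sp (\<tau> # \<Gamma>) (F (bvar \<tau> d) (Suc d)) \<sigma> \<Longrightarrow> ht sp \<Gamma> (lam \<tau> F d) (\<tau> \<rightarrow>\<^sub>t \<sigma>)"
  using abst_ok[of sp \<tau> \<Gamma>] by (simp add: ht_def lam_def)

lemmas tm_simps = rec_def app_def con_def suc_def zero_def raw_def
lemmas ht_intros = ht_Var ht_App ht_lam ht_Cst

lemma addT_ht: "ht sp \<Gamma> addT (Nat \<rightarrow>\<^sub>t Nat \<rightarrow>\<^sub>t Nat)"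
  unfolding addT_def tm_simps by (rule ht_intros | simp add: bvar_def)+

lemma mulT_ht: "ht sp \<Gamma> mulT (Nat \<rightarrow>\<^sub>t Nat \<rightarrow>\<^sub>t Nat)"
  unfolding mulT_def tm_simps add_def by (rule addT_ht ht_intros | simp add: bvar_def)+

lemma predT_ht: "ht sp \<Gamma> predT T1"
  unfolding predT_def tm_simps by (rule ht_intros | simp add: bvar_def)+

lemma monusT_ht: "ht sp \<Gamma> monusT (Nat \<rightarrow>\<^sub>t Nat \<rightarrow>\<^sub>t Nat)"
  unfolding monusT_def tm_simps by (rule predT_ht ht_intros | simp add: bvar_def)+

lemma pow2T_ht: "ht sp \<Gamma> pow2T T1"
  unfolding pow2T_def tm_simps add_def by (rule addT_ht ht_intros | simp add: bvar_def)+

lemma triT_ht: "ht sp \<Gamma> triT T1"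
  unfolding triT_def tm_simps add_def by (rule addT_ht ht_intros | simp add: bvar_def)+

lemma trirootT_ht: "ht sp \<Gamma> trirootT T1"
  unfolding trirootT_def tm_simps tri_def monus_def
  by (rule triT_ht monusT_ht ht_intros | simp add: bvar_def)+

lemma sat_less [simp]: "sat M e (less s t d) = lessv M (evl M e (s d)) (evl M e (t d))"
  using evl_closed[OF conjunct1[OF monusT_ht[unfolded ht_def]], of M e "\<lambda>_. undefined"]
  by (simp add: less_def leq_def LeqT_def suc_def app_def con_def lessv_def)

lemma sat_all_less [simp]:
  assumes "stable d t"
  shows "sat M e (all_less t F d) =
    (\<forall>a\<in>Dom M Nat. lessv M a (evl M e (t d)) \<longrightarrow> sat M (a ## e) (F (bvar Nat d) (Suc d)))"
  by (simp add: all_less_def evl_stable[OF assms])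

fun eqv :: "('u, 'b) struct_scheme \<Rightarrow> ty \<Rightarrow> 'u \<Rightarrow> 'u \<Rightarrow> bool" where
  "eqv M Nat a b = Er M a b"
| "eqv M (\<sigma> \<rightarrow>\<^sub>t \<tau>) a b = (\<forall>x\<in>Dom M \<sigma>. eqv M \<tau> (Ap M a x) (Ap M b x))"
| "eqv M (Seq \<sigma>) a b = (Er M (Ap M (Cv M (Len \<sigma>)) a) (Ap M (Cv M (Len \<sigma>)) b) \<and>
     (\<forall>i\<in>Dom M Nat. lessv M i (Ap M (Cv M (Len \<sigma>)) a) \<longrightarrow>
        eqv M \<sigma> (Ap M (Ap M (Cv M (Nth \<sigma>)) a) i) (Ap M (Ap M (Cv M (Nth \<sigma>)) b) i)))"

lemma sat_eq [simp]:
  "stable d s \<Longrightarrow> stable d t \<Longrightarrow> sat M e (eq \<sigma> s t d) = eqv M \<sigma> (evl M e (s d)) (evl M e (t d))"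
proof (induction \<sigma> arbitrary: s t d e)
  case (Fn \<sigma> \<tau>)
  then show ?case using stable_mono[of d _ "Suc d"] by (simp add: evl_stable)
next
  case (Seq \<sigma>)
  then show ?case using stable_mono[of d _ "Suc d"] by (simp add: evl_stable)
qed simp

section \<open>Normal models\<close>

text \<open>Normality turns extensional equality at every type into identity, so that objects of the
  model can be handled like HOL functions. Axioms with parameters are demanded under all well-typed
  environments, in place of their closures.\<close>

definition normal_model :: "spec \<Rightarrow> fm set \<Rightarrow> 'u struct \<Rightarrow> bool" where
  "normal_model sp T M \<longleftrightarrow>
     (\<forall>c. const_ok sp c \<longrightarrow> Cv M c \<in> Dom M (cty c)) \<and>
     (\<forall>\<sigma> \<tau>. \<forall>f\<in>Dom M (\<sigma> \<rightarrow>\<^sub>t \<tau>). \<forall>x\<in>Dom M \<sigma>. Ap M f x \<in> Dom M \<tau>) \<and>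
     (\<forall>\<sigma>. \<forall>x\<in>Dom M \<sigma>. \<forall>y\<in>Dom M \<sigma>. eqv M \<sigma> x y \<longleftrightarrow> x = y) \<and>
     (\<forall>\<phi>\<in>T. \<forall>\<Gamma> e. fm_ok sp \<Gamma> \<phi> \<longrightarrow> envok M \<Gamma> e \<longrightarrow> sat M e \<phi>)"

lemma fm_ok_lessT: "ht sp \<Gamma> s Nat \<Longrightarrow> ht sp \<Gamma> t Nat \<Longrightarrow> fm_ok sp \<Gamma> (LeqT (App (Cst Succ) s) t)"
  using monusT_ht[of sp \<Gamma>] by (simp add: LeqT_def ht_def)

lemma stable_lift_eq: "stable d s \<Longrightarrow> tm_ok sp \<Gamma> (s d) \<Longrightarrow> tm_ok sp (\<tau> # \<Gamma>) (s (Suc d)) \<and>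
    tyof (s (Suc d)) = tyof (s d)"
  using tm_ok_psub[OF _ wtsub_lsub] by (auto simp: stable_def lift_tm_psub)

lemma fm_ok_eq:
  "stable d s \<Longrightarrow> stable d t \<Longrightarrow> ht sp \<Gamma> (s d) \<sigma> \<Longrightarrow> ht sp \<Gamma> (t d) \<sigma> \<Longrightarrow> fm_ok sp \<Gamma> (eq \<sigma> s t d)"
proof (induction \<sigma> arbitrary: s t d \<Gamma>)
  case Nat
  then show ?case by (simp add: eq0_def ht_def)
next
  case (Fn \<sigma> \<tau>)
  have "fm_ok sp (\<sigma> # \<Gamma>) (eq \<tau> (s \<cdot> bvar \<sigma> d) (t \<cdot> bvar \<sigma> d) (Suc d))"
    using Fn.prems stable_lift_eq[OF Fn.prems(1)] stable_lift_eq[OF Fn.prems(2)]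
    by (intro Fn.IH stable_app stable_bvar)
      (auto intro: stable_mono[of d _ "Suc d"] simp: ht_def, auto simp: app_def bvar_def)
  then show ?case by (simp add: all_def)
next
  case (Seq \<sigma>)
  have "fm_ok sp (Nat # \<Gamma>) (eq \<sigma> (con (Nth \<sigma>) \<cdot> s \<cdot> bvar Nat d) (con (Nth \<sigma>) \<cdot> t \<cdot> bvar Nat d) (Suc d))"
    using Seq.prems stable_lift_eq[OF Seq.prems(1)] stable_lift_eq[OF Seq.prems(2)]
    by (intro Seq.IH stable_app stable_bvar stable_con)
      (auto intro: stable_mono[of d _ "Suc d"] simp: ht_def, auto simp: app_def bvar_def con_def)
  moreover have "ht sp (Nat # \<Gamma>) (App (Cst (Len \<sigma>)) (s (Suc d))) Nat"
    using Seq.prems stable_lift_eq[OF Seq.prems(1)] by (auto simp: ht_def)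
  moreover have "ht sp (Nat # \<Gamma>) (Var Nat 0) Nat" by (simp add: ht_def)
  moreover have "ht sp \<Gamma> (App (Cst (Len \<sigma>)) (s d)) Nat" "ht sp \<Gamma> (App (Cst (Len \<sigma>)) (t d)) Nat"
    using Seq.prems by (auto simp: ht_def)
  ultimately show ?case using fm_ok_lessT[of sp "Nat # \<Gamma>" "Var Nat 0"]
    unfolding eq.simps by (simp add: all_def all_less_def conj_def neg_def imp_def fls_def eq0_def app_def con_def
        less_def leq_def suc_def bvar_def ht_def)
qed

lemma sat_cong: "fm_ok sp \<Gamma> \<phi> \<Longrightarrow> (\<And>n. n < length \<Gamma> \<Longrightarrow> e n = e' n) \<Longrightarrow> sat M e \<phi> = sat M e' \<phi>"
proof (induction \<phi> arbitrary: \<Gamma> e e')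
  case (All \<tau> \<phi>)
  have "sat M (a ## e) \<phi> = sat M (a ## e') \<phi>" for a
    using All.prems by (intro All.IH[of "\<tau> # \<Gamma>"]) (auto simp: less_Suc_eq_0_disj)
  then show ?case by simp
next
  case (Imp \<phi> \<psi>)
  then have "sat M e \<phi> = sat M e' \<phi>" "sat M e \<psi> = sat M e' \<psi>" by (auto intro!: Imp.IH[of \<Gamma>])
  then show ?case by simp
next
  case (Eq s t)
  then show ?case using evl_cong[of sp \<Gamma> s e e' M] evl_cong[of sp \<Gamma> t e e' M] by simp
next
  case (St t)
  then show ?case using evl_cong[of sp \<Gamma> t e e' M] by simp
qed simp

section \<open>The term model of a Henkin set and its quotient by extensional equality\<close>

locale henkin_omega = henkin +
  assumes ax: "ax_eq \<union> ax_ext \<union> ax_standard sp \<subseteq> T"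
begin

definition pre :: "tm struct" where
  "pre = \<lparr>Dom = Dt, Ap = App, Cv = Cst, Er = (\<lambda>s t. Eq s t \<in> H), Sd = (\<lambda>_ t. St t \<in> H)\<rparr>"

lemma pre_simps [simp]: "Dom pre = Dt" "Ap pre = App" "Cv pre = Cst" "Er pre s t = (Eq s t \<in> H)"
  "Sd pre \<tau> t = (St t \<in> H)"
  by (simp_all add: pre_def)

lemma evl_pre: "evl pre e t = psub_tm (\<lambda>_. e) t"
  by (induction t) auto

lemma wtsub_env:
  assumes "envok pre \<Gamma> e"
  shows "\<exists>k. wtsub sp \<Gamma> (\<Gamma>s k) (\<lambda>_. e)"
proof -
  have "\<exists>f. \<forall>n<length \<Gamma>. tm_ok sp (\<Gamma>s (f n)) (e n)"
    using assms by (intro choice) (force simp: envok_def Dt_def okt_def)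
  then obtain f where f: "\<And>n. n < length \<Gamma> \<Longrightarrow> tm_ok sp (\<Gamma>s (f n)) (e n)" by blast
  define m where "m = Max (f ` {..<length \<Gamma>})"
  have "tm_ok sp (\<Gamma>s m) (e n)" if "n < length \<Gamma>" for n
    using tm_ok_le[OF f[OF that]] that by (simp add: m_def)
  then show ?thesis using assms by (auto simp: wtsub_def envok_def Dt_def)
qed

lemma evl_pre_Dt:
  assumes "tm_ok sp \<Gamma> t" "envok pre \<Gamma> e"
  shows "evl pre e t \<in> Dt (tyof t)"
  using wtsub_env[OF assms(2)] tm_ok_psub[OF assms(1)] by (auto simp: evl_pre Dt_def okt_def)

text \<open>The truth lemma. An environment of terms acts as a substitution that disregards type
  annotations, which is legitimate because the environment is well-typed for the context.\<close>

lemma sat_pre: "fm_ok sp \<Gamma> \<phi> \<Longrightarrow> envok pre \<Gamma> e \<Longrightarrow> sat pre e \<phi> \<longleftrightarrow> psub_fm (\<lambda>_. e) \<phi> \<in> H"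
proof (induction \<phi> arbitrary: \<Gamma> e)
  case Fls
  then show ?case by (simp add: Fls_H)
next
  case (Imp \<phi> \<psi>)
  obtain k where "wtsub sp \<Gamma> (\<Gamma>s k) (\<lambda>_. e)" using Imp.prems wtsub_env by blast
  then have "okf (psub_fm (\<lambda>_. e) (Imp \<phi> \<psi>))" using Imp.prems(1) fm_ok_psub okf_def by blast
  then show ?case using Imp.IH[of \<Gamma> e] Imp.prems by (simp add: Imp_H)
next
  case (All \<tau> \<phi>)
  obtain k where "wtsub sp \<Gamma> (\<Gamma>s k) (\<lambda>_. e)" using All.prems wtsub_env by blast
  then have "okf (psub_fm (\<lambda>_. e) (All \<tau> \<phi>))" using All.prems(1) fm_ok_psub okf_def by blast
  moreover have "scons a (\<lambda>_. e) = (\<lambda>_. a ## e)" for a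
    by (intro ext) (simp add: scons_def scn_def)
  ultimately show ?case using All by (simp add: All_H subst_psub_up)
qed (simp_all add: evl_pre)

lemma sat_T: "\<phi> \<in> T \<Longrightarrow> fm_ok sp [] \<phi> \<Longrightarrow> sat pre e \<phi>"
  using sat_pre[of "[]" \<phi> e] axiom_H[of \<phi> 0] fm_ok_append[of sp "[]" \<phi> "\<Gamma>s 0"]
    psub_fm_id[of sp "[]" \<phi>] by simp

lemma Er_refl: "a \<in> Dt Nat \<Longrightarrow> Er pre a a"
proof -
  have "sat pre e (all Nat (\<lambda>x. eq0 x x) 0)" for e
    by (rule sat_T) (use ax in \<open>auto simp: ax_eq_def all_def eq0_def bvar_def\<close>)
  then show "a \<in> Dt Nat \<Longrightarrow> Er pre a a" by simp
qed

lemma Er_eucl: "a \<in> Dt Nat \<Longrightarrow> b \<in> Dt Nat \<Longrightarrow> c \<in> Dt Nat \<Longrightarrow> Er pre a b \<Longrightarrow> Er pre a c \<Longrightarrow> Er pre b c"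
proof -
  have "sat pre e (all Nat (\<lambda>x. all Nat (\<lambda>y. all Nat (\<lambda>z. eq0 x y \<^bold>\<longrightarrow> eq0 x z \<^bold>\<longrightarrow> eq0 y z))) 0)" for e
    by (rule sat_T) (use ax in \<open>auto simp: ax_eq_def all_def eq0_def imp_def bvar_def\<close>)
  from this[of undefined, simplified]
  show "a \<in> Dt Nat \<Longrightarrow> b \<in> Dt Nat \<Longrightarrow> c \<in> Dt Nat \<Longrightarrow> Er pre a b \<Longrightarrow> Er pre a c \<Longrightarrow> Er pre b c"
    unfolding pre_simps by blast
qed

lemma Ap_Dt: "f \<in> Dt (\<sigma> \<rightarrow>\<^sub>t \<tau>) \<Longrightarrow> x \<in> Dt \<sigma> \<Longrightarrow> App f x \<in> Dt \<tau>"
  using okt_App[of f x \<tau>] by (simp add: Dt_def)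

lemma Cst_Dt: "const_ok sp c \<Longrightarrow> Cst c \<in> Dt (cty c)"
  by (simp add: Dt_def okt_def)

lemma ext_pre:
  "f \<in> Dt (\<rho> \<rightarrow>\<^sub>t \<tau>) \<Longrightarrow> x \<in> Dt \<rho> \<Longrightarrow> y \<in> Dt \<rho> \<Longrightarrow> eqv pre \<rho> x y \<Longrightarrow> eqv pre \<tau> (App f x) (App f y)"
proof -
  let ?\<phi> = "all (\<rho> \<rightarrow>\<^sub>t \<tau>) (\<lambda>f. all \<rho> (\<lambda>x. all \<rho> (\<lambda>y. eq \<rho> x y \<^bold>\<longrightarrow> eq \<tau> (f \<cdot> x) (f \<cdot> y)))) 0"
  have "fm_ok sp [] ?\<phi>"
    by (auto simp: all_def imp_def intro!: fm_ok_eq) (auto simp: bvar_def ht_def app_def)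
  moreover have "?\<phi> \<in> T" using ax by (auto simp: ax_ext_def)
  ultimately have "sat pre e ?\<phi>" for e by (intro sat_T)
  from this[of undefined] show "f \<in> Dt (\<rho> \<rightarrow>\<^sub>t \<tau>) \<Longrightarrow> x \<in> Dt \<rho> \<Longrightarrow> y \<in> Dt \<rho> \<Longrightarrow> eqv pre \<rho> x y \<Longrightarrow> eqv pre \<tau> (App f x) (App f y)"
    by simp
qed

lemma St_pre: "x \<in> Dt \<tau> \<Longrightarrow> y \<in> Dt \<tau> \<Longrightarrow> eqv pre \<tau> x y \<Longrightarrow> St x \<in> H \<Longrightarrow> St y \<in> H"
proof -
  let ?\<phi> = "all \<tau> (\<lambda>x. all \<tau> (\<lambda>y. eq \<tau> x y \<^bold>\<longrightarrow> st x \<^bold>\<longrightarrow> st y)) 0"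
  have "fm_ok sp [] ?\<phi>"
    by (auto simp: all_def imp_def st_def intro!: fm_ok_eq) (auto simp: bvar_def ht_def app_def)
  moreover have "?\<phi> \<in> T" using ax by (auto simp: ax_standard_def)
  ultimately have "sat pre e ?\<phi>" for e by (intro sat_T)
  from this[of undefined] show "x \<in> Dt \<tau> \<Longrightarrow> y \<in> Dt \<tau> \<Longrightarrow> eqv pre \<tau> x y \<Longrightarrow> St x \<in> H \<Longrightarrow> St y \<in> H"
    by simp
qed

lemma const_Dt: "Cst (Len \<sigma>) \<in> Dt (Seq \<sigma> \<rightarrow>\<^sub>t Nat)" "Cst (Nth \<sigma>) \<in> Dt (Seq \<sigma> \<rightarrow>\<^sub>t Nat \<rightarrow>\<^sub>t \<sigma>)"
  "Cst Zero \<in> Dt Nat" "Cst Succ \<in> Dt T1" "monusT \<in> Dt (Nat \<rightarrow>\<^sub>t Nat \<rightarrow>\<^sub>t Nat)"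
  using monusT_ht[of sp "\<Gamma>s 0"] by (auto simp: Dt_def okt_def ht_def)

text \<open>Equality at a type \<open>Seq\<close> bounds the entries by the length of the first
  sequence. Transitivity has to change to another length, and the required congruence comes from
  extensionality applied to the term \<open>App monusT (App (Cst Succ) i)\<close>.\<close>

lemma lessv_pre_cong:
  "i \<in> Dt Nat \<Longrightarrow> a \<in> Dt Nat \<Longrightarrow> b \<in> Dt Nat \<Longrightarrow> Er pre a b \<Longrightarrow> lessv pre i b \<Longrightarrow> lessv pre i a"
proof -
  assume *: "i \<in> Dt Nat" "a \<in> Dt Nat" "b \<in> Dt Nat" "Er pre a b" "lessv pre i b"
  have m: "evl pre e monusT = monusT" for e
    using psub_tm_cong[of sp "[]" monusT "\<lambda>_. e" Var] monusT_ht[of sp "[]"]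
    by (simp add: evl_pre ht_def)
  have si: "App (Cst Succ) i \<in> Dt Nat" using Ap_Dt const_Dt(4) *(1) by blast
  then have f: "App monusT (App (Cst Succ) i) \<in> Dt T1" using Ap_Dt const_Dt(5) by blast
  have "Er pre (App (App monusT (App (Cst Succ) i)) a) (App (App monusT (App (Cst Succ) i)) b)"
    using ext_pre[OF f *(2,3)] *(4) by simp
  then have "Er pre (App (App monusT (App (Cst Succ) i)) b) (App (App monusT (App (Cst Succ) i)) a)"
    using Er_eucl[OF Ap_Dt[OF f *(2)] Ap_Dt[OF f *(3)] Ap_Dt[OF f *(2)]] Er_refl[OF Ap_Dt[OF f *(2)]]
    by blast
  then show "lessv pre i a"
    using *(5) Er_eucl[OF Ap_Dt[OF f *(3)] Ap_Dt[OF f *(2)] const_Dt(3)] by (simp add: lessv_def m)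
qed

text \<open>Reflexivity and the Euclidean law go through the induction on types together; the latter
  has the form of the equality axiom at type 0. Symmetry and transitivity follow.\<close>

lemma eqv_equiv:
  "(\<forall>x\<in>Dt \<sigma>. eqv pre \<sigma> x x) \<and>
   (\<forall>x\<in>Dt \<sigma>. \<forall>y\<in>Dt \<sigma>. \<forall>z\<in>Dt \<sigma>. eqv pre \<sigma> x y \<longrightarrow> eqv pre \<sigma> x z \<longrightarrow> eqv pre \<sigma> y z)"
proof (induction \<sigma>)
  case Nat
  show ?case using Er_refl Er_eucl unfolding eqv.simps by blast
next
  case (Fn \<sigma> \<tau>)
  show ?case using Fn.IH(2) Ap_Dt[of _ \<sigma> \<tau>] unfolding eqv.simps pre_simps(1,2) by blast
next
  case (Seq \<sigma>)
  have len: "App (Cst (Len \<sigma>)) x \<in> Dt Nat" if "x \<in> Dt (Seq \<sigma>)" for x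
    using that Ap_Dt const_Dt by blast
  have nth: "App (App (Cst (Nth \<sigma>)) x) i \<in> Dt \<sigma>" if "x \<in> Dt (Seq \<sigma>)" "i \<in> Dt Nat" for x i
    using that Ap_Dt const_Dt(2)[of \<sigma>] by blast
  show ?case
  proof (intro conjI ballI impI)
    fix x assume "x \<in> Dt (Seq \<sigma>)"
    then show "eqv pre (Seq \<sigma>) x x" using Seq.IH len nth Er_refl by (auto simp del: pre_simps(4))
  next
    fix x y z assume *: "x \<in> Dt (Seq \<sigma>)" "y \<in> Dt (Seq \<sigma>)" "z \<in> Dt (Seq \<sigma>)"
      "eqv pre (Seq \<sigma>) x y" "eqv pre (Seq \<sigma>) x z"
    have 1: "Er pre (App (Cst (Len \<sigma>)) y) (App (Cst (Len \<sigma>)) z)"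
      using * Er_eucl[OF len len len, of x y z] unfolding eqv.simps pre_simps(1-3) by blast
    have "eqv pre \<sigma> (App (App (Cst (Nth \<sigma>)) y) i) (App (App (Cst (Nth \<sigma>)) z) i)"
      if i: "i \<in> Dt Nat" "lessv pre i (App (Cst (Len \<sigma>)) y)" for i
    proof -
      have "lessv pre i (App (Cst (Len \<sigma>)) x)"
        using lessv_pre_cong[OF i(1) len[OF *(1)] len[OF *(2)] _ i(2)] *(4) by simp
      then have "eqv pre \<sigma> (App (App (Cst (Nth \<sigma>)) x) i) (App (App (Cst (Nth \<sigma>)) y) i)"
        "eqv pre \<sigma> (App (App (Cst (Nth \<sigma>)) x) i) (App (App (Cst (Nth \<sigma>)) z) i)"
        using *(4,5) i(1) by simp_all
      then show ?thesis using Seq.IH nth *(1-3) i(1) by blast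
    qed
    with 1 show "eqv pre (Seq \<sigma>) y z" by simp
  qed
qed

lemma eqv_refl: "x \<in> Dt \<sigma> \<Longrightarrow> eqv pre \<sigma> x x"
  using eqv_equiv by blast

lemma eqv_sym: "x \<in> Dt \<sigma> \<Longrightarrow> y \<in> Dt \<sigma> \<Longrightarrow> eqv pre \<sigma> x y \<Longrightarrow> eqv pre \<sigma> y x"
  using eqv_equiv by blast

lemma eqv_trans: "x \<in> Dt \<sigma> \<Longrightarrow> y \<in> Dt \<sigma> \<Longrightarrow> z \<in> Dt \<sigma> \<Longrightarrow> eqv pre \<sigma> x y \<Longrightarrow> eqv pre \<sigma> y z \<Longrightarrow> eqv pre \<sigma> x z"
  using eqv_equiv eqv_sym by blast

lemma eqv_App:
  assumes "f \<in> Dt (\<sigma> \<rightarrow>\<^sub>t \<tau>)" "g \<in> Dt (\<sigma> \<rightarrow>\<^sub>t \<tau>)" "x \<in> Dt \<sigma>" "y \<in> Dt \<sigma>"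
    "eqv pre (\<sigma> \<rightarrow>\<^sub>t \<tau>) f g" "eqv pre \<sigma> x y"
  shows "eqv pre \<tau> (App f x) (App g y)"
  using assms eqv_trans[OF Ap_Dt[OF assms(1,3)] Ap_Dt[OF assms(1,4)] Ap_Dt[OF assms(2,4)]]
    ext_pre[OF assms(1,3,4)] by simp

text \<open>Choosing a representative of each class keeps the quotient inside \<open>tm\<close>.
  Every model obtained in this way then has the fixed type \<open>tm struct\<close>, as the later
  choice of one counterexample requires.\<close>

definition nf :: "tm \<Rightarrow> tm" where "nf t = (SOME s. s \<in> Dt (tyof t) \<and> eqv pre (tyof t) t s)"

lemma nf: "t \<in> Dt \<sigma> \<Longrightarrow> nf t \<in> Dt \<sigma> \<and> eqv pre \<sigma> t (nf t)"
proof -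
  assume t: "t \<in> Dt \<sigma>"
  then have "t \<in> Dt (tyof t) \<and> eqv pre (tyof t) t t" using eqv_refl[of t \<sigma>] by (auto simp: Dt_def)
  then have "nf t \<in> Dt (tyof t) \<and> eqv pre (tyof t) t (nf t)" unfolding nf_def by (rule someI)
  then show ?thesis using t by (simp add: Dt_def)
qed

lemma nf_cong: "s \<in> Dt \<sigma> \<Longrightarrow> t \<in> Dt \<sigma> \<Longrightarrow> eqv pre \<sigma> s t \<Longrightarrow> nf s = nf t"
proof -
  assume *: "s \<in> Dt \<sigma>" "t \<in> Dt \<sigma>" "eqv pre \<sigma> s t"
  then have ty: "tyof s = \<sigma>" "tyof t = \<sigma>" by (simp_all add: Dt_def)
  have "u \<in> Dt \<sigma> \<and> eqv pre \<sigma> s u \<longleftrightarrow> u \<in> Dt \<sigma> \<and> eqv pre \<sigma> t u" for u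
    using eqv_trans[of s \<sigma> t u] eqv_trans[of t \<sigma> s u] eqv_sym[of s \<sigma> t] * by blast
  then have "(\<lambda>u. u \<in> Dt (tyof s) \<and> eqv pre (tyof s) s u) = (\<lambda>u. u \<in> Dt (tyof t) \<and> eqv pre (tyof t) t u)"
    unfolding ty by (intro ext)
  then show ?thesis by (simp add: nf_def)
qed

lemma nf_iff: "s \<in> Dt \<sigma> \<Longrightarrow> t \<in> Dt \<sigma> \<Longrightarrow> nf s = nf t \<longleftrightarrow> eqv pre \<sigma> s t"
  using nf_cong nf eqv_trans eqv_sym by metis

definition quo :: "tm struct" where
  "quo = \<lparr>Dom = (\<lambda>\<tau>. nf ` Dt \<tau>), Ap = (\<lambda>f x. nf (App f x)), Cv = (\<lambda>c. nf (Cst c)), Er = (=),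
     Sd = (\<lambda>_ t. St t \<in> H)\<rparr>"

lemma quo_simps [simp]: "Dom quo \<tau> = nf ` Dt \<tau>" "Ap quo f x = nf (App f x)" "Cv quo c = nf (Cst c)"
  "Er quo = (=)" "Sd quo \<tau> t = (St t \<in> H)"
  by (simp_all add: quo_def)

lemma quo_App: "f \<in> Dt (\<sigma> \<rightarrow>\<^sub>t \<tau>) \<Longrightarrow> x \<in> Dt \<sigma> \<Longrightarrow> nf (App (nf f) (nf x)) = nf (App f x)"
proof -
  assume *: "f \<in> Dt (\<sigma> \<rightarrow>\<^sub>t \<tau>)" "x \<in> Dt \<sigma>"
  note n = nf[OF *(1)] nf[OF *(2)]
  have "eqv pre \<tau> (App f x) (App (nf f) (nf x))"
    using eqv_App[of f \<sigma> \<tau> "nf f" x "nf x"] * n by blast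
  then show ?thesis using nf_cong[of "App f x" \<tau>] Ap_Dt * n by metis
qed

lemma evl_quo: "tm_ok sp \<Gamma> t \<Longrightarrow> envok pre \<Gamma> e \<Longrightarrow> evl quo (\<lambda>n. nf (e n)) t = nf (evl pre e t)"
proof (induction t)
  case (App s t)
  then show ?case
    using quo_App[of "evl pre e s" "tyof t" "tyof (App s t)" "evl pre e t"] evl_pre_Dt[of \<Gamma> _ e]
    by (simp del: tyof.simps) (metis tyof.simps(3))
qed auto

lemma sat_quo: "fm_ok sp \<Gamma> \<phi> \<Longrightarrow> envok pre \<Gamma> e \<Longrightarrow> sat quo (\<lambda>n. nf (e n)) \<phi> \<longleftrightarrow> sat pre e \<phi>"
proof (induction \<phi> arbitrary: \<Gamma> e)
  case (Eq s t)
  then show ?case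
    using evl_pre_Dt[of \<Gamma> s e] evl_pre_Dt[of \<Gamma> t e] nf_iff[of "evl pre e s" Nat "evl pre e t"]
      evl_quo[of \<Gamma>] by simp
next
  case (St t)
  have "evl pre e t \<in> Dt (tyof t)" using St evl_pre_Dt by simp
  then have "St (nf (evl pre e t)) \<in> H \<longleftrightarrow> St (evl pre e t) \<in> H"
    using nf St_pre eqv_sym by blast
  then show ?case using St evl_quo[of \<Gamma>] by simp
next
  case (All \<tau> \<phi>)
  have "(\<lambda>n. nf ((a ## e) n)) = nf a ## (\<lambda>n. nf (e n))" for a
    by (intro ext) (simp add: scn_def split: nat.split)
  then have "sat quo (nf a ## (\<lambda>n. nf (e n))) \<phi> \<longleftrightarrow> sat pre (a ## e) \<phi>" if "a \<in> Dt \<tau>" for a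
    using All.IH[of "\<tau> # \<Gamma>" "a ## e"] All.prems that by simp
  then show ?case by simp
next
  case (Imp \<phi> \<psi>)
  then show ?case using Imp.IH[of \<Gamma> e] by simp
qed simp

lemma lift_envok_quo:
  assumes "envok quo \<Gamma> e"
  shows "\<exists>e'. envok pre \<Gamma> e' \<and> (\<forall>n<length \<Gamma>. e n = nf (e' n))"
proof -
  have "\<forall>n. \<exists>t. n < length \<Gamma> \<longrightarrow> t \<in> Dt (\<Gamma> ! n) \<and> e n = nf t"
    using assms by (auto simp: envok_def)
  from choice[OF this] obtain e' where "\<forall>n. n < length \<Gamma> \<longrightarrow> e' n \<in> Dt (\<Gamma> ! n) \<and> e n = nf (e' n)" ..
  then show ?thesis by (auto simp: envok_def)
qed

text \<open>The axiom schemata have open instances; for these the closure is derived and then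
  instantiated by terms that represent the environment.\<close>

lemma sat_quo_T:
  assumes "\<phi> \<in> T" "fm_ok sp \<Gamma> \<phi>" "envok quo \<Gamma> e"
  shows "sat quo e \<phi>"
proof -
  obtain e' where e': "envok pre \<Gamma> e'" "\<And>n. n < length \<Gamma> \<Longrightarrow> e n = nf (e' n)"
    using lift_envok_quo assms(3) by blast
  obtain k where k: "wtsub sp \<Gamma> (\<Gamma>s k) (\<lambda>_. e')" using wtsub_env e'(1) by blast
  have "derives sp T [] [] (closure \<Gamma> \<phi>)"
    using assms by (intro derives_closure derives.Ax)
  then have "derives sp T ([] @ \<Gamma>s k) [] (closure \<Gamma> \<phi>)" by (rule derives_append)
  then have "derives sp T (\<Gamma>s k) [] (psub_fm (\<lambda>_. e') \<phi>)"
    using derives_closureE k assms(2) by simp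
  then have "psub_fm (\<lambda>_. e') \<phi> \<in> H" by (rule ded[of "[]", simplified])
  then have "sat quo (\<lambda>n. nf (e' n)) \<phi>" using assms(2) e'(1) by (simp add: sat_quo sat_pre)
  then show ?thesis using sat_cong[OF assms(2), of e "\<lambda>n. nf (e' n)" quo] e'(2) by simp
qed

lemma lessv_quo: "a \<in> Dt Nat \<Longrightarrow> b \<in> Dt Nat \<Longrightarrow> lessv quo (nf a) (nf b) = lessv pre a b"
proof -
  assume *: "a \<in> Dt Nat" "b \<in> Dt Nat"
  let ?\<phi> = "LeqT (App (Cst Succ) (Var Nat 0)) (Var Nat 1)" and ?\<Gamma> = "[Nat, Nat]"
  let ?e = "a ## b ## (\<lambda>_. b)"
  have ok: "fm_ok sp ?\<Gamma> ?\<phi>" by (rule fm_ok_lessT) (auto simp: ht_def)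
  have "(\<lambda>n. nf (?e n)) = nf a ## nf b ## (\<lambda>_. nf b)"
    by (intro ext) (simp add: scn_def split: nat.split)
  then have "sat quo (nf a ## nf b ## (\<lambda>_. nf b)) ?\<phi> \<longleftrightarrow> sat pre ?e ?\<phi>"
    using sat_quo[OF ok, of ?e] * by simp
  moreover have "evl quo (nf a ## nf b ## (\<lambda>_. nf b)) monusT = evl quo (\<lambda>_. undefined) monusT"
    "evl pre ?e monusT = evl pre (\<lambda>_. undefined) monusT"
    using monusT_ht[of sp "[]"] unfolding ht_def by (auto intro: evl_closed)
  ultimately show ?thesis by (simp add: LeqT_def lessv_def)
qed

lemma eqv_quo: "x \<in> Dt \<sigma> \<Longrightarrow> y \<in> Dt \<sigma> \<Longrightarrow> eqv quo \<sigma> (nf x) (nf y) \<longleftrightarrow> eqv pre \<sigma> x y"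
proof (induction \<sigma> arbitrary: x y)
  case Nat
  then show ?case using nf_iff[OF Nat] by simp
next
  case (Fn \<sigma> \<tau>)
  then show ?case using quo_App[of _ \<sigma> \<tau>] Ap_Dt[of _ \<sigma> \<tau>] by simp
next
  case (Seq \<sigma>)
  have len: "App (Cst (Len \<sigma>)) x \<in> Dt Nat" "nf (App (nf (Cst (Len \<sigma>))) (nf x)) = nf (App (Cst (Len \<sigma>)) x)"
    if "x \<in> Dt (Seq \<sigma>)" for x
    using that Ap_Dt const_Dt(1) quo_App by blast+
  have nth: "App (App (Cst (Nth \<sigma>)) x) i \<in> Dt \<sigma>"
    "nf (App (nf (App (nf (Cst (Nth \<sigma>))) (nf x))) (nf i)) = nf (App (App (Cst (Nth \<sigma>)) x) i)"
    if "x \<in> Dt (Seq \<sigma>)" "i \<in> Dt Nat" for x i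
  proof -
    have *: "App (Cst (Nth \<sigma>)) x \<in> Dt (Nat \<rightarrow>\<^sub>t \<sigma>)" using that Ap_Dt const_Dt(2)[of \<sigma>] by blast
    then show "App (App (Cst (Nth \<sigma>)) x) i \<in> Dt \<sigma>" using that Ap_Dt by blast
    show "nf (App (nf (App (nf (Cst (Nth \<sigma>))) (nf x))) (nf i)) = nf (App (App (Cst (Nth \<sigma>)) x) i)"
      using quo_App[OF const_Dt(2) that(1)] quo_App[OF * that(2)] by simp
  qed
  show ?case
    using Seq nf_iff[OF len(1) len(1), OF Seq.prems] by (simp add: len nth lessv_quo Seq.IH)
qed

lemma normal_quo: "normal_model sp T quo"
  unfolding normal_model_def
proof (intro conjI allI ballI impI)
  fix c assume "const_ok sp c"
  then show "Cv quo c \<in> Dom quo (cty c)" using Cst_Dt by simp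
next
  fix \<sigma> \<tau> f x assume "f \<in> Dom quo (\<sigma> \<rightarrow>\<^sub>t \<tau>)" "x \<in> Dom quo \<sigma>"
  then show "Ap quo f x \<in> Dom quo \<tau>" using quo_App[of _ \<sigma> \<tau>] Ap_Dt[of _ \<sigma> \<tau>] by auto
next
  fix \<sigma> x y assume "x \<in> Dom quo \<sigma>" "y \<in> Dom quo \<sigma>"
  then show "eqv quo \<sigma> x y \<longleftrightarrow> x = y" using eqv_quo[of _ \<sigma>] nf_iff[of _ \<sigma>] by auto
next
  fix \<phi> \<Gamma> e assume "\<phi> \<in> T" "fm_ok sp \<Gamma> \<phi>" "envok quo \<Gamma> e"
  then show "sat quo e \<phi>" by (rule sat_quo_T)
qed

end

theorem completeness:
  assumes "ax_eq \<union> ax_ext \<union> ax_standard sp \<subseteq> T" "fm_ok sp [] \<phi>" "\<not> proves sp T \<phi>"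
  obtains M :: "tm struct" where "normal_model sp T M" "\<not> sat M e \<phi>" "Er M = (=)"
proof -
  obtain \<Gamma>s H where "henkin sp T \<Gamma>s H" and n: "Neg \<phi> \<in> H"
    using henkin_exists assms(2,3) unfolding proves_def by blast
  then interpret henkin_omega sp T \<Gamma>s H
    using assms(1) by (simp add: henkin_omega_def henkin_omega_axioms_def)
  have ok: "fm_ok sp [] (Neg \<phi>)" using assms(2) by simp
  have "psub_fm (\<lambda>_ _. Cst Zero) (Neg \<phi>) = Neg \<phi>" by (rule psub_fm_id[OF ok]) simp
  then have "sat pre (\<lambda>_. Cst Zero) (Neg \<phi>)" using sat_pre[OF ok, of "\<lambda>_. Cst Zero"] n by simp
  then have "\<not> sat quo (\<lambda>n. nf (Cst Zero)) \<phi>"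
    using sat_quo[OF assms(2), of "\<lambda>_. Cst Zero"] by simp
  then have "\<not> sat quo e \<phi>" using sat_cong[OF assms(2), of "\<lambda>n. nf (Cst Zero)" e quo] by simp
  then show ?thesis using that[OF normal_quo] by simp
qed

section \<open>Definability in a normal model\<close>

locale nmodel =
  fixes sp :: spec and T :: "fm set" and M :: "'u struct"
  assumes nm: "normal_model sp T M" and Er [simp]: "Er M = (=)" and T: "RCA0_Omega sp \<subseteq> T"
begin

abbreviation D :: "ty \<Rightarrow> 'u set" where "D \<equiv> Dom M"
abbreviation ap :: "'u \<Rightarrow> 'u \<Rightarrow> 'u" (infixl "\<bullet>" 200) where "ap \<equiv> Ap M"

lemma Cv_D: "const_ok sp c \<Longrightarrow> Cv M c \<in> D (cty c)"
  using nm by (auto simp: normal_model_def)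

lemma ap_D: "f \<in> D (\<sigma> \<rightarrow>\<^sub>t \<tau>) \<Longrightarrow> x \<in> D \<sigma> \<Longrightarrow> f \<bullet> x \<in> D \<tau>"
  using nm unfolding normal_model_def by blast

lemma eqv_eq: "x \<in> D \<sigma> \<Longrightarrow> y \<in> D \<sigma> \<Longrightarrow> eqv M \<sigma> x y \<longleftrightarrow> x = y"
  using nm unfolding normal_model_def by blast

lemma D_ext: "f \<in> D (\<sigma> \<rightarrow>\<^sub>t \<tau>) \<Longrightarrow> g \<in> D (\<sigma> \<rightarrow>\<^sub>t \<tau>) \<Longrightarrow> (\<And>x. x \<in> D \<sigma> \<Longrightarrow> f \<bullet> x = g \<bullet> x) \<Longrightarrow> f = g"
  using eqv_eq[of f "\<sigma> \<rightarrow>\<^sub>t \<tau>" g] eqv_eq[of _ \<tau>] ap_D[of _ \<sigma> \<tau>] by simp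

lemma sat_T: "\<phi> \<in> T \<Longrightarrow> fm_ok sp \<Gamma> \<phi> \<Longrightarrow> envok M \<Gamma> e \<Longrightarrow> sat M e \<phi>"
  using nm unfolding normal_model_def by blast

lemma evl_D: "ht sp \<Gamma> t \<sigma> \<Longrightarrow> envok M \<Gamma> e \<Longrightarrow> evl M e t \<in> D \<sigma>"
proof (induction t arbitrary: \<sigma>)
  case (App s t)
  then have "evl M e s \<in> D (tyof t \<rightarrow>\<^sub>t \<sigma>)" "evl M e t \<in> D (tyof t)" by (auto simp: ht_def)
  then show ?case using ap_D by simp
qed (auto simp: ht_def envok_def Cv_D)

section \<open>Combinatory completeness and definability of predicates\<close>

lemma K_law:
  assumes "x \<in> D \<rho>" "y \<in> D \<tau>"
  shows "Cv M (Comb_K \<rho> \<tau>) \<bullet> x \<bullet> y = x"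
proof -
  let ?\<phi> = "all \<rho> (\<lambda>x. all \<tau> (\<lambda>y. eq \<rho> (con (Comb_K \<rho> \<tau>) \<cdot> x \<cdot> y) x)) 0"
  have "?\<phi> \<in> ax_comb" unfolding ax_comb_def by blast
  then have "?\<phi> \<in> T" using T by (auto simp: RCA0_Omega_def RCA0_omega_def)
  moreover have "fm_ok sp [] ?\<phi>"
    by (auto simp: all_def intro!: fm_ok_eq) (auto simp: bvar_def ht_def app_def con_def)
  ultimately have "sat M (\<lambda>_. undefined) ?\<phi>" using sat_T[of ?\<phi> "[]"] by simp
  moreover have "Cv M (Comb_K \<rho> \<tau>) \<bullet> x \<bullet> y \<in> D \<rho>"
    using assms Cv_D[of "Comb_K \<rho> \<tau>"] ap_D by (metis const_ok.simps(4) cty.simps(3))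
  ultimately show ?thesis using assms eqv_eq[of "Cv M (Comb_K \<rho> \<tau>) \<bullet> x \<bullet> y" \<rho> x] by simp
qed

lemma S_law:
  assumes "x \<in> D (\<delta> \<rightarrow>\<^sub>t \<rho> \<rightarrow>\<^sub>t \<tau>)" "y \<in> D (\<delta> \<rightarrow>\<^sub>t \<rho>)" "z \<in> D \<delta>"
  shows "Cv M (Comb_S \<delta> \<rho> \<tau>) \<bullet> x \<bullet> y \<bullet> z = x \<bullet> z \<bullet> (y \<bullet> z)"
proof -
  let ?\<phi> = "all (\<delta> \<rightarrow>\<^sub>t \<rho> \<rightarrow>\<^sub>t \<tau>) (\<lambda>x. all (\<delta> \<rightarrow>\<^sub>t \<rho>) (\<lambda>y. all \<delta> (\<lambda>z.
        eq \<tau> (con (Comb_S \<delta> \<rho> \<tau>) \<cdot> x \<cdot> y \<cdot> z) (x \<cdot> z \<cdot> (y \<cdot> z))))) 0"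
  have "?\<phi> \<in> ax_comb" unfolding ax_comb_def by blast
  then have "?\<phi> \<in> T" using T by (auto simp: RCA0_Omega_def RCA0_omega_def)
  moreover have "fm_ok sp [] ?\<phi>"
    by (auto simp: all_def intro!: fm_ok_eq) (auto simp: bvar_def ht_def app_def con_def)
  ultimately have "sat M (\<lambda>_. undefined) ?\<phi>" using sat_T[of ?\<phi> "[]"] by simp
  moreover have "Cv M (Comb_S \<delta> \<rho> \<tau>) \<bullet> x \<bullet> y \<bullet> z \<in> D \<tau>"
    using assms Cv_D[of "Comb_S \<delta> \<rho> \<tau>"] ap_D by (metis const_ok.simps(5) cty.simps(4))
  moreover have "x \<bullet> z \<bullet> (y \<bullet> z) \<in> D \<tau>" using assms ap_D by metis
  ultimately show ?thesis
    using assms eqv_eq[of "Cv M (Comb_S \<delta> \<rho> \<tau>) \<bullet> x \<bullet> y \<bullet> z" \<tau> "x \<bullet> z \<bullet> (y \<bullet> z)"] by simp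
qed

lemma abst_ht: "ht sp (\<tau> # \<Gamma>) t \<sigma> \<Longrightarrow> ht sp \<Gamma> (abst \<tau> t) (\<tau> \<rightarrow>\<^sub>t \<sigma>)"
  using abst_ok[of sp \<tau> \<Gamma> t] by (simp add: ht_def)

text \<open>The laws of the combinators hold as identities because the model is normal; hence
  bracket abstraction denotes the function that it is meant to denote.\<close>

lemma evl_abst:
  "ht sp (\<tau> # \<Gamma>) t \<sigma> \<Longrightarrow> envok M \<Gamma> e \<Longrightarrow> a \<in> D \<tau> \<Longrightarrow> evl M e (abst \<tau> t) \<bullet> a = evl M (a ## e) t"
proof (induction t arbitrary: \<sigma>)
  case (Var \<rho> n)
  show ?case
  proof (cases n)
    case 0
    have "Cv M (Comb_K \<tau> (\<tau> \<rightarrow>\<^sub>t \<tau>)) \<in> D (\<tau> \<rightarrow>\<^sub>t (\<tau> \<rightarrow>\<^sub>t \<tau>) \<rightarrow>\<^sub>t \<tau>)" "Cv M (Comb_K \<tau> \<tau>) \<in> D (\<tau> \<rightarrow>\<^sub>t \<tau> \<rightarrow>\<^sub>t \<tau>)"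
      using Cv_D[of "Comb_K \<tau> (\<tau> \<rightarrow>\<^sub>t \<tau>)"] Cv_D[of "Comb_K \<tau> \<tau>"] by simp_all
    then show ?thesis using 0 Var S_law[of _ \<tau> "\<tau> \<rightarrow>\<^sub>t \<tau>" \<tau>] K_law[of _ \<tau> _ "\<tau> \<rightarrow>\<^sub>t \<tau>"] ap_D[of _ \<tau> "\<tau> \<rightarrow>\<^sub>t \<tau>"]
      by simp
  next
    case (Suc m)
    then have "e m \<in> D \<rho>" using Var by (auto simp: ht_def envok_def)
    then show ?thesis using Suc Var K_law by simp
  qed
next
  case (Cst c)
  then show ?case using K_law[OF Cv_D] by (auto simp: ht_def)
next
  case (App s t)
  then have s: "ht sp (\<tau> # \<Gamma>) s (tyof t \<rightarrow>\<^sub>t \<sigma>)" and t: "ht sp (\<tau> # \<Gamma>) t (tyof t)"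
    and \<sigma>: "tyof (App s t) = \<sigma>"
    by (auto simp: ht_def)
  have "evl M e (abst \<tau> s) \<in> D (\<tau> \<rightarrow>\<^sub>t tyof t \<rightarrow>\<^sub>t \<sigma>)" "evl M e (abst \<tau> t) \<in> D (\<tau> \<rightarrow>\<^sub>t tyof t)"
    using evl_D[OF abst_ht[OF s]] evl_D[OF abst_ht[OF t]] App.prems by auto
  then show ?case using App.IH(1)[OF s] App.IH(2)[OF t] App.prems S_law \<sigma> by simp
qed

lemma sat_psub:
  "fm_ok sp \<Gamma> \<phi> \<Longrightarrow> (\<And>n. n < length \<Gamma> \<Longrightarrow> e' n = evl M e (\<theta> (\<Gamma> ! n) n)) \<Longrightarrow> wtsub sp \<Gamma> \<Gamma>' \<theta> \<Longrightarrow>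
   sat M e (psub_fm \<theta> \<phi>) = sat M e' \<phi>"
proof (induction \<phi> arbitrary: \<Gamma> \<Gamma>' e e' \<theta>)
  have evl: "evl M e (psub_tm \<theta> t) = evl M e' t"
    if "tm_ok sp \<Gamma> t" "\<And>n. n < length \<Gamma> \<Longrightarrow> e' n = evl M e (\<theta> (\<Gamma> ! n) n)" for e e' \<theta> t \<Gamma>
    using that by (induction t) auto
  {
    case (Eq s t)
    then show ?case using evl[of \<Gamma> s e' e \<theta>] evl[of \<Gamma> t e' e \<theta>] by simp
  next
    case (St t)
    then show ?case using evl[of \<Gamma> t e' e \<theta>] tm_ok_psub[of sp \<Gamma> t \<Gamma>' \<theta>] by simp
  next
    case (Imp \<phi> \<psi>)
    then show ?case using Imp.IH[of \<Gamma> e' e \<theta> \<Gamma>'] by simp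
  next
    case (All \<tau> \<phi>)
    have "sat M (a ## e) (psub_fm (up \<theta>) \<phi>) = sat M (a ## e') \<phi>" for a
    proof (rule All.IH[of "\<tau> # \<Gamma>"])
      show "(a ## e') n = evl M (a ## e) (up \<theta> ((\<tau> # \<Gamma>) ! n) n)" if "n < length (\<tau> # \<Gamma>)" for n
        using that All.prems(2) by (cases n) (auto simp: evl_lift)
    qed (use All.prems wtsub_up in auto)
    then show ?case by simp
  }
qed simp

text \<open>HOL functions and predicates of environments are shown to be denotations of terms and
  formulas. The axiom schemata can then be applied to HOL predicates without writing the formulas
  down.\<close>

definition tdef :: "ty list \<Rightarrow> ty \<Rightarrow> ((nat \<Rightarrow> 'u) \<Rightarrow> 'u) \<Rightarrow> bool" where
  "tdef \<Gamma> \<sigma> f \<longleftrightarrow> (\<exists>t. ht sp \<Gamma> t \<sigma> \<and> (\<forall>e. envok M \<Gamma> e \<longrightarrow> evl M e t = f e))"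

definition fdef :: "(fm \<Rightarrow> bool) \<Rightarrow> ty list \<Rightarrow> ((nat \<Rightarrow> 'u) \<Rightarrow> bool) \<Rightarrow> bool" where
  "fdef C \<Gamma> P \<longleftrightarrow> (\<exists>\<phi>. fm_ok sp \<Gamma> \<phi> \<and> C \<phi> \<and> (\<forall>e. envok M \<Gamma> e \<longrightarrow> sat M e \<phi> = P e))"

lemma tdef_var: "n < length \<Gamma> \<Longrightarrow> \<Gamma> ! n = \<tau> \<Longrightarrow> tdef \<Gamma> \<tau> (\<lambda>e. e n)"
  unfolding tdef_def by (intro exI[of _ "Var \<tau> n"]) (simp add: ht_def)

lemma tdef_closed: "ht sp [] t \<sigma> \<Longrightarrow> tdef \<Gamma> \<sigma> (\<lambda>e. evl M (\<lambda>_. undefined) t)"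
  unfolding tdef_def ht_def using evl_closed tm_ok_append[of sp "[]" t \<Gamma>]
  by (intro exI[of _ t]) auto

lemma tdef_const: "const_ok sp c \<Longrightarrow> cty c = \<tau> \<Longrightarrow> tdef \<Gamma> \<tau> (\<lambda>e. Cv M c)"
  unfolding tdef_def by (intro exI[of _ "Cst c"]) (simp add: ht_def)

lemma tdef_ap: "tdef \<Gamma> (\<sigma> \<rightarrow>\<^sub>t \<tau>) f \<Longrightarrow> tdef \<Gamma> \<sigma> x \<Longrightarrow> tdef \<Gamma> \<tau> (\<lambda>e. f e \<bullet> x e)"
  unfolding tdef_def by (elim exE conjE, rename_tac s t, rule_tac x = "App s t" in exI) (simp add: ht_def)

lemma tdef_cong: "tdef \<Gamma> \<sigma> f \<Longrightarrow> (\<And>e. envok M \<Gamma> e \<Longrightarrow> f e = g e) \<Longrightarrow> tdef \<Gamma> \<sigma> g"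
  unfolding tdef_def by auto

text \<open>Junk unless some element of the model represents \<open>h\<close>.\<close>
definition lamv :: "ty \<Rightarrow> ty \<Rightarrow> ('u \<Rightarrow> 'u) \<Rightarrow> 'u" where
  "lamv \<tau> \<sigma> h = (THE f. f \<in> D (\<tau> \<rightarrow>\<^sub>t \<sigma>) \<and> (\<forall>a\<in>D \<tau>. f \<bullet> a = h a))"

lemma lamvI: "f \<in> D (\<tau> \<rightarrow>\<^sub>t \<sigma>) \<Longrightarrow> (\<And>a. a \<in> D \<tau> \<Longrightarrow> f \<bullet> a = h a) \<Longrightarrow> lamv \<tau> \<sigma> h = f"
  unfolding lamv_def by (rule the_equality) (auto intro: D_ext)

lemma fdef_eq:
  "C (Eq (Cst Zero) (Cst Zero)) \<Longrightarrow> (\<And>s t. C (Eq s t)) \<Longrightarrow> tdef \<Gamma> Nat f \<Longrightarrow> tdef \<Gamma> Nat g \<Longrightarrow> fdef C \<Gamma> (\<lambda>e. f e = g e)"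
  unfolding tdef_def fdef_def
  by (elim exE conjE, rename_tac s t, rule_tac x = "Eq s t" in exI) (simp add: ht_def)

lemma fdef_imp: "(\<And>\<phi> \<psi>. C \<phi> \<Longrightarrow> C \<psi> \<Longrightarrow> C (Imp \<phi> \<psi>)) \<Longrightarrow> fdef C \<Gamma> P \<Longrightarrow> fdef C \<Gamma> Q \<Longrightarrow> fdef C \<Gamma> (\<lambda>e. P e \<longrightarrow> Q e)"
  unfolding fdef_def by (elim exE conjE, rename_tac s t, rule_tac x = "Imp s t" in exI) simp

abbreviation "qdef \<equiv> fdef qfree"
abbreviation "idef \<equiv> fdef internal"

lemma qdef_eq: "tdef \<Gamma> Nat f \<Longrightarrow> tdef \<Gamma> Nat g \<Longrightarrow> qdef \<Gamma> (\<lambda>e. f e = g e)"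
  by (rule fdef_eq) auto

lemma qdef_imp: "qdef \<Gamma> P \<Longrightarrow> qdef \<Gamma> Q \<Longrightarrow> qdef \<Gamma> (\<lambda>e. P e \<longrightarrow> Q e)"
  by (rule fdef_imp) auto

lemma qdef_False: "qdef \<Gamma> (\<lambda>e. False)"
  unfolding fdef_def by (intro exI[of _ Fls]) simp

lemma qdef_not: "qdef \<Gamma> P \<Longrightarrow> qdef \<Gamma> (\<lambda>e. \<not> P e)"
  using qdef_imp[OF _ qdef_False] by simp

lemma qdef_or: "qdef \<Gamma> P \<Longrightarrow> qdef \<Gamma> Q \<Longrightarrow> qdef \<Gamma> (\<lambda>e. P e \<or> Q e)"
  using qdef_imp[OF qdef_not, of \<Gamma> P Q] by (simp add: imp_conv_disj)

lemma idef_imp: "idef \<Gamma> P \<Longrightarrow> idef \<Gamma> Q \<Longrightarrow> idef \<Gamma> (\<lambda>e. P e \<longrightarrow> Q e)"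
  by (rule fdef_imp) auto

lemma idef_not: "idef \<Gamma> P \<Longrightarrow> idef \<Gamma> (\<lambda>e. \<not> P e)"
proof -
  have "idef \<Gamma> (\<lambda>e. False)" unfolding fdef_def by (intro exI[of _ Fls]) simp
  then show "idef \<Gamma> P \<Longrightarrow> idef \<Gamma> (\<lambda>e. \<not> P e)" using idef_imp[of \<Gamma> P "\<lambda>e. False"] by simp
qed

lemma idef_all:
  "idef (\<tau> # \<Gamma>) (\<lambda>e. P (e 0) (\<lambda>n. e (Suc n))) \<Longrightarrow> idef \<Gamma> (\<lambda>e. \<forall>a\<in>D \<tau>. P a e)"
  unfolding fdef_def by (elim exE conjE, rename_tac \<phi>, rule_tac x = "All \<tau> \<phi>" in exI) simp

lemma idef_ex:
  "idef (\<tau> # \<Gamma>) (\<lambda>e. P (e 0) (\<lambda>n. e (Suc n))) \<Longrightarrow> idef \<Gamma> (\<lambda>e. \<exists>a\<in>D \<tau>. P a e)"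
  using idef_not[OF idef_all[OF idef_not], of \<tau> \<Gamma> P] by simp

subsection \<open>Axiom schemata\<close>

lemma zero_D: "Cv M Zero \<in> D Nat"
  using Cv_D[of Zero] by simp

lemma suc_D: "x \<in> D Nat \<Longrightarrow> Cv M Succ \<bullet> x \<in> D Nat"
  using Cv_D[of Succ] ap_D by simp

lemma sat_T0: "\<phi> \<in> T \<Longrightarrow> fm_ok sp [] \<phi> \<Longrightarrow> sat M (\<lambda>_. undefined) \<phi>"
  using sat_T[of \<phi> "[]"] by simp

lemma suc_not_zero: "x \<in> D Nat \<Longrightarrow> Cv M Succ \<bullet> x \<noteq> Cv M Zero"
proof -
  have "sat M (\<lambda>_. undefined) (all Nat (\<lambda>x. \<^bold>\<not> eq0 (suc x) zero) 0)"
    using T by (intro sat_T0)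
      (auto simp: RCA0_Omega_def RCA0_omega_def ax_succ_def all_def neg_def imp_def eq0_def fls_def
        suc_def zero_def app_def con_def bvar_def)
  then show "x \<in> D Nat \<Longrightarrow> Cv M Succ \<bullet> x \<noteq> Cv M Zero" by (simp add: suc_def zero_def)
qed

lemma suc_inject: "x \<in> D Nat \<Longrightarrow> y \<in> D Nat \<Longrightarrow> Cv M Succ \<bullet> x = Cv M Succ \<bullet> y \<Longrightarrow> x = y"
proof -
  have "sat M (\<lambda>_. undefined) (all Nat (\<lambda>x. all Nat (\<lambda>y. eq0 (suc x) (suc y) \<^bold>\<longrightarrow> eq0 x y)) 0)"
    using T by (intro sat_T0)
      (auto simp: RCA0_Omega_def RCA0_omega_def ax_succ_def all_def neg_def imp_def eq0_def fls_def
        suc_def zero_def app_def con_def bvar_def)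
  then show "x \<in> D Nat \<Longrightarrow> y \<in> D Nat \<Longrightarrow> Cv M Succ \<bullet> x = Cv M Succ \<bullet> y \<Longrightarrow> x = y"
    by (simp add: suc_def)
qed

lemma rec_laws:
  assumes "y \<in> D Nat" "z \<in> D (Nat \<rightarrow>\<^sub>t Nat \<rightarrow>\<^sub>t Nat)"
  shows "Cv M Rec \<bullet> Cv M Zero \<bullet> y \<bullet> z = y"
    and "x \<in> D Nat \<Longrightarrow> Cv M Rec \<bullet> (Cv M Succ \<bullet> x) \<bullet> y \<bullet> z = z \<bullet> (Cv M Rec \<bullet> x \<bullet> y \<bullet> z) \<bullet> x"
proof -
  have "sat M (\<lambda>_. undefined) (all Nat (\<lambda>y. all (Nat \<rightarrow>\<^sub>t Nat \<rightarrow>\<^sub>t Nat) (\<lambda>z. eq0 (con Rec \<cdot> zero \<cdot> y \<cdot> z) y)) 0)"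
    using T by (intro sat_T0)
      (auto simp: RCA0_Omega_def RCA0_omega_def ax_rec_def all_def eq0_def
        suc_def zero_def app_def con_def bvar_def)
  with assms show "Cv M Rec \<bullet> Cv M Zero \<bullet> y \<bullet> z = y" by (simp add: zero_def)
  have "sat M (\<lambda>_. undefined) (all Nat (\<lambda>x. all Nat (\<lambda>y. all (Nat \<rightarrow>\<^sub>t Nat \<rightarrow>\<^sub>t Nat) (\<lambda>z.
        eq0 (con Rec \<cdot> suc x \<cdot> y \<cdot> z) (z \<cdot> (con Rec \<cdot> x \<cdot> y \<cdot> z) \<cdot> x)))) 0)"
    using T by (intro sat_T0)
      (auto simp: RCA0_Omega_def RCA0_omega_def ax_rec_def all_def eq0_def
        suc_def zero_def app_def con_def bvar_def)
  with assms show "x \<in> D Nat \<Longrightarrow> Cv M Rec \<bullet> (Cv M Succ \<bullet> x) \<bullet> y \<bullet> z = z \<bullet> (Cv M Rec \<bullet> x \<bullet> y \<bullet> z) \<bullet> x"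
    by (simp add: suc_def)
qed

lemma qf_induct:
  assumes P: "qdef (Nat # \<Gamma>) (\<lambda>e. P (e 0) (\<lambda>n. e (Suc n)))" and e: "envok M \<Gamma> e"
    and "P (Cv M Zero) e" and step: "\<And>n. n \<in> D Nat \<Longrightarrow> P n e \<Longrightarrow> P (Cv M Succ \<bullet> n) e" and n: "n \<in> D Nat"
  shows "P n e"
proof -
  obtain \<phi> where \<phi>: "fm_ok sp (Nat # \<Gamma>) \<phi>" "qfree \<phi>"
    "\<And>e. envok M (Nat # \<Gamma>) e \<Longrightarrow> sat M e \<phi> = P (e 0) (\<lambda>n. e (Suc n))"
    using P unfolding fdef_def by blast
  let ?s = "App (Cst Succ) (Var Nat 0)"
  let ?\<psi> = "((raw (subst_fm 0 (Cst Zero) \<phi>) \<^bold>\<and>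
        all Nat (\<lambda>n. raw \<phi> \<^bold>\<longrightarrow> raw (subst_fm 0 ?s (lift_fm 1 \<phi>))))
       \<^bold>\<longrightarrow> all Nat (\<lambda>n. raw \<phi>)) 0"
  \<comment> \<open>The lift at 1 makes room for the bound variable and the substitution removes the
    old one; together they replace variable 0 by its successor and fix the parameters.\<close>
  let ?\<theta> = "\<lambda>\<tau> n. if n = 0 then ?s else Var \<tau> n"
  have sub: "subst_fm 0 ?s (lift_fm 1 \<phi>) = psub_fm ?\<theta> \<phi>"
    unfolding subst_fm_psub lift_fm_psub psub_psub_fm
    by (intro psub_fm_cong[OF \<phi>(1)]) (auto simp: ssub_def lsub_def)
  have sub0: "subst_fm 0 (Cst Zero) \<phi> = psub_fm (ssub 0 (Cst Zero)) \<phi>" by (rule subst_fm_psub)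
  have w0: "wtsub sp (Nat # \<Gamma>) \<Gamma> (ssub 0 (Cst Zero))"
    by (auto simp: wtsub_def ssub_def less_Suc_eq_0_disj)
  have w1: "wtsub sp (Nat # \<Gamma>) (Nat # \<Gamma>) ?\<theta>"
    by (auto simp: wtsub_def less_Suc_eq_0_disj)
  have "?\<psi> \<in> ax_qf_ind" unfolding ax_qf_ind_def using \<phi>(2) by blast
  then have "?\<psi> \<in> T" using T by (auto simp: RCA0_Omega_def RCA0_omega_def)
  moreover have "fm_ok sp \<Gamma> ?\<psi>"
    using fm_ok_psub[OF \<phi>(1) w0] fm_ok_psub[OF \<phi>(1) w1] \<phi>(1)
    by (simp add: imp_def conj_def neg_def fls_def all_def raw_def sub[unfolded One_nat_def] sub0)
  ultimately have sat: "sat M e ?\<psi>" using e by (rule sat_T)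
  have "sat M e (psub_fm (ssub 0 (Cst Zero)) \<phi>) = sat M (Cv M Zero ## e) \<phi>"
    by (rule sat_psub[OF \<phi>(1) _ w0]) (auto simp: ssub_def less_Suc_eq_0_disj)
  moreover have "sat M (a ## e) (psub_fm ?\<theta> \<phi>) = sat M ((Cv M Succ \<bullet> a) ## e) \<phi>" for a
    by (rule sat_psub[OF \<phi>(1) _ w1]) (auto simp: less_Suc_eq_0_disj)
  ultimately have "\<forall>a\<in>D Nat. sat M (a ## e) \<phi>"
    using sat assms(3) step \<phi>(3) e zero_D suc_D by (simp add: sub[unfolded One_nat_def] sub0)
  then show ?thesis using n \<phi>(3) e by simp
qed

text \<open>One parameter \<open>c\<close> is enough for the two uses: a functional that lists
  characteristic functions, and a dummy number in the case of a closed statement.\<close>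

lemma qf_choice:
  assumes P: "qdef [\<tau>, \<sigma>, \<rho>] (\<lambda>e. P (e 0) (e 1) (e 2))" and c: "c \<in> D \<rho>"
    and AC: "ax_QF_AC \<sigma> \<tau> \<subseteq> T" and ex: "\<And>x. x \<in> D \<sigma> \<Longrightarrow> \<exists>y\<in>D \<tau>. P y x c"
  shows "\<exists>F\<in>D (\<sigma> \<rightarrow>\<^sub>t \<tau>). \<forall>x\<in>D \<sigma>. P (F \<bullet> x) x c"
proof -
  obtain \<phi> where \<phi>: "fm_ok sp [\<tau>, \<sigma>, \<rho>] \<phi>" "qfree \<phi>"
    "\<And>e. envok M [\<tau>, \<sigma>, \<rho>] e \<Longrightarrow> sat M e \<phi> = P (e 0) (e 1) (e 2)"
    using P unfolding fdef_def by blast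
  let ?s = "App (Var (\<sigma> \<rightarrow>\<^sub>t \<tau>) 1) (Var \<sigma> 0)"
  let ?\<psi> = "(all \<sigma> (\<lambda>x. ex \<tau> (\<lambda>y. raw \<phi>)) \<^bold>\<longrightarrow>
       ex (\<sigma> \<rightarrow>\<^sub>t \<tau>) (\<lambda>F. all \<sigma> (\<lambda>x. raw (subst_fm 0 ?s (lift_fm 2 \<phi>))))) 0"
  let ?\<theta> = "\<lambda>\<tau> n. if n = 0 then ?s else Var \<tau> (if n = 1 then 0 else n)"
  have sub: "subst_fm 0 ?s (lift_fm 2 \<phi>) = psub_fm ?\<theta> \<phi>"
    unfolding subst_fm_psub lift_fm_psub psub_psub_fm
    by (intro psub_fm_cong[OF \<phi>(1)]) (auto simp: ssub_def lsub_def)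
  have w: "wtsub sp [\<tau>, \<sigma>, \<rho>] [\<sigma>, \<sigma> \<rightarrow>\<^sub>t \<tau>, \<rho>] ?\<theta>"
    by (auto simp: wtsub_def less_Suc_eq_0_disj)
  have "?\<psi> \<in> ax_QF_AC \<sigma> \<tau>" unfolding ax_QF_AC_def using \<phi>(2) by blast
  then have "?\<psi> \<in> T" using AC by blast
  moreover have "fm_ok sp [\<rho>] ?\<psi>"
    using fm_ok_psub[OF \<phi>(1) w, unfolded One_nat_def] \<phi>(1)
    by (simp add: imp_def neg_def fls_def ex_def all_def raw_def sub[unfolded One_nat_def])
  ultimately have sat: "sat M (\<lambda>_. c) ?\<psi>" by (rule sat_T) (use c in \<open>simp add: envok_def\<close>)
  have "sat M (x ## F ## (\<lambda>_. c)) (psub_fm ?\<theta> \<phi>) = sat M ((F \<bullet> x) ## x ## (\<lambda>_. c)) \<phi>" for F x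
    by (rule sat_psub[OF \<phi>(1) _ w]) (auto simp: less_Suc_eq_0_disj)
  with sat have imp: "(\<forall>a\<in>D \<sigma>. \<exists>y\<in>D \<tau>. sat M (y ## a ## (\<lambda>_. c)) \<phi>) \<longrightarrow>
      (\<exists>F\<in>D (\<sigma> \<rightarrow>\<^sub>t \<tau>). \<forall>x\<in>D \<sigma>. sat M ((F \<bullet> x) ## x ## (\<lambda>_. c)) \<phi>)"
    by (simp only: sat_sfm sub)
  have "envok M [\<rho>] (\<lambda>_. c)" using c by (simp add: envok_def)
  then have val: "sat M (y ## x ## (\<lambda>_. c)) \<phi> = P y x c" if "y \<in> D \<tau>" "x \<in> D \<sigma>" for x y
    using \<phi>(3)[of "y ## x ## (\<lambda>_. c)"] that by (simp add: numeral_2_eq_2)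
  show ?thesis using imp ex ap_D[of _ \<sigma> \<tau>] by (simp add: val cong: ball_cong bex_cong)
qed

abbreviation Std :: "ty \<Rightarrow> 'u \<Rightarrow> bool" where "Std \<equiv> Sd M"

lemma std_closed:
  assumes "ht sp [] t \<sigma>"
  shows "Std \<sigma> (evl M (\<lambda>_. undefined) t)"
proof -
  have "St t \<in> T" using T assms by (auto simp: RCA0_Omega_def ax_standard_def ht_def)
  then have "sat M (\<lambda>_. undefined) (St t)" using assms by (intro sat_T0) (auto simp: ht_def)
  then show ?thesis using assms by (simp add: ht_def)
qed

lemma std_ap:
  assumes "f \<in> D (\<sigma> \<rightarrow>\<^sub>t \<tau>)" "x \<in> D \<sigma>" "Std (\<sigma> \<rightarrow>\<^sub>t \<tau>) f" "Std \<sigma> x"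
  shows "Std \<tau> (f \<bullet> x)"
proof -
  let ?\<phi> = "all (\<sigma> \<rightarrow>\<^sub>t \<tau>) (\<lambda>f. all \<sigma> (\<lambda>x. st f \<^bold>\<longrightarrow> st x \<^bold>\<longrightarrow> st (f \<cdot> x))) 0"
  have "?\<phi> \<in> ax_standard sp" unfolding ax_standard_def by blast
  then have "?\<phi> \<in> T" using T by (auto simp: RCA0_Omega_def)
  then have "sat M (\<lambda>_. undefined) ?\<phi>"
    by (rule sat_T0) (auto simp: all_def imp_def st_def app_def bvar_def)
  then show ?thesis using assms by (simp add: app_def bvar_def)
qed

lemma std_le:
  assumes "n \<in> D Nat" "m \<in> D Nat" "Std Nat n"
    "evl M (\<lambda>_. undefined) monusT \<bullet> m \<bullet> n = Cv M Zero"
  shows "Std Nat m"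
proof -
  let ?\<phi> = "all Nat (\<lambda>n. all Nat (\<lambda>m. st n \<^bold>\<longrightarrow> leq m n \<^bold>\<longrightarrow> st m)) 0"
  have "?\<phi> \<in> ax_standard sp" unfolding ax_standard_def by blast
  then have "?\<phi> \<in> T" using T by (auto simp: RCA0_Omega_def)
  moreover have "fm_ok sp [] ?\<phi>" using monusT_ht[of sp "[Nat, Nat]"]
    by (auto simp: all_def imp_def st_def leq_def LeqT_def bvar_def ht_def)
  ultimately have "sat M (\<lambda>_. undefined) ?\<phi>" by (rule sat_T0)
  then have "sat M (m ## n ## (\<lambda>_. undefined)) ((st (bvar Nat 0) \<^bold>\<longrightarrow> leq (bvar Nat 1) (bvar Nat 0) \<^bold>\<longrightarrow> st (bvar Nat 1)) 2)"
    using assms(1,2) unfolding sat_sfm(7) by (simp add: numeral_2_eq_2)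
  moreover have "evl M (m ## n ## (\<lambda>_. undefined)) monusT = evl M (\<lambda>_. undefined) monusT"
    using monusT_ht[of sp "[]"] unfolding ht_def by (blast intro: evl_closed)
  ultimately show ?thesis using assms by (simp add: leq_def LeqT_def bvar_def)
qed

definition memv :: "ty \<Rightarrow> 'u \<Rightarrow> 'u \<Rightarrow> bool" where
  "memv \<tau> y w \<longleftrightarrow> (\<exists>i\<in>D Nat. lessv M i (Cv M (Len \<tau>) \<bullet> w) \<and> Cv M (Nth \<tau>) \<bullet> w \<bullet> i = y)"

lemma HAC:
  assumes P: "idef [\<tau>, \<rho>, \<kappa>] (\<lambda>e. P (e 0) (e 1) (e 2))" and c: "c \<in> D \<kappa>"
    and ex: "\<And>x. x \<in> D \<rho> \<Longrightarrow> Std \<rho> x \<Longrightarrow> \<exists>y\<in>D \<tau>. Std \<tau> y \<and> P y x c"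
  shows "\<exists>F\<in>D (\<rho> \<rightarrow>\<^sub>t Seq \<tau>). Std (\<rho> \<rightarrow>\<^sub>t Seq \<tau>) F \<and> (\<forall>x\<in>D \<rho>. Std \<rho> x \<longrightarrow> (\<exists>y\<in>D \<tau>. memv \<tau> y (F \<bullet> x) \<and> P y x c))"
proof -
  obtain \<phi> where \<phi>: "fm_ok sp [\<tau>, \<rho>, \<kappa>] \<phi>" "internal \<phi>"
    "\<And>e. envok M [\<tau>, \<rho>, \<kappa>] e \<Longrightarrow> sat M e \<phi> = P (e 0) (e 1) (e 2)"
    using P unfolding fdef_def by blast
  let ?\<psi> = "(allst \<rho> (\<lambda>x. exst \<tau> (\<lambda>y. raw \<phi>)) \<^bold>\<longrightarrow>
       exst (\<rho> \<rightarrow>\<^sub>t Seq \<tau>) (\<lambda>F. allst \<rho> (\<lambda>x. ex \<tau> (\<lambda>y. mem \<tau> y (F \<cdot> x) \<^bold>\<and> raw (lift_fm 2 \<phi>))))) 0"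
  have w: "wtsub sp [\<tau>, \<rho>, \<kappa>] [\<tau>, \<rho>, \<rho> \<rightarrow>\<^sub>t Seq \<tau>, \<kappa>] (lsub 2)"
    by (auto simp: wtsub_def lsub_def less_Suc_eq_0_disj)
  have "?\<psi> \<in> ax_HAC_int" unfolding ax_HAC_int_def using \<phi>(2) by blast
  then have "?\<psi> \<in> T" using T by (auto simp: RCA0_Omega_def)
  moreover have "fm_ok sp [\<kappa>] ?\<psi>"
  proof -
    have "fm_ok sp [Nat, \<tau>, \<rho>, \<rho> \<rightarrow>\<^sub>t Seq \<tau>, \<kappa>]
      (eq \<tau> (con (Nth \<tau>) \<cdot> (bvar (\<rho> \<rightarrow>\<^sub>t Seq \<tau>) 0 \<cdot> bvar \<rho> 1) \<cdot> bvar Nat 3) (bvar \<tau> 2) 4)"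
      by (rule fm_ok_eq, simp, simp) (auto simp: ht_def app_def con_def bvar_def)
    moreover have "ht sp [Nat, \<tau>, \<rho>, \<rho> \<rightarrow>\<^sub>t Seq \<tau>, \<kappa>] (Var Nat 0) Nat"
      "ht sp [Nat, \<tau>, \<rho>, \<rho> \<rightarrow>\<^sub>t Seq \<tau>, \<kappa>] (App (Cst (Len \<tau>)) (App (Var (\<rho> \<rightarrow>\<^sub>t Seq \<tau>) 3) (Var \<rho> 2))) Nat"
      by (auto simp: ht_def)
    from fm_ok_lessT[OF this] have "fm_ok sp [Nat, \<tau>, \<rho>, \<rho> \<rightarrow>\<^sub>t Seq \<tau>, \<kappa>] (LeqT (App (Cst Succ) (Var Nat 0))
        (App (Cst (Len \<tau>)) (App (Var (\<rho> \<rightarrow>\<^sub>t Seq \<tau>) 3) (Var \<rho> 2))))" .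
    ultimately show ?thesis
      using fm_ok_psub[OF \<phi>(1) w] \<phi>(1)
      by (simp add: imp_def neg_def conj_def fls_def ex_def all_def allst_def exst_def raw_def mem_def
          ex_less_def all_less_def st_def lift_fm_psub less_def leq_def suc_def numeral_eq_Suc)
        (simp add: app_def con_def bvar_def numeral_eq_Suc)
  qed
  ultimately have sat: "sat M (\<lambda>_. c) ?\<psi>" by (rule sat_T) (use c in \<open>simp add: envok_def\<close>)
  have l: "sat M (y ## x ## F ## e) (lift_fm 2 \<phi>) = sat M (y ## x ## e) \<phi>" for F x y e
    unfolding lift_fm_psub
    by (rule sat_psub[OF \<phi>(1) _ w]) (auto simp: less_Suc_eq_0_disj lsub_def numeral_eq_Suc)
  have m: "sat M (y ## x ## F ## e) (mem \<tau> (bvar \<tau> 2) (bvar (\<rho> \<rightarrow>\<^sub>t Seq \<tau>) 0 \<cdot> bvar \<rho> 1) 3) = memv \<tau> y (F \<bullet> x)"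
    if "y \<in> D \<tau>" "x \<in> D \<rho>" "F \<in> D (\<rho> \<rightarrow>\<^sub>t Seq \<tau>)" for F x y e
  proof -
    have "Cv M (Nth \<tau>) \<bullet> (F \<bullet> x) \<bullet> i \<in> D \<tau>" if "i \<in> D Nat" for i
      using that \<open>x \<in> D \<rho>\<close> \<open>F \<in> D _\<close> Cv_D[of "Nth \<tau>"] ap_D
      by (metis const_ok.simps(8) cty.simps(7))
    then show ?thesis using eqv_eq[of _ \<tau> y] \<open>y \<in> D \<tau>\<close>
      by (auto simp: mem_def ex_less_def memv_def)
  qed
  have d: "Suc 0 = 1" "Suc 1 = 2" "Suc 2 = 3" by simp_all
  have "(\<forall>x\<in>D \<rho>. Std \<rho> x \<longrightarrow> (\<exists>y\<in>D \<tau>. Std \<tau> y \<and> sat M (y ## x ## (\<lambda>_. c)) \<phi>)) \<longrightarrow>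
      (\<exists>F\<in>D (\<rho> \<rightarrow>\<^sub>t Seq \<tau>). Std (\<rho> \<rightarrow>\<^sub>t Seq \<tau>) F \<and> (\<forall>x\<in>D \<rho>. Std \<rho> x \<longrightarrow>
        (\<exists>y\<in>D \<tau>. memv \<tau> y (F \<bullet> x) \<and> sat M (y ## x ## (\<lambda>_. c)) \<phi>)))"
    using sat by (simp only: sat_sfm l d m cong: ball_cong bex_cong)
  moreover have "sat M (y ## x ## (\<lambda>_. c)) \<phi> = P y x c" if "y \<in> D \<tau>" "x \<in> D \<rho>" for x y
    using \<phi>(3)[of "y ## x ## (\<lambda>_. c)"] that c by (simp add: envok_def[of M "[\<kappa>]"] numeral_2_eq_2)
  ultimately show ?thesis using ex by (simp cong: ball_cong bex_cong)
qed

lemma PF_TP: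
  assumes P: "idef [\<tau>] (\<lambda>e. P (e 0))" and "\<And>x. x \<in> D \<tau> \<Longrightarrow> Std \<tau> x \<Longrightarrow> P x" "x \<in> D \<tau>"
  shows "P x"
proof -
  obtain \<phi> where \<phi>: "fm_ok sp [\<tau>] \<phi>" "internal \<phi>" "\<And>e. envok M [\<tau>] e \<Longrightarrow> sat M e \<phi> = P (e 0)"
    using P unfolding fdef_def by blast
  let ?\<psi> = "(allst \<tau> (\<lambda>x. raw \<phi>) \<^bold>\<longrightarrow> all \<tau> (\<lambda>x. raw \<phi>)) 0"
  have "?\<psi> \<in> ax_PF_TP sp" unfolding ax_PF_TP_def using \<phi>(1,2) by blast
  then have "?\<psi> \<in> T" using T by (auto simp: RCA0_Omega_def)
  then have "sat M (\<lambda>_. undefined) ?\<psi>"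
    by (rule sat_T0) (use \<phi>(1) in \<open>auto simp: imp_def allst_def all_def raw_def st_def bvar_def\<close>)
  then show ?thesis using assms \<phi>(3) by simp
qed

text \<open>Transfer for the negated formula. It replaces a functional with a parameter-free
  property by a standard one with the same property.\<close>

lemma PF_TP_ex:
  assumes P: "idef [\<tau>] (\<lambda>e. P (e 0))" and "x \<in> D \<tau>" "P x"
  shows "\<exists>x\<in>D \<tau>. Std \<tau> x \<and> P x"
  using PF_TP[OF idef_not[OF P], of x] assms(2,3) by blast

end

section \<open>Arithmetic in a normal model\<close>

context nmodel
begin

definition lam2 :: "('u \<Rightarrow> 'u \<Rightarrow> 'u) \<Rightarrow> 'u" where
  "lam2 h = lamv Nat T1 (\<lambda>r. lamv Nat Nat (h r))"

definition fun2 :: "('u \<Rightarrow> 'u \<Rightarrow> 'u) \<Rightarrow> bool" where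
  "fun2 h \<longleftrightarrow> (\<exists>f\<in>D (Nat \<rightarrow>\<^sub>t T1). \<forall>r\<in>D Nat. \<forall>i\<in>D Nat. f \<bullet> r \<bullet> i = h r i)"

definition recv :: "'u \<Rightarrow> 'u \<Rightarrow> ('u \<Rightarrow> 'u \<Rightarrow> 'u) \<Rightarrow> 'u" where
  "recv n a h = Cv M Rec \<bullet> n \<bullet> a \<bullet> lam2 h"

lemma lam2_eq:
  assumes f: "f \<in> D (Nat \<rightarrow>\<^sub>t T1)" "\<And>r i. r \<in> D Nat \<Longrightarrow> i \<in> D Nat \<Longrightarrow> f \<bullet> r \<bullet> i = h r i"
  shows "lam2 h = f"
  unfolding lam2_def using assms ap_D[OF f(1)] by (intro lamvI) (auto intro: lamvI[symmetric])

lemma fun2_lam2: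
  assumes "fun2 h"
  shows "lam2 h \<in> D (Nat \<rightarrow>\<^sub>t T1)" "r \<in> D Nat \<Longrightarrow> i \<in> D Nat \<Longrightarrow> lam2 h \<bullet> r \<bullet> i = h r i"
  using assms lam2_eq unfolding fun2_def by metis+

lemma recv_0: "fun2 h \<Longrightarrow> a \<in> D Nat \<Longrightarrow> recv (Cv M Zero) a h = a"
  unfolding recv_def by (simp add: rec_laws fun2_lam2)

lemma recv_D: "fun2 h \<Longrightarrow> n \<in> D Nat \<Longrightarrow> a \<in> D Nat \<Longrightarrow> recv n a h \<in> D Nat"
  unfolding recv_def using Cv_D[of Rec] fun2_lam2(1)[of h] ap_D by (metis const_ok.simps(6) cty.simps(5))

lemma recv_suc: "fun2 h \<Longrightarrow> a \<in> D Nat \<Longrightarrow> n \<in> D Nat \<Longrightarrow> recv (Cv M Succ \<bullet> n) a h = h (recv n a h) n"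
  using recv_D[of h n a] unfolding recv_def by (simp add: rec_laws fun2_lam2)

lemma evl_lam:
  "ht sp (\<tau> # \<Gamma>) (F (bvar \<tau> d) (Suc d)) \<sigma> \<Longrightarrow> envok M \<Gamma> e \<Longrightarrow> a \<in> D \<tau> \<Longrightarrow>
   evl M e (lam \<tau> F d) \<bullet> a = evl M (a ## e) (F (bvar \<tau> d) (Suc d))"
  unfolding lam_def by (rule evl_abst)

lemma evl_lam2:
  assumes "ht sp (Nat # Nat # \<Gamma>) (F (bvar Nat d) (bvar Nat (Suc d)) (Suc (Suc d))) Nat" "envok M \<Gamma> e"
    "\<And>r i. r \<in> D Nat \<Longrightarrow> i \<in> D Nat \<Longrightarrow>
      evl M (i ## r ## e) (F (bvar Nat d) (bvar Nat (Suc d)) (Suc (Suc d))) = h r i"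
  shows "evl M e (lam Nat (\<lambda>r. lam Nat (\<lambda>i. F r i)) d) = lam2 h" "fun2 h"
proof -
  let ?f = "evl M e (lam Nat (\<lambda>r. lam Nat (\<lambda>i. F r i)) d)"
  have 1: "ht sp (Nat # \<Gamma>) (lam Nat (\<lambda>i. F (bvar Nat d) i) (Suc d)) T1"
    by (rule ht_lam) (rule assms(1))
  have "ht sp \<Gamma> (lam Nat (\<lambda>r. lam Nat (\<lambda>i. F r i)) d) (Nat \<rightarrow>\<^sub>t T1)" by (rule ht_lam) (rule 1)
  then have f: "?f \<in> D (Nat \<rightarrow>\<^sub>t T1)" by (rule evl_D) (rule assms(2))
  have ap: "?f \<bullet> r \<bullet> i = h r i" if "r \<in> D Nat" "i \<in> D Nat" for r i
    using that assms evl_lam[where F = "\<lambda>r. lam Nat (\<lambda>i. F r i)" and d = d, OF 1 assms(2) that(1)]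
      evl_lam[where F = "F (bvar Nat d)" and d = "Suc d", OF assms(1), of "r ## e" i] by simp
  show "?f = lam2 h" using lam2_eq[OF f ap] by simp
  show "fun2 h" using f ap unfolding fun2_def by blast
qed

lemma evl_rec:
  assumes "ht sp (Nat # Nat # \<Gamma>) (F (bvar Nat d) (bvar Nat (Suc d)) (Suc (Suc d))) Nat" "envok M \<Gamma> e"
    "\<And>r i. r \<in> D Nat \<Longrightarrow> i \<in> D Nat \<Longrightarrow>
      evl M (i ## r ## e) (F (bvar Nat d) (bvar Nat (Suc d)) (Suc (Suc d))) = h r i"
  shows "evl M e (rec n a F d) = recv (evl M e (n d)) (evl M e (a d)) h" "fun2 h"
  using evl_lam2[of \<Gamma> F d e h, OF assms] by (auto simp: rec_def recv_def)

definition cval :: "tm \<Rightarrow> 'u" where "cval t = evl M (\<lambda>_. undefined) t"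

lemma evl_cval: "ht sp [] t \<sigma> \<Longrightarrow> evl M e t = cval t"
  unfolding cval_def ht_def using evl_closed by blast

lemma cval_D: "ht sp [] t \<sigma> \<Longrightarrow> cval t \<in> D \<sigma>"
  unfolding cval_def by (rule evl_D) auto

abbreviation "zr \<equiv> Cv M Zero"
abbreviation "sc \<equiv> \<lambda>x. Cv M Succ \<bullet> x"
definition "pl x y = cval addT \<bullet> x \<bullet> y"
definition "ti x y = cval mulT \<bullet> x \<bullet> y"
definition "mn x y = cval monusT \<bullet> x \<bullet> y"
definition "prd x = cval predT \<bullet> x"
definition "pw x = cval pow2T \<bullet> x"
definition "tr x = cval triT \<bullet> x"
definition "trt x = cval trirootT \<bullet> x"

lemma op_D [simp]:
  "x \<in> D Nat \<Longrightarrow> y \<in> D Nat \<Longrightarrow> pl x y \<in> D Nat"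
  "x \<in> D Nat \<Longrightarrow> y \<in> D Nat \<Longrightarrow> ti x y \<in> D Nat"
  "x \<in> D Nat \<Longrightarrow> y \<in> D Nat \<Longrightarrow> mn x y \<in> D Nat"
  "x \<in> D Nat \<Longrightarrow> prd x \<in> D Nat" "x \<in> D Nat \<Longrightarrow> pw x \<in> D Nat"
  "x \<in> D Nat \<Longrightarrow> tr x \<in> D Nat" "x \<in> D Nat \<Longrightarrow> trt x \<in> D Nat"
  unfolding pl_def ti_def mn_def prd_def pw_def tr_def trt_def
  by (rule ap_D ap_D[of _ Nat T1] cval_D[OF addT_ht] cval_D[OF mulT_ht] cval_D[OF monusT_ht] cval_D[OF predT_ht]
    cval_D[OF pow2T_ht] cval_D[OF triT_ht] cval_D[OF trirootT_ht] | assumption)+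

declare zero_D [simp] suc_D [simp] suc_not_zero [simp] suc_not_zero [symmetric, simp]

lemmas ht_ops = addT_ht mulT_ht monusT_ht predT_ht pow2T_ht triT_ht trirootT_ht
lemmas evl_ops = ht_ops[of sp "[]", THEN evl_cval]

lemma evl_suc [simp]: "evl M e (suc t d) = sc (evl M e (t d))"
  by (simp add: suc_def)

lemma evl_zero [simp]: "evl M e (zero d) = zr"
  by (simp add: zero_def)

lemma evl_add [simp]: "evl M e (add s t d) = pl (evl M e (s d)) (evl M e (t d))"
  by (simp add: add_def pl_def evl_ops)

lemma evl_mul [simp]: "evl M e (mul s t d) = ti (evl M e (s d)) (evl M e (t d))"
  by (simp add: mul_def ti_def evl_ops)

lemma evl_monus [simp]: "evl M e (monus s t d) = mn (evl M e (s d)) (evl M e (t d))"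
  by (simp add: monus_def mn_def evl_ops)

lemma evl_pow2 [simp]: "evl M e (pow2 t d) = pw (evl M e (t d))"
  by (simp add: pow2_def pw_def evl_ops)

lemma evl_tri [simp]: "evl M e (tri t d) = tr (evl M e (t d))"
  by (simp add: tri_def tr_def evl_ops)

lemma evl_triroot [simp]: "evl M e (triroot t d) = trt (evl M e (t d))"
  by (simp add: triroot_def trt_def evl_ops)

lemma lam2_ap:
  assumes "ht sp [Nat, Nat] (F (bvar Nat 0) (bvar Nat (Suc 0)) (Suc (Suc 0))) Nat" "x \<in> D Nat" "y \<in> D Nat"
  shows "cval (lam Nat (\<lambda>x. lam Nat (\<lambda>y. F x y)) 0) \<bullet> x \<bullet> y =
    evl M (y ## x ## (\<lambda>_. undefined)) (F (bvar Nat 0) (bvar Nat (Suc 0)) (Suc (Suc 0)))"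
proof -
  have 1: "ht sp [Nat] (lam Nat (\<lambda>i. F (bvar Nat 0) i) (Suc 0)) T1"
    by (rule ht_lam) (rule assms(1))
  have "envok M [Nat] (x ## (\<lambda>_. undefined))" using assms(2) by simp
  then show ?thesis
    using evl_lam[where F = "\<lambda>x. lam Nat (\<lambda>y. F x y)" and d = 0, OF 1 _ assms(2)] assms(3)
      evl_lam[where F = "F (bvar Nat 0)" and d = "Suc 0", OF assms(1)]
    by (simp add: cval_def)
qed

lemma lam1_ap:
  assumes "ht sp [Nat] (F (bvar Nat 0) (Suc 0)) Nat" "x \<in> D Nat"
  shows "cval (lam Nat (\<lambda>x. F x) 0) \<bullet> x = evl M (x ## (\<lambda>_. undefined)) (F (bvar Nat 0) (Suc 0))"
  using evl_lam[where F = F and d = 0, OF assms(1)] assms(2) by (simp add: cval_def)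

lemma pl_rec: "x \<in> D Nat \<Longrightarrow> y \<in> D Nat \<Longrightarrow> pl x y = recv y x (\<lambda>r i. sc r) \<and> fun2 (\<lambda>r i. sc r)"
proof -
  assume xy: "x \<in> D Nat" "y \<in> D Nat"
  have e: "envok M [Nat, Nat] (y ## x ## (\<lambda>_. undefined))" using xy by simp
  have h: "ht sp (Nat # Nat # [Nat, Nat]) (suc (bvar Nat (Suc (Suc 0))) (Suc (Suc (Suc (Suc 0))))) Nat"
    unfolding tm_simps by (rule ht_ops ht_intros | simp add: bvar_def)+
  have h2: "ht sp [Nat, Nat] (rec (bvar Nat (Suc 0)) (bvar Nat 0) (\<lambda>r i. suc r) (Suc (Suc 0))) Nat"
    unfolding tm_simps by (rule ht_ops ht_intros | simp add: bvar_def)+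
  show ?thesis
    unfolding pl_def addT_def lam2_ap[of "\<lambda>x y. rec y x (\<lambda>r i. suc r)", OF h2 xy]
    using evl_rec[of "[Nat, Nat]" "\<lambda>r i. suc r", OF h e, of "\<lambda>r i. sc r"] by simp
qed

lemma ti_rec: "x \<in> D Nat \<Longrightarrow> y \<in> D Nat \<Longrightarrow> ti x y = recv y zr (\<lambda>r i. pl r x) \<and> fun2 (\<lambda>r i. pl r x)"
proof -
  assume xy: "x \<in> D Nat" "y \<in> D Nat"
  have e: "envok M [Nat, Nat] (y ## x ## (\<lambda>_. undefined))" using xy by simp
  have h: "ht sp (Nat # Nat # [Nat, Nat]) (add (bvar Nat (Suc (Suc 0))) (bvar Nat 0) (Suc (Suc (Suc (Suc 0))))) Nat"
    unfolding tm_simps add_def by (rule ht_ops ht_intros | simp add: bvar_def)+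
  have h2: "ht sp [Nat, Nat] (rec (bvar Nat (Suc 0)) zero (\<lambda>r i. add r (bvar Nat 0)) (Suc (Suc 0))) Nat"
    unfolding tm_simps add_def by (rule ht_ops ht_intros | simp add: bvar_def)+
  show ?thesis
    unfolding ti_def mulT_def lam2_ap[of "\<lambda>x y. rec y zero (\<lambda>r i. add r x)", OF h2 xy]
    using evl_rec[of "[Nat, Nat]" "\<lambda>r i. add r (bvar Nat 0)", OF h e, of "\<lambda>r i. pl r x"] by simp
qed

lemma mn_rec: "x \<in> D Nat \<Longrightarrow> y \<in> D Nat \<Longrightarrow> mn x y = recv y x (\<lambda>r i. prd r) \<and> fun2 (\<lambda>r i. prd r)"
proof -
  assume xy: "x \<in> D Nat" "y \<in> D Nat"
  have e: "envok M [Nat, Nat] (y ## x ## (\<lambda>_. undefined))" using xy by simp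
  have h: "ht sp (Nat # Nat # [Nat, Nat]) ((raw predT \<cdot> bvar Nat (Suc (Suc 0))) (Suc (Suc (Suc (Suc 0))))) Nat"
    unfolding tm_simps by (rule ht_ops ht_intros | simp add: bvar_def)+
  have h2: "ht sp [Nat, Nat] (rec (bvar Nat (Suc 0)) (bvar Nat 0) (\<lambda>r i. raw predT \<cdot> r) (Suc (Suc 0))) Nat"
    unfolding tm_simps by (rule ht_ops ht_intros | simp add: bvar_def)+
  show ?thesis
    unfolding mn_def monusT_def lam2_ap[of "\<lambda>x y. rec y x (\<lambda>r i. raw predT \<cdot> r)", OF h2 xy]
    using evl_rec[of "[Nat, Nat]" "\<lambda>r i. raw predT \<cdot> r", OF h e, of "\<lambda>r i. prd r"]
    by (simp add: evl_ops prd_def)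
qed

lemma prd_rec: "x \<in> D Nat \<Longrightarrow> prd x = recv x zr (\<lambda>r i. i) \<and> fun2 (\<lambda>r i. i)"
proof -
  assume x: "x \<in> D Nat"
  have e: "envok M [Nat] (x ## (\<lambda>_. undefined))" using x by simp
  have h: "ht sp (Nat # Nat # [Nat]) (bvar Nat (Suc (Suc 0)) (Suc (Suc (Suc 0)))) Nat"
    unfolding tm_simps by (rule ht_ops ht_intros | simp add: bvar_def)+
  have h2: "ht sp [Nat] (rec (bvar Nat 0) zero (\<lambda>r i. i) (Suc 0)) Nat"
    unfolding tm_simps by (rule ht_ops ht_intros | simp add: bvar_def)+
  show ?thesis
    unfolding prd_def predT_def lam1_ap[of "\<lambda>x. rec x zero (\<lambda>r i. i)", OF h2 x]
    using evl_rec[of "[Nat]" "\<lambda>r i. i", OF h e, of "\<lambda>r i. i"] by simp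
qed

lemma pw_rec: "x \<in> D Nat \<Longrightarrow> pw x = recv x (sc zr) (\<lambda>r i. pl r r) \<and> fun2 (\<lambda>r i. pl r r)"
proof -
  assume x: "x \<in> D Nat"
  have e: "envok M [Nat] (x ## (\<lambda>_. undefined))" using x by simp
  have h: "ht sp (Nat # Nat # [Nat]) (add (bvar Nat (Suc 0)) (bvar Nat (Suc 0)) (Suc (Suc (Suc 0)))) Nat"
    unfolding tm_simps add_def by (rule ht_ops ht_intros | simp add: bvar_def)+
  have h2: "ht sp [Nat] (rec (bvar Nat 0) (suc zero) (\<lambda>r i. add r r) (Suc 0)) Nat"
    unfolding tm_simps add_def by (rule ht_ops ht_intros | simp add: bvar_def)+
  show ?thesis
    unfolding pw_def pow2T_def lam1_ap[of "\<lambda>x. rec x (suc zero) (\<lambda>r i. add r r)", OF h2 x]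
    using evl_rec[of "[Nat]" "\<lambda>r i. add r r", OF h e, of "\<lambda>r i. pl r r"] by simp
qed

lemma tr_rec: "x \<in> D Nat \<Longrightarrow> tr x = recv x zr (\<lambda>r i. pl r (sc i)) \<and> fun2 (\<lambda>r i. pl r (sc i))"
proof -
  assume x: "x \<in> D Nat"
  have e: "envok M [Nat] (x ## (\<lambda>_. undefined))" using x by simp
  have h: "ht sp (Nat # Nat # [Nat]) (add (bvar Nat (Suc 0)) (suc (bvar Nat (Suc (Suc 0)))) (Suc (Suc (Suc 0)))) Nat"
    unfolding tm_simps add_def by (rule ht_ops ht_intros | simp add: bvar_def)+
  have h2: "ht sp [Nat] (rec (bvar Nat 0) zero (\<lambda>r i. add r (suc i)) (Suc 0)) Nat"
    unfolding tm_simps add_def by (rule ht_ops ht_intros | simp add: bvar_def)+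
  show ?thesis
    unfolding tr_def triT_def lam1_ap[of "\<lambda>x. rec x zero (\<lambda>r i. add r (suc i))", OF h2 x]
    using evl_rec[of "[Nat]" "\<lambda>r i. add r (suc i)", OF h e, of "\<lambda>r i. pl r (sc i)"] by simp
qed

lemma trt_rec: "z \<in> D Nat \<Longrightarrow>
  trt z = recv z zr (\<lambda>r i. recv (mn (tr (sc r)) (sc i)) (sc r) (\<lambda>_ _. r)) \<and>
  fun2 (\<lambda>r i. recv (mn (tr (sc r)) (sc i)) (sc r) (\<lambda>_ _. r)) \<and> (\<forall>r\<in>D Nat. fun2 (\<lambda>_ _. r))"
proof -
  assume z: "z \<in> D Nat"
  let ?s = "\<lambda>n::nat. (Suc ^^ n) 0"
  have e: "envok M [Nat] (z ## (\<lambda>_. undefined))" using z by simp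
  have h: "ht sp (Nat # Nat # [Nat]) (rec (monus (tri (suc (bvar Nat (Suc 0)))) (suc (bvar Nat (Suc (Suc 0)))))
      (suc (bvar Nat (Suc 0))) (\<lambda>_ _. bvar Nat (Suc 0)) (Suc (Suc (Suc 0)))) Nat"
    unfolding tm_simps monus_def tri_def by (rule ht_ops ht_intros | simp add: bvar_def)+
  have h2: "ht sp [Nat] (rec (bvar Nat 0) zero
     (\<lambda>r i. rec (monus (tri (suc r)) (suc i)) (suc r) (\<lambda>_ _. r)) (Suc 0)) Nat"
    unfolding tm_simps monus_def tri_def by (rule ht_ops ht_intros | simp add: bvar_def)+
  have h3: "ht sp (Nat # Nat # [Nat, Nat, Nat]) (bvar Nat (Suc 0) (Suc (Suc (Suc (Suc (Suc 0)))))) Nat"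
    unfolding tm_simps by (rule ht_ops ht_intros | simp add: bvar_def)+
  have in1: "evl M (i ## r ## z ## (\<lambda>_. undefined)) (rec (monus (tri (suc (bvar Nat (Suc 0)))) (suc (bvar Nat (Suc (Suc 0)))))
      (suc (bvar Nat (Suc 0))) (\<lambda>_ _. bvar Nat (Suc 0)) (Suc (Suc (Suc 0)))) =
      recv (mn (tr (sc r)) (sc i)) (sc r) (\<lambda>_ _. r)" "fun2 (\<lambda>_ _. r)"
    if "r \<in> D Nat" "i \<in> D Nat" for r i
    using evl_rec[of "[Nat, Nat, Nat]" "\<lambda>_ _. bvar Nat (Suc 0)", OF h3, of "i ## r ## z ## (\<lambda>_. undefined)" "\<lambda>_ _. r"]
      that z by simp_all
  show ?thesis
    unfolding trt_def trirootT_def lam1_ap[of "\<lambda>z. rec z zero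
     (\<lambda>r i. rec (monus (tri (suc r)) (suc i)) (suc r) (\<lambda>_ _. r))", OF h2 z]
    using evl_rec[of "[Nat]" "\<lambda>r i. rec (monus (tri (suc r)) (suc i)) (suc r) (\<lambda>_ _. r)", OF h e,
        of "\<lambda>r i. recv (mn (tr (sc r)) (sc i)) (sc r) (\<lambda>_ _. r)"] in1 zero_D by simp
qed

lemma rec_eqs:
  "x \<in> D Nat \<Longrightarrow> pl x zr = x" "x \<in> D Nat \<Longrightarrow> y \<in> D Nat \<Longrightarrow> pl x (sc y) = sc (pl x y)"
  "x \<in> D Nat \<Longrightarrow> ti x zr = zr" "x \<in> D Nat \<Longrightarrow> y \<in> D Nat \<Longrightarrow> ti x (sc y) = pl (ti x y) x"
  "x \<in> D Nat \<Longrightarrow> mn x zr = x" "x \<in> D Nat \<Longrightarrow> y \<in> D Nat \<Longrightarrow> mn x (sc y) = prd (mn x y)"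
  "prd zr = zr" "x \<in> D Nat \<Longrightarrow> prd (sc x) = x"
  "pw zr = sc zr" "x \<in> D Nat \<Longrightarrow> pw (sc x) = pl (pw x) (pw x)"
  "tr zr = zr" "x \<in> D Nat \<Longrightarrow> tr (sc x) = pl (tr x) (sc x)"
  "trt zr = zr"
  "x \<in> D Nat \<Longrightarrow> trt (sc x) = recv (mn (tr (sc (trt x))) (sc x)) (sc (trt x)) (\<lambda>_ _. trt x)"
  using pl_rec ti_rec mn_rec prd_rec pw_rec tr_rec prd_rec[OF zero_D] pw_rec[OF zero_D] tr_rec[OF zero_D]
    trt_rec[OF zero_D] conjunct1[OF trt_rec[of x]] conjunct1[OF trt_rec[of "sc x"]] conjunct2[OF trt_rec[of x]]
  by (simp_all add: recv_0 recv_suc)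

text \<open>The recursor with a constant step function is a case distinction on whether its first
  argument is 0. The premise \<open>z\<close> is the case rule for numbers, which is proved by
  induction only afterwards.\<close>

lemma trt_sc:
  assumes z: "\<And>y. y \<in> D Nat \<Longrightarrow> y = zr \<or> y = sc (prd y)" and x: "x \<in> D Nat"
  shows "trt (sc x) = (if mn (tr (sc (trt x))) (sc x) = zr then sc (trt x) else trt x)"
proof -
  from x have m: "mn (tr (sc (trt x))) (sc x) \<in> D Nat" and f: "fun2 (\<lambda>_ _. trt x)"
    using trt_rec[OF zero_D] by simp_all
  from z[OF m] show ?thesis
  proof
    assume "mn (tr (sc (trt x))) (sc x) = zr"
    then show ?thesis using x rec_eqs(14)[OF x] f by (simp add: recv_0)
  next
    assume s: "mn (tr (sc (trt x))) (sc x) = sc (prd (mn (tr (sc (trt x))) (sc x)))"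
    have "recv (sc (prd (mn (tr (sc (trt x))) (sc x)))) (sc (trt x)) (\<lambda>_ _. trt x) = trt x"
      using x m f by (simp add: recv_suc)
    then show ?thesis using s rec_eqs(14)[OF x] m x
      by (metis op_D(4) suc_not_zero)
  qed
qed

lemma tdef_op:
  "tdef \<Gamma> Nat f \<Longrightarrow> tdef \<Gamma> Nat g \<Longrightarrow> tdef \<Gamma> Nat (\<lambda>e. pl (f e) (g e))"
  "tdef \<Gamma> Nat f \<Longrightarrow> tdef \<Gamma> Nat g \<Longrightarrow> tdef \<Gamma> Nat (\<lambda>e. ti (f e) (g e))"
  "tdef \<Gamma> Nat f \<Longrightarrow> tdef \<Gamma> Nat g \<Longrightarrow> tdef \<Gamma> Nat (\<lambda>e. mn (f e) (g e))"
  "tdef \<Gamma> Nat f \<Longrightarrow> tdef \<Gamma> Nat (\<lambda>e. prd (f e))"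
  "tdef \<Gamma> Nat f \<Longrightarrow> tdef \<Gamma> Nat (\<lambda>e. pw (f e))"
  "tdef \<Gamma> Nat f \<Longrightarrow> tdef \<Gamma> Nat (\<lambda>e. tr (f e))"
  "tdef \<Gamma> Nat f \<Longrightarrow> tdef \<Gamma> Nat (\<lambda>e. trt (f e))"
  "tdef \<Gamma> Nat (\<lambda>e. zr)"
  "tdef \<Gamma> Nat f \<Longrightarrow> tdef \<Gamma> Nat (\<lambda>e. sc (f e))"
  unfolding pl_def ti_def mn_def prd_def pw_def tr_def trt_def cval_def
  by (rule tdef_ap tdef_closed[OF ht_ops(1)] tdef_closed[OF ht_ops(2)] tdef_closed[OF ht_ops(3)]
      tdef_closed[OF ht_ops(4)] tdef_closed[OF ht_ops(5)] tdef_closed[OF ht_ops(6)]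
      tdef_closed[OF ht_ops(7)] tdef_const | assumption | simp)+

lemma num_induct:
  assumes "qdef [Nat, Nat, Nat] (\<lambda>e. P (e 0) (e 1) (e 2))" "a \<in> D Nat" "b \<in> D Nat"
    "P zr a b" "\<And>n. n \<in> D Nat \<Longrightarrow> P n a b \<Longrightarrow> P (sc n) a b" "n \<in> D Nat"
  shows "P n a b"
  using qf_induct[of "[Nat, Nat]" "\<lambda>n e. P n (e 0) (e 1)" "a ## b ## (\<lambda>_. undefined)" n] assms
  by (simp add: numeral_2_eq_2)

lemmas qdef_arith = qdef_eq qdef_imp qdef_or qdef_not tdef_op tdef_var

lemma prd_cases: "x \<in> D Nat \<Longrightarrow> x = zr \<or> x = sc (prd x)"
  by (rule num_induct[of "\<lambda>x _ _. x = zr \<or> x = sc (prd x)" zr zr])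
    (auto simp: rec_eqs intro!: qdef_arith)

lemma zr_pl: "x \<in> D Nat \<Longrightarrow> pl zr x = x"
  by (rule num_induct[of "\<lambda>x _ _. pl zr x = x" zr zr]) (auto simp: rec_eqs intro!: qdef_arith)

lemma sc_pl: "x \<in> D Nat \<Longrightarrow> y \<in> D Nat \<Longrightarrow> pl (sc x) y = sc (pl x y)"
  by (rule num_induct[of "\<lambda>y x _. pl (sc x) y = sc (pl x y)" x zr]) (auto simp: rec_eqs intro!: qdef_arith)

lemma pl_comm: "x \<in> D Nat \<Longrightarrow> y \<in> D Nat \<Longrightarrow> pl x y = pl y x"
  by (rule num_induct[of "\<lambda>y x _. pl x y = pl y x" x zr])
    (auto simp: rec_eqs zr_pl sc_pl intro!: qdef_arith)

lemma pl_assoc: "x \<in> D Nat \<Longrightarrow> y \<in> D Nat \<Longrightarrow> z \<in> D Nat \<Longrightarrow> pl (pl x y) z = pl x (pl y z)"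
  by (rule num_induct[of "\<lambda>z x y. pl (pl x y) z = pl x (pl y z)" x y])
    (auto simp: rec_eqs intro!: qdef_arith)

lemma zr_ti: "x \<in> D Nat \<Longrightarrow> ti zr x = zr"
  by (rule num_induct[of "\<lambda>x _ _. ti zr x = zr" zr zr]) (auto simp: rec_eqs intro!: qdef_arith)

lemma sc_ti: "x \<in> D Nat \<Longrightarrow> y \<in> D Nat \<Longrightarrow> ti (sc x) y = pl (ti x y) y"
proof (rule num_induct[of "\<lambda>y x _. ti (sc x) y = pl (ti x y) y" x zr])
  fix n assume "x \<in> D Nat" "n \<in> D Nat" "ti (sc x) n = pl (ti x n) n"
  then show "ti (sc x) (sc n) = pl (ti x (sc n)) (sc n)"
    by (simp add: rec_eqs pl_assoc pl_comm[of n x])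
qed (auto simp: rec_eqs intro!: qdef_arith)

lemma ti_comm: "x \<in> D Nat \<Longrightarrow> y \<in> D Nat \<Longrightarrow> ti x y = ti y x"
  by (rule num_induct[of "\<lambda>y x _. ti x y = ti y x" x zr])
    (auto simp: rec_eqs zr_ti sc_ti intro!: qdef_arith)

lemma ti_pl: "x \<in> D Nat \<Longrightarrow> y \<in> D Nat \<Longrightarrow> z \<in> D Nat \<Longrightarrow> ti x (pl y z) = pl (ti x y) (ti x z)"
  by (rule num_induct[of "\<lambda>z x y. ti x (pl y z) = pl (ti x y) (ti x z)" x y])
    (auto simp: rec_eqs pl_assoc intro!: qdef_arith)

lemma ti_assoc: "x \<in> D Nat \<Longrightarrow> y \<in> D Nat \<Longrightarrow> z \<in> D Nat \<Longrightarrow> ti (ti x y) z = ti x (ti y z)"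
  by (rule num_induct[of "\<lambda>z x y. ti (ti x y) z = ti x (ti y z)" x y])
    (auto simp: rec_eqs ti_pl intro!: qdef_arith)

lemma pl_cancel: "x \<in> D Nat \<Longrightarrow> y \<in> D Nat \<Longrightarrow> z \<in> D Nat \<Longrightarrow> pl x z = pl y z \<longrightarrow> x = y"
  by (rule num_induct[of "\<lambda>z x y. pl x z = pl y z \<longrightarrow> x = y" x y])
    (auto simp: rec_eqs dest: suc_inject[rotated -1] intro!: qdef_arith)

lemma zr_mn: "y \<in> D Nat \<Longrightarrow> mn zr y = zr"
  by (rule num_induct[of "\<lambda>x _ _. mn zr x = zr" zr zr]) (auto simp: rec_eqs intro!: qdef_arith)

lemma mn_sc: "x \<in> D Nat \<Longrightarrow> y \<in> D Nat \<Longrightarrow> mn (sc x) (sc y) = mn x y"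
  by (rule num_induct[of "\<lambda>y x _. mn (sc x) (sc y) = mn x y" x zr])
    (auto simp: rec_eqs intro!: qdef_arith)

lemma pl_mn: "x \<in> D Nat \<Longrightarrow> d \<in> D Nat \<Longrightarrow> mn (pl x d) x = d"
  by (rule num_induct[of "\<lambda>x d _. mn (pl x d) x = d" d zr])
    (auto simp: rec_eqs(5) zr_pl sc_pl mn_sc intro!: qdef_arith)

lemma mn_pl: "x \<in> D Nat \<Longrightarrow> d \<in> D Nat \<Longrightarrow> mn x (pl x d) = zr"
  by (rule num_induct[of "\<lambda>x d _. mn x (pl x d) = zr" d zr])
    (auto simp: zr_mn sc_pl zr_pl mn_sc intro!: qdef_arith)

text \<open>Comparability with an explicit difference is what makes the order on the numbers linear.
  In the induction step the difference grows or shrinks by one, and a difference 0 changes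
  sides.\<close>

lemma pl_total: "x \<in> D Nat \<Longrightarrow> y \<in> D Nat \<Longrightarrow> pl y (mn x y) = x \<or> pl x (mn y x) = y"
proof (rule num_induct[of "\<lambda>x y _. pl y (mn x y) = x \<or> pl x (mn y x) = y" y zr])
  fix n assume y: "y \<in> D Nat" and n: "n \<in> D Nat" and IH: "pl y (mn n y) = n \<or> pl n (mn y n) = y"
  have 1: "pl y (mn (sc n) y) = sc n" if d: "pl y d = n" "d \<in> D Nat" for d
    using pl_mn[of y "sc d"] y d by (simp add: rec_eqs)
  from IH show "pl y (mn (sc n) y) = sc n \<or> pl (sc n) (mn y (sc n)) = y"
  proof
    assume "pl n (mn y n) = y"
    moreover have "mn y n = zr \<or> mn y n = sc (prd (mn y n))" using prd_cases y n by simp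
    moreover have "pl (sc n) (mn y (sc n)) = y" if d: "pl n (sc d) = y" "d \<in> D Nat" for d
      using pl_mn[of "sc n" d] n d by (simp add: rec_eqs(2) sc_pl)
    ultimately show ?thesis using 1[of zr] n y by (metis op_D(3,4) rec_eqs(1) zero_D)
  qed (use 1 y n in simp)
qed (auto simp: rec_eqs zr_pl intro!: qdef_arith)

end

section \<open>The numbers of a counterexample\<close>

definition refutes :: "spec \<times> fm set \<times> tm struct \<Rightarrow> bool" where
  "refutes X = (case X of (sp, T, M) \<Rightarrow> nmodel sp T M \<and>
     (\<not> sat M (\<lambda>_. undefined) (Iff (rel FAN) (rel HB)) \<or>
      \<not> sat M (\<lambda>_. undefined) (Iff (rel HB) (rel UHB)) \<or>
      \<not> sat M (\<lambda>_. undefined) (Iff (rel UHB) HB_star) \<or>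
      ax_QF_AC T2 Nat \<subseteq> T \<and>
        (\<not> sat M (\<lambda>_. undefined) (Iff (rel FAN) HB) \<or> \<not> sat M (\<lambda>_. undefined) (Iff HB UHB))))"

text \<open>Type class instances cannot depend on the parameters of a locale. To have the numbers of a
  model as a type with ordinary arithmetic, one counterexample to the theorem is fixed once and for
  all; if there is none, a copy of the natural numbers takes the place of its numbers.\<close>
definition cex :: "spec \<times> fm set \<times> tm struct" where "cex = (SOME X. refutes X)"
definition sp0 :: spec where "sp0 = fst cex"
definition T0 :: "fm set" where "T0 = fst (snd cex)"
definition M0 :: "tm struct" where "M0 = snd (snd cex)"

text \<open>The laws are those from which an ordered semiring with cut-off subtraction can be built;
  the order itself is recovered from differences.\<close>

definition arith :: "'a set \<Rightarrow> 'a \<Rightarrow> ('a \<Rightarrow> 'a) \<Rightarrow> ('a \<Rightarrow> 'a \<Rightarrow> 'a) \<Rightarrow> ('a \<Rightarrow> 'a \<Rightarrow> 'a) \<Rightarrow> ('a \<Rightarrow> 'a \<Rightarrow> 'a) \<Rightarrow> bool" where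
  "arith S z s p t m \<longleftrightarrow> z \<in> S \<and> (\<forall>x\<in>S. s x \<in> S) \<and> (\<forall>x\<in>S. s x \<noteq> z) \<and> (\<forall>x\<in>S. p x z = x) \<and>
     (\<forall>x\<in>S. t x z = z) \<and> (\<forall>x\<in>S. x = z \<or> (\<exists>y\<in>S. x = s y)) \<and>
     (\<forall>x\<in>S. \<forall>y\<in>S. p x y \<in> S) \<and> (\<forall>x\<in>S. \<forall>y\<in>S. t x y \<in> S) \<and> (\<forall>x\<in>S. \<forall>y\<in>S. m x y \<in> S) \<and>
     (\<forall>x\<in>S. \<forall>y\<in>S. p x y = p y x) \<and> (\<forall>x\<in>S. \<forall>y\<in>S. t x y = t y x) \<and>
     (\<forall>x\<in>S. \<forall>y\<in>S. p x (s y) = s (p x y)) \<and> (\<forall>x\<in>S. \<forall>y\<in>S. t x (s y) = p (t x y) x) \<and>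
     (\<forall>x\<in>S. \<forall>y\<in>S. m (p x y) x = y) \<and> (\<forall>x\<in>S. \<forall>y\<in>S. m x (p x y) = z) \<and>
     (\<forall>x\<in>S. \<forall>y\<in>S. p y (m x y) = x \<or> p x (m y x) = y) \<and>
     (\<forall>x\<in>S. \<forall>y\<in>S. \<forall>w\<in>S. p (p x y) w = p x (p y w)) \<and> (\<forall>x\<in>S. \<forall>y\<in>S. \<forall>w\<in>S. t (t x y) w = t x (t y w)) \<and>
     (\<forall>x\<in>S. \<forall>y\<in>S. \<forall>w\<in>S. t x (p y w) = p (t x y) (t x w)) \<and>
     (\<forall>x\<in>S. \<forall>y\<in>S. \<forall>w\<in>S. p x w = p y w \<longrightarrow> x = y)"

lemma (in nmodel) arith: "arith (D Nat) zr sc pl ti mn"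
  unfolding arith_def
proof (intro conjI ballI)
  show "x = zr \<or> (\<exists>y\<in>D Nat. x = sc y)" if "x \<in> D Nat" for x using prd_cases that op_D(4) by blast
qed (fact zero_D | (rule suc_D suc_not_zero rec_eqs op_D pl_comm ti_comm pl_mn mn_pl pl_total pl_assoc ti_assoc
    ti_pl pl_cancel; assumption))+

definition arith_ops where
  "arith_ops = (SOME (S, z, s, p, t, m). arith S z s p t m \<and>
     (nmodel sp0 T0 M0 \<longrightarrow> (S, z, s, p, t, m) = (Dom M0 Nat, Cv M0 Zero, Ap M0 (Cv M0 Succ),
        nmodel.pl M0, nmodel.ti M0, nmodel.mn M0)))"

definition car :: "tm set" where "car = fst arith_ops"
definition "czr = fst (snd arith_ops)"
definition "csc = fst (snd (snd arith_ops))"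
definition "cpl = fst (snd (snd (snd arith_ops)))"
definition "cti = fst (snd (snd (snd (snd arith_ops))))"
definition "cmn = snd (snd (snd (snd (snd arith_ops))))"

text \<open>The fallback has to consist of elements of \<open>tm\<close>, hence a copy of the
  natural numbers by the variables of type \<open>Nat\<close>.\<close>

lemma arith_nat: "\<exists>S z s p t m. arith (S :: tm set) z s p t m"
proof -
  define i where "i = (\<lambda>t. case t of Var \<tau> n \<Rightarrow> n | _ \<Rightarrow> 0)"
  have i: "i (Var \<tau> n) = n" for \<tau> n by (simp add: i_def)
  have "arith (range (Var Nat)) (Var Nat 0) (\<lambda>x. Var Nat (Suc (i x))) (\<lambda>x y. Var Nat (i x + i y))
    (\<lambda>x y. Var Nat (i x * i y)) (\<lambda>x y. Var Nat (i x - i y))"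
    unfolding arith_def
  proof (intro conjI)
    show "\<forall>x\<in>range (Var Nat). x = Var Nat 0 \<or> (\<exists>y\<in>range (Var Nat). x = Var Nat (Suc (i y)))"
      by (auto simp: i) (metis not0_implies_Suc)
  qed (simp_all add: i algebra_simps, arith?)
  then show ?thesis by blast
qed

lemma arith_ops: "arith car czr csc cpl cti cmn \<and> (nmodel sp0 T0 M0 \<longrightarrow> car = Dom M0 Nat \<and> czr = Cv M0 Zero \<and>
  csc = Ap M0 (Cv M0 Succ) \<and> cpl = nmodel.pl M0 \<and> cti = nmodel.ti M0 \<and> cmn = nmodel.mn M0)"
proof -
  have "\<exists>X. case X of (S, z, s, p, t, m) \<Rightarrow> arith S z s p t m \<and>
     (nmodel sp0 T0 M0 \<longrightarrow> (S, z, s, p, t, m) = (Dom M0 Nat, Cv M0 Zero, Ap M0 (Cv M0 Succ),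
        nmodel.pl M0, nmodel.ti M0, nmodel.mn M0))"
  proof (cases "nmodel sp0 T0 M0")
    case True
    then show ?thesis using nmodel.arith[OF True]
      by (intro exI[of _ "(Dom M0 Nat, Cv M0 Zero, Ap M0 (Cv M0 Succ), nmodel.pl M0, nmodel.ti M0, nmodel.mn M0)"]) simp
  next
    case False
    obtain S z s p t m where "arith (S :: tm set) z s p t m" using arith_nat by blast
    with False show ?thesis by (intro exI[of _ "(S, z, s, p, t, m)"]) simp
  qed
  from someI_ex[OF this, folded arith_ops_def] show ?thesis
    unfolding car_def czr_def csc_def cpl_def cti_def cmn_def by (auto simp: case_prod_beta)
qed

lemma arith_car: "arith car czr csc cpl cti cmn"
  using arith_ops by blast

lemma car:
  "czr \<in> car"
  "x \<in> car \<Longrightarrow> csc x \<in> car"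
  "x \<in> car \<Longrightarrow> y \<in> car \<Longrightarrow> cpl x y \<in> car"
  "x \<in> car \<Longrightarrow> y \<in> car \<Longrightarrow> cti x y \<in> car"
  "x \<in> car \<Longrightarrow> y \<in> car \<Longrightarrow> cmn x y \<in> car"
  using arith_car unfolding arith_def by simp_all

lemma car_laws:
  "x \<in> car \<Longrightarrow> csc x \<noteq> czr"
  "x \<in> car \<Longrightarrow> cpl x czr = x"
  "x \<in> car \<Longrightarrow> cti x czr = czr"
  "x \<in> car \<Longrightarrow> x = czr \<or> (\<exists>y\<in>car. x = csc y)"
  "x \<in> car \<Longrightarrow> y \<in> car \<Longrightarrow> cpl x y = cpl y x"
  "x \<in> car \<Longrightarrow> y \<in> car \<Longrightarrow> cti x y = cti y x"
  "x \<in> car \<Longrightarrow> y \<in> car \<Longrightarrow> cpl x (csc y) = csc (cpl x y)"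
  "x \<in> car \<Longrightarrow> y \<in> car \<Longrightarrow> cti x (csc y) = cpl (cti x y) x"
  "x \<in> car \<Longrightarrow> y \<in> car \<Longrightarrow> cmn (cpl x y) x = y"
  "x \<in> car \<Longrightarrow> y \<in> car \<Longrightarrow> cmn x (cpl x y) = czr"
  "x \<in> car \<Longrightarrow> y \<in> car \<Longrightarrow> cpl y (cmn x y) = x \<or> cpl x (cmn y x) = y"
  "x \<in> car \<Longrightarrow> y \<in> car \<Longrightarrow> w \<in> car \<Longrightarrow> cpl (cpl x y) w = cpl x (cpl y w)"
  "x \<in> car \<Longrightarrow> y \<in> car \<Longrightarrow> w \<in> car \<Longrightarrow> cti (cti x y) w = cti x (cti y w)"
  "x \<in> car \<Longrightarrow> y \<in> car \<Longrightarrow> w \<in> car \<Longrightarrow> cti x (cpl y w) = cpl (cti x y) (cti x w)"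
  "x \<in> car \<Longrightarrow> y \<in> car \<Longrightarrow> w \<in> car \<Longrightarrow> cpl x w = cpl y w \<Longrightarrow> x = y"
  using arith_car unfolding arith_def by meson+

typedef nn = car
  using car by blast

instantiation nn :: linordered_semidom
begin

definition "0 = Abs_nn czr"
definition "1 = Abs_nn (csc czr)"
definition "x + y = Abs_nn (cpl (Rep_nn x) (Rep_nn y))"
definition "x * y = Abs_nn (cti (Rep_nn x) (Rep_nn y))"
definition "x - y = Abs_nn (cmn (Rep_nn x) (Rep_nn y))"
definition "x \<le> y \<longleftrightarrow> (\<exists>z. y = x + (z::nn))"
definition "x < y \<longleftrightarrow> x \<le> y \<and> x \<noteq> (y::nn)"

lemma Rep_car [simp]: "Rep_nn x \<in> car"
  by (rule Rep_nn)

lemma Rep_ops: "Rep_nn 0 = czr" "Rep_nn 1 = csc czr" "Rep_nn (x + y) = cpl (Rep_nn x) (Rep_nn y)"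
  "Rep_nn (x * y) = cti (Rep_nn x) (Rep_nn y)" "Rep_nn (x - y) = cmn (Rep_nn x) (Rep_nn y)"
  unfolding zero_nn_def one_nn_def plus_nn_def times_nn_def minus_nn_def
  by (simp_all add: Abs_nn_inverse car)

lemma Rep_plus1: "Rep_nn (x + 1) = csc (Rep_nn x)"
  by (simp add: Rep_ops car car_laws(2,7))

lemma nn_add: "(a::nn) + b + c = a + (b + c)" "a + b = b + a" "a + 0 = a" "a + 1 \<noteq> 0"
proof -
  show "a + b = b + a" unfolding Rep_nn_inject[symmetric] Rep_ops by (rule car_laws) auto
  have "Rep_nn (a + 1) \<noteq> Rep_nn 0" unfolding Rep_plus1 Rep_ops(1) by (simp add: car_laws(1))
  then show "a + 1 \<noteq> 0" by metis
qed (unfold Rep_nn_inject[symmetric] Rep_ops, simp_all add: car_laws(2,12))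

lemma nn_add_cancel: "a + c = b + c \<Longrightarrow> a = (b::nn)"
  unfolding Rep_nn_inject[symmetric] Rep_ops by (rule car_laws) auto

lemma nn_mult: "(a::nn) * b * c = a * (b * c)" "a * 0 = 0" "a * (b + c) = a * b + a * c"
  unfolding Rep_nn_inject[symmetric] Rep_ops by (simp_all add: car_laws)

lemma nn_mult_comm: "(a::nn) * b = b * a"
  unfolding Rep_nn_inject[symmetric] Rep_ops by (rule car_laws) auto

lemma nn_mult_1: "(a::nn) * 1 = a"
  unfolding Rep_nn_inject[symmetric] Rep_ops using car_laws(5)[OF _ Rep_car] by (simp add: car car_laws(2,3,8))

lemma nn_diff: "(a::nn) + b - a = b" "a - (a + b) = 0" "b + (a - b) = a \<or> a + (b - a) = b"
  unfolding Rep_nn_inject[symmetric] Rep_ops by (simp_all add: car car_laws)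

lemma nn_cases: "(a::nn) = 0 \<or> (\<exists>b. a = b + 1)"
proof -
  have "Rep_nn a = czr \<or> (\<exists>y\<in>car. Rep_nn a = csc y)" using car_laws(4) by simp
  then show ?thesis
    by (metis Rep_plus1 Rep_nn_inject Abs_nn_inverse Rep_ops(1))
qed

lemma nn_sum_zero: "(a::nn) + b = 0 \<Longrightarrow> a = 0"
  using nn_cases[of a] nn_add by metis

lemma nn_no_zero_div: "(a::nn) * b = 0 \<Longrightarrow> a = 0 \<or> b = 0"
proof -
  assume *: "a * b = 0"
  {
    fix c d assume "a = c + 1" "b = d + 1"
    then have "a * b = (c * b + d) + 1" by (metis nn_add(1,2) nn_mult(3) nn_mult_comm nn_mult_1)
    then have False using * nn_add(4) by metis
  }
  then show ?thesis using nn_cases[of a] nn_cases[of b] by blast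
qed

lemma nn_le_diff: "(a::nn) \<le> b \<Longrightarrow> a + (b - a) = b"
  using nn_diff(1) unfolding less_eq_nn_def by metis

lemma nn_le_antisym: "(a::nn) \<le> b \<Longrightarrow> b \<le> a \<Longrightarrow> a = b"
proof -
  assume "a \<le> b" "b \<le> a"
  then obtain c d where b: "b = a + c" and a: "a = b + d" unfolding less_eq_nn_def by blast
  have "(c + d) + a = 0 + a" using a b nn_add(1,2,3) by metis
  then have "c + d = 0" by (rule nn_add_cancel)
  then show "a = b" using b nn_sum_zero nn_add(3) by metis
qed

instance
proof
  fix a b c :: nn
  show "a + b + c = a + (b + c)" "a + b = b + a" "0 + a = a" "a * b * c = a * (b * c)" "a * b = b * a"
    "1 * a = a" "(a + b) * c = a * c + b * c" "a * (b + c) = a * b + a * c" "0 * a = 0" "a * 0 = 0" "a + b - a = b"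
    using nn_add nn_mult nn_mult_comm nn_mult_1 nn_diff by metis+
  show "(0::nn) \<noteq> 1" using nn_add(2,3,4) by metis
  show "a - b - c = a - (b + c)"
  proof -
    consider d where "a = b + c + d" | d where "b + c = a + d"
      using nn_diff(3)[of "b + c" a] by metis
    then show ?thesis
    proof cases
      case (1 d)
      then show ?thesis using nn_diff(1) nn_add(1) by metis
    next
      case (2 d)
      consider e where "a = b + e" | e where "b = a + e" using nn_diff(3)[of b a] by metis
      then show ?thesis
      proof cases
        case (1 e)
        then have "c + b = (e + d) + b" using 2 nn_add(1,2) by metis
        then have "c = e + d" by (rule nn_add_cancel)
        then show ?thesis using 1 2 nn_diff(1,2) by metis
      next
        case (2 e)
        then show ?thesis using nn_diff(2) \<open>b + c = a + d\<close> nn_add(2,3) by metis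
      qed
    qed
  qed
  show "c * (a - b) = c * a - c * b"
  proof -
    consider d where "a = b + d" | d where "b = a + d" using nn_diff(3)[of b a] by metis
    then show ?thesis by cases (simp_all add: nn_mult nn_diff)
  qed
  show "a * b \<noteq> 0" if "a \<noteq> 0" "b \<noteq> 0" using that nn_no_zero_div by blast
  show "(a < b) = (a \<le> b \<and> \<not> b \<le> a)" using nn_le_antisym unfolding less_nn_def by blast
  show "a \<le> a" unfolding less_eq_nn_def using nn_add(3) by metis
  show "a \<le> c" if "a \<le> b" "b \<le> c" using that nn_add(1) unfolding less_eq_nn_def by metis
  show "a = b" if "a \<le> b" "b \<le> a" using that by (rule nn_le_antisym)
  show "a \<le> b \<or> b \<le> a" unfolding less_eq_nn_def using nn_diff(3) by metis
  show "c + a \<le> c + b" if "a \<le> b" using that nn_add(1) unfolding less_eq_nn_def by metis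
  show "c * a < c * b" if ab: "a < b" and c0: "0 < c"
  proof -
    obtain d where b: "b = a + d" using ab unfolding less_nn_def less_eq_nn_def by blast
    then have d: "d \<noteq> 0" using ab nn_add(3) unfolding less_nn_def by metis
    have c: "c \<noteq> 0" using c0 unfolding less_nn_def by blast
    have cb: "c * b = c * a + c * d" using b nn_mult(3) by simp
    have "c * a \<noteq> c * b"
    proof
      assume "c * a = c * b"
      then have "0 + c * a = c * d + c * a" using cb nn_add(2,3) by metis
      then have "c * d = 0" using nn_add_cancel by metis
      then show False using c d nn_no_zero_div by blast
    qed
    then show ?thesis using cb unfolding less_nn_def less_eq_nn_def by blast
  qed
  show "a - b + b = a" if "b \<le> a" using nn_le_diff[OF that] nn_add(2) by metis
  show "(0::nn) < 1" unfolding less_nn_def less_eq_nn_def using nn_add(2,3,4) by metis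
qed

end

lemma nn_ge_0 [simp]: "0 \<le> (x::nn)"
  unfolding less_eq_nn_def by simp

lemma nn_not_less_0 [simp]: "\<not> x < (0::nn)"
  by (simp add: not_less)

lemma nn_le_0 [simp]: "x \<le> (0::nn) \<longleftrightarrow> x = 0"
  using antisym by fastforce

lemma nn_less_1: "x < (1::nn) \<longleftrightarrow> x = 0"
  by (metis nn_cases nn_not_less_0 less_add_same_cancel2 zero_less_one add.commute add_less_cancel_right)

lemma nn_less_iff: "(x::nn) < y \<longleftrightarrow> x + 1 \<le> y"
proof
  assume "x < y"
  then obtain z where z: "y = x + z" "z \<noteq> 0" unfolding less_nn_def less_eq_nn_def by auto
  then show "x + 1 \<le> y" using nn_cases[of z] by (auto simp: less_eq_nn_def algebra_simps)
next
  assume "x + 1 \<le> y"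
  then show "x < y" by (metis less_add_one less_le_trans)
qed

lemma nn_less_plus_1 [simp]: "(x::nn) < y + 1 \<longleftrightarrow> x \<le> y"
  by (simp add: nn_less_iff)

lemma nn_diff_eq_0 [simp]: "(x::nn) - y = 0 \<longleftrightarrow> x \<le> y"
  using nn_diff(2) nn_diff(3)[of y x] by (metis add.right_neutral add.commute le_add_diff_inverse2 less_eq_nn_def)

lemma nn_add_eq_0 [simp]: "(a::nn) + b = 0 \<longleftrightarrow> a = 0 \<and> b = 0"
  using nn_sum_zero[of a b] nn_sum_zero[of b a] by (auto simp: add.commute)

lemma nn_le_step: "(a::nn) \<le> b \<Longrightarrow> a \<le> b + 1"
  by (rule order_trans) auto

lemma nn_diff_le [simp]: "x \<le> y \<Longrightarrow> x - y = (0::nn)"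
  by simp

\<comment> \<open>Fraction fields start from an integral domain, so the semiring of numbers is first
  completed by formal differences.\<close>
quotient_type zz = "nn \<times> nn" / "\<lambda>x y. fst x + snd y = fst y + snd x"
  morphisms zz_rep zz_abs
proof (rule equivpI)
  show "transp (\<lambda>x y :: nn \<times> nn. fst x + snd y = fst y + snd x)"
  proof (rule transpI)
    fix x y z :: "nn \<times> nn"
    assume "fst x + snd y = fst y + snd x" "fst y + snd z = fst z + snd y"
    then have "(fst x + snd y) + (fst y + snd z) = (fst y + snd x) + (fst z + snd y)" by simp
    then have "fst x + snd z + (fst y + snd y) = fst z + snd x + (fst y + snd y)" by (simp add: ac_simps)
    then show "fst x + snd z = fst z + snd x" by simp
  qed
qed (auto simp: reflp_def symp_def)

instantiation zz :: linordered_idom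
begin

lift_definition zero_zz :: zz is "(0, 0)" .
lift_definition one_zz :: zz is "(1, 0)" .
lift_definition plus_zz :: "zz \<Rightarrow> zz \<Rightarrow> zz" is "\<lambda>x y. (fst x + fst y, snd x + snd y)"
  by (simp add: algebra_simps) (metis add.assoc add.commute)
lift_definition uminus_zz :: "zz \<Rightarrow> zz" is "\<lambda>x. (snd x, fst x)"
  by (simp add: algebra_simps)
definition minus_zz :: "zz \<Rightarrow> zz \<Rightarrow> zz" where "x - y = x + - (y::zz)"
lift_definition times_zz :: "zz \<Rightarrow> zz \<Rightarrow> zz" is
  "\<lambda>x y. (fst x * fst y + snd x * snd y, fst x * snd y + snd x * fst y)"
proof (clarsimp)
  fix a b c d e f g h :: nn
  assume 1: "a + d = c + b" and 2: "e + h = g + f"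
  have "(a * e + b * f) + (c * h + d * g) + (d * e + c * f) =
        (a + d) * e + (b + c) * f + (c * h + d * g)" by (simp add: algebra_simps)
  also have "\<dots> = (c + b) * e + (a + d) * f + (c * h + d * g)" using 1 by (simp add: add.commute)
  also have "\<dots> = c * (e + h) + d * (g + f) + (b * e + a * f)" by (simp add: algebra_simps)
  also have "\<dots> = c * (g + f) + d * (e + h) + (b * e + a * f)" using 2 by simp
  also have "\<dots> = (c * g + d * h) + (a * f + b * e) + (d * e + c * f)" by (simp add: algebra_simps)
  finally show "a * e + b * f + (c * h + d * g) = c * g + d * h + (a * f + b * e)" by simp
qed
lift_definition less_eq_zz :: "zz \<Rightarrow> zz \<Rightarrow> bool" is "\<lambda>x y. fst x + snd y \<le> fst y + snd x"
proof (clarsimp)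
  fix a b c d e f g h :: nn
  assume 1: "a + d = c + b" and 2: "e + h = g + f"
  have "a + f \<le> e + b \<longleftrightarrow> (a + f) + (d + h) \<le> (e + b) + (d + h)" by simp
  also have "\<dots> \<longleftrightarrow> (a + d) + (f + h) \<le> (e + h) + (b + d)" by (simp only: ac_simps)
  also have "\<dots> \<longleftrightarrow> (c + h) + (b + f) \<le> (g + d) + (b + f)" unfolding 1 2 by (simp only: ac_simps)
  finally show "(a + f \<le> e + b) = (c + h \<le> g + d)" by simp
qed
definition less_zz :: "zz \<Rightarrow> zz \<Rightarrow> bool" where "x < y \<longleftrightarrow> x \<le> y \<and> \<not> y \<le> (x::zz)"
definition abs_zz :: "zz \<Rightarrow> zz" where "\<bar>x\<bar> = (if x < 0 then - x else (x::zz))"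
definition sgn_zz :: "zz \<Rightarrow> zz" where "sgn x = (if x = 0 then 0 else if 0 < x then 1 else - (1::zz))"

lift_definition zn :: "nn \<Rightarrow> zz" is "\<lambda>n. (n, 0)" .

lemma zn_pos: "(0::zz) < x \<Longrightarrow> \<exists>n. x = zn n \<and> 0 < n"
proof -
  assume "0 < x"
  then have "\<not> x \<le> 0" by (simp add: less_zz_def)
  then show ?thesis
  proof (transfer, clarsimp)
    fix a b :: nn assume "\<not> a \<le> b"
    then show "\<exists>n. a = n + b \<and> 0 < n"
      by (metis le_add_diff_inverse2 linorder_not_le nn_diff_eq_0 less_imp_le neq_iff nn_not_less_0)
  qed
qed

instance
proof
  fix a b c :: zz
  show "a + b + c = a + (b + c)" "a + b = b + a" "0 + a = a" "- a + a = 0" "a * b * c = a * (b * c)"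
    "a * b = b * a" "1 * a = a" "(a + b) * c = a * c + b * c"
    by (transfer, simp add: algebra_simps)+
  show "a + b - a = b" "a - b - c = a - (b + c)" "0 * a = 0" "a * 0 = 0"
    unfolding minus_zz_def by (transfer, simp add: algebra_simps)+
  show "a - b = a + - b" by (simp add: minus_zz_def)
  show "(0::zz) \<noteq> 1" by transfer simp
  show "(a < b) = (a \<le> b \<and> \<not> b \<le> a)" by (simp add: less_zz_def)
  show "a \<le> a" by transfer simp
  show "a \<le> c" if "a \<le> b" "b \<le> c" using that
  proof (transfer, clarsimp)
    fix a b c d e f :: nn assume "a + d \<le> c + b" "c + f \<le> e + d"
    then have "(a + d) + (c + f) \<le> (c + b) + (e + d)" by (rule add_mono)
    then have "(a + f) + (c + d) \<le> (e + b) + (c + d)" by (simp only: ac_simps)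
    then show "a + f \<le> e + b" by simp
  qed
  show "a = b" if "a \<le> b" "b \<le> a" using that by transfer simp
  show "a \<le> b \<or> b \<le> a" by transfer auto
  show add: "c + a \<le> c + b" if "a \<le> b" for a b c :: zz using that
  proof (transfer, clarsimp)
    fix a b c d e f :: nn assume "a + d \<le> c + b"
    then have "(a + d) + (e + f) \<le> (c + b) + (e + f)" by simp
    then show "e + a + (f + d) \<le> e + c + (f + b)" by (simp only: ac_simps)
  qed
  show "\<bar>a\<bar> = (if a < 0 then - a else a)" by (rule abs_zz_def)
  show "sgn a = (if a = 0 then 0 else if 0 < a then 1 else - 1)" by (rule sgn_zz_def)
  show "c * a < c * b" if ab: "a < b" and c0: "0 < c"
  proof -
    have neg: "- x + x = 0" "x + - x = 0" "0 + x = x" "x + 0 = x" for x :: zz by (transfer, simp add: add.commute)+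
    have assoc: "x + y + z = x + (y + z)" "x + y = y + x" for x y z :: zz by (transfer, simp add: ac_simps)+
    have "0 < b + - a"
      using ab add[of a b "- a"] add[of "- a + b" 0 a] neg assoc unfolding less_zz_def by metis
    then obtain m where m: "b + - a = zn m" "0 < m" using zn_pos by blast
    obtain n where n: "c = zn n" "0 < n" using zn_pos[OF c0] by blast
    have b: "b = a + zn m" using m neg assoc by metis
    have "c * b = c * a + zn (n * m)" unfolding b n by transfer (simp add: algebra_simps)
    moreover have "0 < zn (n * m)" using m(2) n(2) unfolding less_zz_def by transfer auto
    moreover have "x < x + y" if "0 < y" for x y :: zz
      using that add[of 0 y x] add[of "x + y" x "- x"] neg assoc unfolding less_zz_def by metis
    ultimately show ?thesis by simp
  qed
qed

end

text \<open>Rational numbers over the numbers of the model. They serve to do linear arithmetic by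
  \<open>linarith\<close>, which does not support semirings.\<close>
type_synonym qq = "zz fract"

definition qn :: "nn \<Rightarrow> qq" where "qn n = Fract (zn n) 1"

lemma zn_simps: "zn 0 = 0" "zn 1 = 1" "zn (a + b) = zn a + zn b" "zn (a * b) = zn a * zn b"
  "zn a \<le> zn b \<longleftrightarrow> a \<le> b" "zn a = zn b \<longleftrightarrow> a = b"
  by (transfer, simp)+

lemma qn_simps [simp]: "qn 0 = 0" "qn 1 = 1" "qn (a + b) = qn a + qn b" "qn (a * b) = qn a * qn b"
  "qn a \<le> qn b \<longleftrightarrow> a \<le> b" "qn a = qn b \<longleftrightarrow> a = b"
  by (simp_all add: qn_def zn_simps Zero_fract_def One_fract_def eq_fract)

lemma qn_less [simp]: "qn a < qn b \<longleftrightarrow> a < b"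
  by (simp add: less_le)

lemma qn_ge_0 [simp]: "0 \<le> qn a"
  using qn_simps(5)[of 0 a] by simp

lemma qn_numeral [simp]: "qn (numeral k) = numeral k"
  by (induction k) (simp_all only: numeral.simps qn_simps)

lemma qn_diff: "b \<le> a \<Longrightarrow> qn (a - b) = qn a - qn b"
  using qn_simps(3)[of "a - b" b] by simp

lemma nn_le_qn: "a \<le> b \<longleftrightarrow> qn a \<le> qn b"
  and nn_less_qn: "a < b \<longleftrightarrow> qn a < qn b"
  and nn_eq_qn: "a = b \<longleftrightarrow> qn a = qn b"
  by simp_all

text \<open>Inside the field the discreteness of the numbers is invisible to linear arithmetic; the
  step of size 1 has to be supplied by hand.\<close>

lemma qn_less_step: "a < b \<Longrightarrow> qn a + 1 \<le> qn b"
  using nn_less_iff[of a b] qn_simps(5)[of "a + 1" b] by (simp del: qn_simps(5))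

lemmas to_qn = nn_le_qn nn_less_qn nn_eq_qn qn_simps(1-4) qn_numeral

section \<open>Definable functions of numbers\<close>

context nmodel
begin

text \<open>Functions of an environment that are given by applicative terms with constants from \<open>W\<close>.\<close>
inductive wd :: "(ty \<Rightarrow> 'u \<Rightarrow> bool) \<Rightarrow> ty list \<Rightarrow> ty \<Rightarrow> ((nat \<Rightarrow> 'u) \<Rightarrow> 'u) \<Rightarrow> bool" for W where
  wd_var: "n < length \<Gamma> \<Longrightarrow> \<Gamma> ! n = \<tau> \<Longrightarrow> wd W \<Gamma> \<tau> (\<lambda>e. e n)"
| wd_con: "u \<in> D \<sigma> \<Longrightarrow> W \<sigma> u \<Longrightarrow> wd W \<Gamma> \<sigma> (\<lambda>e. u)"
| wd_ap: "wd W \<Gamma> (\<sigma> \<rightarrow>\<^sub>t \<tau>) f \<Longrightarrow> wd W \<Gamma> \<sigma> x \<Longrightarrow> wd W \<Gamma> \<tau> (\<lambda>e. f e \<bullet> x e)"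
| wd_cong: "wd W \<Gamma> \<sigma> f \<Longrightarrow> (\<And>e. envok M \<Gamma> e \<Longrightarrow> f e = g e) \<Longrightarrow> wd W \<Gamma> \<sigma> g"

lemma wd_D: "wd W \<Gamma> \<sigma> f \<Longrightarrow> envok M \<Gamma> e \<Longrightarrow> f e \<in> D \<sigma>"
  by (induction rule: wd.induct) (auto simp: envok_def intro: ap_D)

lemma wd_mono: "wd W \<Gamma> \<sigma> f \<Longrightarrow> (\<And>\<sigma> u. u \<in> D \<sigma> \<Longrightarrow> W \<sigma> u \<Longrightarrow> W' \<sigma> u) \<Longrightarrow> wd W' \<Gamma> \<sigma> f"
  by (induction rule: wd.induct) (auto intro: wd.intros)

lemma wd_subst:
  assumes "wd W \<Gamma> \<sigma> f" "\<And>n. n < length \<Gamma> \<Longrightarrow> wd W \<Delta> (\<Gamma> ! n) (\<lambda>e. s e n)"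
  shows "wd W \<Delta> \<sigma> (\<lambda>e. f (s e))"
  using assms
proof (induction rule: wd.induct)
  case (wd_cong \<Gamma> \<sigma> f g)
  have "envok M \<Gamma> (s e)" if "envok M \<Delta> e" for e
    using wd_D[OF wd_cong.prems that] by (simp add: envok_def)
  then show ?case using wd.wd_cong[of W \<Delta> \<sigma> "\<lambda>e. f (s e)" "\<lambda>e. g (s e)"] wd_cong by blast
qed (auto intro: wd.intros)

lemma wd_weak: "wd W \<Gamma> \<sigma> f \<Longrightarrow> wd W (\<tau> # \<Gamma>) \<sigma> (\<lambda>e. f (\<lambda>n. e (Suc n)))"
  by (erule wd_subst) (rule wd_var, auto)

definition Cl :: "ty \<Rightarrow> 'u \<Rightarrow> bool" where "Cl \<sigma> u \<longleftrightarrow> (\<exists>t. ht sp [] t \<sigma> \<and> u = cval t)"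

lemma Cl_const: "const_ok sp c \<Longrightarrow> cty c = \<sigma> \<Longrightarrow> Cl \<sigma> (Cv M c)"
  unfolding Cl_def cval_def by (intro exI[of _ "Cst c"]) (simp add: ht_def)

lemma tdef_wd: "wd Cl \<Gamma> \<sigma> f \<Longrightarrow> tdef \<Gamma> \<sigma> f"
proof (induction rule: wd.induct)
  case (wd_con u \<sigma> \<Gamma>)
  then show ?case using tdef_closed by (auto simp: Cl_def cval_def)
qed (auto intro: tdef_var tdef_ap tdef_cong)

end

locale wcl = nmodel +
  fixes W :: "ty \<Rightarrow> 'a \<Rightarrow> bool"
  assumes W_Cl: "Cl \<sigma> u \<Longrightarrow> W \<sigma> u"
    and W_ap: "f \<in> D (\<sigma> \<rightarrow>\<^sub>t \<tau>) \<Longrightarrow> x \<in> D \<sigma> \<Longrightarrow> W (\<sigma> \<rightarrow>\<^sub>t \<tau>) f \<Longrightarrow> W \<sigma> x \<Longrightarrow> W \<tau> (f \<bullet> x)"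
begin

abbreviation "df \<equiv> wd W"

text \<open>The source of the standardness claims below: as \<open>W\<close> is closed under
  application, a proof that a construction is definable is also a proof that it stays inside the
  world.\<close>

lemma df_W: "df \<Gamma> \<sigma> f \<Longrightarrow> envok M \<Gamma> e \<Longrightarrow> (\<And>n. n < length \<Gamma> \<Longrightarrow> W (\<Gamma> ! n) (e n)) \<Longrightarrow> W \<sigma> (f e)"
  by (induction rule: wd.induct) (auto intro: W_ap dest: wd_D)

lemma df_W0: "df [] \<sigma> (\<lambda>e. u) \<Longrightarrow> W \<sigma> u \<and> u \<in> D \<sigma>"
  using df_W[of "[]" \<sigma> "\<lambda>e. u" undefined] wd_D[of W "[]" \<sigma> "\<lambda>e. u" undefined] by simp

lemma df_const: "const_ok sp c \<Longrightarrow> cty c = \<sigma> \<Longrightarrow> df \<Gamma> \<sigma> (\<lambda>e. Cv M c)"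
  by (rule wd_con) (use Cv_D W_Cl[OF Cl_const] in auto)

lemma df_closed: "ht sp [] t \<sigma> \<Longrightarrow> df \<Gamma> \<sigma> (\<lambda>e. cval t)"
  by (rule wd_con) (use cval_D W_Cl Cl_def in blast)+

lemma df_abst:
  "df \<Gamma>' \<sigma> f \<Longrightarrow> \<Gamma>' = \<tau> # \<Gamma> \<Longrightarrow>
   \<exists>g. df \<Gamma> (\<tau> \<rightarrow>\<^sub>t \<sigma>) g \<and> (\<forall>e a. envok M \<Gamma> e \<longrightarrow> a \<in> D \<tau> \<longrightarrow> g e \<bullet> a = f (a ## e))"
proof (induction rule: wd.induct)
  case (wd_var n \<Gamma>' \<sigma>)
  show ?case
  proof (cases n)
    case 0
    have "Cv M (Comb_K \<tau> (\<tau> \<rightarrow>\<^sub>t \<tau>)) \<in> D (\<tau> \<rightarrow>\<^sub>t (\<tau> \<rightarrow>\<^sub>t \<tau>) \<rightarrow>\<^sub>t \<tau>)" "Cv M (Comb_K \<tau> \<tau>) \<in> D (\<tau> \<rightarrow>\<^sub>t \<tau> \<rightarrow>\<^sub>t \<tau>)"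
      using Cv_D[of "Comb_K \<tau> (\<tau> \<rightarrow>\<^sub>t \<tau>)"] Cv_D[of "Comb_K \<tau> \<tau>"] by simp_all
    moreover have "df \<Gamma> (\<tau> \<rightarrow>\<^sub>t \<tau>) (\<lambda>e. Cv M (Comb_S \<tau> (\<tau> \<rightarrow>\<^sub>t \<tau>) \<tau>) \<bullet> Cv M (Comb_K \<tau> (\<tau> \<rightarrow>\<^sub>t \<tau>)) \<bullet> Cv M (Comb_K \<tau> \<tau>))"
      by (rule wd_ap df_const | simp)+
    ultimately show ?thesis using 0 wd_var S_law[of _ \<tau> "\<tau> \<rightarrow>\<^sub>t \<tau>" \<tau>] K_law[of _ \<tau> _ "\<tau> \<rightarrow>\<^sub>t \<tau>"] ap_D[of _ \<tau> "\<tau> \<rightarrow>\<^sub>t \<tau>"]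
      by (intro exI[of _ "\<lambda>e. Cv M (Comb_S \<tau> (\<tau> \<rightarrow>\<^sub>t \<tau>) \<tau>) \<bullet> Cv M (Comb_K \<tau> (\<tau> \<rightarrow>\<^sub>t \<tau>)) \<bullet> Cv M (Comb_K \<tau> \<tau>)"]) simp
  next
    case (Suc m)
    then have "df \<Gamma> (\<tau> \<rightarrow>\<^sub>t \<sigma>) (\<lambda>e. Cv M (Comb_K \<sigma> \<tau>) \<bullet> e m)"
      using wd_var by (intro wd_ap[of W \<Gamma> \<sigma>] df_const wd.wd_var) auto
    moreover have "envok M \<Gamma> e \<Longrightarrow> e m \<in> D \<sigma>" for e using Suc wd_var by (auto simp: envok_def)
    ultimately show ?thesis using Suc K_law by (intro exI[of _ "\<lambda>e. Cv M (Comb_K \<sigma> \<tau>) \<bullet> e m"]) simp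
  qed
next
  case (wd_con u \<sigma> \<Gamma>')
  then have "df \<Gamma> (\<tau> \<rightarrow>\<^sub>t \<sigma>) (\<lambda>e. Cv M (Comb_K \<sigma> \<tau>) \<bullet> u)"
    by (intro wd_ap[of W \<Gamma> \<sigma>] df_const wd.wd_con) auto
  then show ?case using K_law wd_con by (intro exI[of _ "\<lambda>e. Cv M (Comb_K \<sigma> \<tau>) \<bullet> u"]) simp
next
  case (wd_ap \<Gamma>' \<sigma> \<rho> f x)
  then obtain g h where g: "df \<Gamma> (\<tau> \<rightarrow>\<^sub>t \<sigma> \<rightarrow>\<^sub>t \<rho>) g" "\<And>e a. envok M \<Gamma> e \<Longrightarrow> a \<in> D \<tau> \<Longrightarrow> g e \<bullet> a = f (a ## e)"
    and h: "df \<Gamma> (\<tau> \<rightarrow>\<^sub>t \<sigma>) h" "\<And>e a. envok M \<Gamma> e \<Longrightarrow> a \<in> D \<tau> \<Longrightarrow> h e \<bullet> a = x (a ## e)"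
    by blast
  have "df \<Gamma> (\<tau> \<rightarrow>\<^sub>t \<rho>) (\<lambda>e. Cv M (Comb_S \<tau> \<sigma> \<rho>) \<bullet> g e \<bullet> h e)"
    by (rule wd.wd_ap[OF wd.wd_ap[OF df_const g(1)] h(1)]) simp_all
  moreover have "Cv M (Comb_S \<tau> \<sigma> \<rho>) \<bullet> g e \<bullet> h e \<bullet> a = f (a ## e) \<bullet> x (a ## e)"
    if "envok M \<Gamma> e" "a \<in> D \<tau>" for e a
    using S_law[OF wd_D[OF g(1)] wd_D[OF h(1)]] g(2) h(2) that by simp
  ultimately show ?case by blast
next
  case (wd_cong \<Gamma>' \<sigma> f g)
  then obtain h where h: "df \<Gamma> (\<tau> \<rightarrow>\<^sub>t \<sigma>) h" "\<And>e a. envok M \<Gamma> e \<Longrightarrow> a \<in> D \<tau> \<Longrightarrow> h e \<bullet> a = f (a ## e)"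
    by blast
  then show ?case using wd_cong.hyps(2) wd_cong.prems by (intro exI[of _ h]) auto
qed

lemma df_lam_ex:
  assumes "df (\<tau> # \<Gamma>) \<sigma> (\<lambda>e. h (e 0) (\<lambda>n. e (Suc n)))"
  shows "\<exists>g. df \<Gamma> (\<tau> \<rightarrow>\<^sub>t \<sigma>) g \<and> (\<forall>e. envok M \<Gamma> e \<longrightarrow> lamv \<tau> \<sigma> (\<lambda>a. h a e) = g e \<and> (\<forall>a\<in>D \<tau>. g e \<bullet> a = h a e))"
proof -
  obtain g where g: "df \<Gamma> (\<tau> \<rightarrow>\<^sub>t \<sigma>) g" "\<And>e a. envok M \<Gamma> e \<Longrightarrow> a \<in> D \<tau> \<Longrightarrow> g e \<bullet> a = h a e"
    using df_abst[OF assms refl] by auto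
  moreover have "lamv \<tau> \<sigma> (\<lambda>a. h a e) = g e" if "envok M \<Gamma> e" for e
    by (rule lamvI) (use g that wd_D in blast)+
  ultimately show ?thesis by blast
qed

lemma df_lam: "df (\<tau> # \<Gamma>) \<sigma> (\<lambda>e. h (e 0) (\<lambda>n. e (Suc n))) \<Longrightarrow> df \<Gamma> (\<tau> \<rightarrow>\<^sub>t \<sigma>) (\<lambda>e. lamv \<tau> \<sigma> (\<lambda>a. h a e))"
  by (drule df_lam_ex, elim exE conjE, erule wd_cong) auto

lemma df_lam_ap: "df (\<tau> # \<Gamma>) \<sigma> (\<lambda>e. h (e 0) (\<lambda>n. e (Suc n))) \<Longrightarrow> envok M \<Gamma> e \<Longrightarrow> a \<in> D \<tau> \<Longrightarrow>
  lamv \<tau> \<sigma> (\<lambda>a. h a e) \<bullet> a = h a e"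
  by (drule df_lam_ex) auto

end

locale cx =
  assumes nm0: "nmodel sp0 T0 M0"
begin

sublocale nmodel sp0 T0 M0
  by (rule nm0)

notation ap (infixl "\<bullet>" 200)

abbreviation nv :: "tm \<Rightarrow> nn" where "nv \<equiv> Abs_nn"
abbreviation rv :: "nn \<Rightarrow> tm" where "rv \<equiv> Rep_nn"

lemma D_Nat: "D Nat = car"
  using arith_ops nm0 by simp

lemma rv_D [simp]: "rv n \<in> D Nat"
  by (simp add: D_Nat)

lemma rv_nv [simp]: "u \<in> D Nat \<Longrightarrow> rv (nv u) = u"
  by (simp add: D_Nat Abs_nn_inverse)

lemma nv_rv [simp]: "nv (rv n) = n"
  by (rule Rep_nn_inverse)

lemma nv_eq_iff: "u \<in> D Nat \<Longrightarrow> v \<in> D Nat \<Longrightarrow> nv u = nv v \<longleftrightarrow> u = v"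
  by (simp add: D_Nat Abs_nn_inject)

lemma rv_ops: "rv 0 = zr" "rv 1 = sc zr" "rv (x + y) = pl (rv x) (rv y)" "rv (x * y) = ti (rv x) (rv y)"
  "rv (x - y) = mn (rv x) (rv y)" "rv (x + 1) = sc (rv x)"
  using arith_ops nm0 Rep_plus1[of x] by (simp_all add: Rep_ops)

lemma nv_ops: "nv zr = 0" "u \<in> D Nat \<Longrightarrow> nv (sc u) = nv u + 1"
  "u \<in> D Nat \<Longrightarrow> v \<in> D Nat \<Longrightarrow> nv (pl u v) = nv u + nv v"
  "u \<in> D Nat \<Longrightarrow> v \<in> D Nat \<Longrightarrow> nv (ti u v) = nv u * nv v"
  "u \<in> D Nat \<Longrightarrow> v \<in> D Nat \<Longrightarrow> nv (mn u v) = nv u - nv v"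
  by (simp_all add: Rep_nn_inject[symmetric] rv_ops rec_eqs(1,2))

definition p2 :: "nn \<Rightarrow> nn" where "p2 n = nv (pw (rv n))"
definition tg :: "nn \<Rightarrow> nn" where "tg n = nv (tr (rv n))"
definition tgr :: "nn \<Rightarrow> nn" where "tgr n = nv (trt (rv n))"

lemma rv_p2: "rv (p2 n) = pw (rv n)" "rv (tg n) = tr (rv n)" "rv (tgr n) = trt (rv n)"
  by (simp_all add: p2_def tg_def tgr_def)

lemma p2_0 [simp]: "p2 0 = 1" and p2_s: "p2 (n + 1) = 2 * p2 n"
  by (simp_all add: Rep_nn_inject[symmetric] rv_ops rv_p2 rec_eqs mult_2)

lemma tg_0 [simp]: "tg 0 = 0" and tg_s: "tg (n + 1) = tg n + (n + 1)"
  by (simp_all add: Rep_nn_inject[symmetric] rv_ops rv_p2 rec_eqs)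

lemma tgr_0 [simp]: "tgr 0 = 0"
  by (simp_all add: Rep_nn_inject[symmetric] rv_ops rv_p2 rec_eqs)

lemma tgr_s: "tgr (n + 1) = (if tg (tgr n + 1) \<le> n + 1 then tgr n + 1 else tgr n)"
proof -
  have "mn (tr (sc (trt (rv n)))) (sc (rv n)) = rv (tg (tgr n + 1) - (n + 1))"
    by (simp add: rv_ops rv_p2 rec_eqs(1,2))
  also have "\<dots> = zr \<longleftrightarrow> tg (tgr n + 1) \<le> n + 1" by (simp flip: rv_ops(1) add: Rep_nn_inject)
  finally have "mn (tr (sc (trt (rv n)))) (sc (rv n)) = zr \<longleftrightarrow> tg (tgr n + 1) \<le> n + 1" .
  then show ?thesis
    unfolding Rep_nn_inject[symmetric] rv_p2 rv_ops using trt_sc[OF prd_cases, of "rv n"]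
    by (simp add: rv_p2 rv_ops rec_eqs(1,2))
qed

definition bn :: "bool \<Rightarrow> nn" where "bn P = (if P then 1 else 0)"

lemma bn_simps [simp]: "bn P = 1 \<longleftrightarrow> P" "bn P = 0 \<longleftrightarrow> \<not> P" "bn True = 1" "bn False = 0" "bn P \<le> 1"
  by (auto simp: bn_def)

definition fa :: "tm \<Rightarrow> nn \<Rightarrow> nn" (infixl "\<odot>" 200) where "fa \<alpha> n = nv (\<alpha> \<bullet> rv n)"
definition ln :: "(nn \<Rightarrow> nn) \<Rightarrow> tm" where "ln h = lamv Nat Nat (\<lambda>u. rv (h (nv u)))"
definition prec :: "nn \<Rightarrow> nn \<Rightarrow> (nn \<Rightarrow> nn \<Rightarrow> nn) \<Rightarrow> nn" where
  "prec n a h = nv (recv (rv n) (rv a) (\<lambda>r i. rv (h (nv r) (nv i))))"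

lemma fa_ext: "\<alpha> \<in> D T1 \<Longrightarrow> \<beta> \<in> D T1 \<Longrightarrow> (\<And>n. \<alpha> \<odot> n = \<beta> \<odot> n) \<Longrightarrow> \<alpha> = \<beta>"
  using D_ext[of \<alpha> Nat Nat \<beta>] ap_D[of _ Nat Nat] nv_eq_iff rv_nv unfolding fa_def by metis

text \<open>Later inductions reduce to this one instance of the schema: that \<open>u\<close> has
  value 1 is a quantifier-free formula with the object \<open>u\<close> as parameter, and
  \<open>u\<close> will be the characteristic function of the predicate in question.\<close>

lemma num_ind_obj:
  assumes "u \<in> D T1" "u \<odot> 0 = 1" "\<And>n. u \<odot> n = 1 \<Longrightarrow> u \<odot> (n + 1) = 1"
  shows "u \<odot> n = 1"
proof -
  have eq: "u \<bullet> v = sc zr \<longleftrightarrow> u \<odot> nv v = 1" if "v \<in> D Nat" for v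
    using that ap_D[OF assms(1) that] by (simp add: fa_def Rep_nn_inject[symmetric] rv_ops)
  have "u \<bullet> rv n = sc zr"
  proof (rule qf_induct[of "[T1]" "\<lambda>n e. e 0 \<bullet> n = sc zr" "\<lambda>_. u", simplified])
    have "tdef [Nat, T1] Nat (\<lambda>e. e (Suc 0) \<bullet> e 0)"
      by (rule tdef_ap[of _ Nat]) (rule tdef_var, simp, simp)+
    then show "qdef [Nat, T1] (\<lambda>e. e (Suc 0) \<bullet> e 0 = sc zr)"
      by (intro qdef_eq tdef_op)
    show "envok M0 [T1] (\<lambda>_. u)" using assms(1) by (simp add: envok_def)
    show "u \<bullet> zr = sc zr" using eq[of zr] assms(2) by (simp add: nv_ops)
    show "u \<bullet> sc n = sc zr" if "n \<in> D Nat" "u \<bullet> n = sc zr" for n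
      using that eq assms(3) by (simp add: nv_ops)
  qed simp
  then show ?thesis using eq[of "rv n"] by simp
qed

end

section \<open>Definable numerical functions and decidable predicates\<close>

locale wcx = cx + wcl sp0 T0 M0 W for W
begin

definition nd :: "ty list \<Rightarrow> ((nat \<Rightarrow> tm) \<Rightarrow> nn) \<Rightarrow> bool" where
  "nd \<Gamma> f \<longleftrightarrow> df \<Gamma> Nat (\<lambda>e. rv (f e))"

definition bd :: "ty list \<Rightarrow> ((nat \<Rightarrow> tm) \<Rightarrow> bool) \<Rightarrow> bool" where
  "bd \<Gamma> P \<longleftrightarrow> nd \<Gamma> (\<lambda>e. bn (P e))"

lemma df_ops:
  "df \<Gamma> Nat f \<Longrightarrow> df \<Gamma> Nat g \<Longrightarrow> df \<Gamma> Nat (\<lambda>e. pl (f e) (g e))"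
  "df \<Gamma> Nat f \<Longrightarrow> df \<Gamma> Nat g \<Longrightarrow> df \<Gamma> Nat (\<lambda>e. ti (f e) (g e))"
  "df \<Gamma> Nat f \<Longrightarrow> df \<Gamma> Nat g \<Longrightarrow> df \<Gamma> Nat (\<lambda>e. mn (f e) (g e))"
  "df \<Gamma> Nat f \<Longrightarrow> df \<Gamma> Nat (\<lambda>e. pw (f e))"
  "df \<Gamma> Nat f \<Longrightarrow> df \<Gamma> Nat (\<lambda>e. tr (f e))"
  "df \<Gamma> Nat f \<Longrightarrow> df \<Gamma> Nat (\<lambda>e. trt (f e))"
  "df \<Gamma> Nat (\<lambda>e. zr)"
  "df \<Gamma> Nat f \<Longrightarrow> df \<Gamma> Nat (\<lambda>e. sc (f e))"
  unfolding pl_def ti_def mn_def prd_def pw_def tr_def trt_def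
  by (rule wd_ap df_closed[OF ht_ops(1)] df_closed[OF ht_ops(2)] df_closed[OF ht_ops(3)]
      df_closed[OF ht_ops(4)] df_closed[OF ht_ops(5)] df_closed[OF ht_ops(6)]
      df_closed[OF ht_ops(7)] df_const | assumption | simp)+

lemma nd_var: "n < length \<Gamma> \<Longrightarrow> \<Gamma> ! n = Nat \<Longrightarrow> nd \<Gamma> (\<lambda>e. nv (e n))"
  unfolding nd_def by (rule wd_cong[OF wd_var]) (auto simp: envok_def)

lemma nd_ops:
  "nd \<Gamma> (\<lambda>e. 0)" "nd \<Gamma> (\<lambda>e. 1)"
  "nd \<Gamma> f \<Longrightarrow> nd \<Gamma> g \<Longrightarrow> nd \<Gamma> (\<lambda>e. f e + g e)"
  "nd \<Gamma> f \<Longrightarrow> nd \<Gamma> g \<Longrightarrow> nd \<Gamma> (\<lambda>e. f e * g e)"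
  "nd \<Gamma> f \<Longrightarrow> nd \<Gamma> g \<Longrightarrow> nd \<Gamma> (\<lambda>e. f e - g e)"
  "nd \<Gamma> f \<Longrightarrow> nd \<Gamma> (\<lambda>e. p2 (f e))" "nd \<Gamma> f \<Longrightarrow> nd \<Gamma> (\<lambda>e. tg (f e))" "nd \<Gamma> f \<Longrightarrow> nd \<Gamma> (\<lambda>e. tgr (f e))"
  unfolding nd_def rv_ops rv_p2 by (rule df_ops; assumption?)+

lemma nd_numeral: "nd \<Gamma> (\<lambda>e. numeral k)"
  by (induction k) (simp_all only: numeral.simps nd_ops)

lemma nd_const: "W Nat (rv n) \<Longrightarrow> nd \<Gamma> (\<lambda>e. n)"
  unfolding nd_def by (rule wd_con) auto

lemma nd_weak: "nd \<Gamma> f \<Longrightarrow> nd (\<tau> # \<Gamma>) (\<lambda>e. f (\<lambda>n. e (Suc n)))"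
  unfolding nd_def by (rule wd_weak)

lemma nd_fa: "df \<Gamma> T1 f \<Longrightarrow> nd \<Gamma> n \<Longrightarrow> nd \<Gamma> (\<lambda>e. f e \<odot> n e)"
  unfolding nd_def fa_def by (rule wd_cong, erule (1) wd_ap) (metis wd_D ap_D rv_nv)

lemma nd_ap: "df \<Gamma> (\<sigma> \<rightarrow>\<^sub>t Nat) f \<Longrightarrow> df \<Gamma> \<sigma> x \<Longrightarrow> nd \<Gamma> (\<lambda>e. nv (f e \<bullet> x e))"
  unfolding nd_def by (rule wd_cong, erule (1) wd_ap) (metis wd_D ap_D rv_nv)

lemma nd_cong: "nd \<Gamma> f \<Longrightarrow> (\<And>e. envok M0 \<Gamma> e \<Longrightarrow> f e = g e) \<Longrightarrow> nd \<Gamma> g"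
  unfolding nd_def by (erule wd_cong) simp

lemma bd_cong: "bd \<Gamma> f \<Longrightarrow> (\<And>e. envok M0 \<Gamma> e \<Longrightarrow> f e = g e) \<Longrightarrow> bd \<Gamma> g"
  unfolding bd_def by (erule nd_cong) simp

lemma df_rv: "nd \<Gamma> f \<Longrightarrow> df \<Gamma> Nat (\<lambda>e. rv (f e))"
  by (simp add: nd_def)

lemma bd_le: "nd \<Gamma> f \<Longrightarrow> nd \<Gamma> g \<Longrightarrow> bd \<Gamma> (\<lambda>e. f e \<le> g e)"
  unfolding bd_def
proof (rule nd_cong)
  show "nd \<Gamma> f \<Longrightarrow> nd \<Gamma> g \<Longrightarrow> nd \<Gamma> (\<lambda>e. 1 - (f e - g e))" by (intro nd_ops)
  show "1 - (f e - g e) = bn (f e \<le> g e)" for e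
  proof (cases "f e \<le> g e")
    case True
    then have "f e - g e = 0" by simp
    then show ?thesis using True by (simp add: bn_def)
  next
    case False
    then have "f e - g e \<noteq> 0" by simp
    then have "1 \<le> f e - g e" using nn_less_1[of "f e - g e"] by (simp add: not_less[symmetric])
    then have "1 - (f e - g e) = 0" by simp
    then show ?thesis using False by (simp add: bn_def)
  qed
qed

lemma bd_not: "bd \<Gamma> P \<Longrightarrow> bd \<Gamma> (\<lambda>e. \<not> P e)"
  unfolding bd_def by (rule nd_cong[of _ "\<lambda>e. 1 - bn (P e)"]) (auto intro: nd_ops simp: bn_def)

lemma bd_conj: "bd \<Gamma> P \<Longrightarrow> bd \<Gamma> Q \<Longrightarrow> bd \<Gamma> (\<lambda>e. P e \<and> Q e)"
  unfolding bd_def by (rule nd_cong[of _ "\<lambda>e. bn (P e) * bn (Q e)"]) (auto intro: nd_ops simp: bn_def)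

lemma bd_disj: "bd \<Gamma> P \<Longrightarrow> bd \<Gamma> Q \<Longrightarrow> bd \<Gamma> (\<lambda>e. P e \<or> Q e)"
  using bd_not[OF bd_conj[OF bd_not bd_not], of \<Gamma> P Q] by simp

lemma bd_imp: "bd \<Gamma> P \<Longrightarrow> bd \<Gamma> Q \<Longrightarrow> bd \<Gamma> (\<lambda>e. P e \<longrightarrow> Q e)"
  unfolding imp_conv_disj by (rule bd_disj[OF bd_not])

lemma bd_less: "nd \<Gamma> f \<Longrightarrow> nd \<Gamma> g \<Longrightarrow> bd \<Gamma> (\<lambda>e. f e < g e)"
  using bd_not[OF bd_le, of \<Gamma> g f] by (simp add: not_le)

lemma bd_eq: "nd \<Gamma> f \<Longrightarrow> nd \<Gamma> g \<Longrightarrow> bd \<Gamma> (\<lambda>e. f e = g e)"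
  using bd_conj[OF bd_le bd_le, of \<Gamma> f g g f] by (simp add: eq_iff)

lemma nd_if: "bd \<Gamma> P \<Longrightarrow> nd \<Gamma> f \<Longrightarrow> nd \<Gamma> g \<Longrightarrow> nd \<Gamma> (\<lambda>e. if P e then f e else g e)"
  unfolding bd_def
  by (rule nd_cong[of _ "\<lambda>e. bn (P e) * f e + (1 - bn (P e)) * g e"], intro nd_ops) (simp_all add: bn_def)

lemma nd_bn: "bd \<Gamma> P \<Longrightarrow> nd \<Gamma> (\<lambda>e. bn (P e))"
  by (simp add: bd_def)

lemma df_ln: "nd (Nat # \<Gamma>) (\<lambda>e. h (nv (e 0)) (\<lambda>n. e (Suc n))) \<Longrightarrow> df \<Gamma> T1 (\<lambda>e. ln (\<lambda>n. h n e))"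
  unfolding nd_def ln_def by (rule df_lam)

lemma ln_fa: "nd (Nat # \<Gamma>) (\<lambda>e. h (nv (e 0)) (\<lambda>n. e (Suc n))) \<Longrightarrow> envok M0 \<Gamma> e \<Longrightarrow> ln (\<lambda>n. h n e) \<odot> n = h n e"
  unfolding nd_def ln_def fa_def
  using df_lam_ap[where h = "\<lambda>a e. rv (h (nv a) e)" and a = "rv n"] by simp

lemma prec_ex:
  assumes h: "nd (Nat # Nat # \<Gamma>) (\<lambda>e. h (nv (e 1)) (nv (e 0)) (\<lambda>n. e (Suc (Suc n))))"
  shows "\<exists>f. df \<Gamma> (Nat \<rightarrow>\<^sub>t T1) f \<and> (\<forall>e. envok M0 \<Gamma> e \<longrightarrow> f e = lam2 (\<lambda>r i. rv (h (nv r) (nv i) e)) \<and>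
    fun2 (\<lambda>r i. rv (h (nv r) (nv i) e)))"
proof -
  let ?f = "\<lambda>e. lamv Nat T1 (\<lambda>r. lamv Nat Nat (\<lambda>i. rv (h (nv r) (nv i) e)))"
  have 1: "df (Nat # \<Gamma>) T1 (\<lambda>e. lamv Nat Nat (\<lambda>i. rv (h (nv (e 0)) (nv i) (\<lambda>n. e (Suc n)))))"
    using h by (intro df_lam[where h = "\<lambda>i e. rv (h (nv (e 0)) (nv i) (\<lambda>n. e (Suc n)))"]) (simp add: nd_def)
  have 2: "df \<Gamma> (Nat \<rightarrow>\<^sub>t T1) ?f"
    by (rule df_lam[where h = "\<lambda>r e. lamv Nat Nat (\<lambda>i. rv (h (nv r) (nv i) e))"]) (rule 1)
  have "?f e \<bullet> r \<bullet> i = rv (h (nv r) (nv i) e)" if "envok M0 \<Gamma> e" "r \<in> D Nat" "i \<in> D Nat" for e r i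
  proof -
    have "?f e \<bullet> r = lamv Nat Nat (\<lambda>i. rv (h (nv r) (nv i) e))"
      using df_lam_ap[where h = "\<lambda>r e. lamv Nat Nat (\<lambda>i. rv (h (nv r) (nv i) e))", OF 1 that(1,2)] .
    moreover have "lamv Nat Nat (\<lambda>i. rv (h (nv r) (nv i) e)) \<bullet> i = rv (h (nv r) (nv i) e)"
      using df_lam_ap[where h = "\<lambda>i e. rv (h (nv (e 0)) (nv i) (\<lambda>n. e (Suc n)))" and e = "r ## e" and \<Gamma> = "Nat # \<Gamma>"]
        h that by (simp add: nd_def)
    ultimately show ?thesis by simp
  qed
  then have "fun2 (\<lambda>r i. rv (h (nv r) (nv i) e))" if "envok M0 \<Gamma> e" for e
    using wd_D[OF 2 that] that unfolding fun2_def by blast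
  then show ?thesis using 2 unfolding lam2_def by blast
qed

lemma nd_prec:
  assumes "nd \<Gamma> n" "nd \<Gamma> a" and h: "nd (Nat # Nat # \<Gamma>) (\<lambda>e. h (nv (e 1)) (nv (e 0)) (\<lambda>n. e (Suc (Suc n))))"
  shows "nd \<Gamma> (\<lambda>e. prec (n e) (a e) (\<lambda>r i. h r i e))"
proof -
  obtain f where f: "df \<Gamma> (Nat \<rightarrow>\<^sub>t T1) f" "\<And>e. envok M0 \<Gamma> e \<Longrightarrow> f e = lam2 (\<lambda>r i. rv (h (nv r) (nv i) e))"
    "\<And>e. envok M0 \<Gamma> e \<Longrightarrow> fun2 (\<lambda>r i. rv (h (nv r) (nv i) e))"
    using prec_ex[OF h] by metis
  have "df \<Gamma> Nat (\<lambda>e. Cv M0 Rec \<bullet> rv (n e) \<bullet> rv (a e) \<bullet> f e)"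
    using assms f(1) by (intro wd_ap[of W \<Gamma> "Nat \<rightarrow>\<^sub>t T1"] wd_ap[of W \<Gamma> Nat] df_const) (auto simp: nd_def)
  then show ?thesis unfolding nd_def
  proof (rule wd_cong)
    fix e assume "envok M0 \<Gamma> e"
    then show "Cv M0 Rec \<bullet> rv (n e) \<bullet> rv (a e) \<bullet> f e = rv (prec (n e) (a e) (\<lambda>r i. h r i e))"
      using recv_D[OF f(3), of e "rv (n e)" "rv (a e)"] by (simp add: f(2) prec_def recv_def)
  qed
qed

lemma prec_eqs:
  assumes h: "nd (Nat # Nat # \<Gamma>) (\<lambda>e. h (nv (e 1)) (nv (e 0)) (\<lambda>n. e (Suc (Suc n))))" and e: "envok M0 \<Gamma> e"
  shows "prec 0 a (\<lambda>r i. h r i e) = a"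
    "prec (n + 1) a (\<lambda>r i. h r i e) = h (prec n a (\<lambda>r i. h r i e)) n e"
  using prec_ex[OF h] e unfolding prec_def rv_ops(1,6) by (auto simp: recv_0 recv_suc)

lemma nn_induct:
  assumes "bd [Nat] (\<lambda>e. P (nv (e 0)))" "P 0" "\<And>n. P n \<Longrightarrow> P (n + 1)"
  shows "P n"
proof -
  have 1: "nd (Nat # []) (\<lambda>e. bn (P (nv (e 0))))" using assms(1) by (simp add: bd_def)
  have 2: "ln (\<lambda>n. bn (P n)) \<odot> n = bn (P n)" for n
    using ln_fa[where h = "\<lambda>n e. bn (P n)", OF 1, of undefined] by simp
  have "ln (\<lambda>n. bn (P n)) \<in> D T1"
    using wd_D[OF df_ln[where h = "\<lambda>n e. bn (P n)", OF 1], of undefined] by simp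
  from num_ind_obj[OF this, of n] assms(2,3) show ?thesis unfolding 2 by simp
qed

end

sublocale cx \<subseteq> A: wcx "\<lambda>_ _. True"
  by unfold_locales auto

context cx
begin

definition fd :: "(nn \<Rightarrow> nn) \<Rightarrow> bool" where "fd f \<longleftrightarrow> (\<exists>u\<in>D T1. \<forall>n. u \<odot> n = f n)"
abbreviation pd :: "(nn \<Rightarrow> bool) \<Rightarrow> bool" where "pd P \<equiv> fd (\<lambda>n. bn (P n))"

lemma fd_obj: "fd f \<Longrightarrow> ln f \<in> D T1 \<and> ln f \<odot> n = f n"
proof -
  assume "fd f"
  then obtain u where u: "u \<in> D T1" "\<And>n. u \<odot> n = f n" unfolding fd_def by blast
  have "u \<bullet> v = rv (f (nv v))" if "v \<in> D Nat" for v
    using u(2)[of "nv v"] that ap_D[OF u(1) that] unfolding fa_def by (metis rv_nv)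
  then have "ln f = u" unfolding ln_def by (intro lamvI u(1))
  then show ?thesis using u by simp
qed

lemma fd_nd: "A.nd [Nat] (\<lambda>e. f (nv (e 0))) \<longleftrightarrow> fd f"
proof
  assume 1: "A.nd [Nat] (\<lambda>e. f (nv (e 0)))"
  have "ln f \<in> D T1" "\<And>n. ln f \<odot> n = f n"
    using A.df_ln[where h = "\<lambda>n e. f n" and \<Gamma> = "[]", OF 1, THEN wd_D, of undefined]
      A.ln_fa[where h = "\<lambda>n e. f n" and \<Gamma> = "[]" and e = undefined, OF 1] by simp_all
  then show "fd f" unfolding fd_def by blast
next
  assume "fd f"
  then have *: "ln f \<in> D T1" "\<And>n. ln f \<odot> n = f n" using fd_obj by auto
  have "A.nd [Nat] (\<lambda>e. ln f \<odot> nv (e 0))"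
    by (intro A.nd_fa A.nd_var wd_con) (use * in auto)
  then show "A.nd [Nat] (\<lambda>e. f (nv (e 0)))" by (simp add: *(2))
qed

lemma pd_bd: "A.bd [Nat] (\<lambda>e. P (nv (e 0))) \<longleftrightarrow> pd P"
  unfolding A.bd_def by (rule fd_nd)

lemma nd_fd: "fd f \<Longrightarrow> A.nd \<Gamma> n \<Longrightarrow> A.nd \<Gamma> (\<lambda>e. f (n e))"
  using A.nd_fa[of \<Gamma> "\<lambda>e. ln f" n] fd_obj[of f] wd_con by simp

lemma bd_pd: "pd P \<Longrightarrow> A.nd \<Gamma> n \<Longrightarrow> A.bd \<Gamma> (\<lambda>e. P (n e))"
  unfolding A.bd_def by (rule nd_fd)

lemma nn_ind: "pd P \<Longrightarrow> P 0 \<Longrightarrow> (\<And>n. P n \<Longrightarrow> P (n + 1)) \<Longrightarrow> P n"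
  using A.nn_induct[of P n] pd_bd by blast

definition bsum :: "nn \<Rightarrow> (nn \<Rightarrow> nn) \<Rightarrow> nn" where "bsum n f = prec n 0 (\<lambda>r k. r + f k)"
text \<open>The sum counts the \<open>k\<close> below \<open>n\<close> such that \<open>P\<close>
  fails up to and including \<open>k\<close>. That number is the least \<open>j\<close> below
  \<open>n\<close> with \<open>P j\<close>, and it is \<open>n\<close> if there is none; so bounded
  search is primitive recursive.\<close>

definition bmin :: "nn \<Rightarrow> (nn \<Rightarrow> bool) \<Rightarrow> nn" where
  "bmin n P = bsum n (\<lambda>k. bn (bsum (k + 1) (\<lambda>j. bn (P j)) = 0))"

end

context wcx
begin

lemma nd_subst:
  assumes "nd \<Gamma> f" "\<And>n. n < length \<Gamma> \<Longrightarrow> df \<Delta> (\<Gamma> ! n) (\<lambda>e. s e n)"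
  shows "nd \<Delta> (\<lambda>e. f (s e))"
  using assms wd_subst[of W \<Gamma> Nat "\<lambda>e. rv (f e)"] unfolding nd_def by blast

lemma nd_weak2:
  assumes "nd (\<tau> # \<Gamma>) (\<lambda>e. f (e 0) (\<lambda>n. e (Suc n)))"
  shows "nd (\<tau> # \<sigma> # \<Gamma>) (\<lambda>e. f (e 0) (\<lambda>n. e (Suc (Suc n))))"
proof -
  have "df (\<tau> # \<sigma> # \<Gamma>) ((\<tau> # \<Gamma>) ! n) (\<lambda>e. (e 0 ## (\<lambda>n. e (Suc (Suc n)))) n)" if "n < length (\<tau> # \<Gamma>)" for n
    using that by (cases n) (auto intro: wd_var)
  from nd_subst[OF assms this] show ?thesis by simp
qed

lemma nd_bsum:
  assumes "nd \<Gamma> n" "nd (Nat # \<Gamma>) (\<lambda>e. f (nv (e 0)) (\<lambda>n. e (Suc n)))"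
  shows "nd \<Gamma> (\<lambda>e. bsum (n e) (\<lambda>k. f k e))"
  unfolding bsum_def
  by (rule nd_prec[where h = "\<lambda>r k e. r + f k e"], rule assms(1), rule nd_ops, rule nd_ops)
    (rule nd_var, simp, simp, rule nd_weak2[where f = "\<lambda>k e. f (nv k) e"], rule assms(2))

lemmas defs = nd_ops nd_numeral nd_if nd_bsum nd_fa bd_le bd_less bd_eq bd_not bd_conj bd_disj bd_imp nd_bn nd_var

end

context cx
begin

lemma nd_fd_app: "fd f \<Longrightarrow> A.nd (Nat # \<Gamma>) (\<lambda>e. f (nv (e 0)))"
  by (rule nd_fd) (auto intro: A.nd_var)

lemma bsum_eqs:
  assumes "fd f"
  shows "bsum 0 f = 0" "bsum (n + 1) f = bsum n f + f n"
proof -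
  have "A.nd (Nat # Nat # []) (\<lambda>e. nv (e 1) + f (nv (e 0)))"
    by (rule A.nd_ops A.nd_var nd_fd[OF assms] | simp)+
  from A.prec_eqs[where h = "\<lambda>r k e. r + f k", OF this, of undefined]
  show "bsum 0 f = 0" "bsum (n + 1) f = bsum n f + f n" unfolding bsum_def by simp_all
qed

lemma bsum_D: "fd f \<Longrightarrow> fd (\<lambda>n. bsum n f)"
  unfolding fd_nd[symmetric]
  by (rule A.nd_bsum[where f = "\<lambda>k e. f k"]) (auto simp: fd_nd intro: A.nd_var nd_fd_app)

lemma nd_bsum_fd: "fd f \<Longrightarrow> A.nd \<Gamma> n \<Longrightarrow> A.nd \<Gamma> (\<lambda>e. bsum (n e) f)"
  by (rule nd_fd[OF bsum_D])

lemmas adefs = A.defs nd_bsum_fd A.nd_const nd_fd bd_pd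

text \<open>The link between sums and bounded quantifiers, by which the decidable predicates are
  closed under bounded quantification.\<close>

lemma bsum_bn_0:
  assumes P: "pd P"
  shows "bsum n (\<lambda>k. bn (P k)) = 0 \<longleftrightarrow> (\<forall>k<n. \<not> P k)"
proof -
  let ?S = "\<lambda>n. bsum n (\<lambda>k. bn (P k))"
  have "k < n \<longrightarrow> P k \<longrightarrow> ?S n \<noteq> 0" for k n
  proof (rule A.nn_induct[where n = n])
    show "A.bd [Nat] (\<lambda>e. k < nv (e 0) \<longrightarrow> P k \<longrightarrow> ?S (nv (e 0)) \<noteq> 0)"
      by (rule adefs P | simp)+
  next
    fix n assume "k < n \<longrightarrow> P k \<longrightarrow> ?S n \<noteq> 0"
    then show "k < n + 1 \<longrightarrow> P k \<longrightarrow> ?S (n + 1) \<noteq> 0"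
      by (auto simp: bsum_eqs[OF P] le_less add_nonneg_eq_0_iff)
  qed simp
  moreover have "?S n = 0" if "\<forall>k<n. \<not> P k"
  proof -
    have "m \<le> n \<longrightarrow> ?S m = 0" for m
    proof (rule A.nn_induct[where n = m])
      show "A.bd [Nat] (\<lambda>e. nv (e 0) \<le> n \<longrightarrow> ?S (nv (e 0)) = 0)"
        by (rule adefs P | simp)+
    next
      fix m assume "m \<le> n \<longrightarrow> ?S m = 0"
      then show "m + 1 \<le> n \<longrightarrow> ?S (m + 1) = 0"
        using that nn_less_iff[of m n] by (auto simp: bsum_eqs[OF P])
    qed (simp add: bsum_eqs[OF P])
    then show ?thesis by blast
  qed
  ultimately show ?thesis by blast
qed

lemma bmin:
  assumes P: "pd P"
  shows "bmin n P \<le> n" "j < bmin n P \<Longrightarrow> \<not> P j" "bmin n P < n \<Longrightarrow> P (bmin n P)"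
proof -
  let ?Q = "\<lambda>k. bsum (k + 1) (\<lambda>j. bn (P j)) = 0"
  have "pd ?Q" unfolding pd_bd[symmetric] by (rule adefs P | simp)+
  note b = bsum_eqs[OF this, folded bmin_def]
  have Q: "?Q k \<longleftrightarrow> (\<forall>j\<le>k. \<not> P j)" for k unfolding bsum_bn_0[OF P] by simp
  have bd: "A.nd \<Gamma> f \<Longrightarrow> A.nd \<Gamma> (\<lambda>e. bmin (f e) P)" for \<Gamma> f
    unfolding bmin_def by (rule nd_bsum_fd[OF \<open>pd ?Q\<close>])
  \<comment> \<open>The invariant expresses minimality by a vanishing sum, since bounded quantifiers
    are not yet known to preserve decidability.\<close>
  have 1: "bmin n P \<le> n \<and> bsum (bmin n P) (\<lambda>j. bn (P j)) = 0 \<and> (bmin n P < n \<longrightarrow> P (bmin n P))" for n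
  proof (rule A.nn_induct[where n = n])
    show "A.bd [Nat] (\<lambda>e. bmin (nv (e 0)) P \<le> nv (e 0) \<and> bsum (bmin (nv (e 0)) P) (\<lambda>j. bn (P j)) = 0 \<and>
        (bmin (nv (e 0)) P < nv (e 0) \<longrightarrow> P (bmin (nv (e 0)) P)))"
      by (rule bd adefs P | simp)+
  next
    fix n
    assume IH: "bmin n P \<le> n \<and> bsum (bmin n P) (\<lambda>j. bn (P j)) = 0 \<and> (bmin n P < n \<longrightarrow> P (bmin n P))"
    show "bmin (n + 1) P \<le> n + 1 \<and> bsum (bmin (n + 1) P) (\<lambda>j. bn (P j)) = 0 \<and> (bmin (n + 1) P < n + 1 \<longrightarrow> P (bmin (n + 1) P))"
    proof (cases "bmin n P < n")
      case True
      then have "P (bmin n P)" "bmin n P \<le> n" using IH by auto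
      then have "\<not> ?Q n" unfolding Q by blast
      then show ?thesis using IH True by (auto simp: b bn_def nn_le_step)
    next
      case False
      then have n: "bmin n P = n" using IH by auto
      show ?thesis
      proof (cases "?Q n")
        case True
        then show ?thesis using n by (simp add: b bn_def)
      next
        case False
        moreover have "\<forall>j<n. \<not> P j" using IH n bsum_bn_0[OF P] by simp
        ultimately have "P n" unfolding Q by (auto simp: le_less)
        then show ?thesis using False IH n by (simp add: b bn_def)
      qed
    qed
  qed (simp add: b bsum_eqs[OF P])
  show "bmin n P \<le> n" "bmin n P < n \<Longrightarrow> P (bmin n P)" "j < bmin n P \<Longrightarrow> \<not> P j"
    using 1[of n] bsum_bn_0[OF P] by auto
qed

lemma bmin_le: "pd P \<Longrightarrow> P j \<Longrightarrow> bmin n P \<le> j"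
  using bmin(2)[of P j n] by (meson not_le)

lemma bmin_P: "pd P \<Longrightarrow> P j \<Longrightarrow> j < n \<Longrightarrow> P (bmin n P)"
  using bmin(3)[of P n] bmin_le[of P j n] by auto

end

context wcx
begin

lemma nd_slice:
  assumes "nd (Nat # \<Gamma>) (\<lambda>e. f (nv (e 0)) (\<lambda>n. e (Suc n)))" "envok M0 \<Gamma> e"
  shows "fd (\<lambda>n. f n e)"
  unfolding fd_def
  using ln_fa[OF assms] df_ln[OF assms(1), THEN wd_D, OF assms(2)] by blast

lemma nd_bmin:
  assumes "nd \<Gamma> n" and P: "bd (Nat # \<Gamma>) (\<lambda>e. P (nv (e 0)) (\<lambda>n. e (Suc n)))"
  shows "nd \<Gamma> (\<lambda>e. bmin (n e) (\<lambda>k. P k e))"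
  unfolding bmin_def
  by (rule nd_bsum[where f = "\<lambda>k e. bn (bsum (k + 1) (\<lambda>j. bn (P j e)) = 0)"], rule assms(1), rule defs,
      rule defs, rule nd_bsum[where f = "\<lambda>j e. bn (P j (\<lambda>n. e (Suc n)))"], (rule defs | simp)+, unfold bd_def)
    (rule nd_weak2[where f = "\<lambda>k e. bn (P (nv k) e)"], use P in \<open>simp add: bd_def\<close>, rule nd_ops)

lemma bd_exl:
  assumes "nd \<Gamma> n" and P: "bd (Nat # \<Gamma>) (\<lambda>e. P (nv (e 0)) (\<lambda>n. e (Suc n)))"
  shows "bd \<Gamma> (\<lambda>e. \<exists>k<n e. P k e)"
proof (rule bd_cong)
  show "bd \<Gamma> (\<lambda>e. bsum (n e) (\<lambda>k. bn (P k e)) \<noteq> 0)"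
    by (rule defs assms(1))+ (use P in \<open>simp_all add: bd_def defs\<close>)
  show "bsum (n e) (\<lambda>k. bn (P k e)) \<noteq> 0 \<longleftrightarrow> (\<exists>k<n e. P k e)" if "envok M0 \<Gamma> e" for e
    using bsum_bn_0[OF nd_slice[where f = "\<lambda>k e. bn (P k e)", OF P[unfolded bd_def] that], of "n e"] by auto
qed

lemma bd_exle:
  assumes "nd \<Gamma> n" "bd (Nat # \<Gamma>) (\<lambda>e. P (nv (e 0)) (\<lambda>n. e (Suc n)))"
  shows "bd \<Gamma> (\<lambda>e. \<exists>k\<le>n e. P k e)"
  using bd_exl[of \<Gamma> "\<lambda>e. n e + 1" P] assms by (simp add: defs)

lemma bd_alll:
  assumes "nd \<Gamma> n" "bd (Nat # \<Gamma>) (\<lambda>e. P (nv (e 0)) (\<lambda>n. e (Suc n)))"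
  shows "bd \<Gamma> (\<lambda>e. \<forall>k<n e. P k e)"
  using bd_not[OF bd_exl[OF assms(1) bd_not], of P] assms(2) by simp

lemma bd_allle:
  assumes "nd \<Gamma> n" "bd (Nat # \<Gamma>) (\<lambda>e. P (nv (e 0)) (\<lambda>n. e (Suc n)))"
  shows "bd \<Gamma> (\<lambda>e. \<forall>k\<le>n e. P k e)"
  using bd_not[OF bd_exle[OF assms(1) bd_not], of P] assms(2) by simp

lemmas defs2 = bd_exl bd_exle bd_alll bd_allle nd_bmin defs

end

context cx
begin

lemmas adefs2 = A.defs2 nd_bsum_fd A.nd_const

lemma least:
  assumes "pd P" "P n"
  shows "\<exists>m\<le>n. P m \<and> (\<forall>j<m. \<not> P j)"
  using bmin_P[OF assms, of "n + 1"] bmin_le[OF assms] bmin(2)[OF assms(1)] by auto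

subsection \<open>Powers of two, pairing and sequences\<close>

lemma pd_D: "A.bd [Nat] (\<lambda>e. P (nv (e 0))) \<Longrightarrow> pd P" "A.nd [Nat] (\<lambda>e. f (nv (e 0))) \<Longrightarrow> fd f"
  by (simp_all add: pd_bd fd_nd)

lemma p2_ge: "n + 1 \<le> p2 n"
proof (rule nn_ind[of _ n])
  show "pd (\<lambda>n. n + 1 \<le> p2 n)" by (rule pd_D) (rule adefs2 | simp)+
  show "n + 1 + 1 \<le> p2 (n + 1)" if "n + 1 \<le> p2 n" for n
    using that qn_ge_0[of n] unfolding p2_s to_qn by linarith
qed simp

lemma p2_pos [simp]: "0 < p2 n"
  using p2_ge[of n] by (meson less_le_trans nn_less_plus_1 nn_ge_0)

lemma p2_add: "p2 (n + m) = p2 n * p2 m"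
proof (rule nn_ind[of _ m])
  show "pd (\<lambda>m. p2 (n + m) = p2 n * p2 m)" by (rule pd_D) (rule adefs2 | simp)+
  show "p2 (n + (m + 1)) = p2 n * p2 (m + 1)" if "p2 (n + m) = p2 n * p2 m" for m
    using that p2_s[of "n + m"] p2_s[of m] by (simp add: algebra_simps)
qed simp

lemma tg_mono: "n \<le> m \<Longrightarrow> tg n \<le> tg m"
proof -
  have "tg n \<le> tg (n + d)" for d
  proof (rule nn_ind[of _ d])
    show "pd (\<lambda>d. tg n \<le> tg (n + d))" by (rule pd_D) (rule adefs2 | simp)+
    show "tg n \<le> tg (n + (d + 1))" if "tg n \<le> tg (n + d)" for d
      using that tg_s[of "n + d"] add_increasing2[of "n + d + 1" "tg n" "tg (n + d)"] by (simp add: add.assoc)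
  qed simp
  then show "n \<le> m \<Longrightarrow> tg n \<le> tg m" by (metis nn_le_diff)
qed

lemma tgr: "tg (tgr z) \<le> z \<and> z < tg (tgr z + 1)"
proof (rule nn_ind[of _ z])
  show "pd (\<lambda>z. tg (tgr z) \<le> z \<and> z < tg (tgr z + 1))" by (rule pd_D) (rule adefs2 | simp)+
  show "tg (tgr 0) \<le> 0 \<and> 0 < tg (tgr 0 + 1)" using tg_s[of 0] by simp
  fix z assume IH: "tg (tgr z) \<le> z \<and> z < tg (tgr z + 1)"
  show "tg (tgr (z + 1)) \<le> z + 1 \<and> z + 1 < tg (tgr (z + 1) + 1)"
  proof (cases "tg (tgr z + 1) \<le> z + 1")
    case True
    then have "tgr (z + 1) = tgr z + 1" by (simp add: tgr_s)
    moreover have "tg (tgr z + 1) = z + 1" using IH True by (simp add: nn_less_iff)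
    ultimately show ?thesis using tg_s[of "tgr z + 1"] by (simp add: less_add_same_cancel1 add_pos_nonneg add_nonneg_pos)
  next
    case False
    then show ?thesis using IH by (auto simp: tgr_s not_le intro: less_imp_le less_trans)
  qed
qed

lemma tgr_unique: "tg w \<le> z \<Longrightarrow> z < tg (w + 1) \<Longrightarrow> tgr z = w"
  using tgr[of z] tg_mono[of "w + 1" "tgr z"] tg_mono[of "tgr z + 1" w]
  by (metis le_less_trans nn_less_iff linorder_neq_iff not_le)

definition pr :: "nn \<Rightarrow> nn \<Rightarrow> nn" where "pr x y = tg (x + y) + y"
definition pr2 :: "nn \<Rightarrow> nn" where "pr2 z = z - tg (tgr z)"
definition pr1 :: "nn \<Rightarrow> nn" where "pr1 z = tgr z - pr2 z"

lemma pr_proj [simp]: "pr2 (pr x y) = y" "pr1 (pr x y) = x"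
proof -
  have "tgr (pr x y) = x + y"
  proof (rule tgr_unique)
    show "tg (x + y) \<le> pr x y" by (simp add: pr_def)
    show "pr x y < tg (x + y + 1)" using qn_ge_0[of x] unfolding pr_def tg_s to_qn by linarith
  qed
  then show "pr2 (pr x y) = y" "pr1 (pr x y) = x" unfolding pr1_def pr2_def pr_def by simp_all
qed

lemma tg_ge: "n \<le> tg n"
  using tg_s[of "n - 1"] nn_cases[of n] by (auto simp: tg_s)

lemma pr_ge: "x \<le> pr x y" "y \<le> pr x y"
proof -
  have "x + y \<le> pr x y" using tg_ge[of "x + y"] unfolding pr_def by (rule add_increasing2[OF nn_ge_0])
  then show "x \<le> pr x y" "y \<le> pr x y" by (meson order_trans le_add_same_cancel1 le_add_same_cancel2 nn_ge_0)+
qed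

end

section \<open>Coded sequences and binary expansions\<close>

context wcx
begin

lemma wd_weak2: "df \<Gamma> \<sigma> f \<Longrightarrow> df (\<tau> # \<rho> # \<Gamma>) \<sigma> (\<lambda>e. f (\<lambda>n. e (Suc (Suc n))))"
  by (erule wd_subst) (rule wd_var, auto)

lemma nd_pr: "nd \<Gamma> f \<Longrightarrow> nd \<Gamma> g \<Longrightarrow> nd \<Gamma> (\<lambda>e. pr (f e) (g e))"
  "nd \<Gamma> f \<Longrightarrow> nd \<Gamma> (\<lambda>e. pr1 (f e))" "nd \<Gamma> f \<Longrightarrow> nd \<Gamma> (\<lambda>e. pr2 (f e))"
  unfolding pr_def pr1_def pr2_def by (rule defs | assumption)+

end

context cx
begin

lemma prec_eqs0:
  assumes "A.nd [Nat, Nat] (\<lambda>e. h (nv (e 1)) (nv (e 0)))"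
  shows "prec 0 a h = a" "prec (n + 1) a h = h (prec n a h) n"
  using A.prec_eqs[where h = "\<lambda>r i e. h r i" and \<Gamma> = "[]" and e = undefined] assms by auto

definition ini :: "tm \<Rightarrow> nn \<Rightarrow> nn" where "ini \<alpha> n = prec n 0 (\<lambda>s i. pr s (\<alpha> \<odot> i) + 1)"
text \<open>A nonempty code is the successor of a pair, so \<open>pr1 (r - 1)\<close> removes the
  last entry and \<open>pr2 (r - 1)\<close> reads it. A code is at least as large as the length of
  its sequence, which justifies \<open>s\<close> as the search bound in \<open>len\<close>.\<close>

definition iter :: "nn \<Rightarrow> nn \<Rightarrow> nn" where "iter n s = prec n s (\<lambda>r i. pr1 (r - 1))"
definition len :: "nn \<Rightarrow> nn" where "len s = bmin s (\<lambda>n. iter n s = 0)"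
definition ent :: "nn \<Rightarrow> tm" where "ent s = ln (\<lambda>i. pr2 (iter (len s - (i + 1)) s - 1))"
definition dy :: "tm \<Rightarrow> nn \<Rightarrow> nn" where "dy \<alpha> n = prec n 0 (\<lambda>r i. 2 * r + \<alpha> \<odot> i)"
definition fl :: "nn \<Rightarrow> nn \<Rightarrow> nn" where "fl a d = bmin a (\<lambda>q. a < (q + 1) * d)"
text \<open>The leading binary digits of \<open>a\<close>, written with \<open>k\<close> digits, are
  the floors of \<open>a\<close> by powers of 2; digit \<open>i\<close> is 1 when the next floor is
  not the exact double of the previous one. Positions from \<open>k\<close> on are 0, so that the
  result is a total binary sequence.\<close>

definition dig :: "nn \<Rightarrow> nn \<Rightarrow> tm" where
  "dig a k = ln (\<lambda>i. bn (i < k \<and> fl a (p2 (k - (i + 1))) \<noteq> 2 * fl a (p2 (k - i))))"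
definition bit :: "tm \<Rightarrow> tm" where "bit \<alpha> = ln (\<lambda>i. bn (\<alpha> \<odot> i \<noteq> 0))"
text \<open>\<open>T\<close> is an arbitrary function here and all initial segments are inspected.
  This makes the property monotone in \<open>n\<close> and removes closure under initial segments
  from the working form of the fan theorem.\<close>

definition out :: "tm \<Rightarrow> tm \<Rightarrow> nn \<Rightarrow> bool" where "out T \<alpha> n \<longleftrightarrow> \<not> (\<forall>i\<le>n. T \<odot> ini \<alpha> i = 1)"
text \<open>Binary sequences of length \<open>k\<close> are counted by the numbers below
  \<open>p2 k\<close>. The height of a tree thereby becomes a decidable property with bounded number
  quantifiers, with the same meaning in both worlds.\<close>

definition covd :: "tm \<Rightarrow> nn \<Rightarrow> bool" where "covd T k \<longleftrightarrow> (\<forall>a<p2 k. out T (dig a k) k)"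

end

context wcx
begin

lemma nd_ini: "df \<Gamma> T1 \<alpha> \<Longrightarrow> nd \<Gamma> n \<Longrightarrow> nd \<Gamma> (\<lambda>e. ini (\<alpha> e) (n e))"
  unfolding ini_def
  by (rule nd_prec[where h = "\<lambda>s i e. pr s (\<alpha> e \<odot> i) + 1"]) (rule defs nd_pr wd_weak2 | assumption | simp)+

lemma nd_iter: "nd \<Gamma> n \<Longrightarrow> nd \<Gamma> s \<Longrightarrow> nd \<Gamma> (\<lambda>e. iter (n e) (s e))"
  unfolding iter_def
  by (rule nd_prec[where h = "\<lambda>r i e. pr1 (r - 1)"]) (rule defs nd_pr wd_weak2 | assumption | simp)+

lemma nd_len: "nd \<Gamma> s \<Longrightarrow> nd \<Gamma> (\<lambda>e. len (s e))"
  unfolding len_def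
  by (rule nd_bmin[where P = "\<lambda>n e. iter n (s e) = 0"]) (rule defs2 nd_iter nd_weak | assumption | simp)+

lemma df_ent: "nd \<Gamma> s \<Longrightarrow> df \<Gamma> T1 (\<lambda>e. ent (s e))"
  unfolding ent_def
  by (rule df_ln[where h = "\<lambda>i e. pr2 (iter (len (s e) - (i + 1)) (s e) - 1)"])
    (rule defs nd_iter nd_pr nd_len nd_weak | assumption | simp)+

lemma nd_dy: "df \<Gamma> T1 \<alpha> \<Longrightarrow> nd \<Gamma> n \<Longrightarrow> nd \<Gamma> (\<lambda>e. dy (\<alpha> e) (n e))"
  unfolding dy_def
  by (rule nd_prec[where h = "\<lambda>r i e. 2 * r + \<alpha> e \<odot> i"]) (rule defs nd_pr wd_weak2 | assumption | simp)+

lemma nd_fl: "nd \<Gamma> a \<Longrightarrow> nd \<Gamma> b \<Longrightarrow> nd \<Gamma> (\<lambda>e. fl (a e) (b e))"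
  unfolding fl_def
  by (rule nd_bmin[where P = "\<lambda>q e. a e < (q + 1) * b e"]) (rule defs nd_weak | assumption | simp)+

lemma df_dig: "nd \<Gamma> a \<Longrightarrow> nd \<Gamma> k \<Longrightarrow> df \<Gamma> T1 (\<lambda>e. dig (a e) (k e))"
  unfolding dig_def
  by (rule df_ln[where h = "\<lambda>i e. bn (i < k e \<and> fl (a e) (p2 (k e - (i + 1))) \<noteq> 2 * fl (a e) (p2 (k e - i)))"])
    (rule defs nd_fl nd_weak | assumption | simp)+

lemma df_bit: "df \<Gamma> T1 \<alpha> \<Longrightarrow> df \<Gamma> T1 (\<lambda>e. bit (\<alpha> e))"
  unfolding bit_def
  by (rule df_ln[where h = "\<lambda>i e. bn (\<alpha> e \<odot> i \<noteq> 0)"]) (rule defs wd_weak | assumption | simp)+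

lemma bd_out: "df \<Gamma> T1 T \<Longrightarrow> df \<Gamma> T1 \<alpha> \<Longrightarrow> nd \<Gamma> n \<Longrightarrow> bd \<Gamma> (\<lambda>e. out (T e) (\<alpha> e) (n e))"
  unfolding out_def
  by (rule bd_not, rule bd_allle[where P = "\<lambda>i e. T e \<odot> ini (\<alpha> e) i = 1"]) (rule defs nd_ini wd_weak nd_weak | assumption | simp)+

lemma bd_covd: "df \<Gamma> T1 T \<Longrightarrow> nd \<Gamma> k \<Longrightarrow> bd \<Gamma> (\<lambda>e. covd (T e) (k e))"
  unfolding covd_def
  by (rule bd_alll[where P = "\<lambda>a e. out (T e) (dig a (k e)) (k e)"])
    (rule defs bd_out df_dig wd_weak nd_weak | assumption | simp)+

lemmas defs3 = nd_pr nd_ini nd_iter nd_len df_ent nd_dy nd_fl df_dig df_bit bd_out bd_covd defs2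

end

context cx
begin

lemmas adefs3 = A.defs3 A.nd_const wd_con

lemma fd_lnD: "fd f \<Longrightarrow> ln f \<in> D T1" "fd f \<Longrightarrow> ln f \<odot> n = f n"
  using fd_obj by auto

lemma obj_D [simp]: "\<alpha> \<in> D T1 \<Longrightarrow> bit \<alpha> \<in> D T1" "ent s \<in> D T1" "dig a k \<in> D T1"
  using wd_D[OF A.df_bit[of "[]" "\<lambda>e. \<alpha>"], of undefined] wd_D[OF A.df_ent[of "[]" "\<lambda>e. s"], of undefined]
    wd_D[OF A.df_dig[of "[]" "\<lambda>e. a" "\<lambda>e. k"], of undefined] by (simp_all add: wd_con A.nd_const)

lemma ini_eqs: "\<alpha> \<in> D T1 \<Longrightarrow> ini \<alpha> 0 = 0" "\<alpha> \<in> D T1 \<Longrightarrow> ini \<alpha> (n + 1) = pr (ini \<alpha> n) (\<alpha> \<odot> n) + 1"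
  unfolding ini_def by (rule prec_eqs0, (rule adefs3 | simp)+)+

lemma iter_eqs: "iter 0 s = s" "iter (n + 1) s = pr1 (iter n s - 1)"
  unfolding iter_def by (rule prec_eqs0, (rule adefs3 | simp)+)+

lemma dy_eqs: "\<alpha> \<in> D T1 \<Longrightarrow> dy \<alpha> 0 = 0" "\<alpha> \<in> D T1 \<Longrightarrow> dy \<alpha> (n + 1) = 2 * dy \<alpha> n + \<alpha> \<odot> n"
  unfolding dy_def by (rule prec_eqs0, (rule adefs3 | simp)+)+

lemma bit_app [simp]: "\<alpha> \<in> D T1 \<Longrightarrow> bit \<alpha> \<odot> i = bn (\<alpha> \<odot> i \<noteq> 0)"
  unfolding bit_def by (rule fd_lnD) (rule pd_D, (rule adefs3 | simp)+)

lemma ent_app: "ent s \<odot> i = pr2 (iter (len s - (i + 1)) s - 1)"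
  unfolding ent_def by (rule fd_lnD) (rule pd_D, (rule adefs3 | simp)+)

lemma dig_app: "dig a k \<odot> i = bn (i < k \<and> fl a (p2 (k - (i + 1))) \<noteq> 2 * fl a (p2 (k - i)))"
  unfolding dig_def by (rule fd_lnD) (rule pd_D, (rule adefs3 | simp)+)

lemma ini_cong:
  assumes "\<alpha> \<in> D T1" "\<beta> \<in> D T1" "\<And>i. i < n \<Longrightarrow> \<alpha> \<odot> i = \<beta> \<odot> i"
  shows "ini \<alpha> n = ini \<beta> n"
proof -
  have "m \<le> n \<longrightarrow> ini \<alpha> m = ini \<beta> m" for m
  proof (rule nn_ind[of _ m])
    show "pd (\<lambda>m. m \<le> n \<longrightarrow> ini \<alpha> m = ini \<beta> m)" by (rule pd_D) (rule adefs3 assms | simp)+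
    show "m + 1 \<le> n \<longrightarrow> ini \<alpha> (m + 1) = ini \<beta> (m + 1)" if "m \<le> n \<longrightarrow> ini \<alpha> m = ini \<beta> m" for m
      using that assms nn_less_iff[of m n] by (auto simp: ini_eqs)
  qed (simp add: ini_eqs assms)
  then show ?thesis by blast
qed

lemma dy_cong:
  assumes "\<alpha> \<in> D T1" "\<beta> \<in> D T1" "\<And>i. i < n \<Longrightarrow> \<alpha> \<odot> i = \<beta> \<odot> i"
  shows "dy \<alpha> n = dy \<beta> n"
proof -
  have "m \<le> n \<longrightarrow> dy \<alpha> m = dy \<beta> m" for m
  proof (rule nn_ind[of _ m])
    show "pd (\<lambda>m. m \<le> n \<longrightarrow> dy \<alpha> m = dy \<beta> m)" by (rule pd_D) (rule adefs3 assms | simp)+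
    show "m + 1 \<le> n \<longrightarrow> dy \<alpha> (m + 1) = dy \<beta> (m + 1)" if "m \<le> n \<longrightarrow> dy \<alpha> m = dy \<beta> m" for m
      using that assms nn_less_iff[of m n] by (auto simp: dy_eqs)
  qed (simp add: dy_eqs assms)
  then show ?thesis by blast
qed

lemma iter_ini:
  assumes a: "\<alpha> \<in> D T1"
  shows "n \<le> m \<longrightarrow> iter n (ini \<alpha> m) = ini \<alpha> (m - n)"
proof (rule nn_ind[of _ n])
  show "pd (\<lambda>n. n \<le> m \<longrightarrow> iter n (ini \<alpha> m) = ini \<alpha> (m - n))" by (rule pd_D) (rule adefs3 assms | simp)+
  fix n assume IH: "n \<le> m \<longrightarrow> iter n (ini \<alpha> m) = ini \<alpha> (m - n)"
  show "n + 1 \<le> m \<longrightarrow> iter (n + 1) (ini \<alpha> m) = ini \<alpha> (m - (n + 1))"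
  proof
    assume "n + 1 \<le> m"
    then obtain d where m: "m = n + 1 + d" unfolding less_eq_nn_def by blast
    have "m - n = d + 1" "m - (n + 1) = d" using m by (simp_all add: add.assoc add.commute[of 1])
    then show "iter (n + 1) (ini \<alpha> m) = ini \<alpha> (m - (n + 1))"
      using IH m a by (simp add: iter_eqs ini_eqs add.assoc)
  qed
qed (simp add: iter_eqs)

lemma ini_ge: "\<alpha> \<in> D T1 \<Longrightarrow> n \<le> ini \<alpha> n"
proof (rule nn_ind[of _ n])
  assume a: "\<alpha> \<in> D T1"
  show "pd (\<lambda>n. n \<le> ini \<alpha> n)" by (rule pd_D) (rule adefs3 a | simp)+
  show "n + 1 \<le> ini \<alpha> (n + 1)" if "n \<le> ini \<alpha> n" for n
    using that a pr_ge(1)[of "ini \<alpha> n" "\<alpha> \<odot> n"] by (auto simp: ini_eqs)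
qed simp

lemma ini_0_iff: "\<alpha> \<in> D T1 \<Longrightarrow> ini \<alpha> n = 0 \<longleftrightarrow> n = 0"
  using ini_ge[of \<alpha> n] by (auto simp: ini_eqs)

lemma len_ini: "\<alpha> \<in> D T1 \<Longrightarrow> len (ini \<alpha> m) = m"
proof -
  assume a: "\<alpha> \<in> D T1"
  have P: "pd (\<lambda>n. iter n (ini \<alpha> m) = 0)" by (rule pd_D) (rule adefs3 a | simp)+
  have "iter m (ini \<alpha> m) = 0" using iter_ini[OF a, of m m] a by (simp add: ini_eqs)
  then have 1: "len (ini \<alpha> m) \<le> m" unfolding len_def by (rule bmin_le[OF P])
  have "len (ini \<alpha> m) = m \<or> iter (len (ini \<alpha> m)) (ini \<alpha> m) = 0"
    using bmin(3)[OF P, of "ini \<alpha> m"] bmin(1)[OF P, of "ini \<alpha> m"] 1 ini_ge[OF a, of m]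
    unfolding len_def by (meson antisym le_less_trans not_le order_trans)
  then have "len (ini \<alpha> m) = m \<or> m - len (ini \<alpha> m) = 0" using iter_ini[OF a, of _ m] 1 ini_0_iff[OF a] by auto
  then show ?thesis using 1 by auto
qed

lemma ent_ini: "\<alpha> \<in> D T1 \<Longrightarrow> i < m \<Longrightarrow> ent (ini \<alpha> m) \<odot> i = \<alpha> \<odot> i"
proof -
  assume a: "\<alpha> \<in> D T1" and "i < m"
  then obtain d where m: "m = i + 1 + d" unfolding nn_less_iff less_eq_nn_def by blast
  have "m - (i + 1) = d" "d \<le> m" "m - d = i + 1" using m by (simp_all add: add.commute[of _ d])
  then show ?thesis using iter_ini[OF a, of d m] a by (simp add: ent_app len_ini ini_eqs)
qed

lemma ini_ent_ini: "\<alpha> \<in> D T1 \<Longrightarrow> n \<le> m \<Longrightarrow> ini (ent (ini \<alpha> m)) n = ini \<alpha> n"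
  by (rule ini_cong) (auto intro!: ent_ini elim: less_le_trans)

lemma fl: "0 < d \<Longrightarrow> fl a d * d \<le> a \<and> a < (fl a d + 1) * d"
proof -
  assume d: "0 < d"
  have P: "pd (\<lambda>q. a < (q + 1) * d)" by (rule pd_D) (rule adefs3 | simp)+
  have 1: "1 \<le> d" using d nn_less_iff[of 0 d] by simp
  have "a < (a + 1) * d" using mult_left_mono[OF 1, of "a + 1"] nn_less_iff[of a "(a + 1) * d"] by simp
  then have 2: "a < (fl a d + 1) * d" using bmin(1,3)[OF P, of a] unfolding fl_def by (auto simp: le_less)
  have "fl a d * d \<le> a"
  proof (cases "fl a d = 0")
    case False
    then obtain b where b: "fl a d = b + 1" using nn_cases by blast
    then have "\<not> a < (b + 1) * d" using bmin(2)[OF P, of b a] unfolding fl_def by simp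
    then show ?thesis using b by (simp add: not_less)
  qed simp
  with 2 show ?thesis by blast
qed

lemma fl_unique: "q * d \<le> a \<Longrightarrow> a < (q + 1) * d \<Longrightarrow> fl a d = q"
proof -
  assume q: "q * d \<le> a" "a < (q + 1) * d"
  then have d: "0 < d" by (metis mult_zero_right neq_iff nn_not_less_0)
  have *: "x \<le> y" if "x * d \<le> a" "a < (y + 1) * d" for x y
  proof (rule ccontr)
    assume "\<not> x \<le> y"
    then have "y + 1 \<le> x" by (simp add: nn_less_iff[symmetric] not_le)
    then have "(y + 1) * d \<le> x * d" by (rule mult_right_mono) simp
    then show False using that by (meson le_less_trans not_le order_trans)
  qed
  show ?thesis using *[of q "fl a d"] *[of "fl a d" q] q fl[OF d, of a] by (auto intro: antisym)
qed

abbreviation bin :: "tm \<Rightarrow> bool" where "bin \<alpha> \<equiv> \<alpha> \<in> D T1 \<and> (\<forall>i. \<alpha> \<odot> i \<le> 1)"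

lemma bin_bit [simp]: "\<alpha> \<in> D T1 \<Longrightarrow> bin (bit \<alpha>)"
  by simp

lemma bin_dig [simp]: "bin (dig a k)"
  by (simp add: dig_app)

text \<open>The nesting of dyadic intervals, in terms of numerators: \<open>j\<close> further digits
  choose one of \<open>p2 j\<close> subintervals.\<close>

lemma dy_shift:
  assumes a: "bin \<alpha>"
  shows "dy \<alpha> i * p2 j \<le> dy \<alpha> (i + j) \<and> dy \<alpha> (i + j) < (dy \<alpha> i + 1) * p2 j"
proof (rule nn_ind[of _ j])
  note aD = a[THEN conjunct1]
  show "pd (\<lambda>j. dy \<alpha> i * p2 j \<le> dy \<alpha> (i + j) \<and> dy \<alpha> (i + j) < (dy \<alpha> i + 1) * p2 j)"
    by (rule pd_D) (rule adefs3 aD | simp)+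
  fix j assume IH: "dy \<alpha> i * p2 j \<le> dy \<alpha> (i + j) \<and> dy \<alpha> (i + j) < (dy \<alpha> i + 1) * p2 j"
  have "qn (\<alpha> \<odot> (i + j)) \<le> 1" using a qn_simps(5)[of _ 1] by simp
  moreover have "qn (dy \<alpha> (i + j)) + 1 \<le> (qn (dy \<alpha> i) + 1) * qn (p2 j)" using qn_less_step[OF conjunct2[OF IH]] by simp
  ultimately show "dy \<alpha> i * p2 (j + 1) \<le> dy \<alpha> (i + (j + 1)) \<and> dy \<alpha> (i + (j + 1)) < (dy \<alpha> i + 1) * p2 (j + 1)"
    using conjunct1[OF IH] qn_ge_0[of "\<alpha> \<odot> (i + j)"] unfolding add.assoc[symmetric] dy_eqs(2)[OF aD] p2_s to_qn
    by (intro conjI; simp add: algebra_simps del: qn_simps(5) qn_less qn_ge_0)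
qed simp

lemma dy_less: "bin \<alpha> \<Longrightarrow> dy \<alpha> k < p2 k"
  using dy_shift[of \<alpha> 0 k] by (simp add: dy_eqs)

lemma fl_dy: "bin \<alpha> \<Longrightarrow> fl (dy \<alpha> (i + j)) (p2 j) = dy \<alpha> i"
  using dy_shift[of \<alpha> i j] fl_unique by blast

lemma dig_dy:
  assumes a: "bin \<alpha>" and i: "i < k"
  shows "dig (dy \<alpha> k) k \<odot> i = \<alpha> \<odot> i"
proof -
  obtain d where k: "k = i + 1 + d" using i unfolding nn_less_iff less_eq_nn_def by blast
  have 1: "k - (i + 1) = d" using k by simp
  have "k = i + (d + 1)" using k by (simp add: ac_simps)
  then have 2: "k - i = d + 1" by simp
  have f: "fl (dy \<alpha> k) (p2 (k - (i + 1))) = 2 * dy \<alpha> i + \<alpha> \<odot> i" "fl (dy \<alpha> k) (p2 (k - i)) = dy \<alpha> i"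
    unfolding 1 2 using fl_dy[OF a, of "i + 1" d] fl_dy[OF a, of i "d + 1"] a
    unfolding k[symmetric] \<open>k = i + (d + 1)\<close>[symmetric] by (simp_all add: dy_eqs)
  have "\<alpha> \<odot> i = 0 \<or> \<alpha> \<odot> i = 1" using a nn_less_1[of "\<alpha> \<odot> i"] by (auto simp: le_less)
  then show ?thesis using i unfolding dig_app f by auto
qed

lemma fl_half: "0 < d \<Longrightarrow> fl a d = 2 * fl a (2 * d) \<or> fl a d = 2 * fl a (2 * d) + 1"
proof -
  assume d: "0 < d"
  have *: "fl a (2 * d) * (2 * d) \<le> a" "a < (fl a (2 * d) + 1) * (2 * d)" using fl[of "2 * d" a] d by auto
  show ?thesis
  proof (cases "a < (2 * fl a (2 * d) + 1) * d")
    case True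
    then show ?thesis using fl_unique[of "2 * fl a (2 * d)" d a] * by (simp add: ac_simps)
  next
    case False
    then have "fl a d = 2 * fl a (2 * d) + 1" using *
      by (intro fl_unique) (simp_all only: not_less to_qn, simp_all add: algebra_simps del: qn_simps(5) qn_less)
    then show ?thesis by blast
  qed
qed

text \<open>With \<open>dig_dy\<close> this gives the bijection between numbers below
  \<open>p2 k\<close> and binary sequences of length \<open>k\<close>. The induction reads the
  digits from the leading one, the partial values being floors of \<open>a\<close>.\<close>

lemma dy_dig:
  assumes a: "a < p2 k"
  shows "dy (dig a k) k = a"
proof -
  have "i \<le> k \<longrightarrow> dy (dig a k) i = fl a (p2 (k - i))" for i
  proof (rule nn_ind[of _ i])
    show "pd (\<lambda>i. i \<le> k \<longrightarrow> dy (dig a k) i = fl a (p2 (k - i)))" by (rule pd_D) (rule adefs3 | simp)+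
    show "0 \<le> k \<longrightarrow> dy (dig a k) 0 = fl a (p2 (k - 0))" using a fl_unique[of 0 "p2 k" a] by (simp add: dy_eqs)
    fix i assume IH: "i \<le> k \<longrightarrow> dy (dig a k) i = fl a (p2 (k - i))"
    show "i + 1 \<le> k \<longrightarrow> dy (dig a k) (i + 1) = fl a (p2 (k - (i + 1)))"
    proof
      assume ik: "i + 1 \<le> k"
      then obtain d where k: "k = i + 1 + d" unfolding less_eq_nn_def by blast
      have 1: "k - (i + 1) = d" using k by simp
      have "k = i + (d + 1)" using k by (simp add: ac_simps)
      then have 2: "k - i = d + 1" by simp
      have "dy (dig a k) i = fl a (2 * p2 d)" using IH ik 2 by (simp add: nn_less_iff[symmetric] p2_s)
      moreover have "dig a k \<odot> i = bn (fl a (p2 d) \<noteq> 2 * fl a (2 * p2 d))"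
        using ik unfolding dig_app 1 2 p2_s by (simp add: nn_less_iff)
      ultimately show "dy (dig a k) (i + 1) = fl a (p2 (k - (i + 1)))"
        using fl_half[of "p2 d" a] unfolding 1 by (auto simp: dy_eqs)
    qed
  qed
  then show ?thesis using fl_unique[of a 1 a] by simp
qed

lemma out_cong:
  assumes "\<alpha> \<in> D T1" "\<beta> \<in> D T1" "\<And>i. i < n \<Longrightarrow> \<alpha> \<odot> i = \<beta> \<odot> i"
  shows "out T \<alpha> n = out T \<beta> n"
proof -
  have "ini \<alpha> i = ini \<beta> i" if "i \<le> n" for i
    by (rule ini_cong) (use assms that in auto)
  then show ?thesis unfolding out_def by simp
qed

lemma out_mono: "out T \<alpha> n \<Longrightarrow> n \<le> m \<Longrightarrow> out T \<alpha> m"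
  unfolding out_def by (meson order_trans)

text \<open>Up to \<open>k\<close> every binary sequence agrees with the digits of its own numerator
  \<open>dy \<alpha> k\<close>; this includes nonstandard sequences.\<close>

lemma covdD: "covd T k \<Longrightarrow> bin \<alpha> \<Longrightarrow> out T \<alpha> k"
  using out_cong[of "dig (dy \<alpha> k) k" \<alpha> k T] dig_dy[of \<alpha> _ k] dy_less[of \<alpha> k] unfolding covd_def by auto

end

section \<open>Worlds and the fan theorem\<close>

text \<open>A world is a class of objects closed under application, whose numbers form an initial segment:
  below, either all objects of the model or the standard ones.\<close>
locale wrld = wcx +
  assumes W_le: "W Nat (rv n) \<Longrightarrow> m \<le> n \<Longrightarrow> W Nat (rv m)"
begin

abbreviation S :: "nn \<Rightarrow> bool" where "S n \<equiv> W Nat (rv n)"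

lemma S_nd: "nd [] (\<lambda>e. n) \<Longrightarrow> S n"
  unfolding nd_def by (drule df_W0) simp

lemma W_nd: "df [] \<sigma> (\<lambda>e. u) \<Longrightarrow> W \<sigma> u"
  by (drule df_W0) simp

lemmas wdefs = defs3 nd_const wd_con df_rv

lemma S_fa: "\<alpha> \<in> D T1 \<Longrightarrow> W T1 \<alpha> \<Longrightarrow> S n \<Longrightarrow> S (\<alpha> \<odot> n)"
  by (rule S_nd) (rule wdefs | assumption)+

definition FANw :: bool where
  "FANw \<longleftrightarrow> (\<forall>T\<in>D T1. W T1 T \<longrightarrow> (\<forall>n. S n \<longrightarrow> T \<odot> n \<le> 1) \<longrightarrow>
     (\<forall>s a. S s \<longrightarrow> S a \<longrightarrow> T \<odot> (pr s a + 1) = 1 \<longrightarrow> T \<odot> s = 1 \<and> a \<le> 1) \<longrightarrow>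
     (\<forall>\<alpha>\<in>D T1. W T1 \<alpha> \<longrightarrow> (\<forall>n. S n \<longrightarrow> \<alpha> \<odot> n \<le> 1) \<longrightarrow> (\<exists>n. S n \<and> T \<odot> ini \<alpha> n \<noteq> 1)) \<longrightarrow>
     (\<exists>k. S k \<and> (\<forall>\<alpha>\<in>D T1. W T1 \<alpha> \<longrightarrow> (\<forall>n. S n \<longrightarrow> \<alpha> \<odot> n \<le> 1) \<longrightarrow> (\<exists>n\<le>k. T \<odot> ini \<alpha> n \<noteq> 1))))"

text \<open>The working form: sequences are made binary by \<open>bit\<close>, and the conclusion is
  the decidable \<open>covd\<close>. In the standard world this conclusion says more than the
  literal one, which speaks about standard sequences only.\<close>

definition FANp :: bool where
  "FANp \<longleftrightarrow> (\<forall>T\<in>D T1. W T1 T \<longrightarrow> (\<forall>\<alpha>\<in>D T1. W T1 \<alpha> \<longrightarrow> (\<exists>n. S n \<and> out T (bit \<alpha>) n)) \<longrightarrow>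
     (\<exists>k. S k \<and> covd T k))"

text \<open>In the standard world a sequence is assumed to be binary at standard arguments only.
  \<open>bit\<close> may alter it beyond them, but not below a standard length.\<close>

lemma bit_S: "\<alpha> \<in> D T1 \<Longrightarrow> (\<forall>n. S n \<longrightarrow> \<alpha> \<odot> n \<le> 1) \<Longrightarrow> S n \<Longrightarrow> i \<le> n \<Longrightarrow> bit \<alpha> \<odot> i = \<alpha> \<odot> i"
  using W_le[of n i] nn_less_1[of "\<alpha> \<odot> i"] by (auto simp: bn_def le_less)

lemma ini_bit: "\<alpha> \<in> D T1 \<Longrightarrow> (\<forall>n. S n \<longrightarrow> \<alpha> \<odot> n \<le> 1) \<Longrightarrow> S n \<Longrightarrow> i \<le> n \<Longrightarrow> ini (bit \<alpha>) i = ini \<alpha> i"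
  by (rule ini_cong) (auto intro!: bit_S simp del: bit_app)

lemma FANp_FANw: "FANp \<Longrightarrow> FANw"
  unfolding FANw_def
proof (intro ballI impI)
  fix T assume F: FANp and T: "T \<in> D T1" "W T1 T"
    and bar: "\<forall>\<alpha>\<in>D T1. W T1 \<alpha> \<longrightarrow> (\<forall>n. S n \<longrightarrow> \<alpha> \<odot> n \<le> 1) \<longrightarrow> (\<exists>n. S n \<and> T \<odot> ini \<alpha> n \<noteq> 1)"
  have "\<exists>n. S n \<and> out T (bit \<alpha>) n" if \<alpha>: "\<alpha> \<in> D T1" "W T1 \<alpha>" for \<alpha>
  proof -
    have "W T1 (bit \<alpha>)" by (rule W_nd) (rule wdefs \<alpha>)+
    then obtain n where "S n" "T \<odot> ini (bit \<alpha>) n \<noteq> 1" using bar bin_bit[OF \<alpha>(1)] by blast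
    then show ?thesis unfolding out_def by blast
  qed
  then obtain k where k: "S k" "covd T k" using F T unfolding FANp_def by blast
  have "\<exists>n\<le>k. T \<odot> ini \<alpha> n \<noteq> 1" if \<alpha>: "\<alpha> \<in> D T1" "\<forall>n. S n \<longrightarrow> \<alpha> \<odot> n \<le> 1" for \<alpha>
    using covdD[OF k(2) bin_bit[OF \<alpha>(1)]] ini_bit[OF \<alpha> k(1)] unfolding out_def by auto
  then show "\<exists>k. S k \<and> (\<forall>\<alpha>\<in>D T1. W T1 \<alpha> \<longrightarrow> (\<forall>n. S n \<longrightarrow> \<alpha> \<odot> n \<le> 1) \<longrightarrow> (\<exists>n\<le>k. T \<odot> ini \<alpha> n \<noteq> 1))"
    using k(1) by blast
qed

end

context cx
begin

text \<open>The largest binary tree all of whose nodes have their initial segments in \<open>T\<close>.\<close>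
definition tcl :: "tm \<Rightarrow> tm" where
  "tcl T = ln (\<lambda>s. bn (s = ini (ent s) (len s) \<and> (\<forall>i<len s. ent s \<odot> i \<le> 1) \<and>
     (\<forall>i\<le>len s. T \<odot> ini (ent s) i = 1)))"

lemma tcl_app: "T \<in> D T1 \<Longrightarrow> tcl T \<odot> s = bn (s = ini (ent s) (len s) \<and> (\<forall>i<len s. ent s \<odot> i \<le> 1) \<and>
     (\<forall>i\<le>len s. T \<odot> ini (ent s) i = 1))"
  unfolding tcl_def by (rule fd_lnD) (rule pd_D, (rule adefs3 | simp)+)

lemma tcl_ini: "T \<in> D T1 \<Longrightarrow> \<alpha> \<in> D T1 \<Longrightarrow> tcl T \<odot> ini \<alpha> n = bn ((\<forall>i<n. \<alpha> \<odot> i \<le> 1) \<and> \<not> out T \<alpha> n)"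
  unfolding tcl_app out_def by (auto simp: len_ini ini_ent_ini ent_ini bn_def)

lemma tcl_tree:
  assumes T: "T \<in> D T1" and s: "tcl T \<odot> (pr s a + 1) = 1"
  shows "tcl T \<odot> s = 1 \<and> a \<le> 1"
proof -
  define \<beta> where "\<beta> = ent (pr s a + 1)"
  define n where "n = len (pr s a + 1)"
  have *: "pr s a + 1 = ini \<beta> n" "\<forall>i<n. \<beta> \<odot> i \<le> 1" "\<forall>i\<le>n. T \<odot> ini \<beta> i = 1"
    using s unfolding tcl_app[OF T] \<beta>_def n_def by auto
  have \<beta>: "\<beta> \<in> D T1" by (simp add: \<beta>_def)
  have "n \<noteq> 0" using *(1) \<beta> by (auto simp: ini_eqs)
  then obtain m where m: "n = m + 1" using nn_cases by blast
  have "pr s a = pr (ini \<beta> m) (\<beta> \<odot> m)" using *(1) \<beta> by (simp add: m ini_eqs)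
  then have "s = ini \<beta> m" "a = \<beta> \<odot> m" by (metis pr_proj)+
  then show ?thesis using * \<beta> by (simp add: tcl_ini[OF T] out_def m nn_le_step less_imp_le)
qed

end

context wrld
begin

lemma df_tcl: "df \<Gamma> T1 T \<Longrightarrow> df \<Gamma> T1 (\<lambda>e. tcl (T e))"
  unfolding tcl_def
  by (rule df_ln[where h = "\<lambda>s e. bn (s = ini (ent s) (len s) \<and> (\<forall>i<len s. ent s \<odot> i \<le> 1) \<and>
     (\<forall>i\<le>len s. T e \<odot> ini (ent s) i = 1))"]) (rule defs3 wd_weak nd_weak | assumption | simp)+

lemma FANw_FANp: "FANw \<Longrightarrow> FANp"
  unfolding FANp_def
proof (intro ballI impI)
  fix T assume F: FANw and T: "T \<in> D T1" "W T1 T"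
    and bar: "\<forall>\<alpha>\<in>D T1. W T1 \<alpha> \<longrightarrow> (\<exists>n. S n \<and> out T (bit \<alpha>) n)"
  have "df [] T1 (\<lambda>e. tcl T)" by (rule df_tcl wdefs T)+
  from df_W0[OF this] have t: "W T1 (tcl T)" "tcl T \<in> D T1" by auto
  have "\<exists>n. S n \<and> tcl T \<odot> ini \<alpha> n \<noteq> 1" if \<alpha>: "\<alpha> \<in> D T1" "W T1 \<alpha>" "\<forall>n. S n \<longrightarrow> \<alpha> \<odot> n \<le> 1" for \<alpha>
  proof -
    obtain n where n: "S n" "out T (bit \<alpha>) n" using bar \<alpha> by blast
    then have "out T \<alpha> n" using out_cong[of "bit \<alpha>" \<alpha> n T] bit_S[OF \<alpha>(1,3) n(1)] \<alpha>(1) by (auto simp del: bit_app)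
    then show ?thesis using n(1) by (auto simp: tcl_ini[OF T(1) \<alpha>(1)])
  qed
  then have C: "\<forall>\<alpha>\<in>D T1. W T1 \<alpha> \<longrightarrow> (\<forall>n. S n \<longrightarrow> \<alpha> \<odot> n \<le> 1) \<longrightarrow> (\<exists>n. S n \<and> tcl T \<odot> ini \<alpha> n \<noteq> 1)" by simp
  have A: "\<forall>n. S n \<longrightarrow> tcl T \<odot> n \<le> 1" by (simp add: tcl_app[OF T(1)])
  have B: "\<forall>s a. S s \<longrightarrow> S a \<longrightarrow> tcl T \<odot> (pr s a + 1) = 1 \<longrightarrow> tcl T \<odot> s = 1 \<and> a \<le> 1"
    by (intro allI impI, rule tcl_tree[OF T(1)])
  obtain k where k: "S k" "\<forall>\<alpha>\<in>D T1. W T1 \<alpha> \<longrightarrow> (\<forall>n. S n \<longrightarrow> \<alpha> \<odot> n \<le> 1) \<longrightarrow> (\<exists>n\<le>k. tcl T \<odot> ini \<alpha> n \<noteq> 1)"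
    using F[unfolded FANw_def, THEN bspec, OF t(2), THEN mp, OF t(1), THEN mp, OF A, THEN mp, OF B, THEN mp, OF C]
    by (elim exE conjE)
  \<comment> \<open>Here it matters that numbers below a standard number are standard: all
    \<open>a\<close> below \<open>p2 k\<close>, and with them all digit sequences of length
    \<open>k\<close>, belong to the world, so the bound for sequences in the world applies to each
    of them.\<close>
  have "out T (dig a k) k" if "a < p2 k" for a
  proof -
    have "S (p2 k)" by (rule S_nd) (rule wdefs k)+
    then have a: "S a" using W_le that by (auto simp: less_imp_le)
    have "W T1 (dig a k)" by (rule W_nd) (rule wdefs a k)+
    then obtain n where "n \<le> k" "tcl T \<odot> ini (dig a k) n \<noteq> 1" using k(2) bin_dig[of a k] by blast
    then show ?thesis using out_mono[of T "dig a k" n k] bin_dig[of a k]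
      by (simp add: tcl_ini[OF T(1)])
  qed
  then show "\<exists>k. S k \<and> covd T k" using k(1) unfolding covd_def by blast
qed

lemma FANw_iff: "FANw \<longleftrightarrow> FANp"
  using FANp_FANw FANw_FANp by blast

end

context cx
begin

lemma St_wrld: "wrld Std"
proof unfold_locales
  show "Cl \<sigma> u \<Longrightarrow> Std \<sigma> u" for \<sigma> u using std_closed by (auto simp: Cl_def cval_def)
  show "f \<in> D (\<sigma> \<rightarrow>\<^sub>t \<tau>) \<Longrightarrow> x \<in> D \<sigma> \<Longrightarrow> Std (\<sigma> \<rightarrow>\<^sub>t \<tau>) f \<Longrightarrow> Std \<sigma> x \<Longrightarrow> Std \<tau> (f \<bullet> x)" for f x \<sigma> \<tau>
    by (rule std_ap)
  show "Std Nat (rv m)" if "Std Nat (rv n)" "m \<le> n" for m n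
  proof (rule std_le[OF rv_D rv_D that(1)])
    have "mn (rv m) (rv n) = zr" using that(2) by (simp flip: rv_ops)
    then show "evl M0 (\<lambda>_. undefined) monusT \<bullet> rv m \<bullet> rv n = zr" by (simp add: mn_def cval_def)
  qed
qed

lemma All_wrld: "wrld (\<lambda>_ _. True)"
  by unfold_locales auto

end

section \<open>Rational and real numbers\<close>

lemma qq_frac_add: "0 < d \<Longrightarrow> 0 < d' \<Longrightarrow> a / d + b / d' = (a * d' + b * d) / (d * (d'::qq))"
  by (simp add: field_simps)

lemma qq_frac_le: "0 < d \<Longrightarrow> 0 < d' \<Longrightarrow> a / d \<le> b / d' \<longleftrightarrow> a * d' \<le> b * (d::qq)"
  by (simp add: field_simps)

context cx
begin

definition val :: "nn \<Rightarrow> qq" where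
  "val u = (qn (pr1 (pr1 u)) - qn (pr2 (pr1 u))) / (qn (pr2 u) + 1)"

definition eps :: "nn \<Rightarrow> qq" where "eps n = 1 / qn (p2 n)"

definition mk :: "nn \<Rightarrow> nn \<Rightarrow> nn \<Rightarrow> nn" where "mk p q d = pr (pr p q) (d - 1)"

lemma val_mk: "0 < d \<Longrightarrow> val (mk p q d) = (qn p - qn q) / qn d"
proof -
  assume "0 < d"
  then have "1 \<le> d" using nn_less_iff[of 0 d] by simp
  then show ?thesis by (simp add: val_def mk_def qn_diff)
qed

abbreviation nm :: "nn \<Rightarrow> nn" where "nm u \<equiv> pr1 (pr1 u)"
abbreviation ng :: "nn \<Rightarrow> nn" where "ng u \<equiv> pr2 (pr1 u)"
abbreviation dn :: "nn \<Rightarrow> nn" where "dn u \<equiv> pr2 u + 1"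

lemma dn_pos [simp]: "0 < pr2 u + (1::nn)" "0 < qn (pr2 u) + 1"
  by (simp_all add: add_nonneg_pos)

lemma val_frac: "val u = (qn (nm u) - qn (ng u)) / qn (dn u)"
  by (simp add: val_def)

lemma val_add: "val u + val v = val (mk (nm u * dn v + nm v * dn u) (ng u * dn v + ng v * dn u) (dn u * dn v))"
proof -
  have "0 < dn u * dn v" by (rule mult_pos_pos) simp_all
  then show ?thesis unfolding val_mk[OF \<open>0 < dn u * dn v\<close>] val_frac[of u] val_frac[of v]
    by (subst qq_frac_add) (simp, simp, rule arg_cong2[where f = "(/)"], simp_all add: algebra_simps)
qed

lemma val_uminus: "- val u = val (mk (ng u) (nm u) (dn u))"
  unfolding val_mk[OF dn_pos(1)] unfolding val_frac by (simp add: minus_divide_left)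

lemma val_mult: "val u * val v = val (mk (nm u * nm v + ng u * ng v) (nm u * ng v + ng u * nm v) (dn u * dn v))"
proof -
  have "0 < dn u * dn v" by (rule mult_pos_pos) simp_all
  then show ?thesis unfolding val_mk[OF \<open>0 < dn u * dn v\<close>] val_frac[of u] val_frac[of v] by (simp add: algebra_simps)
qed

lemma val_le: "val u \<le> val v \<longleftrightarrow> nm u * dn v + ng v * dn u \<le> nm v * dn u + ng u * dn v"
proof -
  have "val u \<le> val v \<longleftrightarrow> (qn (nm u) - qn (ng u)) * qn (dn v) \<le> (qn (nm v) - qn (ng v)) * qn (dn u)"
    unfolding val_frac by (rule qq_frac_le) simp_all
  also have "\<dots> \<longleftrightarrow> qn (nm u * dn v + ng v * dn u) \<le> qn (nm v * dn u + ng u * dn v)"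
    by (simp add: algebra_simps del: qn_simps(5))
  finally show ?thesis unfolding qn_simps(5) .
qed

lemma val_qn: "qn n = val (mk n 0 1)" "eps n = val (mk 1 0 (p2 n))"
  by (simp_all add: val_mk eps_def)

lemma eps_pos [simp]: "0 < eps n" "0 \<le> eps n"
  using qn_less[of 0 "p2 n"] by (simp_all add: eps_def del: qn_less add: order_less_imp_le)

lemma eps_add: "eps (n + m) = eps n * eps m"
  by (simp add: eps_def p2_add)

lemma eps_0 [simp]: "eps 0 = 1"
  by (simp add: eps_def)

lemma eps_s: "eps (n + 1) = eps n / 2"
  by (simp add: eps_def p2_s)

lemma eps_mono: "n \<le> m \<Longrightarrow> eps m \<le> eps n"
proof -
  assume "n \<le> m"
  then obtain d where m: "m = n + d" unfolding less_eq_nn_def by blast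
  have "1 \<le> p2 d" using nn_less_iff[of 0 "p2 d"] by simp
  then have "eps d \<le> 1" using qn_simps(5)[of 1 "p2 d"] by (simp add: eps_def del: qn_simps(5))
  then show ?thesis unfolding m eps_add using mult_left_mono[of "eps d" 1 "eps n"] by simp
qed

text \<open>\<open>Q\<close> is the range of the number quantifiers, so that a sequence can be a
  real number in the standard sense whatever it does beyond the standard numbers.\<close>

definition isr :: "(nn \<Rightarrow> bool) \<Rightarrow> (nn \<Rightarrow> qq) \<Rightarrow> bool" where
  "isr Q X \<longleftrightarrow> (\<forall>n i. Q n \<longrightarrow> Q i \<longrightarrow> \<bar>X n - X (n + i)\<bar> < eps n)"
definition ls :: "(nn \<Rightarrow> bool) \<Rightarrow> (nn \<Rightarrow> qq) \<Rightarrow> (nn \<Rightarrow> qq) \<Rightarrow> bool" where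
  "ls Q X Y \<longleftrightarrow> (\<exists>n. Q n \<and> 2 * eps n < Y n - X n)"
definition un :: "(nn \<Rightarrow> bool) \<Rightarrow> (nn \<Rightarrow> qq) \<Rightarrow> bool" where
  "un Q X \<longleftrightarrow> isr Q X \<and> \<not> ls Q X (\<lambda>_. 0) \<and> \<not> ls Q (\<lambda>_. 1) X"
definition rl :: "tm \<Rightarrow> nn \<Rightarrow> qq" where "rl x m = val (x \<odot> m)"
definition lend :: "tm \<Rightarrow> nn \<Rightarrow> nn \<Rightarrow> qq" where "lend I n m = val (pr1 (I \<bullet> rv n \<odot> m))"
definition rend :: "tm \<Rightarrow> nn \<Rightarrow> nn \<Rightarrow> qq" where "rend I n m = val (pr2 (I \<bullet> rv n \<odot> m))"
definition inI :: "(nn \<Rightarrow> bool) \<Rightarrow> tm \<Rightarrow> tm \<Rightarrow> nn \<Rightarrow> bool" where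
  "inI Q x I n \<longleftrightarrow> ls Q (lend I n) (rl x) \<and> ls Q (rl x) (rend I n)"
text \<open>A decidable certificate for \<open>X\<close> being less than \<open>Y\<close>. The term
  \<open>2 * eps n\<close> pays for the drift of both sequences after stage \<open>n\<close>, and
  the surplus \<open>4 * eps m\<close> is what \<open>gap_far\<close> finds again at every stage
  from \<open>m\<close> on.\<close>

definition gap :: "(nn \<Rightarrow> qq) \<Rightarrow> (nn \<Rightarrow> qq) \<Rightarrow> nn \<Rightarrow> bool" where
  "gap X Y m \<longleftrightarrow> (\<exists>n\<le>m. 4 * eps m + 2 * eps n \<le> Y n - X n)"

lemma un_bounds: "un Q X \<Longrightarrow> Q n \<Longrightarrow> - 2 * eps n \<le> X n \<and> X n \<le> 1 + 2 * eps n"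
  unfolding un_def ls_def by (auto simp: not_less algebra_simps)

lemma ls_mono: "ls Q X Y \<Longrightarrow> (\<And>n. Q n \<Longrightarrow> Q' n) \<Longrightarrow> ls Q' X Y"
  unfolding ls_def by blast

lemma un_anti: "un Q X \<Longrightarrow> (\<And>n. Q' n \<Longrightarrow> Q n) \<Longrightarrow> un Q' X"
  unfolding un_def isr_def using ls_mono[of Q' _ _ Q] by blast

end

context wcx
begin

text \<open>Field operations are matched by operations on codes, and comparison by
  \<open>val_le\<close>; hence inequalities between rational expressions are decidable in the model,
  although the field lives outside it.\<close>

definition qd :: "ty list \<Rightarrow> ((nat \<Rightarrow> tm) \<Rightarrow> qq) \<Rightarrow> bool" where
  "qd \<Gamma> F \<longleftrightarrow> (\<exists>f. nd \<Gamma> f \<and> (\<forall>e. F e = val (f e)))"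

lemma nd_mk: "nd \<Gamma> p \<Longrightarrow> nd \<Gamma> q \<Longrightarrow> nd \<Gamma> d \<Longrightarrow> nd \<Gamma> (\<lambda>e. mk (p e) (q e) (d e))"
  unfolding mk_def by (rule defs3 | assumption)+

lemma qdI: "nd \<Gamma> f \<Longrightarrow> qd \<Gamma> (\<lambda>e. val (f e))"
  unfolding qd_def by blast

lemma qd_add: "qd \<Gamma> F \<Longrightarrow> qd \<Gamma> G \<Longrightarrow> qd \<Gamma> (\<lambda>e. F e + G e)"
  unfolding qd_def
  apply (elim exE conjE)
  subgoal for f g
    by (rule exI[of _ "\<lambda>e. mk (nm (f e) * dn (g e) + nm (g e) * dn (f e)) (ng (f e) * dn (g e) + ng (g e) * dn (f e)) (dn (f e) * dn (g e))"])
      (intro conjI nd_mk defs3; simp add: val_add)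
  done

lemma qd_uminus: "qd \<Gamma> F \<Longrightarrow> qd \<Gamma> (\<lambda>e. - F e)"
  unfolding qd_def
  apply (elim exE conjE)
  subgoal for f
    by (rule exI[of _ "\<lambda>e. mk (ng (f e)) (nm (f e)) (dn (f e))"]) (intro conjI nd_mk defs3; simp add: val_uminus)
  done

lemma qd_diff: "qd \<Gamma> F \<Longrightarrow> qd \<Gamma> G \<Longrightarrow> qd \<Gamma> (\<lambda>e. F e - G e)"
  using qd_add[OF _ qd_uminus, of \<Gamma> F G] by simp

lemma qd_mult: "qd \<Gamma> F \<Longrightarrow> qd \<Gamma> G \<Longrightarrow> qd \<Gamma> (\<lambda>e. F e * G e)"
  unfolding qd_def
  apply (elim exE conjE)
  subgoal for f g
    by (rule exI[of _ "\<lambda>e. mk (nm (f e) * nm (g e) + ng (f e) * ng (g e)) (nm (f e) * ng (g e) + ng (f e) * nm (g e)) (dn (f e) * dn (g e))"])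
      (intro conjI nd_mk defs3; simp add: val_mult)
  done

lemma qd_qn: "nd \<Gamma> f \<Longrightarrow> qd \<Gamma> (\<lambda>e. qn (f e))" "nd \<Gamma> f \<Longrightarrow> qd \<Gamma> (\<lambda>e. eps (f e))"
  unfolding val_qn by (rule qdI nd_mk defs3 | assumption)+

lemma qd_num: "qd \<Gamma> (\<lambda>e. 0)" "qd \<Gamma> (\<lambda>e. 1)" "qd \<Gamma> (\<lambda>e. numeral k)"
  using qd_qn(1)[OF nd_ops(1)] qd_qn(1)[OF nd_ops(2)] qd_qn(1)[OF nd_numeral] by simp_all

lemma bd_qle: "qd \<Gamma> F \<Longrightarrow> qd \<Gamma> G \<Longrightarrow> bd \<Gamma> (\<lambda>e. F e \<le> G e)"
  unfolding qd_def by (elim exE conjE) (simp only: val_le, intro defs3)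

lemma bd_qless: "qd \<Gamma> F \<Longrightarrow> qd \<Gamma> G \<Longrightarrow> bd \<Gamma> (\<lambda>e. F e < G e)"
  using bd_not[OF bd_qle, of \<Gamma> G F] by (simp add: not_le)

lemma bd_qabs: "qd \<Gamma> F \<Longrightarrow> qd \<Gamma> G \<Longrightarrow> bd \<Gamma> (\<lambda>e. \<bar>F e\<bar> < G e)"
  unfolding abs_less_iff by (rule bd_conj bd_qless qd_uminus | assumption)+

lemma nd_app2: "df \<Gamma> (Nat \<rightarrow>\<^sub>t T1) I \<Longrightarrow> nd \<Gamma> n \<Longrightarrow> nd \<Gamma> m \<Longrightarrow> nd \<Gamma> (\<lambda>e. I e \<bullet> rv (n e) \<odot> m e)"
  by (rule nd_fa, rule wd_ap, assumption, rule df_rv)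

lemma qd_real: "df \<Gamma> T1 x \<Longrightarrow> nd \<Gamma> m \<Longrightarrow> qd \<Gamma> (\<lambda>e. rl (x e) (m e))"
  "df \<Gamma> (Nat \<rightarrow>\<^sub>t T1) I \<Longrightarrow> nd \<Gamma> n \<Longrightarrow> nd \<Gamma> m \<Longrightarrow> qd \<Gamma> (\<lambda>e. lend (I e) (n e) (m e))"
  "df \<Gamma> (Nat \<rightarrow>\<^sub>t T1) I \<Longrightarrow> nd \<Gamma> n \<Longrightarrow> nd \<Gamma> m \<Longrightarrow> qd \<Gamma> (\<lambda>e. rend (I e) (n e) (m e))"
  unfolding rl_def lend_def rend_def by (rule qdI nd_app2 defs3 | assumption)+

lemma bd_gap:
  assumes "nd \<Gamma> m" "qd (Nat # \<Gamma>) (\<lambda>e. X (nv (e 0)) (\<lambda>n. e (Suc n)))" "qd (Nat # \<Gamma>) (\<lambda>e. Y (nv (e 0)) (\<lambda>n. e (Suc n)))"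
  shows "bd \<Gamma> (\<lambda>e. gap (\<lambda>n. X n e) (\<lambda>n. Y n e) (m e))"
  unfolding gap_def
  by (rule bd_exle[where P = "\<lambda>n e. 4 * eps (m e) + 2 * eps n \<le> Y n e - X n e"])
    (rule assms bd_qle qd_add qd_diff qd_mult qd_qn qd_num nd_weak nd_var | simp)+

lemmas qdefs = bd_qle bd_qless bd_qabs qd_num qd_real qd_qn qd_add qd_mult qd_diff qd_uminus qdI nd_app2 defs3

end

context wrld
begin

text \<open>The field need not be Archimedean over the standard numbers. A positive \<open>q\<close>
  with a code in the world, however, is at least the reciprocal of its denominator \<open>d\<close>,
  and \<open>d\<close> is in the world.\<close>

lemma arch: "qd [] (\<lambda>e. q) \<Longrightarrow> 0 < q \<Longrightarrow> \<exists>m. S m \<and> 4 * eps m \<le> q"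
proof -
  assume q: "qd [] (\<lambda>e. q)" "0 < q"
  then obtain f where f: "nd [] f" "\<And>e. q = val (f e)" unfolding qd_def by blast
  define u where "u = f undefined"
  have u: "S u" unfolding u_def using df_W[OF f(1)[unfolded nd_def], of undefined] by simp
  define d where "d = dn u"
  have "S (d + 2)" unfolding d_def by (rule S_nd) (rule wdefs u)+
  moreover have "4 * eps (d + 2) \<le> q"
  proof -
    have q': "q = (qn (nm u) - qn (ng u)) / qn d" unfolding f(2)[of undefined] u_def[symmetric] d_def by (rule val_frac)
    have d: "0 < qn d" unfolding d_def by simp
    then have "qn (ng u) < qn (nm u)" using q(2) unfolding q' by (simp add: zero_less_divide_iff)
    then have "qn (ng u) + 1 \<le> qn (nm u)" by (simp add: qn_less_step)
    then have "1 / qn d \<le> q" unfolding q' using d by (intro divide_right_mono) auto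
    moreover have "qn d \<le> qn (p2 d)" using p2_ge[of d] unfolding to_qn by linarith
    then have "eps d \<le> 1 / qn d" unfolding eps_def using d by (intro frac_le) simp_all
    moreover have "4 * eps (d + 2) = eps d" using eps_s[of "d + 1"] eps_s[of d] by (simp add: add.assoc)
    ultimately show ?thesis by simp
  qed
  ultimately show ?thesis by blast
qed

lemma isr_le: "isr S X \<Longrightarrow> S M \<Longrightarrow> m \<le> M \<Longrightarrow> \<bar>X m - X M\<bar> < eps m"
proof -
  assume X: "isr S X" and M: "S M" "m \<le> M"
  then obtain i where i: "M = m + i" unfolding less_eq_nn_def by blast
  then have "S m" "S i" using W_le[OF M(1)] by auto
  then show ?thesis using X unfolding isr_def i by blast
qed

lemma gap_far:
  assumes "gap X Y m" "isr S X" "isr S Y" "S M" "m \<le> M"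
  shows "4 * eps M < Y M - X M"
proof -
  obtain n where n: "n \<le> m" "4 * eps m + 2 * eps n \<le> Y n - X n" using assms(1) unfolding gap_def by blast
  have "\<bar>X n - X M\<bar> < eps n" "\<bar>Y n - Y M\<bar> < eps n"
    using isr_le assms(2-5) n(1) by (meson order_trans)+
  moreover have "eps M \<le> eps m" using eps_mono assms(5) .
  ultimately show ?thesis using n(2) by linarith
qed

lemma gap_ls: "gap X Y m \<Longrightarrow> S m \<Longrightarrow> ls S X Y"
  unfolding gap_def ls_def
proof (elim exE conjE)
  fix n assume n: "S m" "n \<le> m" "4 * eps m + 2 * eps n \<le> Y n - X n"
  have "0 < eps m" by simp
  then have "2 * eps n < Y n - X n" using n(3) by linarith
  then show "\<exists>n. S n \<and> 2 * eps n < Y n - X n" using W_le[OF n(1,2)] by blast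
qed

lemma ls_gap:
  assumes "ls S X Y" "\<And>n. S n \<Longrightarrow> qd [] (\<lambda>e. X n)" "\<And>n. S n \<Longrightarrow> qd [] (\<lambda>e. Y n)"
  shows "\<exists>m. S m \<and> gap X Y m"
proof -
  obtain n where n: "S n" "2 * eps n < Y n - X n" using assms(1) unfolding ls_def by blast
  have "qd [] (\<lambda>e. Y n - X n - 2 * eps n)" by (rule qdefs assms nd_const n)+
  then obtain m where m: "S m" "4 * eps m \<le> Y n - X n - 2 * eps n" using arch n(2) by fastforce
  have "S (m + n)" by (rule S_nd) (rule wdefs m n)+
  moreover have "gap X Y (m + n)" unfolding gap_def
    using m(2) eps_mono[of m "m + n"] by (intro exI[of _ n]) (auto simp: algebra_simps)
  ultimately show ?thesis by blast
qed

end

text \<open>The range up to \<open>N\<close> may be infinite from outside, so the maximum has to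
  come from induction in the model; comparison of the values is decidable.\<close>

lemma (in cx) qmax:
  assumes E: "A.bd [Nat] (\<lambda>e. E (nv (e 0)))" and F: "A.qd [Nat] (\<lambda>e. F (nv (e 0)))" and "\<exists>j\<le>N. E j"
  shows "\<exists>j\<le>N. E j \<and> (\<forall>i\<le>N. E i \<longrightarrow> F i \<le> F j)"
proof -
  obtain f where f: "A.nd [Nat] f" "\<And>e. F (nv (e 0)) = val (f e)" using F unfolding A.qd_def by blast
  have fn: "fd (\<lambda>n. f (rv n ## (\<lambda>_. undefined)))"
    unfolding fd_nd[symmetric]
  proof (rule A.nd_cong[OF A.nd_subst[OF f(1), of "[Nat]" "\<lambda>e. e 0 ## (\<lambda>_. undefined)"]])
    show "A.df [Nat] ([Nat] ! n) (\<lambda>e. (e 0 ## (\<lambda>_. undefined)) n)" if "n < length [Nat]" for n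
      using that by (auto intro: wd_var)
  qed (simp add: envok_def)
  have Fv: "F n = val (f (rv n ## (\<lambda>_. undefined)))" for n using f(2)[of "rv n ## (\<lambda>_. undefined)"] by simp
  have E': "pd E" using E by (simp add: pd_bd)
  have Fq: "A.nd \<Gamma> h \<Longrightarrow> A.qd \<Gamma> (\<lambda>e. F (h e))" for \<Gamma> h
    unfolding Fv by (rule A.qdI) (rule nd_fd[OF fn])
  have "(\<exists>j\<le>n. E j) \<longrightarrow> (\<exists>j\<le>n. E j \<and> (\<forall>i\<le>n. E i \<longrightarrow> F i \<le> F j))" for n
  proof (rule nn_ind[of _ n])
    show "pd (\<lambda>n. (\<exists>j\<le>n. E j) \<longrightarrow> (\<exists>j\<le>n. E j \<and> (\<forall>i\<le>n. E i \<longrightarrow> F i \<le> F j)))"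
      by (rule pd_D) (rule A.qdefs bd_pd[OF E'] Fq | simp)+
    show "(\<exists>j\<le>0. E j) \<longrightarrow> (\<exists>j\<le>0. E j \<and> (\<forall>i\<le>0. E i \<longrightarrow> F i \<le> F j))" by simp
    fix n assume IH: "(\<exists>j\<le>n. E j) \<longrightarrow> (\<exists>j\<le>n. E j \<and> (\<forall>i\<le>n. E i \<longrightarrow> F i \<le> F j))"
    have le: "i \<le> n + 1 \<longleftrightarrow> i \<le> n \<or> i = n + 1" for i by (auto simp: le_less[of i "n + 1"])
    show "(\<exists>j\<le>n + 1. E j) \<longrightarrow> (\<exists>j\<le>n + 1. E j \<and> (\<forall>i\<le>n + 1. E i \<longrightarrow> F i \<le> F j))"
    proof
      assume "\<exists>j\<le>n + 1. E j"
      then consider "\<exists>j\<le>n. E j" | "E (n + 1)" "\<not> (\<exists>j\<le>n. E j)" unfolding le by blast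
      then show "\<exists>j\<le>n + 1. E j \<and> (\<forall>i\<le>n + 1. E i \<longrightarrow> F i \<le> F j)"
      proof cases
        case 1
        then obtain j where j: "j \<le> n" "E j" "\<forall>i\<le>n. E i \<longrightarrow> F i \<le> F j" using IH by blast
        show ?thesis
        proof (cases "E (n + 1) \<and> F j \<le> F (n + 1)")
          case True
          then show ?thesis using j unfolding le by (intro exI[of _ "n + 1"]) (auto intro: order_trans)
        next
          case False
          then show ?thesis using j unfolding le by (intro exI[of _ j]) auto
        qed
      next
        case 2
        then show ?thesis unfolding le by (intro exI[of _ "n + 1"]) auto
      qed
    qed
  qed
  then show ?thesis using assms(3) by blast
qed

lemma (in cx) bsum_ge: "fd f \<Longrightarrow> k < n \<Longrightarrow> f k \<le> bsum n f"
proof -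
  assume f: "fd f" and k: "k < n"
  have "k < n \<longrightarrow> f k \<le> bsum n f" for n
  proof (rule nn_ind[of _ n])
    show "pd (\<lambda>n. k < n \<longrightarrow> f k \<le> bsum n f)" by (rule pd_D) (rule adefs3 nd_bsum_fd f | simp)+
    show "k < n + 1 \<longrightarrow> f k \<le> bsum (n + 1) f" if "k < n \<longrightarrow> f k \<le> bsum n f" for n
      using that by (auto simp: bsum_eqs[OF f] le_less[of k n] intro: add_increasing2)
  qed simp
  then show ?thesis using k by blast
qed

text \<open>Choice is postulated for families given by a single object \<open>u\<close>, a form that
  both worlds supply: the full one by quantifier-free choice, the standard one by \<open>HAC\<close>
  and a bounded search.\<close>

locale wac = wrld +
  assumes AC_obj: "u \<in> D (T1 \<rightarrow>\<^sub>t T1) \<Longrightarrow> W (T1 \<rightarrow>\<^sub>t T1) u \<Longrightarrow>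
    (\<And>x. x \<in> D T1 \<Longrightarrow> W T1 x \<Longrightarrow> \<exists>n. S n \<and> u \<bullet> x \<odot> n = 1) \<Longrightarrow>
    \<exists>g\<in>D T2. W T2 g \<and> (\<forall>x\<in>D T1. W T1 x \<longrightarrow> u \<bullet> x \<odot> nv (g \<bullet> x) = 1)"
begin

lemma AC:
  assumes Q: "bd [Nat, T1] (\<lambda>e. Q (e 1) (nv (e 0)))"
    and ex: "\<And>x. x \<in> D T1 \<Longrightarrow> W T1 x \<Longrightarrow> \<exists>n. S n \<and> Q x n"
  shows "\<exists>g\<in>D T2. W T2 g \<and> (\<forall>x\<in>D T1. W T1 x \<longrightarrow> Q x (nv (g \<bullet> x)))"
proof -
  define u where "u = lamv T1 T1 (\<lambda>x. ln (\<lambda>n. bn (Q x n)))"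
  have 1: "nd (Nat # [T1]) (\<lambda>e. bn (Q (e 1) (nv (e 0))))" using Q by (simp add: bd_def)
  have 2: "df [T1] T1 (\<lambda>e. ln (\<lambda>n. bn (Q (e 0) n)))"
    by (rule df_ln[where h = "\<lambda>n e. bn (Q (e 0) n)"]) (use 1 in simp)
  have 3: "df [] (T1 \<rightarrow>\<^sub>t T1) (\<lambda>e. u)" unfolding u_def
    by (rule df_lam[where h = "\<lambda>x e. ln (\<lambda>n. bn (Q x n))"]) (rule 2)
  have ux: "u \<bullet> x \<odot> n = bn (Q x n)" if "x \<in> D T1" for x n
  proof -
    have "u \<bullet> x = ln (\<lambda>n. bn (Q x n))" unfolding u_def
      using df_lam_ap[where h = "\<lambda>x e. ln (\<lambda>n. bn (Q x n))" and e = undefined and \<Gamma> = "[]", OF 2] that by simp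
    moreover have "ln (\<lambda>n. bn (Q x n)) \<odot> n = bn (Q x n)"
      using ln_fa[where h = "\<lambda>n e. bn (Q (e 0) n)" and \<Gamma> = "[T1]" and e = "x ## undefined"] 1 that by simp
    ultimately show ?thesis by simp
  qed
  have "\<exists>n. S n \<and> u \<bullet> x \<odot> n = 1" if "x \<in> D T1" "W T1 x" for x
    using ex[OF that] ux[OF that(1)] by simp
  from AC_obj[OF conjunct2[OF df_W0[OF 3]] conjunct1[OF df_W0[OF 3]] this]
  show ?thesis using ux by (simp cong: ball_cong)
qed

lemma S_ap: "f \<in> D (\<sigma> \<rightarrow>\<^sub>t Nat) \<Longrightarrow> W (\<sigma> \<rightarrow>\<^sub>t Nat) f \<Longrightarrow> x \<in> D \<sigma> \<Longrightarrow> W \<sigma> x \<Longrightarrow> S (nv (f \<bullet> x))"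
  by (rule S_nd) (rule nd_ap wd_con | assumption)+

text \<open>Choice over numbers from choice over sequences: a number is presented by the constant
  sequence, and a sequence stands for its value at 0.\<close>

lemma AC_num:
  assumes Q: "bd [Nat, Nat] (\<lambda>e. Q (nv (e 1)) (nv (e 0)))" and ex: "\<And>p. S p \<Longrightarrow> \<exists>n. S n \<and> Q p n"
  shows "\<exists>f. nd [Nat] (\<lambda>e. f (nv (e 0))) \<and> (\<forall>p. S p \<longrightarrow> Q p (f p))"
proof -
  have "bd [Nat, T1] (\<lambda>e. Q (e 1 \<odot> 0) (nv (e 0)))"
  proof -
    have 0: "df [Nat, T1] Nat (\<lambda>e. rv (e (Suc 0) \<odot> 0))" by (intro df_rv nd_fa wd_var nd_ops) auto
    have "df [Nat, T1] ([Nat, Nat] ! n) (\<lambda>e. (e 0 ## rv (e (Suc 0) \<odot> 0) ## (\<lambda>_. undefined)) n)"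
      if "n < length [Nat, Nat]" for n
      using that 0 wd_var[of 0 "[Nat, T1]" Nat W] by (auto simp: less_Suc_eq_0_disj)
    from nd_subst[OF Q[unfolded bd_def] this] show ?thesis by (simp add: bd_def)
  qed
  moreover have "\<exists>n. S n \<and> Q (x \<odot> 0) n" if "x \<in> D T1" "W T1 x" for x
    using ex[of "x \<odot> 0"] S_fa[OF that, of 0] S_nd[OF nd_ops(1)] by blast
  ultimately obtain g where g: "g \<in> D T2" "W T2 g" "\<And>x. x \<in> D T1 \<Longrightarrow> W T1 x \<Longrightarrow> Q (x \<odot> 0) (nv (g \<bullet> x))"
    using AC[of "\<lambda>x n. Q (x \<odot> 0) n"] by auto
  have l: "df [Nat] T1 (\<lambda>e. ln (\<lambda>_. nv (e 0)))"
    by (rule df_ln[where h = "\<lambda>n e. nv (e 0)"]) (rule nd_var; simp)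
  have "nd [Nat] (\<lambda>e. nv (g \<bullet> ln (\<lambda>_. nv (e 0))))"
    by (rule nd_ap[OF wd_con l]) (use g in auto)
  moreover have "Q p (nv (g \<bullet> ln (\<lambda>_. p)))" if "S p" for p
  proof -
    have "df [] T1 (\<lambda>e. ln (\<lambda>_. p))"
      by (rule df_ln[where h = "\<lambda>n e. p"]) (rule nd_const[OF that])
    from df_W0[OF this] have "W T1 (ln (\<lambda>_. p))" "ln (\<lambda>_. p) \<in> D T1" by auto
    moreover have "ln (\<lambda>_. p) \<odot> 0 = p"
      using ln_fa[where h = "\<lambda>n e. p" and \<Gamma> = "[]" and e = undefined] nd_const[OF that] by simp
    ultimately show ?thesis using g(3) by metis
  qed
  ultimately show ?thesis by (intro exI[of _ "\<lambda>p. nv (g \<bullet> ln (\<lambda>_. p))"]) simp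
qed

end

section \<open>The tree of a cover\<close>

definition clp :: "'a::linorder \<Rightarrow> 'a \<Rightarrow> 'a \<Rightarrow> 'a" where
  "clp l u w = (if w \<le> l then l else if u \<le> w then u else w)"

lemma clp_bounds: "l \<le> u \<Longrightarrow> l \<le> clp l u w \<and> clp l u w \<le> u"
  by (auto simp: clp_def)

lemma clp_diff: "l \<le> (u::qq) \<Longrightarrow> \<bar>w - w'\<bar> < e \<Longrightarrow> \<bar>clp l u w - clp l u w'\<bar> < e"
  by (auto simp: clp_def)

context cx
begin

definition lq :: "tm \<Rightarrow> nn \<Rightarrow> qq" where "lq \<alpha> n = qn (dy \<alpha> n) * eps n"
definition uq :: "tm \<Rightarrow> nn \<Rightarrow> qq" where "uq \<alpha> n = (qn (dy \<alpha> n) + 1) * eps n"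
definition lcode :: "tm \<Rightarrow> nn \<Rightarrow> nn" where "lcode \<alpha> n = mk (dy \<alpha> n) 0 (p2 n)"
definition ucode :: "tm \<Rightarrow> nn \<Rightarrow> nn" where "ucode \<alpha> n = mk (dy \<alpha> n + 1) 0 (p2 n)"

text \<open>The approximations to a candidate point in the dyadic interval that \<open>\<alpha>\<close> determines at level
  \<open>n\<close>: the right end of the interval \<open>j\<close> of the cover, moved into the dyadic interval, or the left end
  of the latter if \<open>j \<ge> n\<close>. The first approximations depend on \<open>\<alpha>\<close> only.\<close>
definition yv :: "tm \<Rightarrow> tm \<Rightarrow> nn \<Rightarrow> nn \<Rightarrow> nn \<Rightarrow> nn" where
  "yv I \<alpha> n j m = (if m < n then lcode \<alpha> (m + 1)
     else if j < n then (let w = pr2 (I \<bullet> rv j \<odot> m) in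
       if val w \<le> lq \<alpha> n then lcode \<alpha> n else if uq \<alpha> n \<le> val w then ucode \<alpha> n else w)
     else lcode \<alpha> n)"
definition yh :: "tm \<Rightarrow> tm \<Rightarrow> nn \<Rightarrow> nn \<Rightarrow> tm" where "yh I \<alpha> n j = ln (\<lambda>m. yv I \<alpha> n j m)"
text \<open>The margin \<open>2 * eps n\<close> outweighs the error of the \<open>n\<close>-th
  approximations to the two ends, so that a visible inclusion is a true one, with room left on both
  sides.\<close>

definition vis :: "tm \<Rightarrow> tm \<Rightarrow> nn \<Rightarrow> nn \<Rightarrow> bool" where
  "vis I \<alpha> n j \<longleftrightarrow> lend I j n + 2 * eps n \<le> lq \<alpha> n \<and> uq \<alpha> n + 2 * eps n \<le> rend I j n"
text \<open>The first clause fails when all candidates select among the first \<open>n\<close>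
  intervals, which is what the covering argument exploits; the second fails when one interval
  settles the whole dyadic piece, which makes every path die. The index \<open>j = n\<close> stands
  for the left end.\<close>

definition alive :: "tm \<Rightarrow> tm \<Rightarrow> tm \<Rightarrow> nn \<Rightarrow> bool" where
  "alive I g \<alpha> n \<longleftrightarrow> (\<exists>j\<le>n. n \<le> nv (g \<bullet> yh I \<alpha> n j)) \<and> \<not> (\<exists>j<n. vis I \<alpha> n j)"

text \<open>Once \<open>\<alpha>\<close> has died, at level \<open>n + 1\<close>, the point \<open>yb\<close> is a candidate at level \<open>n\<close> at which \<open>g\<close> is at
  least \<open>n\<close>; hence \<open>g\<close> at \<open>yb\<close> bounds the time of death.\<close>
definition dth :: "tm \<Rightarrow> tm \<Rightarrow> tm \<Rightarrow> nn \<Rightarrow> nn" where "dth I g \<alpha> m = bmin m (\<lambda>n. \<not> alive I g \<alpha> n)"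
definition yb :: "tm \<Rightarrow> tm \<Rightarrow> tm \<Rightarrow> tm" where
  "yb I g \<alpha> = ln (\<lambda>m. let t = dth I g \<alpha> (m + 2) in if t = m + 2 then lcode \<alpha> (m + 1)
     else yv I \<alpha> (t - 1) (bmin t (\<lambda>j. t - 1 \<le> nv (g \<bullet> yh I \<alpha> (t - 1) j))) m)"
definition ctree :: "tm \<Rightarrow> tm \<Rightarrow> tm" where "ctree I g = ln (\<lambda>s. bn (alive I g (ent s) (len s)))"
definition cbnd :: "tm \<Rightarrow> tm \<Rightarrow> tm" where
  "cbnd I g = lamv T1 Nat (\<lambda>\<alpha>. rv (nv (g \<bullet> yb I g (bit \<alpha>)) + 1))"

end

context wcx
begin

lemma qd_lq: "df \<Gamma> T1 \<alpha> \<Longrightarrow> nd \<Gamma> n \<Longrightarrow> qd \<Gamma> (\<lambda>e. lq (\<alpha> e) (n e))"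
  "df \<Gamma> T1 \<alpha> \<Longrightarrow> nd \<Gamma> n \<Longrightarrow> qd \<Gamma> (\<lambda>e. uq (\<alpha> e) (n e))"
  unfolding lq_def uq_def by (rule qdefs | assumption)+

lemma nd_lcode: "df \<Gamma> T1 \<alpha> \<Longrightarrow> nd \<Gamma> n \<Longrightarrow> nd \<Gamma> (\<lambda>e. lcode (\<alpha> e) (n e))"
  "df \<Gamma> T1 \<alpha> \<Longrightarrow> nd \<Gamma> n \<Longrightarrow> nd \<Gamma> (\<lambda>e. ucode (\<alpha> e) (n e))"
  unfolding lcode_def ucode_def by (rule nd_mk defs3 | assumption)+

lemma nd_yv: "df \<Gamma> (Nat \<rightarrow>\<^sub>t T1) I \<Longrightarrow> df \<Gamma> T1 \<alpha> \<Longrightarrow> nd \<Gamma> n \<Longrightarrow> nd \<Gamma> j \<Longrightarrow> nd \<Gamma> m \<Longrightarrow>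
  nd \<Gamma> (\<lambda>e. yv (I e) (\<alpha> e) (n e) (j e) (m e))"
  unfolding yv_def Let_def by (rule nd_lcode qd_lq qdefs | assumption)+

lemma df_yh: "df \<Gamma> (Nat \<rightarrow>\<^sub>t T1) I \<Longrightarrow> df \<Gamma> T1 \<alpha> \<Longrightarrow> nd \<Gamma> n \<Longrightarrow> nd \<Gamma> j \<Longrightarrow>
  df \<Gamma> T1 (\<lambda>e. yh (I e) (\<alpha> e) (n e) (j e))"
  unfolding yh_def
  by (rule df_ln[where h = "\<lambda>m e. yv (I e) (\<alpha> e) (n e) (j e) m"]) (rule nd_yv nd_var wd_weak nd_weak | assumption | simp)+

lemma bd_vis: "df \<Gamma> (Nat \<rightarrow>\<^sub>t T1) I \<Longrightarrow> df \<Gamma> T1 \<alpha> \<Longrightarrow> nd \<Gamma> n \<Longrightarrow> nd \<Gamma> j \<Longrightarrow>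
  bd \<Gamma> (\<lambda>e. vis (I e) (\<alpha> e) (n e) (j e))"
  unfolding vis_def by (rule qd_lq qdefs | assumption)+

lemma bd_alive: "df \<Gamma> (Nat \<rightarrow>\<^sub>t T1) I \<Longrightarrow> df \<Gamma> T2 g \<Longrightarrow> df \<Gamma> T1 \<alpha> \<Longrightarrow> nd \<Gamma> n \<Longrightarrow>
  bd \<Gamma> (\<lambda>e. alive (I e) (g e) (\<alpha> e) (n e))"
  unfolding alive_def
  apply (rule bd_conj)
   apply (rule bd_exle[where P = "\<lambda>j e. n e \<le> nv (g e \<bullet> yh (I e) (\<alpha> e) (n e) j)"], assumption)
   apply (rule bd_le nd_ap df_yh nd_var wd_weak nd_weak | assumption | simp)+
  apply (rule bd_alll[where P = "\<lambda>j e. \<not> vis (I e) (\<alpha> e) (n e) j"], assumption)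
  apply (rule bd_not bd_vis nd_var wd_weak nd_weak | assumption | simp)+
  done

lemma nd_dth: "df \<Gamma> (Nat \<rightarrow>\<^sub>t T1) I \<Longrightarrow> df \<Gamma> T2 g \<Longrightarrow> df \<Gamma> T1 \<alpha> \<Longrightarrow> nd \<Gamma> n \<Longrightarrow>
  nd \<Gamma> (\<lambda>e. dth (I e) (g e) (\<alpha> e) (n e))"
  unfolding dth_def
  by (rule nd_bmin[where P = "\<lambda>n e. \<not> alive (I e) (g e) (\<alpha> e) n"]) (rule bd_not bd_alive nd_var wd_weak nd_weak | assumption | simp)+

lemma nd_cand:
  "df \<Gamma> (Nat \<rightarrow>\<^sub>t T1) I \<Longrightarrow> df \<Gamma> T2 g \<Longrightarrow> df \<Gamma> T1 \<alpha> \<Longrightarrow> nd \<Gamma> t \<Longrightarrow>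
  nd \<Gamma> (\<lambda>e. bmin (t e) (\<lambda>j. t e - 1 \<le> nv (g e \<bullet> yh (I e) (\<alpha> e) (t e - 1) j)))"
  by (rule nd_bmin[where P = "\<lambda>j e. t e - 1 \<le> nv (g e \<bullet> yh (I e) (\<alpha> e) (t e - 1) j)"])
    (rule bd_le nd_ops nd_ap df_yh nd_var wd_weak nd_weak | assumption | simp)+

lemma df_yb: "df \<Gamma> (Nat \<rightarrow>\<^sub>t T1) I \<Longrightarrow> df \<Gamma> T2 g \<Longrightarrow> df \<Gamma> T1 \<alpha> \<Longrightarrow> df \<Gamma> T1 (\<lambda>e. yb (I e) (g e) (\<alpha> e))"
  unfolding yb_def Let_def
  by (rule df_ln[where h = "\<lambda>m e. if dth (I e) (g e) (\<alpha> e) (m + 2) = m + 2 then lcode (\<alpha> e) (m + 1)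
     else yv (I e) (\<alpha> e) (dth (I e) (g e) (\<alpha> e) (m + 2) - 1) (bmin (dth (I e) (g e) (\<alpha> e) (m + 2))
       (\<lambda>j. dth (I e) (g e) (\<alpha> e) (m + 2) - 1 \<le> nv (g e \<bullet> yh (I e) (\<alpha> e) (dth (I e) (g e) (\<alpha> e) (m + 2) - 1) j))) m"])
    (rule nd_cand nd_if bd_eq nd_dth nd_ops nd_numeral nd_lcode nd_yv nd_var wd_weak nd_weak | assumption | simp)+

lemma df_ctree: "df \<Gamma> (Nat \<rightarrow>\<^sub>t T1) I \<Longrightarrow> df \<Gamma> T2 g \<Longrightarrow> df \<Gamma> T1 (\<lambda>e. ctree (I e) (g e))"
  unfolding ctree_def
  by (rule df_ln[where h = "\<lambda>s e. bn (alive (I e) (g e) (ent s) (len s))"])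
    (rule nd_bn bd_alive df_ent nd_len nd_var wd_weak nd_weak | assumption | simp)+

lemma df_cbnd: "df \<Gamma> (Nat \<rightarrow>\<^sub>t T1) I \<Longrightarrow> df \<Gamma> T2 g \<Longrightarrow> df \<Gamma> T2 (\<lambda>e. cbnd (I e) (g e))"
  unfolding cbnd_def
  by (rule df_lam[where h = "\<lambda>\<alpha> e. rv (nv (g e \<bullet> yb (I e) (g e) (bit \<alpha>)) + 1)"])
    (rule df_rv nd_ops nd_ap df_yb df_bit wd_weak | assumption | (rule wd_var, simp, simp))+

lemmas cdefs = nd_ap[of _ T1] nd_lcode qd_lq nd_yv df_yh bd_vis bd_alive nd_dth nd_cand df_yb df_ctree df_cbnd nd_mk qdefs

end

context cx
begin

lemma lq_shift:
  assumes "bin \<alpha>"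
  shows "lq \<alpha> i \<le> lq \<alpha> (i + j)" "uq \<alpha> (i + j) \<le> uq \<alpha> i"
proof -
  have e: "eps i = qn (p2 j) * eps (i + j)"
    using qn_less[of 0 "p2 j"] by (simp add: eps_add, simp add: eps_def)
  have "qn (dy \<alpha> i) * qn (p2 j) \<le> qn (dy \<alpha> (i + j))" "qn (dy \<alpha> (i + j)) + 1 \<le> (qn (dy \<alpha> i) + 1) * qn (p2 j)"
    using dy_shift[OF assms, of i j] qn_less_step[of "dy \<alpha> (i + j)" "(dy \<alpha> i + 1) * p2 j"]
      qn_simps(5)[of "dy \<alpha> i * p2 j" "dy \<alpha> (i + j)"] by auto
  then show "lq \<alpha> i \<le> lq \<alpha> (i + j)" "uq \<alpha> (i + j) \<le> uq \<alpha> i"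
    unfolding lq_def uq_def e mult.assoc[symmetric] by (auto intro: mult_right_mono)
qed

lemma lq_mono: "bin \<alpha> \<Longrightarrow> i \<le> j \<Longrightarrow> lq \<alpha> i \<le> lq \<alpha> j \<and> uq \<alpha> j \<le> uq \<alpha> i"
  using lq_shift[of \<alpha> i] unfolding less_eq_nn_def by blast

lemma uq_lq: "uq \<alpha> n = lq \<alpha> n + eps n"
  by (simp add: uq_def lq_def algebra_simps)

lemma lq_unit: "bin \<alpha> \<Longrightarrow> 0 \<le> lq \<alpha> n \<and> uq \<alpha> n \<le> 1"
  using lq_shift[of \<alpha> 0 n] by (auto simp: lq_def uq_def dy_eqs)

lemma val_lcode [simp]: "val (lcode \<alpha> n) = lq \<alpha> n" "val (ucode \<alpha> n) = uq \<alpha> n"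
  by (simp_all add: lcode_def ucode_def val_mk lq_def uq_def eps_def)

lemma lq_cong: "\<alpha> \<in> D T1 \<Longrightarrow> \<beta> \<in> D T1 \<Longrightarrow> (\<And>i. i < n \<Longrightarrow> \<alpha> \<odot> i = \<beta> \<odot> i) \<Longrightarrow>
  lq \<alpha> n = lq \<beta> n \<and> uq \<alpha> n = uq \<beta> n \<and> lcode \<alpha> n = lcode \<beta> n \<and> ucode \<alpha> n = ucode \<beta> n"
  using dy_cong[of \<alpha> \<beta> n] by (simp add: lq_def uq_def lcode_def ucode_def)

lemma yh_app: "I \<in> D (Nat \<rightarrow>\<^sub>t T1) \<Longrightarrow> \<alpha> \<in> D T1 \<Longrightarrow> yh I \<alpha> n j \<odot> m = yv I \<alpha> n j m"
  unfolding yh_def by (rule fd_lnD) (rule pd_D, (rule A.cdefs A.nd_const wd_con | simp)+)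

lemma yh_D: "I \<in> D (Nat \<rightarrow>\<^sub>t T1) \<Longrightarrow> \<alpha> \<in> D T1 \<Longrightarrow> yh I \<alpha> n j \<in> D T1"
  unfolding yh_def by (rule fd_lnD) (rule pd_D, (rule A.cdefs A.nd_const wd_con | simp)+)

lemma yh_val: "I \<in> D (Nat \<rightarrow>\<^sub>t T1) \<Longrightarrow> \<alpha> \<in> D T1 \<Longrightarrow> rl (yh I \<alpha> n j) m = (if m < n then lq \<alpha> (m + 1)
   else if j < n then clp (lq \<alpha> n) (uq \<alpha> n) (rend I j m) else lq \<alpha> n)"
  by (simp add: rl_def yh_app yv_def Let_def clp_def rend_def)

lemma yh_cong:
  assumes "I \<in> D (Nat \<rightarrow>\<^sub>t T1)" "\<alpha> \<in> D T1" "\<beta> \<in> D T1" "\<And>i. i < n \<Longrightarrow> \<alpha> \<odot> i = \<beta> \<odot> i"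
  shows "yh I \<alpha> n j = yh I \<beta> n j"
proof (rule fa_ext)
  fix m
  have "lcode \<alpha> (m + 1) = lcode \<beta> (m + 1)" if "m < n"
    using lq_cong[of \<alpha> \<beta> "m + 1"] assms that by (meson le_less_trans nn_less_plus_1)
  moreover have "lq \<alpha> n = lq \<beta> n \<and> uq \<alpha> n = uq \<beta> n \<and> lcode \<alpha> n = lcode \<beta> n \<and> ucode \<alpha> n = ucode \<beta> n"
    by (rule lq_cong) (use assms in auto)
  ultimately show "yh I \<alpha> n j \<odot> m = yh I \<beta> n j \<odot> m"
    by (auto simp: yh_app assms(1-3) yv_def Let_def)
qed (use assms yh_D in auto)

text \<open>Both clauses refer to \<open>\<alpha>\<close> through its dyadic intervals up to level
  \<open>n\<close>; this is what makes being alive a condition on finite codes.\<close>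

lemma alive_cong:
  assumes "I \<in> D (Nat \<rightarrow>\<^sub>t T1)" "\<alpha> \<in> D T1" "\<beta> \<in> D T1" "\<And>i. i < n \<Longrightarrow> \<alpha> \<odot> i = \<beta> \<odot> i"
  shows "alive I g \<alpha> n = alive I g \<beta> n"
proof -
  have "yh I \<alpha> n j = yh I \<beta> n j" for j by (rule yh_cong) (use assms in auto)
  moreover have "lq \<alpha> n = lq \<beta> n \<and> uq \<alpha> n = uq \<beta> n \<and> lcode \<alpha> n = lcode \<beta> n \<and> ucode \<alpha> n = ucode \<beta> n"
    by (rule lq_cong) (use assms in auto)
  ultimately show ?thesis by (simp add: alive_def vis_def)
qed

lemma ctree_app: "I \<in> D (Nat \<rightarrow>\<^sub>t T1) \<Longrightarrow> g \<in> D T2 \<Longrightarrow> ctree I g \<odot> s = bn (alive I g (ent s) (len s))"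
  unfolding ctree_def by (rule fd_lnD) (rule pd_D, (rule A.cdefs A.nd_const wd_con | simp)+)

lemma ctree_out: "I \<in> D (Nat \<rightarrow>\<^sub>t T1) \<Longrightarrow> g \<in> D T2 \<Longrightarrow> \<alpha> \<in> D T1 \<Longrightarrow>
  out (ctree I g) \<alpha> n \<longleftrightarrow> (\<exists>i\<le>n. \<not> alive I g \<alpha> i)"
  using alive_cong[of I "ent (ini \<alpha> _)" \<alpha> _ g] by (auto simp: out_def ctree_app len_ini ent_ini)

lemma alive_0: "alive I g \<alpha> 0"
  by (simp add: alive_def)

lemma pd_alive: "I \<in> D (Nat \<rightarrow>\<^sub>t T1) \<Longrightarrow> g \<in> D T2 \<Longrightarrow> \<alpha> \<in> D T1 \<Longrightarrow> pd (\<lambda>n. \<not> alive I g \<alpha> n)"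
  by (rule pd_D) (rule A.cdefs A.nd_const wd_con | simp)+

lemma cbnd_app: "I \<in> D (Nat \<rightarrow>\<^sub>t T1) \<Longrightarrow> g \<in> D T2 \<Longrightarrow> \<alpha> \<in> D T1 \<Longrightarrow>
  nv (cbnd I g \<bullet> \<alpha>) = nv (g \<bullet> yb I g (bit \<alpha>)) + 1"
  unfolding cbnd_def
  by (subst A.df_lam_ap[where h = "\<lambda>\<alpha> e. rv (nv (g \<bullet> yb I g (bit \<alpha>)) + 1)" and \<Gamma> = "[]" and e = undefined])
    ((rule A.df_rv A.cdefs A.nd_const wd_con wd_var | simp)+)

lemma first_death:
  assumes I: "I \<in> D (Nat \<rightarrow>\<^sub>t T1)" "g \<in> D T2" "\<alpha> \<in> D T1" and dead: "\<not> alive I g \<alpha> t"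
  shows "\<exists>n j. n + 1 \<le> t \<and> \<not> alive I g \<alpha> (n + 1) \<and> (\<forall>i\<le>n. alive I g \<alpha> i) \<and> yb I g \<alpha> = yh I \<alpha> n j \<and>
    n \<le> nv (g \<bullet> yb I g \<alpha>)"
proof -
  note P = pd_alive[OF I]
  obtain N where N: "N \<le> t" "\<not> alive I g \<alpha> N" "\<forall>i<N. alive I g \<alpha> i" using least[OF P dead] by blast
  have "N \<noteq> 0" using N(2) alive_0 by metis
  then obtain n where n: "N = n + 1" using nn_cases by blast
  have al: "alive I g \<alpha> n" using N(3) n by simp
  define j where "j = bmin (n + 1) (\<lambda>j. n \<le> nv (g \<bullet> yh I \<alpha> n j))"
  have Q: "pd (\<lambda>j. n \<le> nv (g \<bullet> yh I \<alpha> n j))" by (rule pd_D) (rule A.cdefs A.nd_const wd_con I | simp)+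
  have gj: "n \<le> nv (g \<bullet> yh I \<alpha> n j)"
    using al bmin_P[OF Q, of _ "n + 1"] unfolding j_def alive_def by auto
  have "yb I g \<alpha> = yh I \<alpha> n j"
  proof (rule fa_ext)
    show "yb I g \<alpha> \<in> D T1" using wd_D[OF A.df_yb[of "[]" "\<lambda>_. I" "\<lambda>_. g" "\<lambda>_. \<alpha>"], of undefined] I by (simp add: wd_con)
    show "yh I \<alpha> n j \<in> D T1" using yh_D I by blast
    fix m
    have "yb I g \<alpha> \<odot> m = (let t = dth I g \<alpha> (m + 2) in if t = m + 2 then lcode \<alpha> (m + 1)
     else yv I \<alpha> (t - 1) (bmin t (\<lambda>j. t - 1 \<le> nv (g \<bullet> yh I \<alpha> (t - 1) j))) m)"
      unfolding yb_def Let_def by (rule fd_lnD) (rule pd_D, (rule A.cdefs A.nd_const wd_con I | simp)+)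
    \<comment> \<open>At argument \<open>m\<close> the search for the death runs below
      \<open>m + 2\<close>. If \<open>m < n\<close> it finds nothing, and the candidate has the
      value \<open>lcode \<alpha> (m + 1)\<close> whatever its level will be; from
      \<open>m = n\<close> on it finds \<open>N = n + 1\<close>, and the candidate is known.\<close>
    also have "\<dots> = yv I \<alpha> n j m"
    proof (cases "m < n")
      case True
      have "dth I g \<alpha> (m + 2) = m + 2"
      proof (rule ccontr)
        assume "dth I g \<alpha> (m + 2) \<noteq> m + 2"
        then have *: "dth I g \<alpha> (m + 2) < m + 2" using bmin(1)[OF P, of "m + 2"] by (simp add: dth_def order.strict_iff_order)
        then have "\<not> alive I g \<alpha> (dth I g \<alpha> (m + 2))" unfolding dth_def by (rule bmin(3)[OF P])
        moreover have "m + 2 \<le> N" using True unfolding n nn_less_iff to_qn by (simp add: algebra_simps)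
        ultimately show False using N(3) * by (meson less_le_trans)
      qed
      then show ?thesis using True by (simp add: yv_def)
    next
      case False
      then have "N < m + 2" unfolding n not_less to_qn by linarith
      then have "dth I g \<alpha> (m + 2) = N"
        unfolding dth_def using bmin_le[OF P N(2)] bmin(3)[OF P, of "m + 2"] N(3) by (meson le_less_trans linorder_neqE order.strict_iff_order)
      then show ?thesis using \<open>N < m + 2\<close> by (auto simp: n j_def Let_def)
    qed
    also have "\<dots> = yh I \<alpha> n j \<odot> m" by (simp add: yh_app I)
    finally show "yb I g \<alpha> \<odot> m = yh I \<alpha> n j \<odot> m" .
  qed
  then show ?thesis using N n gj by auto
qed

lemma dead_bound:
  assumes I: "I \<in> D (Nat \<rightarrow>\<^sub>t T1)" "g \<in> D T2" "\<alpha> \<in> D T1" and dead: "\<not> alive I g (bit \<alpha>) t"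
  shows "out (ctree I g) (bit \<alpha>) (nv (cbnd I g \<bullet> \<alpha>))"
proof -
  obtain n where n: "\<not> alive I g (bit \<alpha>) (n + 1)" "n \<le> nv (g \<bullet> yb I g (bit \<alpha>))"
    using first_death[OF I(1,2) obj_D(1)[OF I(3)] dead] by blast
  have b: "bit \<alpha> \<in> D T1" using I(3) by simp
  show ?thesis unfolding ctree_out[OF I(1,2) b] cbnd_app[OF I] using n by (intro exI[of _ "n + 1"]) simp
qed

end

section \<open>From the fan theorem to the Heine-Borel lemma\<close>

context wrld
begin

definition UFAN :: bool where
  "UFAN \<longleftrightarrow> (\<exists>\<Psi>\<in>D (T1 \<rightarrow>\<^sub>t T2 \<rightarrow>\<^sub>t Nat). W (T1 \<rightarrow>\<^sub>t T2 \<rightarrow>\<^sub>t Nat) \<Psi> \<and> (\<forall>T\<in>D T1. W T1 T \<longrightarrow> (\<forall>h\<in>D T2. W T2 h \<longrightarrow>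
     (\<forall>\<alpha>\<in>D T1. W T1 \<alpha> \<longrightarrow> out T (bit \<alpha>) (nv (h \<bullet> \<alpha>))) \<longrightarrow> covd T (nv (\<Psi> \<bullet> T \<bullet> h)))))"

definition ivls :: "tm \<Rightarrow> bool" where
  "ivls I \<longleftrightarrow> (\<forall>n. S n \<longrightarrow> isr S (lend I n) \<and> isr S (rend I n))"

definition HBw :: bool where
  "HBw \<longleftrightarrow> (\<forall>I\<in>D (Nat \<rightarrow>\<^sub>t T1). W (Nat \<rightarrow>\<^sub>t T1) I \<longrightarrow> ivls I \<longrightarrow>
     (\<forall>x\<in>D T1. W T1 x \<longrightarrow> un S (rl x) \<longrightarrow> (\<exists>n. S n \<and> inI S x I n)) \<longrightarrow>
     (\<exists>k. S k \<and> (\<forall>x\<in>D T1. W T1 x \<longrightarrow> un S (rl x) \<longrightarrow> (\<exists>n\<le>k. inI S x I n))))"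

definition HBs :: bool where
  "HBs \<longleftrightarrow> (\<forall>I\<in>D (Nat \<rightarrow>\<^sub>t T1). W (Nat \<rightarrow>\<^sub>t T1) I \<longrightarrow> ivls I \<longrightarrow>
     (\<forall>x\<in>D T1. W T1 x \<longrightarrow> un S (rl x) \<longrightarrow> (\<exists>n. S n \<and> inI S x I n)) \<longrightarrow>
     (\<exists>k. S k \<and> (\<forall>x\<in>D T1. un (\<lambda>_. True) (rl x) \<longrightarrow> (\<exists>n\<le>k. inI (\<lambda>_. True) x I n))))"

definition UHBw :: bool where
  "UHBw \<longleftrightarrow> (\<exists>H\<in>D ((Nat \<rightarrow>\<^sub>t T1) \<rightarrow>\<^sub>t T2 \<rightarrow>\<^sub>t Nat). W ((Nat \<rightarrow>\<^sub>t T1) \<rightarrow>\<^sub>t T2 \<rightarrow>\<^sub>t Nat) H \<and>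
     (\<forall>I\<in>D (Nat \<rightarrow>\<^sub>t T1). W (Nat \<rightarrow>\<^sub>t T1) I \<longrightarrow> (\<forall>g\<in>D T2. W T2 g \<longrightarrow> ivls I \<longrightarrow>
       (\<forall>x\<in>D T1. W T1 x \<longrightarrow> un S (rl x) \<longrightarrow> inI S x I (nv (g \<bullet> x))) \<longrightarrow>
       (\<forall>x\<in>D T1. W T1 x \<longrightarrow> un S (rl x) \<longrightarrow> (\<exists>n\<le>nv (H \<bullet> I \<bullet> g). inI S x I n)))))"

end

lemma (in cx) un_intro:
  assumes "isr Q X" "\<And>m. 0 \<le> X m \<and> X m \<le> 1"
  shows "un Q X"
proof -
  have "\<not> 2 * eps n < 0 - X n" "\<not> 2 * eps n < X n - 1" for n
    using assms(2)[of n] eps_pos(1)[of n] by linarith+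
  then show ?thesis using assms(1) unfolding un_def ls_def by blast
qed

lemma (in cx) gap_mono: "gap X Y m \<Longrightarrow> m \<le> m' \<Longrightarrow> gap X Y m'"
proof -
  assume "gap X Y m" and m: "m \<le> m'"
  then obtain n where n: "n \<le> m" "4 * eps m + 2 * eps n \<le> Y n - X n" unfolding gap_def by blast
  then have "4 * eps m' + 2 * eps n \<le> Y n - X n" using eps_mono[OF m] by linarith
  then show "gap X Y m'" using n(1) m unfolding gap_def by (meson order_trans)
qed

lemma (in cx) lq_le_uq: "lq \<alpha> n \<le> uq \<alpha> n"
  by (simp add: uq_lq)

locale cover = wac +
  fixes I g
  assumes I: "I \<in> D (Nat \<rightarrow>\<^sub>t T1)" "W (Nat \<rightarrow>\<^sub>t T1) I" and ivl: "ivls I"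
    and g: "g \<in> D T2" "W T2 g"
    and honest: "x \<in> D T1 \<Longrightarrow> W T1 x \<Longrightarrow> un S (rl x) \<Longrightarrow> inI S x I (nv (g \<bullet> x))"
begin

lemma yh_range:
  assumes a: "bin \<alpha>" and k: "k \<le> n" "k \<le> m + 1"
  shows "lq \<alpha> k \<le> rl (yh I \<alpha> n j) m \<and> rl (yh I \<alpha> n j) m \<le> uq \<alpha> k"
proof (cases "m < n")
  case True
  then show ?thesis using lq_mono[OF a k(2)] lq_le_uq[of \<alpha> "m + 1"] a by (auto simp: yh_val I)
next
  case False
  have "lq \<alpha> n \<le> uq \<alpha> n" by (simp add: uq_lq)
  then show ?thesis using False lq_mono[OF a k(1)] clp_bounds[of "lq \<alpha> n" "uq \<alpha> n" "rend I j m"] a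
    by (auto simp: yh_val I)
qed

text \<open>The first approximations use level \<open>m + 1\<close> instead of \<open>m\<close>:
  later ones stay in a dyadic interval of length \<open>eps (m + 1)\<close> and hence differ by
  strictly less than \<open>eps m\<close>. From stage \<open>n\<close> on, moving a number into a
  fixed interval does not increase distances.\<close>

lemma yh_un:
  assumes a: "bin \<alpha>" and j: "S j \<or> n \<le> j"
  shows "un S (rl (yh I \<alpha> n j))"
proof -
  let ?X = "rl (yh I \<alpha> n j)"
  have "0 \<le> ?X m \<and> ?X m \<le> 1" for m
    using yh_range[OF a, of 0 n m j] lq_unit[OF a, of 0] by auto
  moreover have "\<bar>?X m - ?X (m + i)\<bar> < eps m" if "S m" "S i" for m i
  proof (cases "m < n")
    case True
    then have "m + 1 \<le> n" by (simp add: nn_less_iff)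
    then have "lq \<alpha> (m + 1) \<le> ?X (m + i)" "?X (m + i) \<le> uq \<alpha> (m + 1)"
      using yh_range[OF a, of "m + 1" n "m + i" j] by simp_all
    moreover have "?X m = lq \<alpha> (m + 1)" using True a by (simp add: yh_val I)
    ultimately show ?thesis using eps_pos(1)[of m] unfolding uq_lq eps_s abs_less_iff by linarith
  next
    case False
    then have "\<not> m + i < n" by (meson le_less_trans le_add_same_cancel1 nn_ge_0)
    then show ?thesis
      using False j that ivl a clp_diff[of "lq \<alpha> n" "uq \<alpha> n" "rend I j m" "rend I j (m + i)"]
      by (auto simp: yh_val I uq_lq ivls_def isr_def not_le)
  qed
  ultimately show ?thesis by (intro un_intro) (simp_all add: isr_def)
qed

lemma qd_ends: "S k \<Longrightarrow> S n \<Longrightarrow> qd [] (\<lambda>e. lend I k n)" "S k \<Longrightarrow> S n \<Longrightarrow> qd [] (\<lambda>e. rend I k n)"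
  by (rule qd_real wd_con I nd_const | assumption)+

lemma qd_rl: "x \<in> D T1 \<Longrightarrow> W T1 x \<Longrightarrow> S n \<Longrightarrow> qd [] (\<lambda>e. rl x n)"
  by (rule qd_real wd_con nd_const | assumption)+

lemma S_g: "x \<in> D T1 \<Longrightarrow> W T1 x \<Longrightarrow> S (nv (g \<bullet> x))"
  by (rule S_ap) (use g in auto)

lemma honest_gap:
  assumes x: "x \<in> D T1" "W T1 x" "un S (rl x)"
  shows "\<exists>m. S m \<and> gap (lend I (nv (g \<bullet> x))) (rl x) m \<and> gap (rl x) (rend I (nv (g \<bullet> x))) m"
proof -
  let ?k = "nv (g \<bullet> x)"
  have k: "S ?k" using S_g x by blast
  have "ls S (lend I ?k) (rl x)" "ls S (rl x) (rend I ?k)" using honest[OF x] by (auto simp: inI_def)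
  then obtain m1 m2 where m: "S m1" "gap (lend I ?k) (rl x) m1" "S m2" "gap (rl x) (rend I ?k) m2"
    using ls_gap qd_ends[OF k] qd_rl[OF x(1,2)] by metis
  have "S (m1 + m2)" by (rule S_nd) (rule wdefs m)+
  moreover have "gap (lend I ?k) (rl x) (m1 + m2)" "gap (rl x) (rend I ?k) (m1 + m2)"
    by (rule gap_mono[OF m(2)], simp, rule gap_mono[OF m(4)], simp)
  ultimately show ?thesis by blast
qed

text \<open>The limit \<open>x\<close> of the dyadic intervals lies in the interval \<open>k\<close>
  selected by \<open>g\<close> with a positive margin. Once the dyadic interval is short against
  this margin and the level exceeds \<open>k\<close>, that interval is visible.\<close>

lemma dies:
  assumes a: "bin \<alpha>" "W T1 \<alpha>"
  shows "\<exists>n. S n \<and> \<not> alive I g \<alpha> n"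
proof (rule ccontr)
  assume "\<not> ?thesis"
  then have al: "\<And>n. S n \<Longrightarrow> alive I g \<alpha> n" by blast
  define x where "x = ln (\<lambda>m. lcode \<alpha> (m + 1))"
  have aD: "\<alpha> \<in> D T1" using a(1) by blast
  have n: "nd [Nat] (\<lambda>e. lcode \<alpha> (nv (e 0) + 1))" by (rule cdefs nd_var wd_con aD a(2) | simp)+
  have "df [] T1 (\<lambda>e. x)" unfolding x_def by (rule df_ln[where h = "\<lambda>m e. lcode \<alpha> (m + 1)"]) (rule n)
  then have xW: "x \<in> D T1" "W T1 x" by (auto dest: df_W0)
  have rx: "rl x m = lq \<alpha> (m + 1)" for m unfolding x_def rl_def
    using ln_fa[where h = "\<lambda>m e. lcode \<alpha> (m + 1)" and \<Gamma> = "[]" and e = undefined] n by simp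
  have b: "lq \<alpha> m \<le> rl x (m + i) \<and> rl x (m + i) \<le> uq \<alpha> m" for m i
    unfolding rx using lq_mono[OF a(1), of m "m + i + 1"] lq_le_uq[of \<alpha> "m + i + 1"]
    by (auto simp: add.assoc)
  have "un S (rl x)"
  proof -
    have "\<bar>rl x m - rl x (m + i)\<bar> < eps m" for m i
    proof -
      have "lq \<alpha> (m + 1) \<le> rl x (m + i)" "rl x (m + i) \<le> uq \<alpha> (m + 1)"
        unfolding rx using lq_mono[OF a(1), of "m + 1" "m + i + 1"] lq_le_uq[of \<alpha> "m + i + 1"] by auto
      then show ?thesis using eps_pos(1)[of m] unfolding rx[of m] uq_lq eps_s abs_less_iff by linarith
    qed
    moreover have "0 \<le> rl x m \<and> rl x m \<le> 1" for m using b[of 0 m] lq_unit[OF a(1), of 0] by auto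
    ultimately show ?thesis by (intro un_intro) (simp_all add: isr_def)
  qed
  note xun = this
  define k where "k = nv (g \<bullet> x)"
  obtain m where m: "S m" "gap (lend I k) (rl x) m" "gap (rl x) (rend I k) m"
    using honest_gap[OF xW xun] unfolding k_def by blast
  have k: "S k" unfolding k_def using S_g xW by blast
  \<comment> \<open>At least \<open>m\<close> for the margin of the certificate, and beyond
    \<open>k\<close> so that interval \<open>k\<close> is among those inspected.\<close>
  define M where "M = m + k + 1"
  have M: "S M" unfolding M_def by (rule S_nd) (rule wdefs m k)+
  have "isr S (lend I k)" "isr S (rend I k)" "isr S (rl x)" using ivl k xun by (auto simp: ivls_def un_def)
  then have "4 * eps M < rl x M - lend I k M" "4 * eps M < rend I k M - rl x M"
    using gap_far[OF m(2) _ _ M] gap_far[OF m(3) _ _ M] unfolding M_def by (simp_all add: add.assoc)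
  moreover have "lq \<alpha> M \<le> rl x M" "rl x M \<le> uq \<alpha> M" using b[of M 0] by auto
  ultimately have "vis I \<alpha> M k" unfolding vis_def using uq_lq[of \<alpha> M] eps_pos(1)[of M] by simp
  moreover have "k < M" unfolding M_def by (simp add: add.assoc add.left_commute[of m] add_nonneg_pos)
  ultimately show False using al[OF M] unfolding alive_def by blast
qed

text \<open>As \<open>x\<close> may lie outside the world, everything is compared at one stage
  \<open>M\<close> chosen beforehand. At that stage every candidate in question sits inside its
  selected interval with a margin of \<open>4 * eps M\<close>, while \<open>2 * eps M\<close> is
  enough to place \<open>x\<close> in an interval.\<close>

lemma covers:
  assumes k: "S k" and dead: "\<And>\<alpha>. bin \<alpha> \<Longrightarrow> \<exists>t\<le>k. \<not> alive I g \<alpha> t" and x: "x \<in> D T1" "un S (rl x)"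
  shows "\<exists>n\<le>k. inI S x I n"
proof -
  \<comment> \<open>The search bound is exclusive; \<open>k + 1\<close> lets a death at level
    \<open>k\<close> itself be found.\<close>
  define lev where "lev = (\<lambda>a. dth I g (dig a k) (k + 1))"
  define p where "p = (\<lambda>a j. yh I (dig a k) (lev a) j)"
  have nd_lev: "nd \<Gamma> f \<Longrightarrow> nd \<Gamma> (\<lambda>e. lev (f e))" for \<Gamma> f
    unfolding lev_def by (rule cdefs nd_const wd_con I g k | assumption)+
  have df_p: "nd \<Gamma> f \<Longrightarrow> nd \<Gamma> h \<Longrightarrow> df \<Gamma> T1 (\<lambda>e. p (f e) (h e))" for \<Gamma> f h
    unfolding p_def by (rule cdefs nd_lev nd_const wd_con I g k | assumption)+
  have pD: "p a j \<in> D T1" for a j unfolding p_def by (rule yh_D) (use I in auto)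
  have pW: "W T1 (p a j)" if "S a" "S j" for a j
    by (rule W_nd) (rule df_p nd_const that)+
  have pun: "un S (rl (p a j))" if "S j" for a j unfolding p_def by (rule yh_un) (use that in auto)
  define Q where "Q = (\<lambda>q m. let y = p (pr1 q) (pr2 q); i = nv (g \<bullet> y) in
    gap (lend I i) (rl y) m \<and> gap (rl y) (rend I i) m)"
  have "bd [Nat, Nat] (\<lambda>e. Q (nv (e 1)) (nv (e 0)))"
    unfolding Q_def Let_def
    by (rule bd_conj bd_gap[where X = "\<lambda>n e. lend I (nv (g \<bullet> p (pr1 (nv (e 1))) (pr2 (nv (e 1))))) n"
          and Y = "\<lambda>n e. rl (p (pr1 (nv (e 1))) (pr2 (nv (e 1)))) n"]
        bd_gap[where Y = "\<lambda>n e. rend I (nv (g \<bullet> p (pr1 (nv (e 1))) (pr2 (nv (e 1))))) n"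
          and X = "\<lambda>n e. rl (p (pr1 (nv (e 1))) (pr2 (nv (e 1)))) n"]
        qd_real df_p nd_pr nd_var nd_ap[of _ T1] wd_con I g | simp)+
  moreover have "\<exists>m. S m \<and> Q q m" if q: "S q" for q
  proof -
    have "S (pr1 q)" "S (pr2 q)" by ((rule S_nd), (rule wdefs q)+)+
    then show ?thesis unfolding Q_def Let_def using honest_gap[OF pD pW pun] by blast
  qed
  ultimately obtain f where f: "nd [Nat] (\<lambda>e. f (nv (e 0)))" "\<And>q. S q \<Longrightarrow> Q q (f q)"
    using AC_num[of Q] by blast
  have nd_f: "nd \<Gamma> h \<Longrightarrow> nd \<Gamma> (\<lambda>e. f (h e))" for \<Gamma> h
    using nd_subst[OF f(1), of \<Gamma> "\<lambda>e _. rv (h e)"] by (simp add: df_rv)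
  define B where "B = (\<lambda>a. bsum (k + 1) (\<lambda>j. f (pr a j)))"
  have nd_B: "nd \<Gamma> h \<Longrightarrow> nd \<Gamma> (\<lambda>e. B (h e))" for \<Gamma> h
    unfolding B_def by (rule nd_bsum[where f = "\<lambda>j e. f (pr (h e) j)"]) (rule nd_f wdefs nd_weak nd_var k | assumption | simp)+
  \<comment> \<open>The double sum dominates the stages of the certificates of all candidates. The
    summand \<open>k + 2\<close> makes \<open>4 * eps M\<close> at most the length of every dyadic
    interval of level at most \<open>k\<close>.\<close>
  define M where "M = k + 2 + bsum (p2 k) B"
  have M: "S M" unfolding M_def
    by (rule S_nd) (rule wdefs k nd_bsum[where f = "\<lambda>a e. B a"] nd_B nd_var | simp)+
  have fd_f: "fd (\<lambda>j. f (pr a j))" for a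
    by (rule pd_D(2)) (rule adefs3 nd_fd[OF pd_D(2)[OF wd_mono[of W "[Nat]" Nat "\<lambda>e. rv (f (nv (e 0)))" "\<lambda>_ _. True", folded nd_def A.nd_def]], OF f(1)] | simp)+
  have fd_B: "fd B"
    by (rule pd_D(2)) (rule wd_mono[of W "[Nat]" Nat "\<lambda>e. rv (B (nv (e 0)))" "\<lambda>_ _. True", folded nd_def A.nd_def]; (rule nd_B nd_var | simp)+)
  have fM: "f (pr a j) \<le> M" if "a < p2 k" "j \<le> k" for a j
  proof -
    have "f (pr a j) \<le> B a" unfolding B_def using bsum_ge[OF fd_f] that(2) by simp
    also have "\<dots> \<le> bsum (p2 k) B" by (rule bsum_ge[OF fd_B that(1)])
    also have "\<dots> \<le> M" unfolding M_def by simp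
    finally show ?thesis .
  qed
  define q where "q = rl x M"
  have q: "- 2 * eps M \<le> q" "q \<le> 1 + 2 * eps M" using un_bounds[OF x(2) M] by (auto simp: q_def)
  have xr: "isr S (rl x)" using x(2) by (simp add: un_def)
  have "\<exists>a<p2 k. qn a * eps k \<le> q + 2 * eps M \<and> q \<le> (qn a + 1) * eps k + 2 * eps M"
  proof -
    \<comment> \<open>The least \<open>a\<close> whose interval ends to the right of
      \<open>q\<close>; the second disjunct stops the search at the last interval, in case
      \<open>q\<close> exceeds 1 within the tolerance.\<close>
    let ?P = "\<lambda>a. q < (qn a + 1) * eps k \<or> p2 k \<le> a + 1"
    have "pd ?P" unfolding q_def by (rule pd_D) (rule A.qdefs A.nd_const wd_con x nd_var | simp)+
    moreover have "?P (p2 k)" by (simp add: nn_le_step)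
    ultimately obtain a where a: "?P a" "\<forall>b<a. \<not> ?P b" using least[of ?P "p2 k"] by blast
    have "a < p2 k"
    proof (cases "a = 0")
      case False
      then obtain b where "a = b + 1" using nn_cases by blast
      then show ?thesis using a(2) by (auto simp: not_le)
    qed simp
    moreover have "qn a * eps k \<le> q + 2 * eps M"
    proof (cases "a = 0")
      case False
      then obtain b where b: "a = b + 1" using nn_cases by blast
      then have "(qn b + 1) * eps k \<le> q" using a(2) by (auto simp: not_less)
      then show ?thesis using eps_pos(1)[of M] unfolding b qn_simps by linarith
    qed (use q in simp)
    moreover have "q \<le> (qn a + 1) * eps k + 2 * eps M"
    proof (cases "q < (qn a + 1) * eps k")
      case False
      then have "p2 k = a + 1" using a(1) \<open>a < p2 k\<close> by (auto simp: nn_less_iff)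
      then have "(qn a + 1) * eps k = qn (p2 k) * eps k" by simp
      also have "\<dots> = 1" using qn_less[of 0 "p2 k"] by (simp add: eps_def)
      finally show ?thesis using q by simp
    qed (use eps_pos(1)[of M] in linarith)
    ultimately show ?thesis by blast
  qed
  then obtain a where a: "a < p2 k" "qn a * eps k \<le> q + 2 * eps M" "q \<le> (qn a + 1) * eps k + 2 * eps M" by blast
  define \<alpha> where "\<alpha> = dig a k"
  have \<alpha>: "bin \<alpha>" unfolding \<alpha>_def by simp
  have "lq \<alpha> k = qn a * eps k" "uq \<alpha> k = (qn a + 1) * eps k"
    unfolding \<alpha>_def lq_def uq_def using dy_dig[OF a(1)] by simp_all
  note a' = a(2,3)[folded this]
  define N where "N = lev a"
  note Pd = pd_alive[OF I(1) g(1) \<alpha>[THEN conjunct1]]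
  obtain t where t: "t \<le> k" "\<not> alive I g \<alpha> t" using dead[OF \<alpha>] by blast
  have Nk: "N \<le> k" "\<not> alive I g \<alpha> N"
    unfolding N_def lev_def dth_def \<alpha>_def[symmetric] using bmin_le[OF Pd t(2), of "k + 1"] bmin_P[OF Pd t(2), of "k + 1"] t(1)
    by (auto intro: order_trans)
  have lN: "lq \<alpha> N \<le> q + 2 * eps M" "q \<le> uq \<alpha> N + 2 * eps M" using lq_mono[OF \<alpha> Nk(1)] a' by auto
  have MN: "N + 2 \<le> M" using Nk(1) qn_ge_0[of "bsum (p2 k) B"] unfolding M_def to_qn by linarith
  have N0: "N \<le> M" using MN by (meson le_add_same_cancel1 nn_ge_0 order_trans)
  have "4 * eps (N + 2) = eps N" using eps_s[of "N + 1"] eps_s[of N] by (simp add: add.assoc)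
  then have e4: "4 * eps M \<le> eps N" using eps_mono[OF MN] by simp
  have res: "inI S x I i" if "S i" "2 * eps M < q - lend I i M" "2 * eps M < rend I i M - q" for i
    unfolding inI_def ls_def using that M q_def by blast
  show ?thesis
  proof (cases "\<exists>j<N. vis I \<alpha> N j")
    case True
    then obtain j where j: "j < N" "vis I \<alpha> N j" by blast
    have "j \<le> k" using j(1) Nk(1) by simp
    have Sj: "S j" using W_le[OF k \<open>j \<le> k\<close>] .
    have "\<bar>lend I j N - lend I j M\<bar> < eps N" "\<bar>rend I j N - rend I j M\<bar> < eps N"
      using isr_le[OF _ M N0] ivl Sj unfolding ivls_def by blast+
    then have "2 * eps M < q - lend I j M" "2 * eps M < rend I j M - q"
      using j(2) lN e4 eps_pos(1)[of M] unfolding vis_def by linarith+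
    then show ?thesis using res[OF Sj] \<open>j \<le> k\<close> by blast
  next
    case False
    then have gN: "nv (g \<bullet> p a j) < N" if "j \<le> N" for j
      using Nk(2) that unfolding alive_def p_def N_def[symmetric] \<alpha>_def[symmetric] by (meson not_le)
    \<comment> \<open>The candidates that are not to the right of \<open>x\<close>, up to the
      tolerance. The rightmost of them replaces the supremum that the model may lack.\<close>
    let ?E = "\<lambda>j. rl (p a j) M \<le> q + 2 * eps M"
    have pv: "rl (p a j) M = (if j < N then clp (lq \<alpha> N) (uq \<alpha> N) (rend I j M) else lq \<alpha> N)" for j
      unfolding p_def \<alpha>_def[symmetric] N_def[symmetric] using N0[folded not_less] \<alpha> by (simp add: yh_val I)
    have "rl (p a N) M = lq \<alpha> N" by (simp add: pv)
    then have "\<exists>j\<le>N. ?E j" using lN by (intro exI[of _ N]) simp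
    moreover have qp: "A.qd [Nat] (\<lambda>e. rl (p a (nv (e 0))) M)"
      unfolding p_def by (rule A.cdefs A.nd_const A.nd_var wd_con I g | simp)+
    moreover have "A.bd [Nat] (\<lambda>e. ?E (nv (e 0)))"
      unfolding q_def by (rule qp A.bd_qle A.qdefs A.nd_const wd_con x | simp)+
    ultimately obtain j where j: "j \<le> N" "?E j" "\<And>i. i \<le> N \<Longrightarrow> ?E i \<Longrightarrow> rl (p a i) M \<le> rl (p a j) M"
      using qmax[of ?E "\<lambda>j. rl (p a j) M" N] by blast
    have jk: "j \<le> k" using j(1) Nk(1) by simp
    have Sj: "S j" "S a" "S (pr a j)"
    proof -
      have "S (p2 k)" by (rule S_nd) (rule wdefs k)+
      then show "S a" using a(1) W_le by (auto simp: less_imp_le)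
      show "S j" using W_le[OF k jk] .
      show "S (pr a j)" by (rule S_nd) (rule wdefs \<open>S a\<close> \<open>S j\<close>)+
    qed
    define i where "i = nv (g \<bullet> p a j)"
    have iN: "i < N" unfolding i_def by (rule gN[OF j(1)])
    then have ik: "i \<le> k" using Nk(1) by simp
    have Si: "S i" using W_le[OF k ik] .
    have G: "gap (lend I i) (rl (p a j)) (f (pr a j))" "gap (rl (p a j)) (rend I i) (f (pr a j))"
      using f(2)[OF Sj(3)] unfolding Q_def Let_def i_def by auto
    have r: "isr S (lend I i)" "isr S (rend I i)" "isr S (rl (p a j))"
      using ivl Si pun[OF Sj(1)] by (auto simp: ivls_def un_def)
    have G': "4 * eps M < rl (p a j) M - lend I i M" "4 * eps M < rend I i M - rl (p a j) M"
      using gap_far[OF G(1) r(1,3) M fM[OF a(1) jk]] gap_far[OF G(2) r(3,2) M fM[OF a(1) jk]] by auto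
    \<comment> \<open>Otherwise the right end of interval \<open>i\<close>, moved into the dyadic
      interval, is itself a candidate that satisfies \<open>?E\<close>, because
      \<open>i < N\<close>. If it stays unmoved, it is further right than candidate
      \<open>j\<close>, against the choice of \<open>j\<close>. If it is moved to the end
      \<open>uq\<close>, then candidate \<open>j\<close> is at that end as well, and interval
      \<open>i\<close> reaches beyond \<open>x\<close> after all.\<close>
    have "2 * eps M < rend I i M - q"
    proof (rule ccontr)
      assume n: "\<not> 2 * eps M < rend I i M - q"
      have lu: "lq \<alpha> N \<le> uq \<alpha> N" by (simp add: uq_lq)
      have pj: "lq \<alpha> N \<le> rl (p a j) M" unfolding pv using clp_bounds[OF lu] by simp
      have "\<not> rend I i M \<le> lq \<alpha> N" using pj G'(2) eps_pos(1)[of M] by linarith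
      then have pi: "rl (p a i) M = (if uq \<alpha> N \<le> rend I i M then uq \<alpha> N else rend I i M)"
        using iN unfolding pv[of i] clp_def by simp
      have "rl (p a i) M \<le> rend I i M" unfolding pi by simp
      then have "?E i" using n by linarith
      then have le: "rl (p a i) M \<le> rl (p a j) M" using iN by (intro j(3)) simp_all
      have "rl (p a i) M = uq \<alpha> N \<or> rl (p a i) M = rend I i M" unfolding pi by simp
      then show False using le G'(2) n lN eps_pos(1)[of M] by (elim disjE) linarith+
    qed
    then have "inI S x I i" using G'(1) j(2) eps_pos(1)[of M] by (intro res[OF Si]) linarith+
    then show ?thesis using ik by blast
  qed
qed

end

context wac
begin

text \<open>Being a real number in the unit interval is not a decidable property, so choice is
  applied to all sequences: \<open>q\<close> either codes an interval together with the stage of a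
  certificate, or bounds a witness that \<open>x\<close> is no such real. At points of the unit
  interval the second alternative is excluded.\<close>

lemma honest_ex:
  assumes I: "I \<in> D (Nat \<rightarrow>\<^sub>t T1)" "W (Nat \<rightarrow>\<^sub>t T1) I" and ivl: "ivls I"
    and cov: "\<forall>x\<in>D T1. W T1 x \<longrightarrow> un S (rl x) \<longrightarrow> (\<exists>n. S n \<and> inI S x I n)"
  shows "\<exists>g. cover W I g"
proof -
  define Q where "Q = (\<lambda>x q. (gap (lend I (pr1 q)) (rl x) (pr2 q) \<and> gap (rl x) (rend I (pr1 q)) (pr2 q)) \<or>
    (\<exists>n\<le>q. \<exists>i\<le>q. \<not> \<bar>rl x n - rl x (n + i)\<bar> < eps n) \<or> (\<exists>n\<le>q. 2 * eps n < 0 - rl x n) \<or>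
    (\<exists>n\<le>q. 2 * eps n < rl x n - 1))"
  have "bd [Nat, T1] (\<lambda>e. Q (e 1) (nv (e 0)))"
    unfolding Q_def
    by (rule bd_disj bd_conj bd_gap[where X = "\<lambda>n e. lend I (pr1 (nv (e 0))) n" and Y = "\<lambda>n e. rl (e 1) n"]
        bd_gap[where X = "\<lambda>n e. rl (e 1) n" and Y = "\<lambda>n e. rend I (pr1 (nv (e 0))) n"]
        bd_exle[where P = "\<lambda>n e. \<exists>i\<le>nv (e 0). \<not> \<bar>rl (e 1) n - rl (e 1) (n + i)\<bar> < eps n"]
        bd_exle[where P = "\<lambda>i e. \<not> \<bar>rl (e 2) (nv (e 0)) - rl (e 2) (nv (e 0) + i)\<bar> < eps (nv (e 0))"]
        bd_exle[where P = "\<lambda>n e. 2 * eps n < 0 - rl (e 1) n"]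
        bd_exle[where P = "\<lambda>n e. 2 * eps n < rl (e 1) n - 1"]
        qdefs nd_var wd_con wd_var I | simp add: numeral_2_eq_2)+
  moreover have "\<exists>q. S q \<and> Q x q" if x: "x \<in> D T1" "W T1 x" for x
  proof -
    consider "un S (rl x)" | n i where "S n" "S i" "\<not> \<bar>rl x n - rl x (n + i)\<bar> < eps n"
      | n where "S n" "2 * eps n < 0 - rl x n" | n where "S n" "2 * eps n < rl x n - 1"
      unfolding un_def isr_def ls_def by blast
    then show ?thesis
    proof cases
      case 1
      then obtain k where k: "S k" "inI S x I k" using cov x by blast
      have q: "qd [] (\<lambda>e. lend I k n)" "qd [] (\<lambda>e. rend I k n)" "qd [] (\<lambda>e. rl x n)" if "S n" for n
        by (rule qd_real wd_con I x nd_const k that)+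
      obtain m1 m2 where m: "S m1" "gap (lend I k) (rl x) m1" "S m2" "gap (rl x) (rend I k) m2"
        using k(2) ls_gap q unfolding inI_def by metis
      have "gap (lend I k) (rl x) (m1 + m2)" "gap (rl x) (rend I k) (m1 + m2)"
        by (rule gap_mono[OF m(2)], simp, rule gap_mono[OF m(4)], simp)
      then have "Q x (pr k (m1 + m2))" unfolding Q_def by simp
      moreover have "S (pr k (m1 + m2))" by (rule S_nd) (rule wdefs m k)+
      ultimately show ?thesis by blast
    next
      case (2 n i)
      have "S (n + i)" by (rule S_nd) (rule wdefs 2)+
      moreover have "\<exists>n'\<le>n + i. \<exists>i'\<le>n + i. \<not> \<bar>rl x n' - rl x (n' + i')\<bar> < eps n'"
        using 2(3) by (intro exI[of _ n] conjI exI[of _ i]) auto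
      then have "Q x (n + i)" unfolding Q_def by blast
      ultimately show ?thesis by blast
    next
      case (3 n)
      then have "Q x n" unfolding Q_def by blast
      then show ?thesis using 3 by blast
    next
      case (4 n)
      then have "Q x n" unfolding Q_def by blast
      then show ?thesis using 4 by blast
    qed
  qed
  ultimately obtain h where h: "h \<in> D T2" "W T2 h" "\<And>x. x \<in> D T1 \<Longrightarrow> W T1 x \<Longrightarrow> Q x (nv (h \<bullet> x))"
    using AC[of Q] by auto
  define g where "g = lamv T1 Nat (\<lambda>x. rv (pr1 (nv (h \<bullet> x))))"
  have 1: "df [T1] Nat (\<lambda>e. rv (pr1 (nv (h \<bullet> e 0))))"
    by (rule df_rv nd_pr nd_ap wd_con h wd_var | simp)+
  have 2: "df [] T2 (\<lambda>e. g)" unfolding g_def by (rule df_lam[where h = "\<lambda>x e. rv (pr1 (nv (h \<bullet> x)))"]) (rule 1)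
  have gx: "nv (g \<bullet> x) = pr1 (nv (h \<bullet> x))" if "x \<in> D T1" for x
    using df_lam_ap[where h = "\<lambda>x e. rv (pr1 (nv (h \<bullet> x)))" and \<Gamma> = "[]" and e = undefined, OF 1] that
    unfolding g_def by simp
  have "inI S x I (nv (g \<bullet> x))" if x: "x \<in> D T1" "W T1 x" "un S (rl x)" for x
  proof -
    let ?q = "nv (h \<bullet> x)"
    have q: "S ?q" by (rule S_ap) (use h x in auto)
    have "Q x ?q" using h(3) x by blast
    moreover have "\<not> (\<exists>n\<le>?q. \<exists>i\<le>?q. \<not> \<bar>rl x n - rl x (n + i)\<bar> < eps n)"
      "\<not> (\<exists>n\<le>?q. 2 * eps n < 0 - rl x n)" "\<not> (\<exists>n\<le>?q. 2 * eps n < rl x n - 1)"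
      using x(3) W_le[OF q] unfolding un_def isr_def ls_def by blast+
    ultimately have "gap (lend I (pr1 ?q)) (rl x) (pr2 ?q)" "gap (rl x) (rend I (pr1 ?q)) (pr2 ?q)"
      unfolding Q_def by blast+
    moreover have "S (pr2 ?q)" by (rule S_nd) (rule wdefs q)+
    ultimately show ?thesis unfolding inI_def gx[OF x(1)] using gap_ls by blast
  qed
  then have "cover W I g" using I ivl df_W0[OF 2] by unfold_locales auto
  then show ?thesis by blast
qed

end

context cover
begin

lemma tree_W: "ctree I g \<in> D T1" "W T1 (ctree I g)" "cbnd I g \<in> D T2" "W T2 (cbnd I g)"
proof -
  have "df [] T1 (\<lambda>e. ctree I g)" "df [] T2 (\<lambda>e. cbnd I g)" by (rule df_ctree df_cbnd wd_con I g)+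
  then show "ctree I g \<in> D T1" "W T1 (ctree I g)" "cbnd I g \<in> D T2" "W T2 (cbnd I g)" by (auto dest: df_W0)
qed

lemma dies_bit: "\<alpha> \<in> D T1 \<Longrightarrow> W T1 \<alpha> \<Longrightarrow> \<exists>n. S n \<and> \<not> alive I g (bit \<alpha>) n"
  by (rule dies) (simp, rule W_nd, (rule wdefs | assumption)+)

lemma covd_covers: "S k \<Longrightarrow> covd (ctree I g) k \<Longrightarrow> x \<in> D T1 \<Longrightarrow> un S (rl x) \<Longrightarrow> \<exists>n\<le>k. inI S x I n"
  by (rule covers) (use covdD[of "ctree I g" k] ctree_out[OF I(1) g(1)] in auto)

end

context wac
begin

text \<open>The final quantifier ranges over all \<open>x\<close> of the model that are points in
  the sense of the world. In the standard world this contains both the relativised lemma and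
  \<open>HBs\<close>.\<close>

lemma FANp_covers:
  assumes F: FANp and I: "I \<in> D (Nat \<rightarrow>\<^sub>t T1)" "W (Nat \<rightarrow>\<^sub>t T1) I" and ivl: "ivls I"
    and cov: "\<forall>x\<in>D T1. W T1 x \<longrightarrow> un S (rl x) \<longrightarrow> (\<exists>n. S n \<and> inI S x I n)"
  shows "\<exists>k. S k \<and> (\<forall>x\<in>D T1. un S (rl x) \<longrightarrow> (\<exists>n\<le>k. inI S x I n))"
proof -
  obtain g where "cover W I g" using honest_ex[OF I ivl cov] by blast
  then interpret cover W I g .
  have "\<exists>n. S n \<and> out (ctree I g) (bit \<alpha>) n" if "\<alpha> \<in> D T1" "W T1 \<alpha>" for \<alpha>
    using dies_bit[OF that] ctree_out[OF I(1) g(1), of "bit \<alpha>"] that by auto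
  then obtain k where "S k" "covd (ctree I g) k" using F tree_W unfolding FANp_def by blast
  then show ?thesis using covd_covers by blast
qed

lemma FANp_HBw: "FANp \<Longrightarrow> HBw"
  unfolding HBw_def using FANp_covers by metis

lemma FANp_HBs: "FANp \<Longrightarrow> HBs"
  unfolding HBs_def
proof (intro ballI impI)
  fix I assume *: FANp "I \<in> D (Nat \<rightarrow>\<^sub>t T1)" "W (Nat \<rightarrow>\<^sub>t T1) I" "ivls I"
    "\<forall>x\<in>D T1. W T1 x \<longrightarrow> un S (rl x) \<longrightarrow> (\<exists>n. S n \<and> inI S x I n)"
  obtain k where k: "S k" "\<forall>x\<in>D T1. un S (rl x) \<longrightarrow> (\<exists>n\<le>k. inI S x I n)" using FANp_covers[OF *] by blast
  have "\<exists>n\<le>k. inI (\<lambda>_. True) x I n" if "x \<in> D T1" "un (\<lambda>_. True) (rl x)" for x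
    using k(2) that un_anti[OF that(2), of S] ls_mono[of S _ _ "\<lambda>_. True"] unfolding inI_def by blast
  then show "\<exists>k. S k \<and> (\<forall>x\<in>D T1. un (\<lambda>_. True) (rl x) \<longrightarrow> (\<exists>n\<le>k. inI (\<lambda>_. True) x I n))" using k(1) by blast
qed

text \<open>Tree and bound are definable from \<open>I\<close> and \<open>g\<close> without further
  constants, so the required functional is \<open>\<Psi>\<close> composed with these two
  constructions.\<close>

lemma UFAN_UHBw: "UFAN \<Longrightarrow> UHBw"
proof -
  assume UFAN
  then obtain \<Psi> where \<Psi>: "\<Psi> \<in> D (T1 \<rightarrow>\<^sub>t T2 \<rightarrow>\<^sub>t Nat)" "W (T1 \<rightarrow>\<^sub>t T2 \<rightarrow>\<^sub>t Nat) \<Psi>"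
    "\<And>T h. T \<in> D T1 \<Longrightarrow> W T1 T \<Longrightarrow> h \<in> D T2 \<Longrightarrow> W T2 h \<Longrightarrow> (\<forall>\<alpha>\<in>D T1. W T1 \<alpha> \<longrightarrow> out T (bit \<alpha>) (nv (h \<bullet> \<alpha>))) \<Longrightarrow>
      covd T (nv (\<Psi> \<bullet> T \<bullet> h))"
    unfolding UFAN_def by blast
  define H where "H = lamv (Nat \<rightarrow>\<^sub>t T1) (T2 \<rightarrow>\<^sub>t Nat) (\<lambda>I. lamv T2 Nat (\<lambda>g. \<Psi> \<bullet> ctree I g \<bullet> cbnd I g))"
  have 1: "df [T2, Nat \<rightarrow>\<^sub>t T1] Nat (\<lambda>e. \<Psi> \<bullet> ctree (e 1) (e 0) \<bullet> cbnd (e 1) (e 0))"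
    by (rule wd_ap[of W _ T2] wd_ap[of W _ T1] wd_con \<Psi> df_ctree df_cbnd wd_var | simp)+
  have 2: "df [Nat \<rightarrow>\<^sub>t T1] (T2 \<rightarrow>\<^sub>t Nat) (\<lambda>e. lamv T2 Nat (\<lambda>g. \<Psi> \<bullet> ctree (e 0) g \<bullet> cbnd (e 0) g))"
    by (rule df_lam[where h = "\<lambda>g e. \<Psi> \<bullet> ctree (e 0) g \<bullet> cbnd (e 0) g"]) (use 1 in simp)
  have 3: "df [] ((Nat \<rightarrow>\<^sub>t T1) \<rightarrow>\<^sub>t T2 \<rightarrow>\<^sub>t Nat) (\<lambda>e. H)" unfolding H_def
    by (rule df_lam[where h = "\<lambda>I e. lamv T2 Nat (\<lambda>g. \<Psi> \<bullet> ctree I g \<bullet> cbnd I g)"]) (rule 2)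
  have H: "H \<bullet> I \<bullet> g = \<Psi> \<bullet> ctree I g \<bullet> cbnd I g" if "I \<in> D (Nat \<rightarrow>\<^sub>t T1)" "g \<in> D T2" for I g
  proof -
    have "H \<bullet> I = lamv T2 Nat (\<lambda>g. \<Psi> \<bullet> ctree I g \<bullet> cbnd I g)" unfolding H_def
      using df_lam_ap[where h = "\<lambda>I e. lamv T2 Nat (\<lambda>g. \<Psi> \<bullet> ctree I g \<bullet> cbnd I g)" and \<Gamma> = "[]" and e = undefined, OF 2]
        that(1) by simp
    then show ?thesis
      using df_lam_ap[where h = "\<lambda>g e. \<Psi> \<bullet> ctree (e 0) g \<bullet> cbnd (e 0) g" and \<Gamma> = "[Nat \<rightarrow>\<^sub>t T1]" and e = "I ## undefined"]
        1 that by simp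
  qed
  have "\<exists>n\<le>nv (H \<bullet> I \<bullet> g). inI S x I n"
    if *: "I \<in> D (Nat \<rightarrow>\<^sub>t T1)" "W (Nat \<rightarrow>\<^sub>t T1) I" "g \<in> D T2" "W T2 g" "ivls I"
      "\<forall>x\<in>D T1. W T1 x \<longrightarrow> un S (rl x) \<longrightarrow> inI S x I (nv (g \<bullet> x))" and x: "x \<in> D T1" "un S (rl x)" for I g x
  proof -
    interpret cover W I g using * by unfold_locales auto
    have "covd (ctree I g) (nv (\<Psi> \<bullet> ctree I g \<bullet> cbnd I g))"
      by (rule \<Psi>(3)) (use tree_W dies_bit dead_bound[OF *(1,3)] in blast)+
    moreover have "S (nv (\<Psi> \<bullet> ctree I g \<bullet> cbnd I g))"
      by (rule S_nd) (rule nd_ap[of _ T2] wd_ap[of W _ T1] wd_con \<Psi> tree_W)+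
    ultimately show ?thesis unfolding H[OF *(1,3)] using covd_covers x by blast
  qed
  then show UHBw unfolding UHBw_def using df_W0[OF 3] by blast
qed

lemma UHBw_HBw: "UHBw \<Longrightarrow> HBw"
  unfolding HBw_def
proof (intro ballI impI)
  fix I assume U: UHBw and I: "I \<in> D (Nat \<rightarrow>\<^sub>t T1)" "W (Nat \<rightarrow>\<^sub>t T1) I" "ivls I"
    "\<forall>x\<in>D T1. W T1 x \<longrightarrow> un S (rl x) \<longrightarrow> (\<exists>n. S n \<and> inI S x I n)"
  obtain g where "cover W I g" using honest_ex[OF I] by blast
  then interpret cover W I g .
  obtain H where H: "H \<in> D ((Nat \<rightarrow>\<^sub>t T1) \<rightarrow>\<^sub>t T2 \<rightarrow>\<^sub>t Nat)" "W ((Nat \<rightarrow>\<^sub>t T1) \<rightarrow>\<^sub>t T2 \<rightarrow>\<^sub>t Nat) H"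
    and H': "\<forall>I\<in>D (Nat \<rightarrow>\<^sub>t T1). W (Nat \<rightarrow>\<^sub>t T1) I \<longrightarrow> (\<forall>g\<in>D T2. W T2 g \<longrightarrow> ivls I \<longrightarrow>
       (\<forall>x\<in>D T1. W T1 x \<longrightarrow> un S (rl x) \<longrightarrow> inI S x I (nv (g \<bullet> x))) \<longrightarrow>
       (\<forall>x\<in>D T1. W T1 x \<longrightarrow> un S (rl x) \<longrightarrow> (\<exists>n\<le>nv (H \<bullet> I \<bullet> g). inI S x I n)))"
    using U unfolding UHBw_def by (elim bexE conjE)
  have h: "\<forall>x\<in>D T1. W T1 x \<longrightarrow> un S (rl x) \<longrightarrow> inI S x I (nv (g \<bullet> x))" using honest by blast
  note H3 = H'[THEN bspec, OF I(1), THEN mp, OF I(2), THEN bspec, OF g(1), THEN mp, OF g(2), THEN mp, OF ivl, THEN mp, OF h]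
  have "S (nv (H \<bullet> I \<bullet> g))" by (rule S_nd) (rule nd_ap[of _ T2] wd_ap[of W _ "Nat \<rightarrow>\<^sub>t T1"] wd_con H I g)+
  then show "\<exists>k. S k \<and> (\<forall>x\<in>D T1. W T1 x \<longrightarrow> un S (rl x) \<longrightarrow> (\<exists>n\<le>k. inI S x I n))" using H3 by blast
qed

end

subsection \<open>Coding a tree and a bound by one functional\<close>

context cx
begin

text \<open>Transfer is available for a single variable; hence tree and bound travel as one
  functional. The value of the argument at 0 is a tag: with tag 0 the value at 1 is passed to
  \<open>T\<close>, otherwise the shifted sequence is passed to \<open>h\<close>.\<close>

definition cT :: "tm \<Rightarrow> tm" where "cT f = ln (\<lambda>n. nv (f \<bullet> ln (\<lambda>i. if i = 0 then 0 else n)))"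
definition cH :: "tm \<Rightarrow> tm" where "cH f = lamv T1 Nat (\<lambda>\<alpha>. f \<bullet> ln (\<lambda>i. if i = 0 then 1 else \<alpha> \<odot> (i - 1)))"
definition sh :: "tm \<Rightarrow> tm" where "sh x = ln (\<lambda>i. x \<odot> (i + 1))"
definition cc :: "tm \<Rightarrow> tm \<Rightarrow> tm" where
  "cc T h = lamv T1 Nat (\<lambda>x. rv (if x \<odot> 0 = 0 then T \<odot> (x \<odot> 1) else nv (h \<bullet> sh x)))"

end

context wcx
begin

lemma df_pre: "nd \<Gamma> n \<Longrightarrow> df \<Gamma> T1 (\<lambda>e. ln (\<lambda>i. if i = 0 then 0 else n e))"
  "df \<Gamma> T1 \<alpha> \<Longrightarrow> df \<Gamma> T1 (\<lambda>e. ln (\<lambda>i. if i = 0 then 1 else \<alpha> e \<odot> (i - 1)))"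
   apply (rule df_ln[where h = "\<lambda>i e. if i = 0 then 0 else n e"])
   apply (rule defs nd_weak | assumption | simp)+
  apply (rule df_ln[where h = "\<lambda>i e. if i = 0 then 1 else \<alpha> e \<odot> (i - 1)"])
  apply (rule defs wd_weak | assumption | simp)+
  done

lemma df_cT: "df \<Gamma> T2 f \<Longrightarrow> df \<Gamma> T1 (\<lambda>e. cT (f e))"
  unfolding cT_def
  by (rule df_ln[where h = "\<lambda>n e. nv (f e \<bullet> ln (\<lambda>i. if i = 0 then 0 else n))"])
    (rule nd_ap[of _ T1] df_pre nd_var wd_weak | assumption | simp)+

lemma df_cH: "df \<Gamma> T2 f \<Longrightarrow> df \<Gamma> T2 (\<lambda>e. cH (f e))"
  unfolding cH_def
  by (rule df_lam[where h = "\<lambda>\<alpha> e. f e \<bullet> ln (\<lambda>i. if i = 0 then 1 else \<alpha> \<odot> (i - 1))"])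
    (rule wd_ap[of W _ T1] df_pre wd_weak | assumption | (rule wd_var, simp, simp))+

lemma df_sh: "df \<Gamma> T1 x \<Longrightarrow> df \<Gamma> T1 (\<lambda>e. sh (x e))"
  unfolding sh_def by (rule df_ln[where h = "\<lambda>i e. x e \<odot> (i + 1)"]) (rule defs wd_weak | assumption | simp)+

lemma df_cc: "df \<Gamma> T1 T \<Longrightarrow> df \<Gamma> T2 h \<Longrightarrow> df \<Gamma> T2 (\<lambda>e. cc (T e) (h e))"
  unfolding cc_def
  by (rule df_lam[where h = "\<lambda>x e. rv (if x \<odot> 0 = 0 then T e \<odot> (x \<odot> 1) else nv (h e \<bullet> sh x))"])
    (rule df_rv df_sh defs nd_ap[of _ T1] wd_weak | assumption | (rule wd_var, simp, simp))+

lemmas codefs = df_pre df_cT df_cH df_sh df_cc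

end

context cx
begin

lemma code_D: "f \<in> D T2 \<Longrightarrow> cT f \<in> D T1" "f \<in> D T2 \<Longrightarrow> cH f \<in> D T2" "T \<in> D T1 \<Longrightarrow> h \<in> D T2 \<Longrightarrow> cc T h \<in> D T2"
  "x \<in> D T1 \<Longrightarrow> sh x \<in> D T1"
  using A.df_W0[OF A.df_cT[OF wd_con]] A.df_W0[OF A.df_cH[OF wd_con]] A.df_W0[OF A.df_cc[OF wd_con wd_con]]
    A.df_W0[OF A.df_sh[OF wd_con]] by auto

lemma pre_fd: "fd (\<lambda>i. if i = 0 then 0 else n)"
  "\<alpha> \<in> D T1 \<Longrightarrow> fd (\<lambda>i. if i = 0 then 1 else \<alpha> \<odot> (i - 1))" "\<alpha> \<in> D T1 \<Longrightarrow> fd (\<lambda>i. \<alpha> \<odot> (i + 1))"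
proof -
  show "fd (\<lambda>i. if i = 0 then 0 else n)" by (rule pd_D) (rule adefs3 | simp)+
  show "fd (\<lambda>i. if i = 0 then 1 else \<alpha> \<odot> (i - 1))" if "\<alpha> \<in> D T1" by (rule pd_D) (rule adefs3 that | simp)+
  show "fd (\<lambda>i. \<alpha> \<odot> (i + 1))" if "\<alpha> \<in> D T1" by (rule pd_D) (rule adefs3 that | simp)+
qed

lemma pre_app: "ln (\<lambda>i. if i = 0 then 0 else n) \<odot> i = (if i = 0 then 0 else n)"
  "\<alpha> \<in> D T1 \<Longrightarrow> ln (\<lambda>i. if i = 0 then 1 else \<alpha> \<odot> (i - 1)) \<odot> i = (if i = 0 then 1 else \<alpha> \<odot> (i - 1))"
  "\<alpha> \<in> D T1 \<Longrightarrow> sh \<alpha> \<odot> i = \<alpha> \<odot> (i + 1)"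
  unfolding sh_def by (rule fd_lnD, erule pre_fd | rule fd_lnD, rule pre_fd)+

lemma pre_D: "ln (\<lambda>i. if i = 0 then 0 else n) \<in> D T1"
  "\<alpha> \<in> D T1 \<Longrightarrow> ln (\<lambda>i. if i = 0 then 1 else \<alpha> \<odot> (i - 1)) \<in> D T1"
  by (rule fd_lnD, erule pre_fd | rule fd_lnD, rule pre_fd)+

lemma sh_pre: "\<alpha> \<in> D T1 \<Longrightarrow> sh (ln (\<lambda>i. if i = 0 then 1 else \<alpha> \<odot> (i - 1))) = \<alpha>"
  by (rule fa_ext) (auto simp: pre_app pre_D code_D)

lemma cT_app: "f \<in> D T2 \<Longrightarrow> cT f \<odot> n = nv (f \<bullet> ln (\<lambda>i. if i = 0 then 0 else n))"
  unfolding cT_def by (rule fd_lnD) (rule pd_D, (rule A.nd_ap[of _ T1] A.codefs adefs3 | simp)+)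

lemma cH_app: "f \<in> D T2 \<Longrightarrow> \<alpha> \<in> D T1 \<Longrightarrow> cH f \<bullet> \<alpha> = f \<bullet> ln (\<lambda>i. if i = 0 then 1 else \<alpha> \<odot> (i - 1))"
  unfolding cH_def
  by (rule A.df_lam_ap[where h = "\<lambda>\<alpha> e. f \<bullet> ln (\<lambda>i. if i = 0 then 1 else \<alpha> \<odot> (i - 1))" and \<Gamma> = "[]" and e = undefined])
    (rule wd_ap[of _ _ T1] A.codefs wd_con wd_var | simp)+

lemma cc_app: "T \<in> D T1 \<Longrightarrow> h \<in> D T2 \<Longrightarrow> x \<in> D T1 \<Longrightarrow>
  cc T h \<bullet> x = rv (if x \<odot> 0 = 0 then T \<odot> (x \<odot> 1) else nv (h \<bullet> sh x))"
  unfolding cc_def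
  by (rule A.df_lam_ap[where h = "\<lambda>x e. rv (if x \<odot> 0 = 0 then T \<odot> (x \<odot> 1) else nv (h \<bullet> sh x))" and \<Gamma> = "[]" and e = undefined])
    (rule A.df_rv A.nd_if A.defs A.nd_ap[of _ T1] A.codefs wd_con | (rule wd_var, simp, simp) | simp)+

lemma code_inv: assumes "T \<in> D T1" "h \<in> D T2" shows "cT (cc T h) = T" "cH (cc T h) = h"
proof -
  show "cT (cc T h) = T"
    by (rule fa_ext) (use assms in \<open>auto simp: cT_app cc_app code_D pre_D pre_app\<close>)
  show "cH (cc T h) = h"
  proof (rule D_ext)
    fix \<alpha> assume a: "\<alpha> \<in> D T1"
    have "rv (nv (h \<bullet> \<alpha>)) = h \<bullet> \<alpha>" using ap_D[OF assms(2) a] by simp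
    then show "cH (cc T h) \<bullet> \<alpha> = h \<bullet> \<alpha>" using a assms by (simp add: cH_app cc_app code_D pre_D pre_app sh_pre)
  qed (use assms code_D in auto)
qed

lemma covd_mono: "covd T k \<Longrightarrow> k \<le> k' \<Longrightarrow> covd T k'"
  using covdD[of T k] out_mono[of T _ k k'] bin_dig unfolding covd_def[of T k'] by blast

lemma Cl_wcx: "wcx Cl"
proof unfold_locales
  fix f x \<sigma> \<tau> assume "f \<in> D (\<sigma> \<rightarrow>\<^sub>t \<tau>)" "x \<in> D \<sigma>" "Cl (\<sigma> \<rightarrow>\<^sub>t \<tau>) f" "Cl \<sigma> x"
  then obtain s t where "ht sp0 [] s (\<sigma> \<rightarrow>\<^sub>t \<tau>)" "f = cval s" "ht sp0 [] t \<sigma>" "x = cval t" unfolding Cl_def by blast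
  then show "Cl \<tau> (f \<bullet> x)" unfolding Cl_def by (intro exI[of _ "App s t"]) (auto simp: cval_def intro: ht_App)
qed

end

sublocale cx \<subseteq> C: wcx Cl
  by (rule Cl_wcx)

context cx
begin

text \<open>With closed terms as the only constants, the characteristic function is denoted by a
  term, and the property becomes an equation without parameters, as transfer requires.\<close>

lemma bd_qdef: "C.bd \<Gamma> P \<Longrightarrow> qdef \<Gamma> P"
proof -
  assume "C.bd \<Gamma> P"
  then have "tdef \<Gamma> Nat (\<lambda>e. rv (bn (P e)))" by (simp add: C.bd_def C.nd_def tdef_wd)
  then have "qdef \<Gamma> (\<lambda>e. rv (bn (P e)) = sc zr)" by (intro qdef_eq tdef_op)
  moreover have "rv (bn P) = sc zr \<longleftrightarrow> P" for P by (simp add: rv_ops(2)[symmetric] Rep_nn_inject)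
  ultimately show ?thesis by simp
qed

lemma qdef_idef: "qdef \<Gamma> P \<Longrightarrow> idef \<Gamma> P"
proof -
  have "qfree \<phi> \<Longrightarrow> internal \<phi>" for \<phi> by (induction \<phi>) auto
  then show "qdef \<Gamma> P \<Longrightarrow> idef \<Gamma> P" unfolding fdef_def by blast
qed

lemma bd_idef: "C.bd \<Gamma> P \<Longrightarrow> idef \<Gamma> P"
  by (rule qdef_idef[OF bd_qdef])

end

subsection \<open>Choice in the two worlds\<close>

context cx
begin

lemma lessv_nv: "i \<in> D Nat \<Longrightarrow> b \<in> D Nat \<Longrightarrow> lessv M0 i b \<longleftrightarrow> nv i < nv b"
proof -
  assume *: "i \<in> D Nat" "b \<in> D Nat"
  have "lessv M0 i b \<longleftrightarrow> mn (sc i) b = zr" by (simp add: lessv_def mn_def cval_def)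
  also have "\<dots> \<longleftrightarrow> nv i + 1 - nv b = 0"
    using * nv_eq_iff[of "mn (sc i) b" zr] by (simp add: nv_ops)
  finally show ?thesis by (simp add: nn_less_iff)
qed

lemma AC_obj_M: "u \<in> D (T1 \<rightarrow>\<^sub>t T1) \<Longrightarrow> (\<And>x. x \<in> D T1 \<Longrightarrow> \<exists>n. u \<bullet> x \<odot> n = 1) \<Longrightarrow>
    \<exists>g\<in>D T2. \<forall>x\<in>D T1. u \<bullet> x \<odot> nv (g \<bullet> x) = 1"
proof -
  assume u: "u \<in> D (T1 \<rightarrow>\<^sub>t T1)" and ex: "\<And>x. x \<in> D T1 \<Longrightarrow> \<exists>n. u \<bullet> x \<odot> n = 1"
  have eq: "u \<bullet> x \<bullet> y = sc zr \<longleftrightarrow> u \<bullet> x \<odot> nv y = 1" if "x \<in> D T1" "y \<in> D Nat" for x y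
    using ap_D[OF ap_D[OF u that(1)] that(2)] that by (simp add: fa_def Rep_nn_inject[symmetric] rv_ops)
  have "qdef [Nat, T1, T1 \<rightarrow>\<^sub>t T1] (\<lambda>e. e 2 \<bullet> e 1 \<bullet> e 0 = sc zr)"
    by (intro qdef_eq tdef_op tdef_ap[of _ Nat] tdef_ap[of _ T1] tdef_var) (simp_all add: numeral_2_eq_2)
  moreover have "\<exists>y\<in>D Nat. u \<bullet> x \<bullet> y = sc zr" if x: "x \<in> D T1" for x
  proof -
    obtain n where "u \<bullet> x \<odot> n = 1" using ex[OF x] by blast
    then show ?thesis using eq[OF x, of "rv n"] by (intro bexI[of _ "rv n"]) auto
  qed
  moreover have "ax_QF_AC T1 Nat \<subseteq> T0" using T by (auto simp: RCA0_Omega_def RCA0_omega_def)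
  ultimately obtain F where F: "F \<in> D T2" "\<forall>x\<in>D T1. u \<bullet> x \<bullet> (F \<bullet> x) = sc zr"
    using qf_choice[of Nat T1 "T1 \<rightarrow>\<^sub>t T1" "\<lambda>y x u. u \<bullet> x \<bullet> y = sc zr" u] u by blast
  then show ?thesis using eq ap_D[OF F(1)] by (intro bexI[of _ F]) auto
qed

text \<open>\<open>HAC\<close> yields a finite sequence of candidates instead of a single one. The
  sum of the weights \<open>w\<close> of its entries dominates the weight of each, and it is built
  by application, hence standard for standard data.\<close>

definition sbd :: "ty \<Rightarrow> tm \<Rightarrow> (tm \<Rightarrow> nn) \<Rightarrow> tm \<Rightarrow> nn" where
  "sbd \<tau> F w x = bsum (nv (Cv M0 (Len \<tau>) \<bullet> (F \<bullet> x))) (\<lambda>i. w (Cv M0 (Nth \<tau>) \<bullet> (F \<bullet> x) \<bullet> rv i))"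

end

context wcx
begin

lemma df_nth:
  assumes "df \<Gamma> (\<rho> \<rightarrow>\<^sub>t Seq \<tau>) F" "df \<Gamma> \<rho> x" "nd \<Gamma> i"
  shows "df \<Gamma> \<tau> (\<lambda>e. Cv M0 (Nth \<tau>) \<bullet> (F e \<bullet> x e) \<bullet> rv (i e))"
  by (rule wd_ap[of W \<Gamma> Nat] wd_ap[of W \<Gamma> "Seq \<tau>"] df_const wd_ap[OF assms(1,2)] df_rv assms | simp)+

lemma nd_sbd:
  assumes F: "df \<Gamma> (\<rho> \<rightarrow>\<^sub>t Seq \<tau>) F" and x: "df \<Gamma> \<rho> x"
    and w: "\<And>\<Gamma> y. df \<Gamma> \<tau> y \<Longrightarrow> nd \<Gamma> (\<lambda>e. w (y e))"
  shows "nd \<Gamma> (\<lambda>e. sbd \<tau> (F e) w (x e))"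
proof -
  have 1: "nd \<Gamma> (\<lambda>e. nv (Cv M0 (Len \<tau>) \<bullet> (F e \<bullet> x e)))"
    by (rule nd_ap[of _ "Seq \<tau>"] df_const wd_ap[OF F x] | simp)+
  have "df (Nat # \<Gamma>) \<tau> (\<lambda>e. Cv M0 (Nth \<tau>) \<bullet> (F (\<lambda>n. e (Suc n)) \<bullet> x (\<lambda>n. e (Suc n))) \<bullet> rv (nv (e 0)))"
    by (rule df_nth[of _ \<rho>]) (rule wd_weak F x nd_var | simp)+
  then show ?thesis unfolding sbd_def
    by (intro nd_bsum[where f = "\<lambda>i e. w (Cv M0 (Nth \<tau>) \<bullet> (F e \<bullet> x e) \<bullet> rv i)"] 1 w) simp
qed

end

context cx
begin

lemma sbd_ge:
  assumes F: "F \<in> D (\<rho> \<rightarrow>\<^sub>t Seq \<tau>)" and x: "x \<in> D \<rho>" and y: "memv \<tau> y (F \<bullet> x)"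
    and w: "\<And>\<Gamma> y. A.df \<Gamma> \<tau> y \<Longrightarrow> A.nd \<Gamma> (\<lambda>e. w (y e))"
  shows "w y \<le> sbd \<tau> F w x"
proof -
  obtain i where i: "i \<in> D Nat" "lessv M0 i (Cv M0 (Len \<tau>) \<bullet> (F \<bullet> x))" "Cv M0 (Nth \<tau>) \<bullet> (F \<bullet> x) \<bullet> i = y"
    using y unfolding memv_def by blast
  have L: "Cv M0 (Len \<tau>) \<bullet> (F \<bullet> x) \<in> D Nat"
    using A.df_W0[OF wd_ap[OF A.df_const[of "Len \<tau>"] wd_ap[OF wd_con[OF F] wd_con[OF x]]], of Nat] by simp
  have "fd (\<lambda>i. w (Cv M0 (Nth \<tau>) \<bullet> (F \<bullet> x) \<bullet> rv i))"
    unfolding fd_nd[symmetric] by (rule w A.df_nth[of _ \<rho>] wd_con F x A.nd_var | simp)+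
  from bsum_ge[OF this, of "nv i"] i show ?thesis
    unfolding sbd_def using lessv_nv[OF i(1) L] by simp
qed

text \<open>The length of a standard sequence is a standard number, so every index below it is
  standard, and with the index also the entry.\<close>

lemma memv_std:
  assumes F: "F \<in> D (\<rho> \<rightarrow>\<^sub>t Seq \<tau>)" "Std (\<rho> \<rightarrow>\<^sub>t Seq \<tau>) F" and x: "x \<in> D \<rho>" "Std \<rho> x" and y: "memv \<tau> y (F \<bullet> x)"
  shows "Std \<tau> y"
proof -
  interpret St: wrld Std by (rule St_wrld)
  obtain i where i: "i \<in> D Nat" "lessv M0 i (Cv M0 (Len \<tau>) \<bullet> (F \<bullet> x))" "Cv M0 (Nth \<tau>) \<bullet> (F \<bullet> x) \<bullet> i = y"
    using y unfolding memv_def by blast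
  have "St.df [] Nat (\<lambda>e. Cv M0 (Len \<tau>) \<bullet> (F \<bullet> x))"
    by (rule wd_ap[of _ _ "Seq \<tau>"] St.df_const wd_ap[OF wd_con[where u = F and W = Std, OF F] wd_con[where u = x and W = Std, OF x]] | simp)+
  from St.df_W0[OF this] have L: "Cv M0 (Len \<tau>) \<bullet> (F \<bullet> x) \<in> D Nat" "Std Nat (Cv M0 (Len \<tau>) \<bullet> (F \<bullet> x))" by auto
  have "Std Nat (rv (nv i))"
    using L St.W_le[of "nv (Cv M0 (Len \<tau>) \<bullet> (F \<bullet> x))" "nv i"] lessv_nv[OF i(1) L(1)] i(2) by (simp add: less_imp_le)
  then have "Std Nat i" using i(1) by simp
  then have "St.df [] \<tau> (\<lambda>e. Cv M0 (Nth \<tau>) \<bullet> (F \<bullet> x) \<bullet> rv (nv i))"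
    using i(1) by (intro St.df_nth[of _ \<rho>] wd_con F x St.nd_const) simp_all
  from St.df_W0[OF this] show ?thesis using i by simp
qed

text \<open>The bound obtained from the finite sequences is turned into a choice by bounded search,
  since the matrix is decidable. The search is definable from standard objects, so the resulting
  functional is standard.\<close>

lemma AC_obj_St:
  assumes u: "u \<in> D (T1 \<rightarrow>\<^sub>t T1)" "Std (T1 \<rightarrow>\<^sub>t T1) u"
    and ex: "\<And>x. x \<in> D T1 \<Longrightarrow> Std T1 x \<Longrightarrow> \<exists>n. Std Nat (rv n) \<and> u \<bullet> x \<odot> n = 1"
  shows "\<exists>g\<in>D T2. Std T2 g \<and> (\<forall>x\<in>D T1. Std T1 x \<longrightarrow> u \<bullet> x \<odot> nv (g \<bullet> x) = 1)"
proof -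
  interpret St: wrld Std by (rule St_wrld)
  have A1: "C.bd [Nat, T1, T1 \<rightarrow>\<^sub>t T1] (\<lambda>e. e 2 \<bullet> e 1 \<odot> nv (e 0) = 1)"
    by (rule C.bd_eq C.nd_fa wd_ap[of _ _ T1] wd_var C.nd_var C.nd_ops | simp add: numeral_2_eq_2)+
  have A2: "\<exists>y\<in>D Nat. Std Nat y \<and> u \<bullet> x \<odot> nv y = 1" if x: "x \<in> D T1" "Std T1 x" for x
  proof -
    obtain n where "Std Nat (rv n)" "u \<bullet> x \<odot> n = 1" using ex[OF x] by blast
    then show ?thesis by (intro bexI[of _ "rv n"]) auto
  qed
  obtain F where F: "F \<in> D (T1 \<rightarrow>\<^sub>t Seq Nat)" "Std (T1 \<rightarrow>\<^sub>t Seq Nat) F"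
    "\<forall>x\<in>D T1. Std T1 x \<longrightarrow> (\<exists>y\<in>D Nat. memv Nat y (F \<bullet> x) \<and> u \<bullet> x \<odot> nv y = 1)"
    using HAC[where P = "\<lambda>y x u. u \<bullet> x \<odot> nv y = 1", OF bd_idef[OF A1] u(1) A2] by blast
  have w: "wcx W \<Longrightarrow> wd W \<Gamma> Nat y \<Longrightarrow> wcx.nd W \<Gamma> (\<lambda>e. nv (y e))" for W \<Gamma> y
    using wd_cong[of W \<Gamma> Nat y] wd_D[of W \<Gamma> Nat y] by (simp add: wcx.nd_def)
  define g where "g = lamv T1 Nat (\<lambda>x. rv (bmin (sbd Nat F nv x + 1) (\<lambda>n. u \<bullet> x \<odot> n = 1)))"
  have 1: "St.df [T1] Nat (\<lambda>e. rv (bmin (sbd Nat F nv (e 0) + 1) (\<lambda>n. u \<bullet> e 0 \<odot> n = 1)))"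
    by (rule St.df_rv St.nd_bmin[where P = "\<lambda>n e. u \<bullet> e 0 \<odot> n = 1"] St.nd_ops St.nd_sbd[of _ T1] w St.wcx_axioms
        St.bd_eq St.nd_fa wd_ap[of _ _ T1] wd_var wd_con u F(1,2) St.nd_var | simp)+
  have 2: "St.df [] T2 (\<lambda>e. g)" unfolding g_def
    by (rule St.df_lam[where h = "\<lambda>x e. rv (bmin (sbd Nat F nv x + 1) (\<lambda>n. u \<bullet> x \<odot> n = 1))"]) (rule 1)
  have "u \<bullet> x \<odot> nv (g \<bullet> x) = 1" if x: "x \<in> D T1" "Std T1 x" for x
  proof -
    have g: "nv (g \<bullet> x) = bmin (sbd Nat F nv x + 1) (\<lambda>n. u \<bullet> x \<odot> n = 1)"
      using St.df_lam_ap[where h = "\<lambda>x e. rv (bmin (sbd Nat F nv x + 1) (\<lambda>n. u \<bullet> x \<odot> n = 1))" and \<Gamma> = "[]" and e = undefined, OF 1]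
        x unfolding g_def by simp
    obtain y where y: "memv Nat y (F \<bullet> x)" "u \<bullet> x \<odot> nv y = 1" using F(3) x by blast
    have "nv y \<le> sbd Nat F nv x" by (rule sbd_ge[OF F(1) x(1) y(1)]) (rule w[OF A.wcx_axioms])
    moreover have "pd (\<lambda>n. u \<bullet> x \<odot> n = 1)"
      by (rule pd_D) (rule A.bd_eq A.nd_fa wd_ap[of _ _ T1] wd_con u(1) x(1) A.nd_var A.nd_ops | simp)+
    ultimately show ?thesis unfolding g using y(2) bmin_P[of "\<lambda>n. u \<bullet> x \<odot> n = 1" "nv y"] by simp
  qed
  then show ?thesis using St.df_W0[OF 2] by blast
qed

end

sublocale cx \<subseteq> St: wac Std
proof -
  interpret wrld Std by (rule St_wrld)
  show "wac Std" by unfold_locales (rule AC_obj_St)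
qed

sublocale cx \<subseteq> Al: wac "\<lambda>_ _. True"
proof -
  interpret wrld "\<lambda>_ _. True" by (rule All_wrld)
  show "wac (\<lambda>_ _. True)" by unfold_locales (use AC_obj_M in auto)
qed

context cx
begin

lemma FANp_UFAN_St: "St.FANp \<Longrightarrow> St.UFAN"
proof -
  assume F: St.FANp
  \<comment> \<open>The hypothesis of the fan theorem quantifies over standard sequences and is not
    internal. Therefore the standard \<open>y\<close> carries both a height
    \<open>y \<odot> 0\<close> and a possible counterexample \<open>sh y\<close> to the hypothesis,
    and \<open>HAC\<close> applies to the resulting internal formula.\<close>
  define P where "P = (\<lambda>y f. out (cT f) (bit (sh y)) (nv (cH f \<bullet> sh y)) \<longrightarrow> covd (cT f) (y \<odot> 0))"
  have "C.bd [T1, T2, Nat] (\<lambda>e. P (e 0) (e 1))" unfolding P_def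
    by (rule C.defs3 C.codefs C.nd_ap[of _ T1] wd_var | simp)+
  then have 1: "idef [T1, T2, Nat] (\<lambda>e. P (e 0) (e 1))" by (rule bd_idef)
  have ex: "\<exists>y\<in>D T1. Std T1 y \<and> P y f" if f: "f \<in> D T2" "Std T2 f" for f
  proof (cases "\<forall>\<alpha>\<in>D T1. Std T1 \<alpha> \<longrightarrow> out (cT f) (bit \<alpha>) (nv (cH f \<bullet> \<alpha>))")
    case True
    have t: "cT f \<in> D T1" "Std T1 (cT f)" "cH f \<in> D T2" "Std T2 (cH f)"
      using St.df_W0[OF St.df_cT[OF wd_con]] St.df_W0[OF St.df_cH[OF wd_con]] f by auto
    have "\<exists>n. Std Nat (rv n) \<and> out (cT f) (bit \<alpha>) n" if "\<alpha> \<in> D T1" "Std T1 \<alpha>" for \<alpha>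
      using True that St.S_ap[OF t(3,4) that] by blast
    then obtain k where k: "Std Nat (rv k)" "covd (cT f) k" using F t unfolding St.FANp_def by blast
    have 2: "St.nd [Nat] (\<lambda>e. k)" by (rule St.nd_const[OF k(1)])
    have "St.df [] T1 (\<lambda>e. ln (\<lambda>i. k))" by (rule St.df_ln[where h = "\<lambda>i e. k"]) (rule 2)
    moreover have "ln (\<lambda>i. k) \<odot> 0 = k" using St.ln_fa[where h = "\<lambda>i e. k" and \<Gamma> = "[]" and e = undefined] 2 by simp
    ultimately show ?thesis using k(2) St.df_W0 unfolding P_def by metis
  next
    case False
    then obtain \<alpha> where \<alpha>: "\<alpha> \<in> D T1" "Std T1 \<alpha>" "\<not> out (cT f) (bit \<alpha>) (nv (cH f \<bullet> \<alpha>))" by blast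
    have "St.df [] T1 (\<lambda>e. ln (\<lambda>i. if i = 0 then 1 else \<alpha> \<odot> (i - 1)))" by (rule St.df_pre wd_con \<alpha>)+
    from St.df_W0[OF this] show ?thesis using \<alpha> sh_pre[OF \<alpha>(1)] unfolding P_def by metis
  qed
  obtain Z where Z: "Z \<in> D (T2 \<rightarrow>\<^sub>t Seq T1)" "Std (T2 \<rightarrow>\<^sub>t Seq T1) Z"
    "\<forall>f\<in>D T2. Std T2 f \<longrightarrow> (\<exists>y\<in>D T1. memv T1 y (Z \<bullet> f) \<and> P y f)"
    using HAC[where P = "\<lambda>y f _. P y f", OF 1 zero_D ex] by blast
  have w: "wcx W \<Longrightarrow> wd W \<Gamma> T1 y \<Longrightarrow> wcx.nd W \<Gamma> (\<lambda>e. y e \<odot> 0)" for W \<Gamma> y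
    by (rule wcx.nd_fa, assumption, assumption, rule wcx.nd_ops)
  define \<Psi> where "\<Psi> = lamv T1 (T2 \<rightarrow>\<^sub>t Nat) (\<lambda>T. lamv T2 Nat (\<lambda>h. rv (sbd T1 Z (\<lambda>y. y \<odot> 0) (cc T h))))"
  have a: "St.df [T2, T1] Nat (\<lambda>e. rv (sbd T1 Z (\<lambda>y. y \<odot> 0) (cc (e 1) (e 0))))"
    by (rule St.df_rv St.nd_sbd[of _ T2] w[OF St.wcx_axioms] wd_con Z(1,2) St.df_cc wd_var | simp)+
  have b: "St.df [T1] (T2 \<rightarrow>\<^sub>t Nat) (\<lambda>e. lamv T2 Nat (\<lambda>h. rv (sbd T1 Z (\<lambda>y. y \<odot> 0) (cc (e 0) h))))"
    by (rule St.df_lam[where h = "\<lambda>h e. rv (sbd T1 Z (\<lambda>y. y \<odot> 0) (cc (e 0) h))"]) (use a in simp)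
  have c: "St.df [] (T1 \<rightarrow>\<^sub>t T2 \<rightarrow>\<^sub>t Nat) (\<lambda>e. \<Psi>)" unfolding \<Psi>_def
    by (rule St.df_lam[where h = "\<lambda>T e. lamv T2 Nat (\<lambda>h. rv (sbd T1 Z (\<lambda>y. y \<odot> 0) (cc T h)))"]) (rule b)
  have "covd T (nv (\<Psi> \<bullet> T \<bullet> h))"
    if *: "T \<in> D T1" "Std T1 T" "h \<in> D T2" "Std T2 h" "\<forall>\<alpha>\<in>D T1. Std T1 \<alpha> \<longrightarrow> out T (bit \<alpha>) (nv (h \<bullet> \<alpha>))" for T h
  proof -
    have "\<Psi> \<bullet> T = lamv T2 Nat (\<lambda>h. rv (sbd T1 Z (\<lambda>y. y \<odot> 0) (cc T h)))" unfolding \<Psi>_def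
      using St.df_lam_ap[where h = "\<lambda>T e. lamv T2 Nat (\<lambda>h. rv (sbd T1 Z (\<lambda>y. y \<odot> 0) (cc T h)))" and \<Gamma> = "[]" and e = undefined, OF b]
        * by simp
    moreover have "lamv T2 Nat (\<lambda>h. rv (sbd T1 Z (\<lambda>y. y \<odot> 0) (cc T h))) \<bullet> h = rv (sbd T1 Z (\<lambda>y. y \<odot> 0) (cc T h))"
      using St.df_lam_ap[where h = "\<lambda>h e. rv (sbd T1 Z (\<lambda>y. y \<odot> 0) (cc (e 0) h))" and \<Gamma> = "[T1]" and e = "T ## undefined"]
        a * by simp
    ultimately have v: "nv (\<Psi> \<bullet> T \<bullet> h) = sbd T1 Z (\<lambda>y. y \<odot> 0) (cc T h)" by simp
    have "St.df [] T2 (\<lambda>e. cc T h)" by (rule St.df_cc wd_con *)+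
    from St.df_W0[OF this] have f: "cc T h \<in> D T2" "Std T2 (cc T h)" by auto
    obtain y where y: "y \<in> D T1" "memv T1 y (Z \<bullet> cc T h)" "P y (cc T h)" using Z(3) f by blast
    \<comment> \<open>As an entry of a standard sequence \<open>y\<close> is standard; so the
      hypothesis holds at \<open>sh y\<close>, and the height carried by \<open>y\<close> is
      correct.\<close>
    have "Std T1 y" by (rule memv_std[OF Z(1,2) f y(2)])
    then have "St.df [] T1 (\<lambda>e. sh y)" using y(1) by (intro St.df_sh wd_con)
    from St.df_W0[OF this] have "covd T (y \<odot> 0)" using y(3) * unfolding P_def code_inv[OF *(1,3)] by blast
    moreover have "y \<odot> 0 \<le> sbd T1 Z (\<lambda>y. y \<odot> 0) (cc T h)"
      by (rule sbd_ge[OF Z(1) f(1) y(2)]) (rule w[OF A.wcx_axioms])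
    ultimately show ?thesis unfolding v by (rule covd_mono)
  qed
  then show St.UFAN unfolding St.UFAN_def using St.df_W0[OF c] by blast
qed

end

section \<open>From the Heine-Borel lemma to the fan theorem\<close>

text \<open>Binary sequences are embedded in the unit interval as the points of the Cantor set; with \<open>u\<close> the
  value of \<open>cb\<close> at level \<open>n\<close>, such a point lies between \<open>3 u / 4\<^sup>n\<close> and \<open>(3 u + 1) / 4\<^sup>n\<close>. The cover
  consists of neighbourhoods of the nodes outside the tree and of the gaps of the Cantor set. Since the
  numerators at hand are multiples of 3, neighbourhoods of distinct nodes of one level do not share
  such points.\<close>

context cx
begin

definition cb :: "tm \<Rightarrow> nn \<Rightarrow> nn" where "cb \<alpha> n = prec n 0 (\<lambda>r i. 4 * r + \<alpha> \<odot> i)"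
text \<open>An index \<open>z\<close> codes the digits and the length of a node together with a tag.
  Tag 0 at a node outside \<open>T\<close> gives a neighbourhood of that node; every other index
  gives the gap between the children of its node, so that each index denotes an interval.\<close>

definition outn :: "tm \<Rightarrow> nn \<Rightarrow> bool" where
  "outn T z \<longleftrightarrow> pr2 z = 0 \<and> T \<odot> ini (dig (pr1 (pr1 z)) (pr2 (pr1 z))) (pr2 (pr1 z)) \<noteq> 1"
definition cnum :: "nn \<Rightarrow> nn" where "cnum z = 3 * cb (dig (pr1 (pr1 z)) (pr2 (pr1 z))) (pr2 (pr1 z))"
text \<open>At level \<open>i\<close> the node with numerator \<open>c = cnum z\<close> spans
  \<open>c\<close> to \<open>c + 1\<close> in units of the \<open>i\<close>-th power of 1/4; its
  neighbourhood adds one unit on both sides. In units of the next level its children span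
  \<open>4 c\<close> to \<open>4 c + 1\<close> and \<open>4 c + 3\<close> to \<open>4 c + 4\<close>,
  which leaves the gap from \<open>4 c + 1\<close> to \<open>4 c + 3\<close>. Powers of 4 appear as
  \<open>p2 (i + i)\<close>.\<close>

definition lcd :: "tm \<Rightarrow> nn \<Rightarrow> nn" where
  "lcd T z = (let i = pr2 (pr1 z) in if outn T z then mk (cnum z) 1 (p2 (i + i)) else mk (4 * cnum z + 1) 0 (4 * p2 (i + i)))"
definition rcd :: "tm \<Rightarrow> nn \<Rightarrow> nn" where
  "rcd T z = (let i = pr2 (pr1 z) in if outn T z then mk (cnum z + 2) 0 (p2 (i + i)) else mk (4 * cnum z + 3) 0 (4 * p2 (i + i)))"
definition cint :: "tm \<Rightarrow> tm" where "cint T = lamv Nat T1 (\<lambda>z. ln (\<lambda>m. pr (lcd T (nv z)) (rcd T (nv z))))"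
definition cpt :: "tm \<Rightarrow> tm" where "cpt \<alpha> = ln (\<lambda>m. mk (3 * cb \<alpha> m) 0 (p2 (m + m)))"

text \<open>The path to a real number outside all gaps, by numerators \<open>u\<close>.\<close>
definition dc :: "tm \<Rightarrow> nn \<Rightarrow> nn \<Rightarrow> nn" where
  "dc x r i = bn ((12 * qn r + 2) * eps (i + i + 2) < rl x (i + i + 6))"
definition dcn :: "tm \<Rightarrow> nn \<Rightarrow> nn" where "dcn x n = prec n 0 (\<lambda>r i. 4 * r + dc x r i)"
definition dcp :: "tm \<Rightarrow> tm" where "dcp x = ln (\<lambda>i. dc x (dcn x i) i)"

end

context wcx
begin

lemma nd_cb: "df \<Gamma> T1 \<alpha> \<Longrightarrow> nd \<Gamma> n \<Longrightarrow> nd \<Gamma> (\<lambda>e. cb (\<alpha> e) (n e))"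
  unfolding cb_def
  by (rule nd_prec[where h = "\<lambda>r i e. 4 * r + \<alpha> e \<odot> i"]) (rule defs nd_pr wd_weak2 | assumption | simp)+

lemma bd_outn: "df \<Gamma> T1 T \<Longrightarrow> nd \<Gamma> z \<Longrightarrow> bd \<Gamma> (\<lambda>e. outn (T e) (z e))"
  unfolding outn_def by (rule defs3 | assumption)+

lemma nd_cnum: "nd \<Gamma> z \<Longrightarrow> nd \<Gamma> (\<lambda>e. cnum (z e))"
  unfolding cnum_def by (rule nd_cb defs3 | assumption)+

lemma nd_lcd: "df \<Gamma> T1 T \<Longrightarrow> nd \<Gamma> z \<Longrightarrow> nd \<Gamma> (\<lambda>e. lcd (T e) (z e))"
  "df \<Gamma> T1 T \<Longrightarrow> nd \<Gamma> z \<Longrightarrow> nd \<Gamma> (\<lambda>e. rcd (T e) (z e))"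
  unfolding lcd_def rcd_def Let_def by (rule nd_cnum bd_outn nd_mk defs3 | assumption)+

lemma df_cint1: "df \<Gamma> T1 T \<Longrightarrow> nd \<Gamma> z \<Longrightarrow> df \<Gamma> T1 (\<lambda>e. ln (\<lambda>m. pr (lcd (T e) (z e)) (rcd (T e) (z e))))"
  by (rule df_ln[where h = "\<lambda>m e. pr (lcd (T e) (z e)) (rcd (T e) (z e))"]) (rule nd_pr nd_lcd wd_weak nd_weak | assumption)+

lemma df_cint: "df \<Gamma> T1 T \<Longrightarrow> df \<Gamma> (Nat \<rightarrow>\<^sub>t T1) (\<lambda>e. cint (T e))"
  unfolding cint_def
  by (rule df_lam[where h = "\<lambda>z e. ln (\<lambda>m. pr (lcd (T e) (nv z)) (rcd (T e) (nv z)))"]) (rule df_cint1 wd_weak nd_var | assumption | simp)+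

lemma df_cpt: "df \<Gamma> T1 \<alpha> \<Longrightarrow> df \<Gamma> T1 (\<lambda>e. cpt (\<alpha> e))"
  unfolding cpt_def
  by (rule df_ln[where h = "\<lambda>m e. mk (3 * cb (\<alpha> e) m) 0 (p2 (m + m))"]) (rule nd_mk nd_cb defs3 wd_weak | assumption | simp)+

lemma nd_dc: "df \<Gamma> T1 x \<Longrightarrow> nd \<Gamma> r \<Longrightarrow> nd \<Gamma> i \<Longrightarrow> nd \<Gamma> (\<lambda>e. dc (x e) (r e) (i e))"
  unfolding dc_def by (rule nd_bn qdefs | assumption)+

lemma nd_dcn: "df \<Gamma> T1 x \<Longrightarrow> nd \<Gamma> n \<Longrightarrow> nd \<Gamma> (\<lambda>e. dcn (x e) (n e))"
  unfolding dcn_def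
  by (rule nd_prec[where h = "\<lambda>r i e. 4 * r + dc (x e) r i"]) (rule nd_dc defs nd_pr wd_weak2 | assumption | simp)+

lemma df_dcp: "df \<Gamma> T1 x \<Longrightarrow> df \<Gamma> T1 (\<lambda>e. dcp (x e))"
  unfolding dcp_def
  by (rule df_ln[where h = "\<lambda>i e. dc (x e) (dcn (x e) i) i"]) (rule nd_dc nd_dcn wd_weak nd_var | assumption | simp)+

lemmas ctdefs = nd_cb df_cint df_cpt nd_dcn df_dcp nd_dc qdefs

end

context cx
begin

lemma cb_eqs: "\<alpha> \<in> D T1 \<Longrightarrow> cb \<alpha> 0 = 0" "\<alpha> \<in> D T1 \<Longrightarrow> cb \<alpha> (n + 1) = 4 * cb \<alpha> n + \<alpha> \<odot> n"
  unfolding cb_def by (rule prec_eqs0, (rule adefs3 | simp)+)+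

lemma dcn_eqs: "x \<in> D T1 \<Longrightarrow> dcn x 0 = 0" "x \<in> D T1 \<Longrightarrow> dcn x (n + 1) = 4 * dcn x n + dc x (dcn x n) n"
  unfolding dcn_def by (rule prec_eqs0, (rule A.nd_dc adefs3 | simp)+)+

lemma dcp_app: "x \<in> D T1 \<Longrightarrow> dcp x \<odot> i = dc x (dcn x i) i" and dcp_D: "x \<in> D T1 \<Longrightarrow> dcp x \<in> D T1"
  unfolding dcp_def by (rule fd_lnD, rule pd_D, (rule A.ctdefs adefs3 | simp)+)+

lemma dcp_bin: "x \<in> D T1 \<Longrightarrow> bin (dcp x)"
  by (simp add: dcp_D dcp_app dc_def)

lemma cb_dcp: "x \<in> D T1 \<Longrightarrow> cb (dcp x) n = dcn x n"
proof (rule nn_ind[of _ n])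
  assume x: "x \<in> D T1"
  show "pd (\<lambda>n. cb (dcp x) n = dcn x n)" by (rule pd_D) (rule A.ctdefs adefs3 x | simp)+
  show "cb (dcp x) (n + 1) = dcn x (n + 1)" if "cb (dcp x) n = dcn x n" for n
    using that x by (simp add: cb_eqs dcn_eqs dcp_D dcp_app)
qed (simp add: cb_eqs dcn_eqs dcp_D)

lemma cpt_val: "\<alpha> \<in> D T1 \<Longrightarrow> rl (cpt \<alpha>) m = 3 * qn (cb \<alpha> m) * eps (m + m)" and cpt_D: "\<alpha> \<in> D T1 \<Longrightarrow> cpt \<alpha> \<in> D T1"
proof -
  assume a: "\<alpha> \<in> D T1"
  have "cpt \<alpha> \<odot> m = mk (3 * cb \<alpha> m) 0 (p2 (m + m))"
    unfolding cpt_def by (rule fd_lnD) (rule pd_D, (rule A.nd_mk A.ctdefs adefs3 a | simp)+)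
  then show "rl (cpt \<alpha>) m = 3 * qn (cb \<alpha> m) * eps (m + m)" by (simp add: rl_def val_mk eps_def)
  show "cpt \<alpha> \<in> D T1"
    unfolding cpt_def by (rule fd_lnD) (rule pd_D, (rule A.nd_mk A.ctdefs adefs3 a | simp)+)
qed

lemma cint_ends:
  assumes T: "T \<in> D T1"
  shows "lend (cint T) z m = (let e = eps (pr2 (pr1 z) + pr2 (pr1 z)) in
      if outn T z then (qn (cnum z) - 1) * e else (4 * qn (cnum z) + 1) * (e / 4))"
    "rend (cint T) z m = (let e = eps (pr2 (pr1 z) + pr2 (pr1 z)) in
      if outn T z then (qn (cnum z) + 2) * e else (4 * qn (cnum z) + 3) * (e / 4))"
proof -
  have 1: "A.df [Nat] T1 (\<lambda>e. ln (\<lambda>m. pr (lcd T (nv (e 0))) (rcd T (nv (e 0)))))"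
    by (rule A.df_cint1 wd_con T A.nd_var | simp)+
  have "cint T \<bullet> rv z = ln (\<lambda>m. pr (lcd T z) (rcd T z))" unfolding cint_def
    using A.df_lam_ap[where h = "\<lambda>z e. ln (\<lambda>m. pr (lcd T (nv z)) (rcd T (nv z)))" and \<Gamma> = "[]" and e = undefined and a = "rv z", OF 1]
    by simp
  moreover have "ln (\<lambda>m. pr (lcd T z) (rcd T z)) \<odot> m = pr (lcd T z) (rcd T z)"
    by (rule fd_lnD) (rule pd_D, (rule adefs3 | simp)+)
  ultimately have c: "cint T \<bullet> rv z \<odot> m = pr (lcd T z) (rcd T z)" by simp
  have p: "0 < 4 * p2 n" for n by (rule mult_pos_pos) (simp_all add: zero_less_numeral)
  have e4: "eps n / 4 = 1 / (4 * qn (p2 n))" for n by (simp add: eps_def)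
  show "lend (cint T) z m = (let e = eps (pr2 (pr1 z) + pr2 (pr1 z)) in
      if outn T z then (qn (cnum z) - 1) * e else (4 * qn (cnum z) + 1) * (e / 4))"
    "rend (cint T) z m = (let e = eps (pr2 (pr1 z) + pr2 (pr1 z)) in
      if outn T z then (qn (cnum z) + 2) * e else (4 * qn (cnum z) + 3) * (e / 4))"
    unfolding lend_def rend_def c Let_def e4 by (simp_all add: lcd_def rcd_def Let_def val_mk p eps_def)
qed

lemma cb_shift:
  assumes a: "bin \<alpha>"
  shows "qn (cb \<alpha> i) * eps (i + i) \<le> qn (cb \<alpha> (i + j)) * eps (i + j + (i + j)) \<and>
    (3 * qn (cb \<alpha> (i + j)) + 1) * eps (i + j + (i + j)) \<le> (3 * qn (cb \<alpha> i) + 1) * eps (i + i)"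
proof (rule nn_ind[of _ j])
  note aD = a[THEN conjunct1]
  show "pd (\<lambda>j. qn (cb \<alpha> i) * eps (i + i) \<le> qn (cb \<alpha> (i + j)) * eps (i + j + (i + j)) \<and>
    (3 * qn (cb \<alpha> (i + j)) + 1) * eps (i + j + (i + j)) \<le> (3 * qn (cb \<alpha> i) + 1) * eps (i + i))"
    by (rule pd_D) (rule A.ctdefs adefs3 aD | simp)+
  fix j assume IH: "qn (cb \<alpha> i) * eps (i + i) \<le> qn (cb \<alpha> (i + j)) * eps (i + j + (i + j)) \<and>
    (3 * qn (cb \<alpha> (i + j)) + 1) * eps (i + j + (i + j)) \<le> (3 * qn (cb \<alpha> i) + 1) * eps (i + i)"
  define n where "n = i + j"
  define e where "e = eps (n + 1 + (n + 1))"
  have e: "eps (n + n) = 4 * e" "0 < e"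
    using eps_s[of "n + n"] eps_s[of "n + n + 1"] by (simp_all add: e_def ac_simps)
  have b: "0 \<le> qn (\<alpha> \<odot> n)" "qn (\<alpha> \<odot> n) \<le> 1" using a qn_simps(5)[of "\<alpha> \<odot> n" 1] by simp_all
  have "qn (\<alpha> \<odot> n) * e \<le> 1 * e" "0 \<le> qn (\<alpha> \<odot> n) * e" using b e(2) by (intro mult_right_mono mult_nonneg_nonneg; simp)+
  then show "qn (cb \<alpha> i) * eps (i + i) \<le> qn (cb \<alpha> (i + (j + 1))) * eps (i + (j + 1) + (i + (j + 1))) \<and>
    (3 * qn (cb \<alpha> (i + (j + 1))) + 1) * eps (i + (j + 1) + (i + (j + 1))) \<le> (3 * qn (cb \<alpha> i) + 1) * eps (i + i)"
    using IH unfolding add.assoc[of i j 1, symmetric] n_def[symmetric] e_def[symmetric] e(1) cb_eqs(2)[OF aD] qn_simps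
    by (simp add: algebra_simps)
qed simp

lemma cpt_bounds:
  assumes a: "bin \<alpha>"
  shows "i \<le> m \<Longrightarrow> 3 * qn (cb \<alpha> i) * eps (i + i) \<le> rl (cpt \<alpha>) m"
    "rl (cpt \<alpha>) m < (3 * qn (cb \<alpha> i) + 1) * eps (i + i)"
proof -
  show L: "3 * qn (cb \<alpha> i) * eps (i + i) \<le> rl (cpt \<alpha>) m" if im: "i \<le> m" for i m
  proof -
    obtain j where "m = i + j" using im unfolding less_eq_nn_def by blast
    then show ?thesis using cb_shift[OF a, of i j] a by (simp add: cpt_val)
  qed
  have U: "rl (cpt \<alpha>) m < (3 * qn (cb \<alpha> i) + 1) * eps (i + i)" if im: "i \<le> m" for i m
  proof -
    obtain j where m: "m = i + j" using im unfolding less_eq_nn_def by blast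
    have "rl (cpt \<alpha>) m < (3 * qn (cb \<alpha> m) + 1) * eps (m + m)"
      using a eps_pos(1)[of "m + m"] by (simp add: cpt_val algebra_simps)
    then show ?thesis using cb_shift[OF a, of i j] unfolding m by linarith
  qed
  show "rl (cpt \<alpha>) m < (3 * qn (cb \<alpha> i) + 1) * eps (i + i)"
  proof (cases "i \<le> m")
    case False
    then have "rl (cpt \<alpha>) m \<le> rl (cpt \<alpha>) i" using L[of m i] a by (simp add: cpt_val)
    then show ?thesis using U[of i i] by simp
  qed (rule U)
qed

lemma cpt_un: "bin \<alpha> \<Longrightarrow> un Q (rl (cpt \<alpha>))"
proof (rule un_intro)
  assume a: "bin \<alpha>"
  have "\<bar>rl (cpt \<alpha>) m - rl (cpt \<alpha>) (m + i)\<bar> < eps m" for m i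
  proof -
    have "3 * qn (cb \<alpha> m) * eps (m + m) = rl (cpt \<alpha>) m" using a by (simp add: cpt_val)
    then have "rl (cpt \<alpha>) m \<le> rl (cpt \<alpha>) (m + i)" "rl (cpt \<alpha>) (m + i) < rl (cpt \<alpha>) m + eps (m + m)"
      using cpt_bounds(1)[OF a, of m "m + i"] cpt_bounds(2)[OF a, of "m + i" m] by (simp_all add: algebra_simps)
    moreover have "eps (m + m) \<le> eps m" by (rule eps_mono) simp
    ultimately show ?thesis unfolding abs_less_iff by linarith
  qed
  then show "isr Q (rl (cpt \<alpha>))" unfolding isr_def by blast
  show "0 \<le> rl (cpt \<alpha>) m \<and> rl (cpt \<alpha>) m \<le> 1" for m
    using cpt_bounds[OF a, where i = 0] a by (simp add: cb_eqs order_less_imp_le)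
qed

lemma cb_inj:
  assumes "bin \<alpha>" "bin \<beta>"
  shows "cb \<alpha> n = cb \<beta> n \<longrightarrow> (\<forall>j<n. \<alpha> \<odot> j = \<beta> \<odot> j)"
proof (rule nn_ind[of _ n])
  note D = assms[THEN conjunct1]
  show "pd (\<lambda>n. cb \<alpha> n = cb \<beta> n \<longrightarrow> (\<forall>j<n. \<alpha> \<odot> j = \<beta> \<odot> j))" by (rule pd_D) (rule A.nd_cb adefs3 D | simp)+
  fix n assume IH: "cb \<alpha> n = cb \<beta> n \<longrightarrow> (\<forall>j<n. \<alpha> \<odot> j = \<beta> \<odot> j)"
  show "cb \<alpha> (n + 1) = cb \<beta> (n + 1) \<longrightarrow> (\<forall>j<n + 1. \<alpha> \<odot> j = \<beta> \<odot> j)"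
  proof
    assume "cb \<alpha> (n + 1) = cb \<beta> (n + 1)"
    then have e: "4 * qn (cb \<alpha> n) + qn (\<alpha> \<odot> n) = 4 * qn (cb \<beta> n) + qn (\<beta> \<odot> n)" unfolding cb_eqs(2)[OF D(1)] cb_eqs(2)[OF D(2)] to_qn .
    have b: "0 \<le> qn (\<alpha> \<odot> n)" "qn (\<alpha> \<odot> n) \<le> 1" "0 \<le> qn (\<beta> \<odot> n)" "qn (\<beta> \<odot> n) \<le> 1"
      using assms qn_simps(5)[of _ 1] by simp_all
    have "\<not> cb \<alpha> n < cb \<beta> n" "\<not> cb \<beta> n < cb \<alpha> n"
      using qn_less_step[of "cb \<alpha> n" "cb \<beta> n"] qn_less_step[of "cb \<beta> n" "cb \<alpha> n"] e b by linarith+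
    then have c: "cb \<alpha> n = cb \<beta> n" by simp
    then have "\<alpha> \<odot> n = \<beta> \<odot> n" using e by simp
    then show "\<forall>j<n + 1. \<alpha> \<odot> j = \<beta> \<odot> j" using IH c by (auto simp: le_less)
  qed
qed simp

lemma pr_le: "pr1 z \<le> z" "pr2 z \<le> z"
proof -
  have sub: "a - b \<le> a" for a b :: nn using nn_diff(3)[of b a] by (metis le_add_same_cancel2 nn_diff_eq_0 nn_ge_0 nn_le_diff linorder_linear)
  show "pr2 z \<le> z" unfolding pr2_def by (rule sub)
  have "pr1 z \<le> tgr z" unfolding pr1_def by (rule sub)
  also have "\<dots> \<le> tg (tgr z)" by (rule tg_ge)
  also have "\<dots> \<le> z" using tgr by blast
  finally show "pr1 z \<le> z" .
qed

text \<open>Points of the Cantor set are tested, one for each node of level \<open>k\<close>. Such a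
  point lies in no gap, and it lies in the neighbourhood of a node only if it passes through that
  node, whose level is at most \<open>k\<close> because indices bound their components.\<close>

lemma cint_covd:
  assumes T: "T \<in> D T1" and c: "\<And>a. a < p2 k \<Longrightarrow> \<exists>z\<le>k. inI (\<lambda>_. True) (cpt (dig a k)) (cint T) z"
  shows "covd T k"
  unfolding covd_def
proof (intro allI impI)
  fix a assume "a < p2 k"
  then obtain z where z: "z \<le> k" "inI (\<lambda>_. True) (cpt (dig a k)) (cint T) z" using c by blast
  define \<beta> where "\<beta> = dig a k"
  have \<beta>: "bin \<beta>" by (simp add: \<beta>_def)
  let ?x = "rl (cpt \<beta>)"
  define i where "i = pr2 (pr1 z)"
  define \<gamma> where "\<gamma> = dig (pr1 (pr1 z)) i"
  have \<gamma>: "bin \<gamma>" by (simp add: \<gamma>_def)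
  define e where "e = eps (i + i)"
  have e: "0 < e" by (simp add: e_def)
  have cn: "qn (cnum z) = 3 * qn (cb \<gamma> i)" by (simp add: cnum_def \<gamma>_def i_def)
  obtain n n' where n: "2 * eps n < ?x n - lend (cint T) z n" "2 * eps n' < rend (cint T) z n' - ?x n'"
    using z(2) unfolding inI_def ls_def \<beta>_def by auto
  have xr: "isr (\<lambda>_. True) ?x" using cpt_un[OF \<beta>] by (simp add: un_def)
  have lo: "3 * qn (cb \<beta> j) * eps (j + j) < rend (cint T) z 0" for j
  proof -
    have "3 * qn (cb \<beta> j) * eps (j + j) \<le> ?x (n' + j)" by (rule cpt_bounds(1)[OF \<beta>]) simp
    moreover have "\<bar>?x n' - ?x (n' + j)\<bar> < eps n'" using xr by (simp add: isr_def)
    moreover have "rend (cint T) z n' = rend (cint T) z 0" by (simp add: cint_ends[OF T])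
    ultimately show ?thesis using n(2) eps_pos(1)[of n'] by linarith
  qed
  have hi: "lend (cint T) z 0 < (3 * qn (cb \<beta> j) + 1) * eps (j + j)" for j
  proof -
    have "lend (cint T) z n = lend (cint T) z 0" by (simp add: cint_ends[OF T])
    then show ?thesis using cpt_bounds(2)[OF \<beta>, of n j] n(1) eps_pos(1)[of n] by linarith
  qed
  have iz: "i \<le> z" unfolding i_def using pr_le order_trans by blast
  show "out T (dig a k) k"
  proof (cases "outn T z")
    case True
    have "(3 * qn (cb \<gamma> i) - 1) * e < (3 * qn (cb \<beta> i) + 1) * e" "3 * qn (cb \<beta> i) * e < (3 * qn (cb \<gamma> i) + 2) * e"
      using hi[of i] lo[of i] True unfolding cint_ends[OF T] Let_def i_def[symmetric] e_def[symmetric] cn by simp_all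
    then have "3 * qn (cb \<gamma> i) - 1 < 3 * qn (cb \<beta> i) + 1" "3 * qn (cb \<beta> i) < 3 * qn (cb \<gamma> i) + 2"
      using e by (simp_all only: mult_less_cancel_right_pos)
    \<comment> \<open>Multiples of 3 that are less than 2 apart coincide.\<close>
    then have "\<not> cb \<gamma> i < cb \<beta> i" "\<not> cb \<beta> i < cb \<gamma> i"
      using qn_less_step[of "cb \<gamma> i" "cb \<beta> i"] qn_less_step[of "cb \<beta> i" "cb \<gamma> i"] by linarith+
    then have "\<forall>j<i. \<beta> \<odot> j = \<gamma> \<odot> j" using cb_inj[OF \<beta> \<gamma>, of i] by auto
    then have "ini \<beta> i = ini \<gamma> i" using \<beta> \<gamma> by (intro ini_cong) auto
    moreover have "T \<odot> ini \<gamma> i \<noteq> 1" using True by (simp add: outn_def \<gamma>_def i_def)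
    ultimately show ?thesis using iz z(1) unfolding out_def \<beta>_def[symmetric] by (metis order_trans)
  next
    case False
    define v where "v = cb \<beta> (i + 1)"
    have e4: "eps (i + 1 + (i + 1)) = e / 4"
      using eps_s[of "i + i"] eps_s[of "i + i + 1"] by (simp add: e_def ac_simps)
    have "(12 * qn (cb \<gamma> i) + 1) * (e / 4) < (3 * qn v + 1) * (e / 4)" "3 * qn v * (e / 4) < (12 * qn (cb \<gamma> i) + 3) * (e / 4)"
      using hi[of "i + 1"] lo[of "i + 1"] False unfolding cint_ends[OF T] Let_def i_def[symmetric] e_def[symmetric] cn v_def e4
      by simp_all
    then have *: "12 * qn (cb \<gamma> i) + 1 < 3 * qn v + 1" "3 * qn v < 12 * qn (cb \<gamma> i) + 3"
      using e by (simp_all only: mult_less_cancel_right_pos divide_pos_pos zero_less_numeral)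
    \<comment> \<open>The numerator \<open>v\<close> of the point at the next level would lie
      strictly between \<open>4 * cb \<gamma> i\<close> and its successor.\<close>
    then have "4 * qn (cb \<gamma> i) < qn v" by linarith
    then have "4 * cb \<gamma> i < v" unfolding to_qn .
    from qn_less_step[OF this] show ?thesis using * by simp
  qed
qed

end

context wac
begin

text \<open>A point outside all gaps follows a path of the Cantor set up to a small error. The path
  is defined from \<open>x\<close>, so it lies in the world and leaves \<open>T\<close> at some
  level \<open>i\<close>; then the point is in the neighbourhood of the node at that level.\<close>

lemma cint_cover:
  assumes T: "T \<in> D T1" "W T1 T" and bar: "\<forall>\<alpha>\<in>D T1. W T1 \<alpha> \<longrightarrow> (\<exists>n. S n \<and> out T (bit \<alpha>) n)"
    and x: "x \<in> D T1" "W T1 x" "un S (rl x)"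
  shows "\<exists>z. S z \<and> inI S x (cint T) z"
proof (rule ccontr)
  assume neg: "\<not> ?thesis"
  define \<alpha> where "\<alpha> = dcp x"
  have \<alpha>: "bin \<alpha>" unfolding \<alpha>_def by (rule dcp_bin[OF x(1)])
  have "df [] T1 (\<lambda>e. \<alpha>)" unfolding \<alpha>_def by (rule df_dcp wd_con x)+
  then have "W T1 \<alpha>" by (auto dest: df_W0)
  then obtain n where n: "S n" "out T (bit \<alpha>) n" using bar \<alpha> by blast
  have "bit \<alpha> \<odot> i = \<alpha> \<odot> i" for i using \<alpha> nn_less_1[of "\<alpha> \<odot> i"] by (auto simp: bn_def le_less)
  then have "bit \<alpha> = \<alpha>" using \<alpha> by (intro fa_ext) auto
  then obtain i where i: "i \<le> n" "T \<odot> ini \<alpha> i \<noteq> 1" using n(2) by (auto simp: out_def)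
  \<comment> \<open>The digit at \<open>j\<close> is decided at stage \<open>j + j + 6\<close>,
    where the error is a sixteenth of the unit of level \<open>j + 1\<close>; \<open>M\<close> is at
    least as late for all \<open>j\<close> up to \<open>n\<close>.\<close>
  define M where "M = n + n + 6"
  have M: "S M" unfolding M_def by (rule S_nd) (rule wdefs n)+
  define c where "c = (\<lambda>j. 3 * qn (cb \<alpha> j))"
  define q where "q = rl x M"
  have xr: "isr S (rl x)" using x(3) by (simp add: un_def)
  have node: "\<exists>z. S z \<and> pr2 z = t \<and> pr2 (pr1 z) = j \<and> qn (cnum z) = c j \<and> ini (dig (pr1 (pr1 z)) j) j = ini \<alpha> j"
    if "j \<le> n" "S t" for j t
  proof (intro exI[of _ "pr (pr (dy \<alpha> j) j) t"] conjI)
    have "S j" using W_le[OF n(1) that(1)] .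
    then show "S (pr (pr (dy \<alpha> j) j) t)" using \<open>W T1 \<alpha>\<close> \<alpha> that by (intro S_nd) (rule wdefs | simp)+
    have d: "\<And>i. i < j \<Longrightarrow> dig (dy \<alpha> j) j \<odot> i = \<alpha> \<odot> i" by (rule dig_dy[OF \<alpha>])
    then show "ini (dig (pr1 (pr1 (pr (pr (dy \<alpha> j) j) t))) j) j = ini \<alpha> j" using \<alpha> by (simp add: ini_cong)
    have "cb (dig (dy \<alpha> j) j) m = cb \<alpha> m" if "m \<le> j" for m
    proof -
      have "m \<le> j \<longrightarrow> cb (dig (dy \<alpha> j) j) m = cb \<alpha> m"
      proof (rule nn_ind[of _ m])
        show "pd (\<lambda>m. m \<le> j \<longrightarrow> cb (dig (dy \<alpha> j) j) m = cb \<alpha> m)"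
          by (rule pd_D) (rule A.nd_cb adefs3 \<alpha>[THEN conjunct1] | simp)+
        show "m + 1 \<le> j \<longrightarrow> cb (dig (dy \<alpha> j) j) (m + 1) = cb \<alpha> (m + 1)" if "m \<le> j \<longrightarrow> cb (dig (dy \<alpha> j) j) m = cb \<alpha> m" for m
          using that d[of m] \<alpha> nn_less_iff[of m j] by (auto simp: cb_eqs)
      qed (simp add: cb_eqs \<alpha>)
      then show ?thesis using that by blast
    qed
    then show "qn (cnum (pr (pr (dy \<alpha> j) j) t)) = c j" by (simp add: cnum_def c_def)
  qed simp_all
  have far: "q - l \<le> 2 * eps M \<or> r - q \<le> 2 * eps M"
    if "S z" "\<And>m. lend (cint T) z m = l" "\<And>m. rend (cint T) z m = r" for z l r
    using neg that M unfolding inI_def ls_def q_def by (metis not_le)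
  \<comment> \<open>The error term is \<open>2 * eps M\<close> at every level, because each step
    uses the avoidance of a gap at the same stage \<open>M\<close>; no errors add up.\<close>
  have claim: "j \<le> n \<longrightarrow> c j * eps (j + j) - 2 * eps M \<le> q \<and> q \<le> (c j + 1) * eps (j + j) + 2 * eps M" for j
  proof (rule nn_ind[of _ j])
    show "pd (\<lambda>j. j \<le> n \<longrightarrow> c j * eps (j + j) - 2 * eps M \<le> q \<and> q \<le> (c j + 1) * eps (j + j) + 2 * eps M)"
      unfolding c_def q_def by (rule pd_D) (rule A.ctdefs adefs3 \<alpha>[THEN conjunct1] x(1) | simp)+
    show "0 \<le> n \<longrightarrow> c 0 * eps (0 + 0) - 2 * eps M \<le> q \<and> q \<le> (c 0 + 1) * eps (0 + 0) + 2 * eps M"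
      using un_bounds[OF x(3) M] \<alpha> by (simp add: c_def cb_eqs q_def)
    fix j assume IH: "j \<le> n \<longrightarrow> c j * eps (j + j) - 2 * eps M \<le> q \<and> q \<le> (c j + 1) * eps (j + j) + 2 * eps M"
    show "j + 1 \<le> n \<longrightarrow> c (j + 1) * eps (j + 1 + (j + 1)) - 2 * eps M \<le> q \<and> q \<le> (c (j + 1) + 1) * eps (j + 1 + (j + 1)) + 2 * eps M"
    proof
      assume jn: "j + 1 \<le> n"
      then have jn': "j \<le> n" by (simp add: nn_less_iff[symmetric])
      define e where "e = eps (j + j + 2)"
      have j2: "j + 1 + (j + 1) = j + j + 1 + 1" by (simp only: ac_simps)
      have j3: "j + j + 2 = j + j + 1 + 1" by (simp add: add.assoc)
      have e: "eps (j + j) = 4 * e" "eps (j + 1 + (j + 1)) = e" "0 < e"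
        unfolding e_def j2 j3 using eps_s[of "j + j"] eps_s[of "j + j + 1"] by simp_all
      have e16: "eps (j + j + 6) = e / 16"
        unfolding e_def using eps_s[of "j + j + 2"] eps_s[of "j + j + 3"] eps_s[of "j + j + 4"] eps_s[of "j + j + 5"]
        by (simp add: add.assoc)
      have jM: "j + j + 6 \<le> M" unfolding M_def using jn' by (intro add_mono) auto
      have E: "eps M \<le> e / 16" using eps_mono[OF jM] e16 by simp
      have near: "\<bar>rl x (j + j + 6) - q\<bar> < e / 16" using isr_le[OF xr M jM] e16 by (simp add: q_def)
      have "S 1" by (rule S_nd) (rule wdefs)
      then obtain z where z: "S z" "pr2 z = 1" "pr2 (pr1 z) = j" "qn (cnum z) = c j" using node[OF jn'] by blast
      have no: "\<not> outn T z" using z(2) by (simp add: outn_def)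
      have "lend (cint T) z m = (4 * c j + 1) * e" "rend (cint T) z m = (4 * c j + 3) * e" for m
        using no by (simp_all add: cint_ends[OF T(1)] z Let_def e(1))
      from far[OF z(1) this] have gapd: "q \<le> (4 * c j + 1) * e + 2 * eps M \<or> (4 * c j + 3) * e - 2 * eps M \<le> q"
        by linarith
      have IH': "c j * (4 * e) - 2 * eps M \<le> q" "q \<le> (c j + 1) * (4 * e) + 2 * eps M" using IH jn' e(1) by auto
      have cs: "c (j + 1) = 4 * c j + 3 * qn (\<alpha> \<odot> j)" using \<alpha> by (simp add: c_def cb_eqs)
      \<comment> \<open>The digit is decided by comparison with the middle of the gap. As
        \<open>x\<close> avoids the gap up to \<open>2 * eps M\<close>, which is at most an eighth
        of the unit \<open>e\<close>, an error of a sixteenth cannot lead to the wrong side.\<close>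
      have \<alpha>j: "\<alpha> \<odot> j = bn ((4 * c j + 2) * e < rl x (j + j + 6))"
        unfolding \<alpha>_def dcp_app[OF x(1)] dc_def c_def e_def cb_dcp[OF x(1)] by simp
      show "c (j + 1) * eps (j + 1 + (j + 1)) - 2 * eps M \<le> q \<and> q \<le> (c (j + 1) + 1) * eps (j + 1 + (j + 1)) + 2 * eps M"
        using gapd
      proof
        assume *: "q \<le> (4 * c j + 1) * e + 2 * eps M"
        then have "rl x (j + j + 6) \<le> (4 * c j + 2) * e"
          using near E e(3) unfolding abs_less_iff by (simp add: algebra_simps)
        then have "c (j + 1) = 4 * c j" using cs \<alpha>j by simp
        then show ?thesis using * IH' e(2) by (simp add: algebra_simps)
      next
        assume *: "(4 * c j + 3) * e - 2 * eps M \<le> q"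
        then have "(4 * c j + 2) * e < rl x (j + j + 6)"
          using near E e(3) unfolding abs_less_iff by (simp add: algebra_simps)
        then have "c (j + 1) = 4 * c j + 3" using cs \<alpha>j by simp
        then show ?thesis using * IH' e(2) by (simp add: algebra_simps)
      qed
    qed
  qed
  have "S 0" by (rule S_nd) (rule wdefs)
  then obtain z where z: "S z" "pr2 z = 0" "pr2 (pr1 z) = i" "qn (cnum z) = c i" "ini (dig (pr1 (pr1 z)) i) i = ini \<alpha> i"
    using node[OF i(1)] by blast
  have o: "outn T z" using z i(2) by (simp add: outn_def)
  define e where "e = eps (i + i)"
  have "lend (cint T) z m = (c i - 1) * e" "rend (cint T) z m = (c i + 2) * e" for m
    using o by (simp_all add: cint_ends[OF T(1)] z Let_def e_def)
  from far[OF z(1) this] have "q \<le> (c i - 1) * e + 2 * eps M \<or> (c i + 2) * e - 2 * eps M \<le> q" by linarith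
  moreover have "c i * e - 2 * eps M \<le> q" "q \<le> (c i + 1) * e + 2 * eps M" using claim[of i] i(1) by (auto simp: e_def)
  \<comment> \<open>The neighbourhood exceeds the node by one unit \<open>e\<close> on either side,
    which is more than twice the tolerance \<open>2 * eps M\<close>.\<close>
  moreover have "4 * eps M < e"
  proof -
    have "i + i + 3 \<le> M" unfolding M_def using i(1) by (intro add_mono) auto
    then have "eps M \<le> eps (i + i + 3)" by (rule eps_mono)
    moreover have "8 * eps (i + i + 3) = e"
      using eps_s[of "i + i"] eps_s[of "i + i + 1"] eps_s[of "i + i + 2"] by (simp add: e_def add.assoc)
    moreover have "0 < e" by (simp add: e_def)
    ultimately show ?thesis by linarith
  qed
  ultimately show False by (auto simp: algebra_simps)
qed

lemma cint_W: "T \<in> D T1 \<Longrightarrow> W T1 T \<Longrightarrow> cint T \<in> D (Nat \<rightarrow>\<^sub>t T1) \<and> W (Nat \<rightarrow>\<^sub>t T1) (cint T) \<and> ivls (cint T)"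
proof -
  assume T: "T \<in> D T1" "W T1 T"
  have "df [] (Nat \<rightarrow>\<^sub>t T1) (\<lambda>e. cint T)" by (rule df_cint wd_con T)+
  from df_W0[OF this] show ?thesis by (simp add: ivls_def isr_def cint_ends[OF T(1)])
qed

lemma dig_cpt_W: "S k \<Longrightarrow> a < p2 k \<Longrightarrow> cpt (dig a k) \<in> D T1 \<and> W T1 (cpt (dig a k))"
proof -
  assume k: "S k" "a < p2 k"
  have "S (p2 k)" by (rule S_nd) (rule wdefs k)+
  then have "S a" using W_le k(2) by (auto simp: less_imp_le)
  then have "df [] T1 (\<lambda>e. cpt (dig a k))" by (intro df_cpt df_dig nd_const k)
  from df_W0[OF this] show ?thesis by blast
qed

lemma HBw_FANp: "HBw \<Longrightarrow> FANp"
  unfolding FANp_def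
proof (intro ballI impI)
  fix T assume H: HBw and T: "T \<in> D T1" "W T1 T" and bar: "\<forall>\<alpha>\<in>D T1. W T1 \<alpha> \<longrightarrow> (\<exists>n. S n \<and> out T (bit \<alpha>) n)"
  obtain k where k: "S k" "\<forall>x\<in>D T1. W T1 x \<longrightarrow> un S (rl x) \<longrightarrow> (\<exists>n\<le>k. inI S x (cint T) n)"
    using H[unfolded HBw_def] cint_W[OF T] cint_cover[OF T bar] by blast
  have "covd T k"
    by (rule cint_covd[OF T(1)])
      (use k(2) dig_cpt_W[OF k(1)] cpt_un[OF bin_dig] ls_mono[of S _ _ "\<lambda>_. True"] in \<open>unfold inI_def, blast\<close>)
  then show "\<exists>k. S k \<and> covd T k" using k(1) by blast
qed

lemma HBs_FANp: "HBs \<Longrightarrow> FANp"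
  unfolding FANp_def
proof (intro ballI impI)
  fix T assume H: HBs and T: "T \<in> D T1" "W T1 T" and bar: "\<forall>\<alpha>\<in>D T1. W T1 \<alpha> \<longrightarrow> (\<exists>n. S n \<and> out T (bit \<alpha>) n)"
  obtain k where k: "S k" "\<forall>x\<in>D T1. un (\<lambda>_. True) (rl x) \<longrightarrow> (\<exists>n\<le>k. inI (\<lambda>_. True) x (cint T) n)"
    using H[unfolded HBs_def] cint_W[OF T] cint_cover[OF T bar] by blast
  have "covd T k"
    by (rule cint_covd[OF T(1)]) (use k(2) dig_cpt_W[OF k(1)] cpt_un[OF bin_dig] in blast)
  then show "\<exists>k. S k \<and> covd T k" using k(1) by blast
qed

end

section \<open>The internal principles\<close>

context cx
begin

text \<open>Transfer is applied to a statement about codes of a tree together with a bound. For a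
  standard code the bound \<open>cH f\<close> sends standard sequences to standard levels, so that
  the hypothesis of the standard fan theorem holds. For an arbitrary tree, choice supplies a
  bound.\<close>

lemma FANp_St_M: "St.FANp \<Longrightarrow> Al.FANp"
proof -
  assume F: St.FANp
  define P where "P = (\<lambda>f. (\<forall>\<alpha>\<in>D T1. out (cT f) (bit \<alpha>) (nv (cH f \<bullet> \<alpha>))) \<longrightarrow> (\<exists>k\<in>D Nat. covd (cT f) (nv k)))"
  have "C.bd [T1, T2] (\<lambda>e. out (cT (e 1)) (bit (e 0)) (nv (cH (e 1) \<bullet> e 0)))"
    "C.bd [Nat, T2] (\<lambda>e. covd (cT (e 1)) (nv (e 0)))"
    by (rule C.defs3 C.codefs C.nd_ap[of _ T1] wd_var | simp)+
  then have "idef [T2] (\<lambda>e. P (e 0))"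
    unfolding P_def
    by (intro idef_imp idef_all[where P = "\<lambda>\<alpha> e. out (cT (e 0)) (bit \<alpha>) (nv (cH (e 0) \<bullet> \<alpha>))"]
        idef_ex[where P = "\<lambda>k e. covd (cT (e 0)) (nv k)"]) (auto intro: bd_idef)
  moreover have "P f" if f: "f \<in> D T2" "Std T2 f" for f
    unfolding P_def
  proof
    assume bar: "\<forall>\<alpha>\<in>D T1. out (cT f) (bit \<alpha>) (nv (cH f \<bullet> \<alpha>))"
    have t: "cT f \<in> D T1" "Std T1 (cT f)" "cH f \<in> D T2" "Std T2 (cH f)"
      using St.df_W0[OF St.df_cT[OF wd_con]] St.df_W0[OF St.df_cH[OF wd_con]] f by auto
    have "\<exists>n. Std Nat (rv n) \<and> out (cT f) (bit \<alpha>) n" if "\<alpha> \<in> D T1" "Std T1 \<alpha>" for \<alpha>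
      using bar that St.S_ap[OF t(3,4) that] by blast
    then obtain k where "covd (cT f) k" using F t unfolding St.FANp_def by blast
    then show "\<exists>k\<in>D Nat. covd (cT f) (nv k)" by (intro bexI[of _ "rv k"]) simp_all
  qed
  ultimately have P: "P f" if "f \<in> D T2" for f using PF_TP[of T2 P] that by blast
  show Al.FANp
    unfolding Al.FANp_def
  proof (intro ballI impI)
    fix T assume T: "T \<in> D T1" and bar: "\<forall>\<alpha>\<in>D T1. True \<longrightarrow> (\<exists>n. True \<and> out T (bit \<alpha>) n)"
    have "A.bd [Nat, T1] (\<lambda>e. out T (bit (e 1)) (nv (e 0)))" by (rule A.defs3 wd_con T wd_var | simp)+
    then obtain h where h: "h \<in> D T2" "\<forall>\<alpha>\<in>D T1. out T (bit \<alpha>) (nv (h \<bullet> \<alpha>))"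
      using Al.AC[of "\<lambda>x n. out T (bit x) n"] bar by auto
    have "P (cc T h)" using P code_D(3)[OF T h(1)] by blast
    then show "\<exists>k. True \<and> covd T k" using h(2) unfolding P_def code_inv[OF T h(1)] by blast
  qed
qed

definition mu :: "tm \<Rightarrow> bool" where
  "mu m \<longleftrightarrow> (\<forall>x\<in>D T1. \<forall>t\<in>D Nat. x \<odot> nv t \<noteq> 0 \<longrightarrow> x \<odot> nv (m \<bullet> x) \<noteq> 0)"

text \<open>Being a search operator is an internal property without parameters, so transfer applies
  to the existence of one.\<close>

lemma mu_std: "m \<in> D T2 \<Longrightarrow> mu m \<Longrightarrow> \<exists>m\<in>D T2. Std T2 m \<and> mu m"
proof (rule PF_TP_ex)
  have "C.bd [Nat, T1, T2] (\<lambda>e. e 1 \<odot> nv (e 0) \<noteq> 0 \<longrightarrow> e 1 \<odot> nv (e 2 \<bullet> e 1) \<noteq> 0)"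
    by (rule C.defs3 C.nd_ap[of _ T1] wd_var | simp add: numeral_2_eq_2)+
  note b = bd_idef[OF this]
  have "idef [T1, T2] (\<lambda>e. \<forall>t\<in>D Nat. e 0 \<odot> nv t \<noteq> 0 \<longrightarrow> e 0 \<odot> nv (e 1 \<bullet> e 0) \<noteq> 0)"
    by (rule idef_all[where P = "\<lambda>t e. e 0 \<odot> nv t \<noteq> 0 \<longrightarrow> e 0 \<odot> nv (e 1 \<bullet> e 0) \<noteq> 0"])
      (use b in \<open>simp add: numeral_2_eq_2\<close>)
  then show "idef [T2] (\<lambda>e. mu (e 0))" unfolding mu_def
    by (intro idef_all[where P = "\<lambda>x e. \<forall>t\<in>D Nat. x \<odot> nv t \<noteq> 0 \<longrightarrow> x \<odot> nv (e 0 \<bullet> x) \<noteq> 0"]) simp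
qed

text \<open>Grilliot's trick: a functional that is unbounded along a sequence converging to \<open>\<beta>\<close> is not
  continuous at \<open>\<beta>\<close>, and its values at suitable members of the sequence give a search operator.\<close>
lemma grilliot:
  assumes h: "h \<in> D T2" and b: "\<beta> \<in> D T1" and unb: "\<And>n. n < nv (h \<bullet> ent (ini \<beta> n))"
  shows "\<exists>m\<in>D T2. mu m"
proof -
  define H where "H = nv (h \<bullet> \<beta>)"
  \<comment> \<open>If \<open>s\<close> is the first place where \<open>x\<close> is nonzero,
    \<open>gm x\<close> is the member \<open>ent (ini \<beta> s)\<close> of the sequence; it is
    \<open>\<beta>\<close> if there is no such place. The value at \<open>i\<close> can be computed
    from \<open>x\<close> up to \<open>i\<close>, since that member agrees with
    \<open>\<beta>\<close> below \<open>s\<close>.\<close>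
  define gm where "gm = (\<lambda>x. ln (\<lambda>i. if bmin (i + 1) (\<lambda>t. x \<odot> t \<noteq> 0) = i + 1 then \<beta> \<odot> i
    else ent (ini \<beta> (bmin (i + 1) (\<lambda>t. x \<odot> t \<noteq> 0))) \<odot> i))"
  define m where "m = lamv T1 Nat (\<lambda>x. rv (bmin (nv (h \<bullet> gm x)) (\<lambda>t. x \<odot> t \<noteq> 0)))"
  have nb: "A.df \<Gamma> T1 x \<Longrightarrow> A.nd \<Gamma> n \<Longrightarrow> A.nd \<Gamma> (\<lambda>e. bmin (n e) (\<lambda>t. x e \<odot> t \<noteq> 0))" for \<Gamma> x n
    by (rule A.nd_bmin[where P = "\<lambda>t e. x e \<odot> t \<noteq> 0"]) (rule A.defs3 wd_weak | assumption | simp)+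
  have ng: "A.df \<Gamma> T1 x \<Longrightarrow> A.df \<Gamma> T1 (\<lambda>e. gm (x e))" for \<Gamma> x
    unfolding gm_def
    by (rule A.df_ln[where h = "\<lambda>i e. if bmin (i + 1) (\<lambda>t. x e \<odot> t \<noteq> 0) = i + 1 then \<beta> \<odot> i
      else ent (ini \<beta> (bmin (i + 1) (\<lambda>t. x e \<odot> t \<noteq> 0))) \<odot> i"]) (rule nb A.defs3 wd_con[of \<beta>] b wd_weak | assumption | simp)+
  have 1: "A.df [T1] Nat (\<lambda>e. rv (bmin (nv (h \<bullet> gm (e 0))) (\<lambda>t. e 0 \<odot> t \<noteq> 0)))"
    by (rule A.df_rv nb ng A.nd_ap[of _ T1] wd_con[of h] h wd_var | simp)+
  have mD: "m \<in> D T2" unfolding m_def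
    using A.df_lam[where h = "\<lambda>x e. rv (bmin (nv (h \<bullet> gm x)) (\<lambda>t. x \<odot> t \<noteq> 0))" and \<Gamma> = "[]", OF 1] A.df_W0 by blast
  have "x \<odot> nv (m \<bullet> x) \<noteq> 0" if x: "x \<in> D T1" and t: "x \<odot> t \<noteq> 0" for x t
  proof -
    have mx: "nv (m \<bullet> x) = bmin (nv (h \<bullet> gm x)) (\<lambda>t. x \<odot> t \<noteq> 0)" unfolding m_def
      using A.df_lam_ap[where h = "\<lambda>x e. rv (bmin (nv (h \<bullet> gm x)) (\<lambda>t. x \<odot> t \<noteq> 0))" and \<Gamma> = "[]" and e = undefined, OF 1] x
      by simp
    have P: "pd (\<lambda>t. x \<odot> t \<noteq> 0)" by (rule pd_D) (rule A.defs3 wd_con x | simp)+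
    obtain s where s: "x \<odot> s \<noteq> 0" "\<forall>j<s. x \<odot> j = 0" using least[OF P t] by blast
    have "gm x = ent (ini \<beta> s)"
    proof (rule fa_ext)
      show "gm x \<in> D T1" using A.df_W0[OF ng[OF wd_con[of x]]] x by blast
      fix i
      have "fd (\<lambda>i. if bmin (i + 1) (\<lambda>t. x \<odot> t \<noteq> 0) = i + 1 then \<beta> \<odot> i else ent (ini \<beta> (bmin (i + 1) (\<lambda>t. x \<odot> t \<noteq> 0))) \<odot> i)"
        by (rule pd_D) (rule nb A.defs3 wd_con x b | simp)+
      then have g: "gm x \<odot> i = (if bmin (i + 1) (\<lambda>t. x \<odot> t \<noteq> 0) = i + 1 then \<beta> \<odot> i else ent (ini \<beta> (bmin (i + 1) (\<lambda>t. x \<odot> t \<noteq> 0))) \<odot> i)"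
        unfolding gm_def by (rule fd_lnD)
      show "gm x \<odot> i = ent (ini \<beta> s) \<odot> i"
      proof (cases "i < s")
        case True
        have "bmin (i + 1) (\<lambda>t. x \<odot> t \<noteq> 0) = i + 1"
        proof (rule ccontr)
          assume n: "\<not> ?thesis"
          then have l: "bmin (i + 1) (\<lambda>t. x \<odot> t \<noteq> 0) < i + 1" using bmin(1)[OF P, of "i + 1"] by (simp add: order.strict_iff_order)
          then have "bmin (i + 1) (\<lambda>t. x \<odot> t \<noteq> 0) < s" using True by simp
          then show False using s(2) bmin(3)[OF P l] by blast
        qed
        then show ?thesis using g True by (simp add: ent_ini[OF b])
      next
        case False
        then have "s < i + 1" by simp
        then have "bmin (i + 1) (\<lambda>t. x \<odot> t \<noteq> 0) = s"
          using bmin_le[OF P s(1), of "i + 1"] bmin_P[OF P s(1), of "i + 1"] s(2) by (auto simp: le_less)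
        then show ?thesis using g \<open>s < i + 1\<close> by auto
      qed
    qed simp
    \<comment> \<open>The value of \<open>h\<close> at the member with index \<open>s\<close>
      exceeds \<open>s\<close>, so it is a search bound below which the nonzero place is
      found.\<close>
    then have "s < nv (h \<bullet> gm x)" using unb[of s] by simp
    then show ?thesis unfolding mx by (rule bmin_P[OF P s(1)])
  qed
  then have "mu m" unfolding mu_def by blast
  then show ?thesis using mD by blast
qed

text \<open>The part of \<open>T\<close> above the node with numerator \<open>a\<close> at level
  \<open>n\<close> has died out by level \<open>k\<close>. The condition is decidable, so that a
  search operator can decide whether some \<open>k\<close> satisfies it.\<close>

definition badn :: "tm \<Rightarrow> nn \<Rightarrow> nn \<Rightarrow> nn \<Rightarrow> bool" where
  "badn T a n k \<longleftrightarrow> n \<le> k \<and> (\<forall>b<p2 k. dy (dig b k) n = a \<longrightarrow> out T (dig b k) k)"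
definition bads :: "tm \<Rightarrow> nn \<Rightarrow> nn \<Rightarrow> tm" where "bads T a n = ln (\<lambda>k. bn (badn T a n k))"
definition bado :: "tm \<Rightarrow> tm \<Rightarrow> nn \<Rightarrow> nn \<Rightarrow> bool" where "bado m T a n \<longleftrightarrow> badn T a n (nv (m \<bullet> bads T a n))"
text \<open>The path turns right exactly when the left child is found to have a bounded subtree; in
  an unbounded tree it thus keeps to nodes with unbounded subtrees.\<close>

definition lpn :: "tm \<Rightarrow> tm \<Rightarrow> nn \<Rightarrow> nn" where
  "lpn m T n = prec n 0 (\<lambda>r i. 2 * r + bn (bado m T (2 * r) (i + 1)))"
definition lpp :: "tm \<Rightarrow> tm \<Rightarrow> tm" where "lpp m T = ln (\<lambda>i. bn (bado m T (2 * lpn m T i) (i + 1)))"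

end

context wcx
begin

lemma bd_badn: "df \<Gamma> T1 T \<Longrightarrow> nd \<Gamma> a \<Longrightarrow> nd \<Gamma> n \<Longrightarrow> nd \<Gamma> k \<Longrightarrow> bd \<Gamma> (\<lambda>e. badn (T e) (a e) (n e) (k e))"
  unfolding badn_def
  by (rule bd_conj, rule bd_le, assumption, assumption,
      rule bd_alll[where P = "\<lambda>b e. dy (dig b (k e)) (n e) = a e \<longrightarrow> out (T e) (dig b (k e)) (k e)"])
    (rule defs3 wd_weak nd_weak | assumption | simp)+

lemma df_bads: "df \<Gamma> T1 T \<Longrightarrow> nd \<Gamma> a \<Longrightarrow> nd \<Gamma> n \<Longrightarrow> df \<Gamma> T1 (\<lambda>e. bads (T e) (a e) (n e))"
  unfolding bads_def
  by (rule df_ln[where h = "\<lambda>k e. bn (badn (T e) (a e) (n e) k)"]) (rule nd_bn bd_badn wd_weak nd_weak nd_var | assumption | simp)+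

lemma bd_bado: "df \<Gamma> T2 m \<Longrightarrow> df \<Gamma> T1 T \<Longrightarrow> nd \<Gamma> a \<Longrightarrow> nd \<Gamma> n \<Longrightarrow> bd \<Gamma> (\<lambda>e. bado (m e) (T e) (a e) (n e))"
  unfolding bado_def by (rule bd_badn nd_ap[of _ T1] df_bads | assumption)+

lemma nd_lpn: "df \<Gamma> T2 m \<Longrightarrow> df \<Gamma> T1 T \<Longrightarrow> nd \<Gamma> n \<Longrightarrow> nd \<Gamma> (\<lambda>e. lpn (m e) (T e) (n e))"
  unfolding lpn_def
  by (rule nd_prec[where h = "\<lambda>r i e. 2 * r + bn (bado (m e) (T e) (2 * r) (i + 1))"])
    (rule bd_bado defs wd_weak2 | assumption | simp)+

lemma df_lpp: "df \<Gamma> T2 m \<Longrightarrow> df \<Gamma> T1 T \<Longrightarrow> df \<Gamma> T1 (\<lambda>e. lpp (m e) (T e))"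
  unfolding lpp_def
  by (rule df_ln[where h = "\<lambda>i e. bn (bado (m e) (T e) (2 * lpn (m e) (T e) i) (i + 1))"])
    (rule bd_bado nd_lpn defs wd_weak | assumption | simp)+

end

context cx
begin

lemma bado: "mu m \<Longrightarrow> m \<in> D T2 \<Longrightarrow> T \<in> D T1 \<Longrightarrow> bado m T a n \<longleftrightarrow> (\<exists>k. badn T a n k)"
proof
  assume m: "mu m" "m \<in> D T2" and T: "T \<in> D T1"
  have f: "fd (\<lambda>k. bn (badn T a n k))" by (rule pd_D) (rule A.nd_bn A.bd_badn wd_con T A.nd_const A.nd_var | simp)+
  have B: "bads T a n \<in> D T1" "\<And>k. bads T a n \<odot> k = bn (badn T a n k)"
    unfolding bads_def using fd_lnD[OF f] by auto
  assume "\<exists>k. badn T a n k"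
  then obtain k where "bads T a n \<odot> nv (rv k) \<noteq> 0" using B(2) by auto
  then have "bads T a n \<odot> nv (m \<bullet> bads T a n) \<noteq> 0" using m(1) B(1) rv_D unfolding mu_def by blast
  then show "bado m T a n" unfolding bado_def B(2) by simp
qed (auto simp: bado_def)

text \<open>The invariant is that the subtree above the current node is unbounded. Through
  \<open>bado\<close> it has a characteristic function, which makes the induction along the path
  legitimate.\<close>

lemma leftmost:
  assumes m: "mu m" "m \<in> D T2" and T: "T \<in> D T1" and unc: "\<And>k. \<not> covd T k"
  shows "bin (lpp m T) \<and> (\<forall>n. \<not> out T (lpp m T) n)"
proof -
  let ?\<alpha> = "lpp m T"
  have ao: "?\<alpha> \<in> D T1" "?\<alpha> \<odot> i = bn (bado m T (2 * lpn m T i) (i + 1))" for i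
    unfolding lpp_def by (rule fd_lnD, rule pd_D, (rule A.nd_bn A.bd_bado A.nd_lpn A.defs wd_con m T | simp)+)+
  have bin: "bin ?\<alpha>" using ao by simp
  have l0: "lpn m T 0 = 0" and ls: "lpn m T (n + 1) = 2 * lpn m T n + bn (bado m T (2 * lpn m T n) (n + 1))" for n
    unfolding lpn_def by (rule prec_eqs0, (rule A.bd_bado A.defs wd_con m T | simp)+)+
  have dl: "dy ?\<alpha> n = lpn m T n" for n
  proof (rule nn_ind[of _ n])
    show "pd (\<lambda>n. dy ?\<alpha> n = lpn m T n)" by (rule pd_D) (rule A.nd_dy A.nd_lpn A.defs wd_con m T ao(1) | simp)+
  qed (simp_all add: dy_eqs ao l0 ls)
  have "\<not> bado m T (lpn m T n) n" for n
  proof (rule nn_ind[of _ n])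
    show "pd (\<lambda>n. \<not> bado m T (lpn m T n) n)" by (rule pd_D) (rule A.bd_bado A.nd_lpn A.defs wd_con m T | simp)+
    show "\<not> bado m T (lpn m T 0) 0"
      unfolding bado[OF m T] badn_def l0 using unc by (auto simp: covd_def dy_eqs)
    fix n assume IH: "\<not> bado m T (lpn m T n) n"
    define a where "a = lpn m T n"
    show "\<not> bado m T (lpn m T (n + 1)) (n + 1)"
    proof (cases "bado m T (2 * a) (n + 1)")
      case True
      show ?thesis
      proof
        assume "bado m T (lpn m T (n + 1)) (n + 1)"
        then have "bado m T (2 * a + 1) (n + 1)" using True by (simp add: ls a_def)
        then obtain k1 k2 where k: "badn T (2 * a) (n + 1) k1" "badn T (2 * a + 1) (n + 1) k2"
          using True unfolding bado[OF m T] by blast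
        \<comment> \<open>If both children had bounded subtrees, the sum of the two bounds would
          bound the subtree of the node itself.\<close>
        define k where "k = k1 + k2"
        have k12: "k1 \<le> k" "k2 \<le> k" by (simp_all add: k_def)
        have nk: "n \<le> k" "n + 1 \<le> k1" "n + 1 \<le> k2" using k k12(1) by (auto simp: badn_def nn_less_iff[symmetric])
        then obtain b where b: "b < p2 k" "dy (dig b k) n = a" "\<not> out T (dig b k) k"
          using IH unfolding bado[OF m T] badn_def a_def[symmetric] by blast
        define \<delta> where "\<delta> = dig b k"
        have \<delta>: "bin \<delta>" by (simp add: \<delta>_def)
        have no: False if kk: "badn T (dy \<delta> (n + 1)) (n + 1) k'" "k' \<le> k" "n + 1 \<le> k'" for k'
        proof -
          have d: "dig (dy \<delta> k') k' \<odot> i = \<delta> \<odot> i" if "i < k'" for i by (rule dig_dy[OF \<delta> that])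
          have "dy (dig (dy \<delta> k') k') (n + 1) = dy \<delta> (n + 1)"
          proof (rule dy_cong)
            show "dig (dy \<delta> k') k' \<odot> i = \<delta> \<odot> i" if "i < n + 1" for i by (rule d) (rule less_le_trans[OF that kk(3)])
          qed (use \<delta> in auto)
          then have "out T (dig (dy \<delta> k') k') k'" using kk(1) dy_less[OF \<delta>] unfolding badn_def by blast
          then have "out T \<delta> k'" using out_cong[of "dig (dy \<delta> k') k'" \<delta> k' T] d \<delta> by simp
          then show False using out_mono[OF _ kk(2)] b(3) unfolding \<delta>_def by blast
        qed
        have "dy \<delta> (n + 1) = 2 * a + \<delta> \<odot> n" using b(2) \<delta> by (simp add: dy_eqs \<delta>_def)
        moreover have "\<delta> \<odot> n = 0 \<or> \<delta> \<odot> n = 1" using \<delta> nn_less_1[of "\<delta> \<odot> n"] by (auto simp: le_less)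
        ultimately show False using no k k12 nk by auto
      qed
    next
      case False
      then show ?thesis by (simp add: ls a_def)
    qed
  qed
  then have "\<exists>b<p2 n. dy (dig b n) n = dy ?\<alpha> n \<and> \<not> out T (dig b n) n" for n
    unfolding bado[OF m T] badn_def dl[symmetric] by blast
  then have "\<not> out T (dig (dy ?\<alpha> n) n) n" for n using dy_dig by metis
  then have "\<not> out T ?\<alpha> n" for n
    using out_cong[of "dig (dy ?\<alpha> n) n" ?\<alpha> n T] dig_dy[OF bin] ao(1) by simp
  then show ?thesis using bin by blast
qed

lemma bit_bin: "bin \<alpha> \<Longrightarrow> bit \<alpha> = \<alpha>"
proof (rule fa_ext)
  show "bin \<alpha> \<Longrightarrow> bit \<alpha> \<odot> i = \<alpha> \<odot> i" for i using nn_less_1[of "\<alpha> \<odot> i"] by (auto simp: bn_def le_less)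
qed auto

text \<open>With a search operator the height of a tree is found by a search for the decidable
  \<open>covd\<close>. For a standard tree the operator is taken to be standard; if the tree were
  unbounded, its leftmost path would be standard and would contradict the hypothesis on standard
  sequences.\<close>

lemma mu_UFAN:
  assumes m: "mu m" "m \<in> D T2" and F: Al.FANp
  shows "St.FANp \<and> Al.UFAN"
proof
  have cov: "covd T (nv (m \<bullet> ln (\<lambda>k. bn (covd T k))))" if T: "T \<in> D T1" and k: "covd T k" and m: "mu m" "m \<in> D T2" for T k m
  proof -
    have "fd (\<lambda>k. bn (covd T k))" by (rule pd_D) (rule A.defs3 wd_con T | simp)+
    note l = fd_lnD[OF this]
    have "ln (\<lambda>k. bn (covd T k)) \<odot> nv (rv k) \<noteq> 0" using l(2) k by simp
    then have "ln (\<lambda>k. bn (covd T k)) \<odot> nv (m \<bullet> ln (\<lambda>k. bn (covd T k))) \<noteq> 0"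
      using m(1) l(1) rv_D unfolding mu_def by blast
    then show ?thesis unfolding l(2) by simp
  qed
  show Al.UFAN
  proof -
    define \<Psi> where "\<Psi> = lamv T1 (T2 \<rightarrow>\<^sub>t Nat) (\<lambda>T. lamv T2 Nat (\<lambda>h. m \<bullet> ln (\<lambda>k. bn (covd T k))))"
    have l: "A.df \<Gamma> T1 T \<Longrightarrow> A.df \<Gamma> T1 (\<lambda>e. ln (\<lambda>k. bn (covd (T e) k)))" for \<Gamma> T
      by (rule A.df_ln[where h = "\<lambda>k e. bn (covd (T e) k)"]) (rule A.defs3 wd_weak | assumption | simp)+
    have a: "A.df [T2, T1] Nat (\<lambda>e. m \<bullet> ln (\<lambda>k. bn (covd (e 1) k)))"
      by (rule wd_ap[of _ _ T1] wd_con[of m] m l wd_var | simp)+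
    have b: "A.df [T1] (T2 \<rightarrow>\<^sub>t Nat) (\<lambda>e. lamv T2 Nat (\<lambda>h. m \<bullet> ln (\<lambda>k. bn (covd (e 0) k))))"
      by (rule A.df_lam[where h = "\<lambda>h e. m \<bullet> ln (\<lambda>k. bn (covd (e 0) k))"]) (use a in simp)
    have c: "A.df [] (T1 \<rightarrow>\<^sub>t T2 \<rightarrow>\<^sub>t Nat) (\<lambda>e. \<Psi>)" unfolding \<Psi>_def
      by (rule A.df_lam[where h = "\<lambda>T e. lamv T2 Nat (\<lambda>h. m \<bullet> ln (\<lambda>k. bn (covd T k)))"]) (rule b)
    have "covd T (nv (\<Psi> \<bullet> T \<bullet> h))"
      if *: "T \<in> D T1" "h \<in> D T2" "\<forall>\<alpha>\<in>D T1. True \<longrightarrow> out T (bit \<alpha>) (nv (h \<bullet> \<alpha>))" for T h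
    proof -
      have "\<Psi> \<bullet> T = lamv T2 Nat (\<lambda>h. m \<bullet> ln (\<lambda>k. bn (covd T k)))" unfolding \<Psi>_def
        using A.df_lam_ap[where h = "\<lambda>T e. lamv T2 Nat (\<lambda>h. m \<bullet> ln (\<lambda>k. bn (covd T k)))" and \<Gamma> = "[]" and e = undefined, OF b] * by simp
      moreover have "lamv T2 Nat (\<lambda>h. m \<bullet> ln (\<lambda>k. bn (covd T k))) \<bullet> h = m \<bullet> ln (\<lambda>k. bn (covd T k))"
        using A.df_lam_ap[where h = "\<lambda>h e. m \<bullet> ln (\<lambda>k. bn (covd (e 0) k))" and \<Gamma> = "[T1]" and e = "T ## undefined"] a * by simp
      ultimately have v: "\<Psi> \<bullet> T \<bullet> h = m \<bullet> ln (\<lambda>k. bn (covd T k))" by simp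
      have "\<exists>k. True \<and> covd T k" using F[unfolded Al.FANp_def] * by blast
      then obtain k where "covd T k" by blast
      from cov[OF *(1) this m] show ?thesis unfolding v .
    qed
    then show ?thesis unfolding Al.UFAN_def using A.df_W0[OF c] by blast
  qed
  show St.FANp
    unfolding St.FANp_def
  proof (intro ballI impI)
    fix T assume T: "T \<in> D T1" "Std T1 T" and bar: "\<forall>\<alpha>\<in>D T1. Std T1 \<alpha> \<longrightarrow> (\<exists>n. Std Nat (rv n) \<and> out T (bit \<alpha>) n)"
    obtain m where m: "m \<in> D T2" "Std T2 m" "mu m" using mu_std assms by blast
    have "\<exists>k. covd T k"
    proof (rule ccontr)
      assume "\<nexists>k. covd T k"
      then have *: "bin (lpp m T)" "\<And>n. \<not> out T (lpp m T) n" using leftmost[OF m(3,1) T(1)] by auto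
      have "St.df [] T1 (\<lambda>e. lpp m T)" by (rule St.df_lpp wd_con m T)+
      then have "Std T1 (lpp m T)" by (auto dest: St.df_W0)
      then show False using bar * bit_bin[OF *(1)] by metis
    qed
    then obtain k where "covd T k" by blast
    from cov[OF T(1) this m(3,1)] have "covd T (nv (m \<bullet> ln (\<lambda>k. bn (covd T k))))" .
    moreover have "Std Nat (rv (nv (m \<bullet> ln (\<lambda>k. bn (covd T k)))))"
      by (rule St.S_nd) (rule St.nd_ap[of _ T1] wd_con m St.df_ln[where h = "\<lambda>k e. bn (covd T k)"] T St.defs3 | simp)+
    ultimately show "\<exists>k. Std Nat (rv k) \<and> covd T k" by blast
  qed
qed

lemma QF_FANp:
  assumes QF: "ax_QF_AC T2 Nat \<subseteq> T0" and F: Al.FANp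
  shows "St.FANp \<and> Al.UFAN"
proof -
  \<comment> \<open>The number \<open>y\<close> serves twice, as the height and as the code of a
    test sequence. This keeps the formula quantifier-free, as the choice schema for type 2 demands,
    and a standard \<open>y\<close> gives a standard test sequence.\<close>
  define \<Theta> where "\<Theta> = (\<lambda>f y. out (cT f) (bit (ent y)) (nv (cH f \<bullet> ent y)) \<longrightarrow> covd (cT f) y)"
  have bd\<Theta>: "C.df \<Gamma> T2 f \<Longrightarrow> C.nd \<Gamma> y \<Longrightarrow> C.bd \<Gamma> (\<lambda>e. \<Theta> (f e) (y e))" for \<Gamma> f y
    unfolding \<Theta>_def by (rule C.codefs C.nd_ap[of _ T1] C.bd_imp C.bd_out C.bd_covd C.df_bit C.df_ent | assumption)+
  show ?thesis
  proof (cases "\<forall>f\<in>D T2. \<exists>y. \<Theta> f y")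
    case True
    have "C.bd [Nat, T2, Nat] (\<lambda>e. \<Theta> (e 1) (nv (e 0)))" by (rule bd\<Theta> wd_var C.nd_var | simp)+
    note q = bd_qdef[OF this]
    have ex: "\<exists>y\<in>D Nat. \<Theta> f (nv y)" if f: "f \<in> D T2" for f
    proof -
      obtain y where "\<Theta> f y" using True f by blast
      then show ?thesis by (intro bexI[of _ "rv y"]) simp_all
    qed
    obtain \<Psi>0 where \<Psi>0: "\<Psi>0 \<in> D (T2 \<rightarrow>\<^sub>t Nat)" "\<forall>f\<in>D T2. \<Theta> f (nv (\<Psi>0 \<bullet> f))"
      using qf_choice[where P = "\<lambda>y f _. \<Theta> f (nv y)", OF q zero_D QF ex] by blast
    have St.FANp
      unfolding St.FANp_def
    proof (intro ballI impI)
      fix T assume T: "T \<in> D T1" "Std T1 T" and bar: "\<forall>\<alpha>\<in>D T1. Std T1 \<alpha> \<longrightarrow> (\<exists>n. Std Nat (rv n) \<and> out T (bit \<alpha>) n)"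
      have "C.bd [T2, T2 \<rightarrow>\<^sub>t Nat] (\<lambda>e. \<Theta> (e 0) (nv (e 1 \<bullet> e 0)))" by (rule bd\<Theta> C.nd_ap[of _ T2] wd_var | simp)+
      then have "idef [T2 \<rightarrow>\<^sub>t Nat] (\<lambda>e. \<forall>f\<in>D T2. \<Theta> f (nv (e 0 \<bullet> f)))"
        by (intro idef_all[where P = "\<lambda>f e. \<Theta> f (nv (e 0 \<bullet> f))"]) (use bd_idef in simp)
      from PF_TP_ex[OF this \<Psi>0] obtain \<Psi> where \<Psi>: "\<Psi> \<in> D (T2 \<rightarrow>\<^sub>t Nat)" "Std (T2 \<rightarrow>\<^sub>t Nat) \<Psi>" "\<forall>f\<in>D T2. \<Theta> f (nv (\<Psi> \<bullet> f))"
        by blast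
      have "St.bd [Nat, T1] (\<lambda>e. out T (bit (e 1)) (nv (e 0)))" by (rule St.defs3 wd_con T wd_var | simp)+
      from St.AC[of "\<lambda>x n. out T (bit x) n", OF this] bar
      obtain h where h: "h \<in> D T2" "Std T2 h" "\<forall>\<alpha>\<in>D T1. Std T1 \<alpha> \<longrightarrow> out T (bit \<alpha>) (nv (h \<bullet> \<alpha>))" by auto
      have "St.df [] T2 (\<lambda>e. cc T h)" by (rule St.df_cc wd_con T h)+
      from St.df_W0[OF this] have f: "cc T h \<in> D T2" "Std T2 (cc T h)" by auto
      define y where "y = nv (\<Psi> \<bullet> cc T h)"
      have y: "Std Nat (rv y)" unfolding y_def by (rule St.S_ap[OF \<Psi>(1,2) f])
      have "St.df [] T1 (\<lambda>e. ent y)" by (rule St.df_ent St.nd_const y)+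
      then have e: "Std T1 (ent y)" by (auto dest: St.df_W0)
      have "\<Theta> (cc T h) y" using \<Psi>(3) f(1) unfolding y_def by blast
      then have "covd T y" using h(3) e obj_D(2) unfolding \<Theta>_def code_inv[OF T(1) h(1)] by blast
      then show "\<exists>k. Std Nat (rv k) \<and> covd T k" using y by blast
    qed
    moreover have Al.UFAN
    proof -
      define \<Psi> where "\<Psi> = lamv T1 (T2 \<rightarrow>\<^sub>t Nat) (\<lambda>T. lamv T2 Nat (\<lambda>h. \<Psi>0 \<bullet> cc T h))"
      have a: "A.df [T2, T1] Nat (\<lambda>e. \<Psi>0 \<bullet> cc (e 1) (e 0))"
        by (rule wd_ap[of _ _ T2] wd_con \<Psi>0(1) A.df_cc wd_var | simp)+
      have b: "A.df [T1] (T2 \<rightarrow>\<^sub>t Nat) (\<lambda>e. lamv T2 Nat (\<lambda>h. \<Psi>0 \<bullet> cc (e 0) h))"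
        by (rule A.df_lam[where h = "\<lambda>h e. \<Psi>0 \<bullet> cc (e 0) h"]) (use a in simp)
      have c: "A.df [] (T1 \<rightarrow>\<^sub>t T2 \<rightarrow>\<^sub>t Nat) (\<lambda>e. \<Psi>)" unfolding \<Psi>_def
        by (rule A.df_lam[where h = "\<lambda>T e. lamv T2 Nat (\<lambda>h. \<Psi>0 \<bullet> cc T h)"]) (rule b)
      have "covd T (nv (\<Psi> \<bullet> T \<bullet> h))"
        if *: "T \<in> D T1" "h \<in> D T2" "\<forall>\<alpha>\<in>D T1. True \<longrightarrow> out T (bit \<alpha>) (nv (h \<bullet> \<alpha>))" for T h
      proof -
        have "\<Psi> \<bullet> T = lamv T2 Nat (\<lambda>h. \<Psi>0 \<bullet> cc T h)" unfolding \<Psi>_def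
          using A.df_lam_ap[where h = "\<lambda>T e. lamv T2 Nat (\<lambda>h. \<Psi>0 \<bullet> cc T h)" and \<Gamma> = "[]" and e = undefined, OF b] * by simp
        moreover have "lamv T2 Nat (\<lambda>h. \<Psi>0 \<bullet> cc T h) \<bullet> h = \<Psi>0 \<bullet> cc T h"
          using A.df_lam_ap[where h = "\<lambda>h e. \<Psi>0 \<bullet> cc (e 0) h" and \<Gamma> = "[T1]" and e = "T ## undefined"] a * by simp
        ultimately have v: "\<Psi> \<bullet> T \<bullet> h = \<Psi>0 \<bullet> cc T h" by simp
        have "\<Theta> (cc T h) (nv (\<Psi>0 \<bullet> cc T h))" using \<Psi>0(2) code_D(3)[OF *(1,2)] by blast
        then show ?thesis using *(3) obj_D(2) unfolding v \<Theta>_def code_inv[OF *(1,2)] by blast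
      qed
      then show ?thesis unfolding Al.UFAN_def using A.df_W0[OF c] by blast
    qed
    ultimately show ?thesis by blast
  next
    case False
    \<comment> \<open>In this case \<open>h\<close> bounds the exit of every coded sequence although
      \<open>T\<close> has no height, so by the fan theorem some path never leaves \<open>T\<close>.
      Its initial segments, coded and decoded again, converge to it while \<open>h\<close> is
      unbounded along them.\<close>
    then obtain f where f: "f \<in> D T2" "\<And>y. \<not> \<Theta> f y" by blast
    define T where "T = cT f"
    define h where "h = cH f"
    have D: "T \<in> D T1" "h \<in> D T2" using code_D f(1) by (auto simp: T_def h_def)
    have o: "out T (bit (ent y)) (nv (h \<bullet> ent y))" and nc: "\<not> covd T y" for y
      using f(2)[of y] unfolding \<Theta>_def T_def h_def by auto
    obtain \<alpha> where \<alpha>: "\<alpha> \<in> D T1" "\<And>n. \<not> out T (bit \<alpha>) n"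
    proof -
      have "\<not> (\<forall>\<alpha>\<in>D T1. True \<longrightarrow> (\<exists>n. True \<and> out T (bit \<alpha>) n))"
        using F[unfolded Al.FANp_def, THEN bspec, OF D(1), THEN mp, OF TrueI] nc by (metis (no_types))
      then show thesis using that by auto
    qed
    define \<beta> where "\<beta> = bit \<alpha>"
    have \<beta>: "bin \<beta>" unfolding \<beta>_def using \<alpha>(1) by simp
    have "n < nv (h \<bullet> ent (ini \<beta> n))" for n
    proof (rule ccontr)
      let ?e = "ent (ini \<beta> n)"
      assume "\<not> n < nv (h \<bullet> ?e)"
      then have "out T (bit ?e) n" using out_mono[OF o[of "ini \<beta> n"]] by (simp add: not_less)
      moreover have "bit ?e \<odot> i = \<beta> \<odot> i" if "i < n" for i
        using \<beta> that nn_less_1[of "\<beta> \<odot> i"] by (auto simp: ent_ini bn_def le_less)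
      ultimately have "out T \<beta> n" using out_cong[of "bit ?e" \<beta> n T] \<beta> by simp
      then show False using \<alpha>(2) unfolding \<beta>_def by blast
    qed
    from grilliot[OF D(2) \<beta>[THEN conjunct1] this] obtain m where "m \<in> D T2" "mu m" by blast
    then show ?thesis using mu_UFAN[of m] F by simp
  qed
qed

end

section \<open>The meaning of the formulas\<close>

text \<open>Reals occur in the formulas as functions of terms that are placed under further binders;
  the value of what they contain must not change there.\<close>

lemma evl_stable_gen:
  "stable d s \<Longrightarrow> d \<le> d' \<Longrightarrow> (\<And>i. e' (i + (d' - d)) = e i) \<Longrightarrow> evl M e' (s d') = evl M e (s d)"
proof (induction "d' - d" arbitrary: d' e')
  case 0
  then have "d' = d" "e' = e" by auto
  then show ?case by simp
next
  case (Suc k)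
  then obtain c where c: "d' = Suc c" "d \<le> c" by (cases d') auto
  have e': "e' = e' 0 ## (\<lambda>i. e' (Suc i))" by (rule ext) (simp add: scn_def split: nat.split)
  have "evl M e' (s d') = evl M (\<lambda>i. e' (Suc i)) (s c)"
    by (subst e') (use evl_stable[OF stable_mono[OF Suc.prems(1) c(2)]] c(1) in simp)
  also have "\<dots> = evl M e (s d)"
    using Suc.hyps(2) Suc.prems c by (intro Suc.hyps(1)) (auto simp: Suc_diff_le)
  finally show ?case .
qed

lemma qq_gap: "0 < a \<Longrightarrow> 0 < b \<Longrightarrow> 0 < p \<Longrightarrow> 2 * (a * b) < p * x \<longleftrightarrow> 2 * (1 / p) < x / (b * (a::qq))"
  by (simp add: field_simps)

definition bq :: "fm \<Rightarrow> bool" where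
  "bq \<phi> \<longleftrightarrow> (\<exists>t. \<phi> = LeqT (Var Nat 0) (lift_tm 0 t) \<or> \<phi> = LeqT (App (Cst Succ) (Var Nat 0)) (lift_tm 0 t))"

text \<open>\<open>rel\<close> recognises bounded quantifiers by their syntactic form. For each
  other quantifier of the principles it has to be excluded that its body accidentally has this
  form.\<close>

lemma bounded_quant_simps [simp]:
  "\<not> bounded_quant (\<sigma> \<rightarrow>\<^sub>t \<tau>) \<phi>"
  "\<not> bounded_quant \<tau> (eq0 s t d)" "\<not> bounded_quant \<tau> (leq s t d)" "\<not> bounded_quant \<tau> (rclose n u v d)"
  "\<not> bounded_quant \<tau> (all \<sigma> F d)"
  "bounded_quant \<tau> ((A \<^bold>\<longrightarrow> B) d) \<longleftrightarrow> \<tau> = Nat \<and> bq (A d)" "bounded_quant \<tau> ((\<^bold>\<not> A) d) \<longleftrightarrow> \<tau> = Nat \<and> bq (A d)"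
  "\<not> bounded_quant \<tau> ((A \<^bold>\<and> B) d)"
  "\<not> bq ((A \<^bold>\<longrightarrow> B) d)" "\<not> bq ((\<^bold>\<not> A) d)" "\<not> bq ((A \<^bold>\<and> B) d)" "\<not> bq (all \<sigma> F d)" "\<not> bq (rgap n u v d)"
  "\<not> bq (in_tree s t d)"
  by (auto simp: bounded_quant_def bq_def eq0_def leq_def rclose_def less_def all_def imp_def neg_def conj_def
      LeqT_def rgap_def in_tree_def suc_def mul_def app_def con_def raw_def zero_def fls_def)

text \<open>The flag \<open>b\<close> selects between a formula and its relativisation, so that one
  computation of meanings serves both worlds.\<close>

locale sworld = wac +
  fixes b :: bool
  assumes b: "W = (if b then Std else (\<lambda>_ _. True))"
begin

definition satw :: "(nat \<Rightarrow> tm) \<Rightarrow> fm \<Rightarrow> bool" where "satw e \<phi> = sat M0 e (if b then rel \<phi> else \<phi>)"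

lemma satw_simps [simp]:
  "satw e ((A \<^bold>\<longrightarrow> B) d) = (satw e (A d) \<longrightarrow> satw e (B d))"
  "satw e ((\<^bold>\<not> A) d) = (\<not> satw e (A d))"
  "satw e ((A \<^bold>\<and> B) d) = (satw e (A d) \<and> satw e (B d))"
  "satw e (eq0 s t d) = (evl M0 e (s d) = evl M0 e (t d))"
  "satw e (leq s t d) = sat M0 e (leq s t d)"
  "satw e (rclose n u v d) = sat M0 e (rclose n u v d)"
  "satw e (rgap n u v d) = sat M0 e (rgap n u v d)"
proof -
  have r: "rel (leq s t d) = leq s t d" for s t d by (simp add: leq_def LeqT_def)
  show "satw e ((A \<^bold>\<longrightarrow> B) d) = (satw e (A d) \<longrightarrow> satw e (B d))"
    "satw e ((\<^bold>\<not> A) d) = (\<not> satw e (A d))"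
    "satw e ((A \<^bold>\<and> B) d) = (satw e (A d) \<and> satw e (B d))"
    by (simp_all add: satw_def imp_def neg_def conj_def fls_def)
  show "satw e (eq0 s t d) = (evl M0 e (s d) = evl M0 e (t d))" by (simp add: satw_def eq0_def)
  show "satw e (leq s t d) = sat M0 e (leq s t d)"
    "satw e (rclose n u v d) = sat M0 e (rclose n u v d)" "satw e (rgap n u v d) = sat M0 e (rgap n u v d)"
    by (simp_all only: satw_def rclose_def rgap_def less_def r if_cancel)
qed

lemma satw_all [simp]:
  "\<not> bounded_quant \<tau> (F (bvar \<tau> d) (Suc d)) \<Longrightarrow>
   satw e (all \<tau> F d) \<longleftrightarrow> (\<forall>a\<in>D \<tau>. W \<tau> a \<longrightarrow> satw (a ## e) (F (bvar \<tau> d) (Suc d)))"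
  by (auto simp: satw_def all_def b)

lemma satw_ex [simp]:
  "\<not> bounded_quant \<tau> ((\<^bold>\<not> F (bvar \<tau> d)) (Suc d)) \<Longrightarrow>
   satw e (ex \<tau> F d) \<longleftrightarrow> (\<exists>a\<in>D \<tau>. W \<tau> a \<and> satw (a ## e) (F (bvar \<tau> d) (Suc d)))"
  unfolding ex_def by simp

lemma evl_proj: "evl M0 e (t d) \<in> D Nat \<Longrightarrow> evl M0 e (proj1 t d) = rv (pr1 (nv (evl M0 e (t d))))"
  "evl M0 e (t d) \<in> D Nat \<Longrightarrow> evl M0 e (proj2 t d) = rv (pr2 (nv (evl M0 e (t d))))"
  "evl M0 e (s d) \<in> D Nat \<Longrightarrow> evl M0 e (t d) \<in> D Nat \<Longrightarrow>
    evl M0 e (pairing s t d) = rv (pr (nv (evl M0 e (s d))) (nv (evl M0 e (t d))))"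
  by (simp_all add: proj1_def proj2_def pairing_def pr1_def pr2_def pr_def rv_ops rv_p2)

lemma sat_leq: "evl M0 e (s d) \<in> D Nat \<Longrightarrow> evl M0 e (t d) \<in> D Nat \<Longrightarrow>
  sat M0 e (leq s t d) \<longleftrightarrow> nv (evl M0 e (s d)) \<le> nv (evl M0 e (t d))"
proof -
  assume *: "evl M0 e (s d) \<in> D Nat" "evl M0 e (t d) \<in> D Nat"
  have "sat M0 e (leq s t d) \<longleftrightarrow> mn (evl M0 e (s d)) (evl M0 e (t d)) = zr"
    by (simp add: leq_def LeqT_def evl_ops mn_def)
  also have "\<dots> \<longleftrightarrow> nv (evl M0 e (s d)) - nv (evl M0 e (t d)) = 0"
    using * nv_eq_iff[of "mn (evl M0 e (s d)) (evl M0 e (t d))" zr] by (simp add: nv_ops)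
  finally show ?thesis by simp
qed

text \<open>A bounded quantifier is not relativised and ranges over all numbers up to the bound in
  either world; this is why \<open>FANw\<close> and \<open>HBw\<close> have a plain \<open>n\<close>
  below \<open>k\<close>.\<close>

lemma sat_ex_le [simp]:
  assumes "stable d t" "evl M0 e (t d) \<in> D Nat"
  shows "satw e (ex_le t F d) \<longleftrightarrow> (\<exists>n\<le>nv (evl M0 e (t d)). satw (rv n ## e) (F (bvar Nat d) (Suc d)))"
proof -
  let ?\<phi> = "((leq (bvar Nat d) t \<^bold>\<longrightarrow> \<^bold>\<not> F (bvar Nat d))) (Suc d)"
  have "t (Suc d) = lift_tm 0 (t d)" using assms(1) by (auto simp: stable_def)
  then have bqt: "bounded_quant Nat ?\<phi>"
    by (auto simp: bounded_quant_def imp_def leq_def bvar_def)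
  have l: "sat M0 (n ## e) (leq (bvar Nat d) t (Suc d)) \<longleftrightarrow> nv n \<le> nv (evl M0 e (t d))" if "n \<in> D Nat" for n
    using that assms evl_stable[OF assms(1), of M0 n e] by (subst sat_leq) simp_all
  have "satw e (ex_le t F d) \<longleftrightarrow> \<not> (\<forall>n\<in>D Nat. satw (n ## e) ?\<phi>)"
    unfolding ex_le_def all_le_def satw_simps(2) using bqt by (simp add: satw_def all_def)
  also have "\<dots> \<longleftrightarrow> (\<exists>n\<in>D Nat. nv n \<le> nv (evl M0 e (t d)) \<and> satw (n ## e) (F (bvar Nat d) (Suc d)))"
    using l by auto
  also have "\<dots> \<longleftrightarrow> (\<exists>n\<le>nv (evl M0 e (t d)). satw (rv n ## e) (F (bvar Nat d) (Suc d)))"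
    using rv_D rv_nv nv_rv by metis
  finally show ?thesis .
qed

lemma evl_rdiff: "evl M0 e (u d) = rv u' \<Longrightarrow> evl M0 e (v d) = rv v' \<Longrightarrow>
  evl M0 e (rdiff u v d) = rv ((nm u' * dn v' + ng v' * dn u') - (nm v' * dn u' + ng u' * dn v')) \<and>
  evl M0 e (rden u d) = rv (dn u')"
  by (simp add: rdiff_def rpos_def rneg_def rden_def evl_proj rv_ops rec_eqs(1,2))

lemma qn_absdiff: "qn ((x - y) + (y - x)) = \<bar>qn x - qn y\<bar>"
  by (cases "x \<le> y") (auto simp: qn_diff abs_if not_le)

lemma sat_less_rv: "sat M0 e (less s t d) \<longleftrightarrow> x < y" if "evl M0 e (s d) = rv x" "evl M0 e (t d) = rv y"
  using that by (simp add: lessv_nv)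

lemma val_sub: "val u - val v = (qn (nm u * dn v + ng v * dn u) - qn (nm v * dn u + ng u * dn v)) / (qn (dn u) * qn (dn v))"
proof -
  have "0 < qn (dn u)" "0 < qn (dn v)" by simp_all
  then show ?thesis unfolding val_frac[of u] val_frac[of v] by (simp add: field_simps del: dn_pos)
qed

lemma sat_rclose:
  assumes "evl M0 e (n d) = rv n'" "evl M0 e (u d) = rv u'" "evl M0 e (v d) = rv v'"
  shows "sat M0 e (rclose n u v d) \<longleftrightarrow> \<bar>val u' - val v'\<bar> < eps n'"
proof -
  define U where "U = nm u' * dn v' + ng v' * dn u'"
  define V where "V = nm v' * dn u' + ng u' * dn v'"
  have d: "evl M0 e (rdiff u v d) = rv (U - V)" "evl M0 e (rden u d) = rv (dn u')"
    "evl M0 e (rdiff v u d) = rv (V - U)" "evl M0 e (rden v d) = rv (dn v')"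
    using evl_rdiff[of e u d u' v v', OF assms(2,3)] evl_rdiff[of e v d v' u u', OF assms(3,2)] by (simp_all add: U_def V_def)
  have "sat M0 e (rclose n u v d) \<longleftrightarrow> p2 n' * ((U - V) + (V - U)) < dn u' * dn v'"
    unfolding rclose_def by (rule sat_less_rv) (simp_all add: d assms rv_ops rv_p2)
  also have "\<dots> \<longleftrightarrow> qn (p2 n') * \<bar>qn U - qn V\<bar> < qn (dn u') * qn (dn v')"
    unfolding nn_less_qn qn_simps(4) qn_absdiff ..
  also have "\<dots> \<longleftrightarrow> \<bar>(qn U - qn V) / (qn (dn u') * qn (dn v'))\<bar> < eps n'"
  proof -
    have "0 < qn (dn u') * qn (dn v')" "0 < qn (p2 n')" using qn_less[of 0 "p2 n'"] by (simp_all add: mult_pos_pos)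
    then show ?thesis unfolding eps_def abs_divide by (simp add: field_simps abs_of_pos)
  qed
  finally show ?thesis unfolding val_sub U_def V_def .
qed

lemma sat_rgap:
  assumes "evl M0 e (n d) = rv n'" "evl M0 e (u d) = rv u'" "evl M0 e (v d) = rv v'"
  shows "sat M0 e (rgap n u v d) \<longleftrightarrow> 2 * eps n' < val v' - val u'"
proof -
  define U where "U = nm u' * dn v' + ng v' * dn u'"
  define V where "V = nm v' * dn u' + ng u' * dn v'"
  have d: "evl M0 e (rden u d) = rv (dn u')" "evl M0 e (rdiff v u d) = rv (V - U)" "evl M0 e (rden v d) = rv (dn v')"
    using evl_rdiff[of e u d u' v v', OF assms(2,3)] evl_rdiff[of e v d v' u u', OF assms(3,2)] by (simp_all add: U_def V_def)
  have two: "rv 2 = sc (sc zr)" using rv_ops(6)[of 1] by (simp add: rv_ops(2))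
  have pos: "0 < dn u' * dn v'" by (rule mult_pos_pos) simp_all
  have "sat M0 e (rgap n u v d) \<longleftrightarrow> 2 * (dn u' * dn v') < p2 n' * (V - U)"
    unfolding rgap_def by (rule sat_less_rv) (simp_all add: d assms rv_ops rv_p2 two)
  also have "\<dots> \<longleftrightarrow> 2 * (qn (dn u') * qn (dn v')) < qn (p2 n') * (qn V - qn U)"
  proof (cases "U \<le> V")
    case True
    then show ?thesis unfolding nn_less_qn qn_simps(4) qn_numeral by (simp add: qn_diff)
  next
    case False
    then have z: "V - U = 0" "qn V - qn U \<le> 0" by (simp_all add: not_le order_less_imp_le)
    have "qn (p2 n') * (qn V - qn U) \<le> 0" by (rule mult_nonneg_nonpos) (use z in simp_all)
    moreover have "0 < 2 * (qn (dn u') * qn (dn v'))" by (simp add: mult_pos_pos)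
    ultimately have "\<not> 2 * (qn (dn u') * qn (dn v')) < qn (p2 n') * (qn V - qn U)" by linarith
    then show ?thesis using z(1) by simp
  qed
  also have "\<dots> \<longleftrightarrow> 2 * eps n' < (qn V - qn U) / (qn (dn v') * qn (dn u'))"
  proof -
    have "0 < qn (dn u')" "0 < qn (dn v')" "0 < qn (p2 n')" using qn_less[of 0 "p2 n'"] by simp_all
    then show ?thesis unfolding eps_def by (rule qq_gap)
  qed
  finally show ?thesis unfolding val_sub U_def V_def .
qed

text \<open>\<open>q\<close>, placed at depth \<open>d\<close> or below, denotes the sequence of rationals \<open>X\<close>.\<close>
definition rs :: "(nat \<Rightarrow> tm) \<Rightarrow> nat \<Rightarrow> rseq \<Rightarrow> (nn \<Rightarrow> qq) \<Rightarrow> bool" where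
  "rs e d q X \<longleftrightarrow> (\<forall>d' e' n k. d \<le> d' \<longrightarrow> (\<forall>i. e' (i + (d' - d)) = e i) \<longrightarrow> evl M0 e' (n d') = rv k \<longrightarrow>
     (\<exists>u. evl M0 e' (q n d') = rv u \<and> val u = X k))"

lemma rsD: "rs e d q X \<Longrightarrow> evl M0 (a ## e) (n (Suc d)) = rv k \<Longrightarrow> \<exists>u. evl M0 (a ## e) (q n (Suc d)) = rv u \<and> val u = X k"
  unfolding rs_def by (drule spec[of _ "Suc d"], drule spec[of _ "a ## e"], drule spec[of _ n], drule spec[of _ k]) auto

lemma rsD2: "rs e d q X \<Longrightarrow> evl M0 (a ## c ## e) (n (Suc (Suc d))) = rv k \<Longrightarrow>
  \<exists>u. evl M0 (a ## c ## e) (q n (Suc (Suc d))) = rv u \<and> val u = X k"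
  unfolding rs_def by (drule spec[of _ "Suc (Suc d)"], drule spec[of _ "a ## c ## e"], drule spec[of _ n], drule spec[of _ k]) auto

lemma all_D: "(\<forall>a\<in>D Nat. P a) \<longleftrightarrow> (\<forall>n. P (rv n))" "(\<exists>a\<in>D Nat. P a) \<longleftrightarrow> (\<exists>n. P (rv n))"
  using rv_D rv_nv by metis+

lemma satw_is_real: "rs e d q X \<Longrightarrow> satw e (is_real q d) \<longleftrightarrow> isr S X"
proof -
  assume q: "rs e d q X"
  have "satw (rv i ## rv n ## e) (rclose (bvar Nat d) (q (bvar Nat d)) (q (add (bvar Nat d) (bvar Nat (Suc d)))) (Suc (Suc d)))
    \<longleftrightarrow> \<bar>X n - X (n + i)\<bar> < eps n" for n i
  proof -
    have "evl M0 (rv i ## rv n ## e) (bvar Nat d (Suc (Suc d))) = rv n"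
      "evl M0 (rv i ## rv n ## e) (add (bvar Nat d) (bvar Nat (Suc d)) (Suc (Suc d))) = rv (n + i)" by (simp_all add: rv_ops)
    note a = this
    obtain u v where u: "evl M0 (rv i ## rv n ## e) (q (bvar Nat d) (Suc (Suc d))) = rv u" "val u = X n"
      and v: "evl M0 (rv i ## rv n ## e) (q (add (bvar Nat d) (bvar Nat (Suc d))) (Suc (Suc d))) = rv v" "val v = X (n + i)"
      using rsD2[of e d q X "rv i" "rv n" "bvar Nat d" n, OF q a(1)]
        rsD2[of e d q X "rv i" "rv n" "add (bvar Nat d) (bvar Nat (Suc d))" "n + i", OF q a(2)] by blast
    show ?thesis
      using sat_rclose[where n = "bvar Nat d" and u = "q (bvar Nat d)" and v = "q (add (bvar Nat d) (bvar Nat (Suc d)))", OF a(1) u(1) v(1)]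
        u(2) v(2) by simp
  qed
  then show ?thesis unfolding is_real_def isr_def by (simp add: all_D)
qed

lemma satw_real_less: "rs e d q X \<Longrightarrow> rs e d r Y \<Longrightarrow> satw e (real_less q r d) \<longleftrightarrow> ls S X Y"
proof -
  assume q: "rs e d q X" "rs e d r Y"
  have "satw (rv n ## e) (rgap (bvar Nat d) (q (bvar Nat d)) (r (bvar Nat d)) (Suc d)) \<longleftrightarrow> 2 * eps n < Y n - X n" for n
  proof -
    have "evl M0 (rv n ## e) (bvar Nat d (Suc d)) = rv n" by simp
    note a = this
    obtain u v where u: "evl M0 (rv n ## e) (q (bvar Nat d) (Suc d)) = rv u" "val u = X n"
      and v: "evl M0 (rv n ## e) (r (bvar Nat d) (Suc d)) = rv v" "val v = Y n"
      using rsD[of e d q X "rv n" "bvar Nat d" n, OF q(1) a] rsD[of e d r Y "rv n" "bvar Nat d" n, OF q(2) a] by blast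
    show ?thesis
      using sat_rgap[where n = "bvar Nat d" and u = "q (bvar Nat d)" and v = "r (bvar Nat d)", OF a u(1) v(1)] u(2) v(2) by simp
  qed
  then show ?thesis unfolding real_less_def ls_def by (simp add: all_D)
qed

lemma rs_const: "rs e d real0 (\<lambda>_. 0)" "rs e d real1 (\<lambda>_. 1)"
proof -
  have p0: "pr 0 0 = 0" by (simp add: pr_def)
  have "pr1 0 = 0" "pr2 0 = 0" using pr_proj[of 0 0] unfolding p0 by auto
  then have "val 0 = 0" by (simp add: val_def)
  then show "rs e d real0 (\<lambda>_. 0)" unfolding rs_def real0_def by (auto intro!: exI[of _ 0] simp: rv_ops)
  have "evl M0 e' (pairing (pairing (suc zero) zero) zero d') = rv (pr (pr 1 0) 0)" for e' d'
    using rv_ops(1,2) nv_ops(1) nv_ops(2)[of zr] by (simp add: evl_proj)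
  then show "rs e d real1 (\<lambda>_. 1)" unfolding rs_def real1_def by (auto simp: val_def)
qed

lemma rs_of1: "stable d x \<Longrightarrow> evl M0 e (x d) \<in> D T1 \<Longrightarrow> rs e d (of1 x) (rl (evl M0 e (x d)))"
  unfolding rs_def of1_def rl_def
proof (intro allI impI)
  fix d' e' n k
  assume *: "stable d x" "evl M0 e (x d) \<in> D T1" "d \<le> d'" "\<forall>i. e' (i + (d' - d)) = e i" "evl M0 e' (n d') = rv k"
  then have "evl M0 e' (x d') = evl M0 e (x d)" by (intro evl_stable_gen) auto
  then show "\<exists>u. evl M0 e' ((x \<cdot> n) d') = rv u \<and> val u = val (evl M0 e (x d) \<odot> k)"
    using * ap_D[OF *(2) rv_D] by (intro exI[of _ "evl M0 e (x d) \<odot> k"]) (simp add: fa_def)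
qed

lemma rs_ends:
  assumes "stable d I" "evl M0 e (I d) \<in> D (Nat \<rightarrow>\<^sub>t T1)" "stable d n" "evl M0 e (n d) = rv k"
  shows "rs e d (left_end I n) (lend (evl M0 e (I d)) k)" "rs e d (right_end I n) (rend (evl M0 e (I d)) k)"
proof -
  let ?x = "evl M0 e (I d) \<bullet> rv k"
  have x: "?x \<in> D T1" using ap_D[OF assms(2) rv_D] .
  have *: "evl M0 e' ((I \<cdot> n \<cdot> m) d') = rv (?x \<odot> j)"
    if "d \<le> d'" "\<forall>i. e' (i + (d' - d)) = e i" "evl M0 e' (m d') = rv j" for d' e' m j
  proof -
    have "evl M0 e' (I d') = evl M0 e (I d)" "evl M0 e' (n d') = evl M0 e (n d)"
      using that by (auto intro: evl_stable_gen[OF assms(1)] evl_stable_gen[OF assms(3)])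
    then show ?thesis using that(3) assms(4) ap_D[OF x rv_D] by (simp add: fa_def)
  qed
  show "rs e d (left_end I n) (lend (evl M0 e (I d)) k)" "rs e d (right_end I n) (rend (evl M0 e (I d)) k)"
    unfolding rs_def left_end_def right_end_def lend_def rend_def using * by (auto simp: evl_proj)
qed

lemma satw_in_unit [simp]: "stable d x \<Longrightarrow> evl M0 e (x d) \<in> D T1 \<Longrightarrow> satw e (in_unit x d) \<longleftrightarrow> un S (rl (evl M0 e (x d)))"
  unfolding in_unit_def un_def by (simp add: satw_is_real[OF rs_of1] satw_real_less[OF rs_of1 rs_const(1)] satw_real_less[OF rs_const(2) rs_of1])

lemma satw_in_interval [simp]:
  "stable d x \<Longrightarrow> evl M0 e (x d) \<in> D T1 \<Longrightarrow> stable d I \<Longrightarrow> evl M0 e (I d) \<in> D (Nat \<rightarrow>\<^sub>t T1) \<Longrightarrow> stable d n \<Longrightarrow>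
   evl M0 e (n d) \<in> D Nat \<Longrightarrow>
   satw e (in_interval x I n d) \<longleftrightarrow> inI S (evl M0 e (x d)) (evl M0 e (I d)) (nv (evl M0 e (n d)))"
  unfolding in_interval_def inI_def
  using satw_real_less[OF rs_ends(1)[of d I e n "nv (evl M0 e (n d))"] rs_of1[of d x e]]
    satw_real_less[OF rs_of1[of d x e] rs_ends(2)[of d I e n "nv (evl M0 e (n d))"]] by simp

lemma satw_intervals [simp]:
  assumes "stable d I" "evl M0 e (I d) \<in> D (Nat \<rightarrow>\<^sub>t T1)"
  shows "satw e (intervals I d) \<longleftrightarrow> ivls (evl M0 e (I d))"
proof -
  have I: "evl M0 (rv k ## e) (I (Suc d)) = evl M0 e (I d)" for k by (rule evl_stable[OF assms(1)])
  have st: "stable (Suc d) I" using stable_mono[OF assms(1)] by simp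
  have "satw (rv k ## e) (is_real (left_end I (bvar Nat d)) (Suc d)) \<longleftrightarrow> isr S (lend (evl M0 e (I d)) k)"
    "satw (rv k ## e) (is_real (right_end I (bvar Nat d)) (Suc d)) \<longleftrightarrow> isr S (rend (evl M0 e (I d)) k)" for k
    using satw_is_real[OF rs_ends(1)[OF st, of "rv k ## e" "bvar Nat d" k]] satw_is_real[OF rs_ends(2)[OF st, of "rv k ## e" "bvar Nat d" k]]
      assms(2) I by simp_all
  then show ?thesis unfolding intervals_def ivls_def by (simp add: all_D)
qed

lemma nb [simp]: "\<not> bq (intervals I d)" "\<not> bq (in_unit x d)" "\<not> bq (in_interval x I n d)"
  "\<not> bq (all_unit F d)" "\<not> bounded_quant \<tau> (all_unit F d)"
  by (simp_all add: intervals_def in_unit_def in_interval_def all_unit_def)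

lemma satw_HB: "satw (\<lambda>_. undefined) HB \<longleftrightarrow> HBw"
  unfolding HB_def HBw_def all_unit_def by (simp add: all_D cong: ball_cong_simp bex_cong_simp)

lemma satw_UHB: "satw (\<lambda>_. undefined) UHB \<longleftrightarrow> UHBw"
  unfolding UHB_def UHBw_def all_unit_def by (simp add: all_D ap_D[of _ T2] ap_D[of _ T1] ap_D[of _ "Nat \<rightarrow>\<^sub>t T1" "T2 \<rightarrow>\<^sub>t Nat"] cong: ball_cong_simp bex_cong_simp)

lemma evl_initial:
  assumes "envok M0 \<Gamma> e" "c < d" "d - Suc c < length \<Gamma>" "\<Gamma> ! (d - Suc c) = T1" "evl M0 e (n d) \<in> D Nat"
  shows "evl M0 e (initial (bvar T1 c) n d) = rv (ini (e (d - Suc c)) (nv (evl M0 e (n d))))"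
proof -
  let ?\<alpha> = "e (d - Suc c)"
  let ?F = "\<lambda>s i. snoc s (bvar T1 c \<cdot> i)"
  let ?h = "\<lambda>r i. rv (pr (nv r) (?\<alpha> \<odot> nv i) + 1)"
  have \<alpha>: "?\<alpha> \<in> D T1" using assms(1,3,4) unfolding envok_def by metis
  have i: "Suc (Suc d) - Suc c = Suc (Suc (d - Suc c))" using assms(2) by simp
  have 1: "ht sp0 (Nat # Nat # \<Gamma>) (?F (bvar Nat d) (bvar Nat (Suc d)) (Suc (Suc d))) Nat"
    unfolding tm_simps snoc_def pairing_def tri_def add_def
    by (rule ht_ops ht_intros | simp add: bvar_def i assms(3,4) del: diff_Suc_Suc)+
  have 2: "evl M0 (i ## r ## e) (?F (bvar Nat d) (bvar Nat (Suc d)) (Suc (Suc d))) = ?h r i"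
    if "r \<in> D Nat" "i \<in> D Nat" for r i
  proof -
    have "evl M0 (i ## r ## e) ((bvar T1 c \<cdot> bvar Nat (Suc d)) (Suc (Suc d))) = rv (?\<alpha> \<odot> nv i)"
      using that ap_D[OF \<alpha> that(2)] i by (simp add: fa_def del: diff_Suc_Suc)
    then show ?thesis using that by (simp add: snoc_def evl_proj rv_ops rec_eqs(1,2) del: evl_app)
  qed
  have "evl M0 e (initial (bvar T1 c) n d) = recv (evl M0 e (n d)) zr ?h" "fun2 ?h"
    using evl_rec(1)[where F = ?F and n = n and a = zero and h = ?h, OF 1 assms(1) 2]
      evl_rec(2)[where F = ?F and h = ?h, OF 1 assms(1) 2] by (simp_all add: initial_def)
  moreover have "recv (evl M0 e (n d)) zr ?h \<in> D Nat" by (rule recv_D[OF calculation(2) assms(5) zero_D])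
  ultimately show ?thesis using assms(5) by (simp add: ini_def prec_def rv_ops(1))
qed

lemma satw_binary: "stable d x \<Longrightarrow> evl M0 e (x d) \<in> D T1 \<Longrightarrow> satw e (binary x d) \<longleftrightarrow> (\<forall>n. S n \<longrightarrow> evl M0 e (x d) \<odot> n \<le> 1)"
proof -
  assume x: "stable d x" "evl M0 e (x d) \<in> D T1"
  have "sat M0 (rv n ## e) (leq (x \<cdot> bvar Nat d) (suc zero) (Suc d)) \<longleftrightarrow> evl M0 e (x d) \<odot> n \<le> 1" for n
    using ap_D[OF x(2) rv_D[of n]] evl_stable[OF x(1), of M0 "rv n" e] nv_ops(2)[of zr]
    by (subst sat_leq) (simp_all add: fa_def nv_ops)
  then show ?thesis unfolding binary_def by (simp add: all_D)
qed

lemma satw_in_tree: "evl M0 e (T d) \<in> D T1 \<Longrightarrow> evl M0 e (s d) = rv n \<Longrightarrow> satw e (in_tree s T d) \<longleftrightarrow> evl M0 e (T d) \<odot> n = 1"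
  unfolding in_tree_def using ap_D[of "evl M0 e (T d)" Nat Nat "rv n"] rv_ops(2)
  by (simp add: fa_def Rep_nn_inject[symmetric])

lemma nb2 [simp]: "\<not> bq (binary x d)" "\<not> bq (binary_tree x d)" "\<not> bounded_quant \<tau> (binary x d)" "\<not> bq (in_tree s x d)"
  by (simp_all add: binary_def binary_tree_def)

lemma satw_binary_tree:
  assumes "stable d x" "evl M0 e (x d) \<in> D T1"
  shows "satw e (binary_tree x d) \<longleftrightarrow> (\<forall>n. S n \<longrightarrow> evl M0 e (x d) \<odot> n \<le> 1) \<and>
    (\<forall>s a. S s \<longrightarrow> S a \<longrightarrow> evl M0 e (x d) \<odot> (pr s a + 1) = 1 \<longrightarrow> evl M0 e (x d) \<odot> s = 1 \<and> a \<le> 1)"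
proof -
  let ?e = "\<lambda>a s. rv a ## rv s ## e"
  let ?d = "Suc (Suc d)"
  have X: "evl M0 (?e a s) (x ?d) = evl M0 e (x d)" for a s
    using evl_stable[OF stable_mono[OF assms(1), of "Suc d"], of M0 "rv a" "rv s ## e"]
      evl_stable[OF assms(1), of M0 "rv s" e] by simp
  have "evl M0 (?e a s) (snoc (bvar Nat d) (bvar Nat (Suc d)) ?d) = rv (pr s a + 1)" for a s
    by (simp add: snoc_def evl_proj rv_ops rec_eqs(1,2))
  then have 1: "satw (?e a s) (in_tree (snoc (bvar Nat d) (bvar Nat (Suc d))) x ?d) \<longleftrightarrow> evl M0 e (x d) \<odot> (pr s a + 1) = 1" for a s
    using satw_in_tree[of "?e a s" x ?d] X assms(2) by simp
  have 2: "satw (?e a s) (in_tree (bvar Nat d) x ?d) \<longleftrightarrow> evl M0 e (x d) \<odot> s = 1" for a s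
    using satw_in_tree[of "?e a s" x ?d "bvar Nat d" s] X assms(2) by simp
  have 3: "sat M0 (?e a s) (leq (bvar Nat (Suc d)) (suc zero) ?d) \<longleftrightarrow> a \<le> 1" for a s
    by (subst sat_leq) (simp_all add: nv_ops)
  show ?thesis unfolding binary_tree_def by (simp add: satw_binary assms all_D 1 2 3)
qed

lemma satw_FAN: "satw (\<lambda>_. undefined) FAN \<longleftrightarrow> FANw"
proof -
  have 1: "satw (rv n ## \<alpha> ## T ## e) (in_tree (initial (bvar T1 (Suc 0)) (bvar Nat (Suc (Suc 0)))) (bvar T1 0) (Suc (Suc (Suc 0))))
      \<longleftrightarrow> T \<odot> ini \<alpha> n = 1" if "T \<in> D T1" "\<alpha> \<in> D T1" for n T \<alpha> e
    using satw_in_tree[of "rv n ## \<alpha> ## T ## e" "bvar T1 0" "Suc (Suc (Suc 0))"] that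
      evl_initial[of "[Nat, T1, T1]" "rv n ## \<alpha> ## T ## e" "Suc 0" "Suc (Suc (Suc 0))" "bvar Nat (Suc (Suc 0))"] by simp
  have 2: "satw (rv n ## \<alpha> ## rv k ## T ## e) (in_tree (initial (bvar T1 (Suc (Suc 0))) (bvar Nat (Suc (Suc (Suc 0))))) (bvar T1 0) (Suc (Suc (Suc (Suc 0)))))
      \<longleftrightarrow> T \<odot> ini \<alpha> n = 1" if "T \<in> D T1" "\<alpha> \<in> D T1" for n k T \<alpha> e
    using satw_in_tree[of "rv n ## \<alpha> ## rv k ## T ## e" "bvar T1 0" "Suc (Suc (Suc (Suc 0)))"] that
      evl_initial[of "[Nat, T1, Nat, T1]" "rv n ## \<alpha> ## rv k ## T ## e" "Suc (Suc 0)" "Suc (Suc (Suc (Suc 0)))" "bvar Nat (Suc (Suc (Suc 0)))"]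
    by simp
  show ?thesis unfolding FAN_def FANw_def by (simp add: satw_binary satw_binary_tree all_D 1 2 imp_conjL cong: ball_cong_simp bex_cong_simp)
qed

end

sublocale cx \<subseteq> st: sworld Std True
  by unfold_locales simp

sublocale cx \<subseteq> al: sworld "\<lambda>_ _. True" False
  by unfold_locales simp

context cx
begin

lemma sat_rel: "sat M0 e (rel \<phi>) = st.satw e \<phi>" "sat M0 e \<phi> = al.satw e \<phi>"
  by (simp_all add: st.satw_def al.satw_def)

text \<open>The hypotheses are relativised and the conclusion is internal, so the two meaning
  functions are combined: the standard one for the former, the full one for the latter.\<close>

lemma sat_HB_star: "sat M0 (\<lambda>_. undefined) HB_star \<longleftrightarrow> St.HBs"
proof -
  have r: "sat M0 e (srel A d) = st.satw e (A d)" for e A d by (simp add: srel_def sat_rel(1))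
  have a': "sat M0 e (in_unit x d) = al.satw e (in_unit x d)" "sat M0 e (ex_le t F d) = al.satw e (ex_le t F d)" for e x t F d
    by (simp_all only: al.satw_def if_False)
  show ?thesis unfolding HB_star_def St.HBs_def
    by (simp add: r a' all_unit_def st.all_D cong: ball_cong_simp bex_cong_simp)
qed

theorem not_refutes: "\<not> refutes cex"
proof -
  have F: "sat M0 (\<lambda>_. undefined) (rel FAN) = St.FANp" "sat M0 (\<lambda>_. undefined) (rel HB) = St.HBw"
    "sat M0 (\<lambda>_. undefined) (rel UHB) = St.UHBw" "sat M0 (\<lambda>_. undefined) HB = Al.HBw" "sat M0 (\<lambda>_. undefined) UHB = Al.UHBw"
    using st.satw_FAN st.satw_HB st.satw_UHB al.satw_HB al.satw_UHB St.FANw_iff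
    by (simp_all add: sat_rel(1)) (simp_all add: sat_rel(2))
  have 1: "St.FANp = St.HBw" "St.HBw = St.UHBw" "St.UHBw = St.HBs"
    using St.FANp_HBw St.HBw_FANp St.UFAN_UHBw FANp_UFAN_St St.UHBw_HBw St.FANp_HBs St.HBs_FANp by blast+
  have 2: "St.FANp = Al.HBw" "Al.HBw = Al.UHBw" if "ax_QF_AC T2 Nat \<subseteq> T0"
    using FANp_St_M Al.FANp_HBw Al.HBw_FANp QF_FANp[OF that] Al.UFAN_UHBw Al.UHBw_HBw by blast+
  have "cex = (sp0, T0, M0)" by (simp add: sp0_def T0_def M0_def)
  show ?thesis unfolding refutes_def \<open>cex = (sp0, T0, M0)\<close> using 1 2 by (auto simp: sat_Iff F sat_HB_star)
qed

end

text \<open>If some triple refuted the theorem, so would the chosen one; its model would then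
  satisfy the assumption of \<open>cx\<close>, where this has been excluded.\<close>

lemma no_counterexample: "\<not> refutes X"
proof
  assume "refutes X"
  then have r: "refutes cex" unfolding cex_def by (rule someI)
  moreover have "cex = (sp0, T0, M0)" by (simp add: sp0_def T0_def M0_def)
  ultimately have "refutes (sp0, T0, M0)" by simp
  then have "nmodel sp0 T0 M0" unfolding refutes_def by auto
  then interpret cx by (rule cx.intro)
  show False using not_refutes r by blast
qed

section \<open>Well-formedness of the principles and the return to derivability\<close>

lemma fm_ok_rel: "fm_ok sp \<Gamma> \<phi> \<Longrightarrow> fm_ok sp \<Gamma> (rel \<phi>)"
  by (induction \<phi> arbitrary: \<Gamma>) auto

lemma fm_ok_Iff: "fm_ok sp \<Gamma> \<phi> \<Longrightarrow> fm_ok sp \<Gamma> \<psi> \<Longrightarrow> fm_ok sp \<Gamma> (Iff \<phi> \<psi>)"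
  by (simp add: Iff_def conj_def neg_def imp_def fls_def raw_def)

lemma fok_intros:
  "fm_ok sp \<Gamma> (A d) \<Longrightarrow> fm_ok sp \<Gamma> (B d) \<Longrightarrow> fm_ok sp \<Gamma> ((A \<^bold>\<longrightarrow> B) d)"
  "fm_ok sp \<Gamma> (A d) \<Longrightarrow> fm_ok sp \<Gamma> (B d) \<Longrightarrow> fm_ok sp \<Gamma> ((A \<^bold>\<and> B) d)"
  "fm_ok sp \<Gamma> (A d) \<Longrightarrow> fm_ok sp \<Gamma> ((\<^bold>\<not> A) d)"
  "fm_ok sp (\<tau> # \<Gamma>) (F (bvar \<tau> d) (Suc d)) \<Longrightarrow> fm_ok sp \<Gamma> (all \<tau> F d)"
  "fm_ok sp (\<tau> # \<Gamma>) (F (bvar \<tau> d) (Suc d)) \<Longrightarrow> fm_ok sp \<Gamma> (ex \<tau> F d)"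
  "fm_ok sp (\<tau> # \<Gamma>) (F (bvar \<tau> d) (Suc d)) \<Longrightarrow> fm_ok sp \<Gamma> (allst \<tau> F d)"
  "fm_ok sp (\<tau> # \<Gamma>) (F (bvar \<tau> d) (Suc d)) \<Longrightarrow> fm_ok sp \<Gamma> (exst \<tau> F d)"
  "fm_ok sp \<Gamma> (A d) \<Longrightarrow> fm_ok sp \<Gamma> (srel A d)"
  "ht sp \<Gamma> (s d) Nat \<Longrightarrow> ht sp \<Gamma> (t d) Nat \<Longrightarrow> fm_ok sp \<Gamma> (eq0 s t d)"
  "ht sp \<Gamma> (s d) Nat \<Longrightarrow> ht sp \<Gamma> (t d) Nat \<Longrightarrow> fm_ok sp \<Gamma> (leq s t d)"
  "ht sp (Nat # \<Gamma>) (t (Suc d)) Nat \<Longrightarrow> fm_ok sp (Nat # \<Gamma>) (F (bvar Nat d) (Suc d)) \<Longrightarrow> fm_ok sp \<Gamma> (ex_le t F d)"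
  using monusT_ht[of sp \<Gamma>] monusT_ht[of sp "Nat # \<Gamma>"] fm_ok_rel
  by (auto simp: imp_def conj_def neg_def fls_def all_def ex_def allst_def exst_def st_def srel_def eq0_def leq_def
      LeqT_def ht_def bvar_def ex_le_def all_le_def)

lemma tok_intros:
  "ht sp \<Gamma> (zero d) Nat" "ht sp \<Gamma> (t d) Nat \<Longrightarrow> ht sp \<Gamma> (suc t d) Nat"
  "ht sp \<Gamma> (s d) Nat \<Longrightarrow> ht sp \<Gamma> (t d) Nat \<Longrightarrow> ht sp \<Gamma> (add s t d) Nat"
  "ht sp \<Gamma> (s d) Nat \<Longrightarrow> ht sp \<Gamma> (t d) Nat \<Longrightarrow> ht sp \<Gamma> (mul s t d) Nat"
  "ht sp \<Gamma> (s d) Nat \<Longrightarrow> ht sp \<Gamma> (t d) Nat \<Longrightarrow> ht sp \<Gamma> (monus s t d) Nat"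
  "ht sp \<Gamma> (t d) Nat \<Longrightarrow> ht sp \<Gamma> (pow2 t d) Nat"
  "ht sp \<Gamma> (t d) Nat \<Longrightarrow> ht sp \<Gamma> (tri t d) Nat"
  "ht sp \<Gamma> (t d) Nat \<Longrightarrow> ht sp \<Gamma> (triroot t d) Nat"
  "ht sp \<Gamma> (s d) (\<sigma> \<rightarrow>\<^sub>t \<tau>) \<Longrightarrow> ht sp \<Gamma> (t d) \<sigma> \<Longrightarrow> ht sp \<Gamma> ((s \<cdot> t) d) \<tau>"
  using addT_ht[of sp \<Gamma>] mulT_ht[of sp \<Gamma>] monusT_ht[of sp \<Gamma>] pow2T_ht[of sp \<Gamma>] triT_ht[of sp \<Gamma>] trirootT_ht[of sp \<Gamma>]
  by (auto simp: zero_def suc_def add_def mul_def monus_def pow2_def tri_def triroot_def app_def con_def raw_def ht_def)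

lemma ht_bvar: "d - Suc c < length \<Gamma> \<Longrightarrow> \<Gamma> ! (d - Suc c) = \<tau> \<Longrightarrow> ht sp \<Gamma> (bvar \<tau> c d) \<tau>"
  by (simp add: bvar_def ht_def)

lemma ht_initial:
  assumes "c < d" "d - Suc c < length \<Gamma>" "\<Gamma> ! (d - Suc c) = T1" "ht sp \<Gamma> (n d) Nat"
  shows "ht sp \<Gamma> (initial (bvar T1 c) n d) Nat"
proof -
  have i: "Suc (Suc d) - Suc c = Suc (Suc (d - Suc c))" using assms(1) by simp
  have "ht sp (Nat # Nat # \<Gamma>) (snoc (bvar Nat d) (bvar T1 c \<cdot> bvar Nat (Suc d)) (Suc (Suc d))) Nat"
    unfolding snoc_def pairing_def by (rule tok_intros ht_bvar | simp add: i assms(2,3) del: diff_Suc_Suc)+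
  then have "ht sp \<Gamma> (lam Nat (\<lambda>r. lam Nat (\<lambda>i. snoc r (bvar T1 c \<cdot> i))) d) (Nat \<rightarrow>\<^sub>t T1)"
    by (intro ht_lam)
  then show ?thesis using assms(4) unfolding initial_def rec_def
    by (intro tok_intros(9)[of sp \<Gamma> _ d "Nat \<rightarrow>\<^sub>t T1"] tok_intros(9)[of sp \<Gamma> _ d Nat] tok_intros(1)) (auto simp: con_def ht_def)
qed

lemma fok_real:
  "ht sp \<Gamma> (n d) Nat \<Longrightarrow> ht sp \<Gamma> (u d) Nat \<Longrightarrow> ht sp \<Gamma> (v d) Nat \<Longrightarrow> fm_ok sp \<Gamma> (rclose n u v d)"
  "ht sp \<Gamma> (n d) Nat \<Longrightarrow> ht sp \<Gamma> (u d) Nat \<Longrightarrow> ht sp \<Gamma> (v d) Nat \<Longrightarrow> fm_ok sp \<Gamma> (rgap n u v d)"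
  unfolding rclose_def rgap_def less_def rdiff_def rden_def rpos_def rneg_def proj1_def proj2_def
  by (rule fok_intros tok_intros | assumption)+

lemmas fok = fok_intros fok_real ht_initial tok_intros ht_bvar

lemma fm_ok_FAN: "fm_ok sp [] FAN"
  unfolding FAN_def binary_tree_def binary_def in_tree_def snoc_def pairing_def
  by (rule fok | simp)+

lemmas real_defs = intervals_def in_interval_def all_unit_def in_unit_def is_real_def real_less_def real0_def real1_def
  of1_def left_end_def right_end_def proj1_def proj2_def pairing_def

lemma fm_ok_HB: "fm_ok sp [] HB" "fm_ok sp [] UHB" "fm_ok sp [] HB_star"
  unfolding HB_def UHB_def HB_star_def real_defs by (rule fok | simp)+

text \<open>An underivable equivalence fails in a normal model by completeness, and by
  \<open>r\<close> such a model is a counterexample in the sense of \<open>refutes\<close>.\<close>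

lemma proves_Iff:
  assumes T: "RCA0_Omega sp \<subseteq> T" and ok: "fm_ok sp [] \<phi>" "fm_ok sp [] \<psi>"
    and r: "\<And>M. nmodel sp T M \<Longrightarrow> \<not> sat M (\<lambda>_. undefined) (Iff \<phi> \<psi>) \<Longrightarrow> refutes (sp, T, M)"
  shows "proves sp T (Iff \<phi> \<psi>)"
proof (rule ccontr)
  assume n: "\<not> proves sp T (Iff \<phi> \<psi>)"
  have "ax_eq \<union> ax_ext \<union> ax_standard sp \<subseteq> T" using T by (auto simp: RCA0_Omega_def RCA0_omega_def)
  from completeness[OF this fm_ok_Iff[OF ok] n]
  obtain M :: "tm struct" where M: "normal_model sp T M" "\<not> sat M (\<lambda>_. undefined) (Iff \<phi> \<psi>)" "Er M = (=)" by metis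
  then have "nmodel sp T M" using T by unfold_locales auto
  from r[OF this M(2)] no_counterexample show False by blast
qed

theorem corollary5p7:
  fixes sp :: spec
  assumes "admissible sp"
  shows "proves sp (RCA0_Omega sp) (Iff (rel FAN) (rel HB)) \<and>
         proves sp (RCA0_Omega sp) (Iff (rel HB) (rel UHB)) \<and>
         proves sp (RCA0_Omega sp) (Iff (rel UHB) HB_star) \<and>
         proves sp (RCA0_Omega sp \<union> ax_QF_AC T2 Nat) (Iff (rel FAN) HB) \<and>
         proves sp (RCA0_Omega sp \<union> ax_QF_AC T2 Nat) (Iff HB UHB)"
  by (intro conjI proves_Iff fm_ok_rel fm_ok_FAN fm_ok_HB) (auto simp: refutes_def)

end
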